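(* Let $R$ be a normed ring, let $1\to\Lambda\to\Gamma\to Q\to1$ be an extension of (discrete) groups and let $A$ be a seminormed $\Gamma$-module over $R$. Then there is a first-quadrant spectral sequence $(E_r^{\bullet,\bullet})_r$ converging to $H_b^*(\Gamma;A)$. Moreover, there is an isomorphism of seminormed $R$-modules $$E_2^{p,q}\cong H_b^p(Q;H_b^q(\Lambda;A))$$ in each of the following cases: (i) the group $Q$ is finite; (ii) $q=0$; (iii) $R=\mathbb{R}$, $A$ is a Banach $\Gamma$-module and $H_b^q(\Lambda;A)$ is Banach.
   Context: Fix a normed ring $(R,|\cdot|)$. A seminormed $R$-module is an $R$-module with a seminorm satisfying $\|ra_1+a_2\|\le|r|\|a_1\|+\|a_2\|$; isomorphisms of seminormed $R$-modules are isometric $R$-linear bijections. A seminormed $\Gamma$-module is a seminormed $R$-module with an isometric $R$-linear $\Gamma$-action; a Banach $\Gamma$-module is a real Banach space with isometric linear $\Gamma$-action. The bounded cohomology $H_b^*(\Gamma;A)$ is the cohomology of the complex of bounded functions $\Gamma^n\to A$ (sup seminorm) with the standard inhomogeneous differential of group cohomology, equipped with the induced seminorm; equivalently it is the bounded cohomology of the nerve of $\Gamma$ with the local coefficients given by $A$. The group $Q=\Gamma/\Lambda$ acts isometrically on $H_b^q(\Lambda;A)$ via conjugation on $\Lambda$ and the action of $\Gamma$ on $A$. "$H_b^q(\Lambda;A)$ is Banach" means that its induced seminorm is a complete norm. The spectral sequence is one of $R$-modules (convergence is as $R$-modules), whose second-page terms carry seminorms. *)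

theory Defs
  imports Complex_Main "HOL-Algebra.Algebra" "HOL-Algebra.Algebraic_Closure_Type"
begin

section \<open>Modules over a not necessarily commutative ring\<close>

text \<open>The library's locale \<^locale>\<open>module\<close> requires a commutative ring of scalars. The ring operations
  \<open>mult\<close> and \<open>one\<close> that a \<^type>\<open>module_ext\<close> record inherits from ring records play no role.\<close>

locale left_module = R?: ring R + M?: abelian_group M
  for R :: "('r, 's) ring_scheme" (structure)
    and M :: "('r, 'm, 'x) module_scheme" (structure) +
  assumes smult_closed: "a \<in> carrier R \<Longrightarrow> x \<in> carrier M \<Longrightarrow> a \<odot>\<^bsub>M\<^esub> x \<in> carrier M"
    and smult_l_distr: "a \<in> carrier R \<Longrightarrow> b \<in> carrier R \<Longrightarrow> x \<in> carrier M \<Longrightarrow>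
      (a \<oplus> b) \<odot>\<^bsub>M\<^esub> x = a \<odot>\<^bsub>M\<^esub> x \<oplus>\<^bsub>M\<^esub> b \<odot>\<^bsub>M\<^esub> x"
    and smult_r_distr: "a \<in> carrier R \<Longrightarrow> x \<in> carrier M \<Longrightarrow> y \<in> carrier M \<Longrightarrow>
      a \<odot>\<^bsub>M\<^esub> (x \<oplus>\<^bsub>M\<^esub> y) = a \<odot>\<^bsub>M\<^esub> x \<oplus>\<^bsub>M\<^esub> a \<odot>\<^bsub>M\<^esub> y"
    and smult_assoc: "a \<in> carrier R \<Longrightarrow> b \<in> carrier R \<Longrightarrow> x \<in> carrier M \<Longrightarrow>
      (a \<otimes> b) \<odot>\<^bsub>M\<^esub> x = a \<odot>\<^bsub>M\<^esub> (b \<odot>\<^bsub>M\<^esub> x)"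
    and smult_one: "x \<in> carrier M \<Longrightarrow> \<one> \<odot>\<^bsub>M\<^esub> x = x"

definition linear_maps ::
    "('r, 's) ring_scheme \<Rightarrow> ('r, 'm, 'x) module_scheme \<Rightarrow> ('r, 'n, 'y) module_scheme \<Rightarrow> ('m \<Rightarrow> 'n) set"
  where "linear_maps R M N = {f \<in> carrier M \<rightarrow> carrier N.
    (\<forall>x\<in>carrier M. \<forall>y\<in>carrier M. f (x \<oplus>\<^bsub>M\<^esub> y) = f x \<oplus>\<^bsub>N\<^esub> f y) \<and>
    (\<forall>a\<in>carrier R. \<forall>x\<in>carrier M. f (a \<odot>\<^bsub>M\<^esub> x) = a \<odot>\<^bsub>N\<^esub> f x)}"

definition module_isos ::
    "('r, 's) ring_scheme \<Rightarrow> ('r, 'm, 'x) module_scheme \<Rightarrow> ('r, 'n, 'y) module_scheme \<Rightarrow> ('m \<Rightarrow> 'n) set"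
  where "module_isos R M N = {f \<in> linear_maps R M N. bij_betw f (carrier M) (carrier N)}"

text \<open>The subquotient \<open>Z/B\<close> of \<open>M\<close> for submodules \<open>B \<subseteq> Z\<close> of \<open>M\<close>.\<close>

definition subquotient :: "('r, 'm, 'x) module_scheme \<Rightarrow> 'm set \<Rightarrow> 'm set \<Rightarrow> ('r, 'm set) module"
  where "subquotient M Z B = \<lparr>
    carrier = (\<lambda>x. B +>\<^bsub>M\<^esub> x) ` Z,
    monoid.mult = undefined,
    monoid.one = undefined,
    ring.zero = B,
    ring.add = set_add M,
    module.smult = (\<lambda>a c. (\<Union>x\<in>c. B +>\<^bsub>M\<^esub> (a \<odot>\<^bsub>M\<^esub> x)))\<rparr>"


section \<open>Normed rings and seminormed modules\<close>

record 'r normed_ring = "'r ring" +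
  absval :: "'r \<Rightarrow> real"

locale normed_ring = ring R for R :: "('r, 's) normed_ring_scheme" (structure) +
  assumes absval_nonneg: "a \<in> carrier R \<Longrightarrow> 0 \<le> absval R a"
    and absval_eq_0_iff: "a \<in> carrier R \<Longrightarrow> absval R a = 0 \<longleftrightarrow> a = \<zero>"
    and absval_minus: "a \<in> carrier R \<Longrightarrow> absval R (\<ominus> a) = absval R a"
    and absval_triangle: "a \<in> carrier R \<Longrightarrow> b \<in> carrier R \<Longrightarrow>
      absval R (a \<oplus> b) \<le> absval R a + absval R b"
    and absval_mult: "a \<in> carrier R \<Longrightarrow> b \<in> carrier R \<Longrightarrow>
      absval R (a \<otimes> b) \<le> absval R a * absval R b"

text \<open>``\<open>R = \<real>\<close>'', up to isometric isomorphism of normed rings.\<close>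

definition is_real_normed_ring :: "('r, 's) normed_ring_scheme \<Rightarrow> bool"
  where "is_real_normed_ring R \<longleftrightarrow>
    (\<exists>\<phi>\<in>ring_iso R (ring_of_type_algebra :: real ring). \<forall>a\<in>carrier R. absval R a = \<bar>\<phi> a\<bar>)"

record ('r, 'm) seminormed_module = "('r, 'm) module" +
  seminorm :: "'m \<Rightarrow> real"

text \<open>Since \<open>|1| = 1\<close> is not part of \<^locale>\<open>normed_ring\<close>, the triangle inequality and the
  symmetry of the seminorm do not follow from \<open>seminorm_smult_add\<close> and are listed separately.\<close>

locale seminormed_module = normed_ring R + left_module R M
  for R :: "('r, 's) normed_ring_scheme" (structure)
    and M :: "('r, 'm, 'x) seminormed_module_scheme" (structure) +
  assumes seminorm_nonneg: "x \<in> carrier M \<Longrightarrow> 0 \<le> seminorm M x"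
    and seminorm_zero: "seminorm M \<zero>\<^bsub>M\<^esub> = 0"
    and seminorm_minus: "x \<in> carrier M \<Longrightarrow> seminorm M (\<ominus>\<^bsub>M\<^esub> x) = seminorm M x"
    and seminorm_triangle: "x \<in> carrier M \<Longrightarrow> y \<in> carrier M \<Longrightarrow>
      seminorm M (x \<oplus>\<^bsub>M\<^esub> y) \<le> seminorm M x + seminorm M y"
    and seminorm_smult_add: "a \<in> carrier R \<Longrightarrow> x \<in> carrier M \<Longrightarrow> y \<in> carrier M \<Longrightarrow>
      seminorm M (a \<odot>\<^bsub>M\<^esub> x \<oplus>\<^bsub>M\<^esub> y) \<le> absval R a * seminorm M x + seminorm M y"

definition isometrically_isomorphic ::
    "('r, 's) ring_scheme \<Rightarrow> ('r, 'm, 'x) seminormed_module_scheme \<Rightarrow>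
     ('r, 'n, 'y) seminormed_module_scheme \<Rightarrow> bool"
  where "isometrically_isomorphic R M N \<longleftrightarrow>
    (\<exists>f\<in>module_isos R M N. \<forall>x\<in>carrier M. seminorm N (f x) = seminorm M x)"

definition complete_norm :: "('r, 'm, 'x) seminormed_module_scheme \<Rightarrow> bool"
  where "complete_norm M \<longleftrightarrow>
    (\<forall>x\<in>carrier M. seminorm M x = 0 \<longrightarrow> x = \<zero>\<^bsub>M\<^esub>) \<and>
    (\<forall>u :: nat \<Rightarrow> 'm. range u \<subseteq> carrier M \<longrightarrow>
      (\<forall>e>0. \<exists>N. \<forall>m\<ge>N. \<forall>n\<ge>N. seminorm M (u m \<ominus>\<^bsub>M\<^esub> u n) < e) \<longrightarrow>
      (\<exists>x\<in>carrier M. (\<lambda>n. seminorm M (u n \<ominus>\<^bsub>M\<^esub> x)) \<longlonglongrightarrow> 0))"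

definition seminormed_subquotient ::
    "('r, 'm, 'x) seminormed_module_scheme \<Rightarrow> 'm set \<Rightarrow> 'm set \<Rightarrow> ('r, 'm set) seminormed_module"
  where "seminormed_subquotient M Z B =
    module.extend (subquotient M Z B)
      (seminormed_module.fields (\<lambda>c. Inf (seminorm M ` c)))"


section \<open>Bounded cohomology of groups\<close>

locale seminormed_group_module = group G + seminormed_module R A
  for R :: "('r, 's) normed_ring_scheme"
    and G :: "('g, 'h) monoid_scheme"
    and A :: "('r, 'a, 'x) seminormed_module_scheme"
    and act :: "'g \<Rightarrow> 'a \<Rightarrow> 'a" +
  assumes act_linear: "g \<in> carrier G \<Longrightarrow> act g \<in> linear_maps R A A"
    and act_one: "x \<in> carrier A \<Longrightarrow> act \<one>\<^bsub>G\<^esub> x = x"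
    and act_mult: "g \<in> carrier G \<Longrightarrow> h \<in> carrier G \<Longrightarrow> x \<in> carrier A \<Longrightarrow>
      act (g \<otimes>\<^bsub>G\<^esub> h) x = act g (act h x)"
    and act_isometric: "g \<in> carrier G \<Longrightarrow> x \<in> carrier A \<Longrightarrow> seminorm A (act g x) = seminorm A x"

definition tuples :: "('g, 'h) monoid_scheme \<Rightarrow> nat \<Rightarrow> 'g list set"
  where "tuples G n = {gs. length gs = n \<and> set gs \<subseteq> carrier G}"

text \<open>Cochains are functions on lists that are \<^const>\<open>undefined\<close> outside of \<^term>\<open>tuples G n\<close>.\<close>

definition bounded_cochains ::
    "('g, 'h) monoid_scheme \<Rightarrow> ('r, 'a, 'x) seminormed_module_scheme \<Rightarrow> nat \<Rightarrow>
     ('r, 'g list \<Rightarrow> 'a) seminormed_module"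
  where "bounded_cochains G A n = \<lparr>
    carrier = {f \<in> tuples G n \<rightarrow>\<^sub>E carrier A. \<exists>b. \<forall>gs\<in>tuples G n. seminorm A (f gs) \<le> b},
    monoid.mult = undefined,
    monoid.one = undefined,
    ring.zero = (\<lambda>gs\<in>tuples G n. \<zero>\<^bsub>A\<^esub>),
    ring.add = (\<lambda>f f'. \<lambda>gs\<in>tuples G n. f gs \<oplus>\<^bsub>A\<^esub> f' gs),
    module.smult = (\<lambda>a f. \<lambda>gs\<in>tuples G n. a \<odot>\<^bsub>A\<^esub> f gs),
    seminorm = (\<lambda>f. SUP gs\<in>tuples G n. seminorm A (f gs))\<rparr>"

definition alt_sign :: "('a, 'x) ring_scheme \<Rightarrow> nat \<Rightarrow> 'a \<Rightarrow> 'a"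
  where "alt_sign A i x = (if even i then x else \<ominus>\<^bsub>A\<^esub> x)"

text \<open>\<open>merge G i [g\<^sub>1, \<dots>, g\<^sub>n\<^sub>+\<^sub>1] = [g\<^sub>1, \<dots>, g\<^sub>i g\<^sub>i\<^sub>+\<^sub>1, \<dots>, g\<^sub>n\<^sub>+\<^sub>1]\<close> for \<open>1 \<le> i \<le> n\<close>; list indices start at 0.\<close>

definition merge :: "('g, 'h) monoid_scheme \<Rightarrow> nat \<Rightarrow> 'g list \<Rightarrow> 'g list"
  where "merge G i gs = take (i - 1) gs @ [gs ! (i - 1) \<otimes>\<^bsub>G\<^esub> gs ! i] @ drop (i + 1) gs"

definition coboundary ::
    "('g, 'h) monoid_scheme \<Rightarrow> ('r, 'a, 'x) seminormed_module_scheme \<Rightarrow> ('g \<Rightarrow> 'a \<Rightarrow> 'a) \<Rightarrow> nat \<Rightarrow>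
     ('g list \<Rightarrow> 'a) \<Rightarrow> 'g list \<Rightarrow> 'a"
  where "coboundary G A act n f = (\<lambda>gs\<in>tuples G (Suc n).
    act (hd gs) (f (tl gs)) \<oplus>\<^bsub>A\<^esub>
    (\<Oplus>\<^bsub>A\<^esub>i\<in>{1..n}. alt_sign A i (f (merge G i gs))) \<oplus>\<^bsub>A\<^esub>
    alt_sign A (Suc n) (f (butlast gs)))"

definition cocycles ::
    "('g, 'h) monoid_scheme \<Rightarrow> ('r, 'a, 'x) seminormed_module_scheme \<Rightarrow> ('g \<Rightarrow> 'a \<Rightarrow> 'a) \<Rightarrow> nat \<Rightarrow>
     ('g list \<Rightarrow> 'a) set"
  where "cocycles G A act n =
    {f \<in> carrier (bounded_cochains G A n).
      coboundary G A act n f = \<zero>\<^bsub>bounded_cochains G A (Suc n)\<^esub>}"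

fun coboundaries ::
    "('g, 'h) monoid_scheme \<Rightarrow> ('r, 'a, 'x) seminormed_module_scheme \<Rightarrow> ('g \<Rightarrow> 'a \<Rightarrow> 'a) \<Rightarrow> nat \<Rightarrow>
     ('g list \<Rightarrow> 'a) set"
  where
    "coboundaries G A act 0 = {\<zero>\<^bsub>bounded_cochains G A 0\<^esub>}"
  | "coboundaries G A act (Suc n) = coboundary G A act n ` carrier (bounded_cochains G A n)"

definition bounded_cohomology ::
    "('g, 'h) monoid_scheme \<Rightarrow> ('r, 'a, 'x) seminormed_module_scheme \<Rightarrow> ('g \<Rightarrow> 'a \<Rightarrow> 'a) \<Rightarrow> nat \<Rightarrow>
     ('r, ('g list \<Rightarrow> 'a) set) seminormed_module"
  where "bounded_cohomology G A act n =
    seminormed_subquotient (bounded_cochains G A n) (cocycles G A act n) (coboundaries G A act n)"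


section \<open>Group extensions and the action of the quotient\<close>

locale group_extension = L: group L + G: group G + Q: group Q
  for L :: "('l, 'lx) monoid_scheme" and \<iota> :: "'l \<Rightarrow> 'g"
    and G :: "('g, 'gx) monoid_scheme" and \<pi> :: "'g \<Rightarrow> 'q"
    and Q :: "('q, 'qx) monoid_scheme" +
  assumes mon: "\<iota> \<in> mon L G"
    and epi: "\<pi> \<in> epi G Q"
    and exact: "kernel G Q \<pi> = \<iota> ` carrier L"

text \<open>\<open>(g \<cdot> f)(l\<^sub>1, \<dots>, l\<^sub>n) = g \<cdot> f (g\<^sup>-\<^sup>1 l\<^sub>1 g, \<dots>, g\<^sup>-\<^sup>1 l\<^sub>n g)\<close>, with \<open>L\<close> identified with a subgroup of \<open>G\<close> via \<open>\<iota>\<close>.\<close>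

definition conj_cochain ::
    "('l, 'lx) monoid_scheme \<Rightarrow> ('l \<Rightarrow> 'g) \<Rightarrow> ('g, 'gx) monoid_scheme \<Rightarrow> ('g \<Rightarrow> 'a \<Rightarrow> 'a) \<Rightarrow>
     nat \<Rightarrow> 'g \<Rightarrow> ('l list \<Rightarrow> 'a) \<Rightarrow> 'l list \<Rightarrow> 'a"
  where "conj_cochain L \<iota> G act n g f = (\<lambda>ls\<in>tuples L n.
    act g (f (map (\<lambda>l. inv_into (carrier L) \<iota> (inv\<^bsub>G\<^esub> g \<otimes>\<^bsub>G\<^esub> \<iota> l \<otimes>\<^bsub>G\<^esub> g)) ls)))"

text \<open>The class \<open>x \<cdot> c\<close> consists of all \<open>g \<cdot> f\<close> with \<open>g\<close> a lift of \<open>x\<close> and \<open>f\<close> a representative of \<open>c\<close>: a lift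
  \<open>g\<close> of \<open>x\<close> maps the coset \<open>c\<close> of the coboundaries onto a coset that does not depend on the choice of \<open>g\<close>.\<close>

definition quotient_act ::
    "('l, 'lx) monoid_scheme \<Rightarrow> ('l \<Rightarrow> 'g) \<Rightarrow> ('g, 'gx) monoid_scheme \<Rightarrow> ('g \<Rightarrow> 'q) \<Rightarrow>
     ('g \<Rightarrow> 'a \<Rightarrow> 'a) \<Rightarrow> nat \<Rightarrow> 'q \<Rightarrow> ('l list \<Rightarrow> 'a) set \<Rightarrow> ('l list \<Rightarrow> 'a) set"
  where "quotient_act L \<iota> G \<pi> act n x c =
    {conj_cochain L \<iota> G act n g f | g f. g \<in> carrier G \<and> \<pi> g = x \<and> f \<in> c}"


section \<open>First-quadrant spectral sequences\<close>

text \<open>Cohomological spectral sequences of \<open>R\<close>-modules, with pages numbered from 1;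
  \<open>E r p q\<close> is the term in bidegree \<open>(p, q)\<close> of the \<open>r\<close>-th page.\<close>

definition page_kernel ::
    "(nat \<Rightarrow> int \<Rightarrow> int \<Rightarrow> ('r, 'e, 'x) module_scheme) \<Rightarrow> (nat \<Rightarrow> int \<Rightarrow> int \<Rightarrow> 'e \<Rightarrow> 'e) \<Rightarrow>
     nat \<Rightarrow> int \<Rightarrow> int \<Rightarrow> 'e set"
  where "page_kernel E d r p q =
    {x \<in> carrier (E r p q). d r p q x = \<zero>\<^bsub>E r (p + int r) (q - int r + 1)\<^esub>}"

definition page_image ::
    "(nat \<Rightarrow> int \<Rightarrow> int \<Rightarrow> ('r, 'e, 'x) module_scheme) \<Rightarrow> (nat \<Rightarrow> int \<Rightarrow> int \<Rightarrow> 'e \<Rightarrow> 'e) \<Rightarrow>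
     nat \<Rightarrow> int \<Rightarrow> int \<Rightarrow> 'e set"
  where "page_image E d r p q =
    d r (p - int r) (q + int r - 1) ` carrier (E r (p - int r) (q + int r - 1))"

locale spectral_sequence = ring R
  for R :: "('r, 's) ring_scheme"
    and E :: "nat \<Rightarrow> int \<Rightarrow> int \<Rightarrow> ('r, 'e, 'x) module_scheme"
    and d :: "nat \<Rightarrow> int \<Rightarrow> int \<Rightarrow> 'e \<Rightarrow> 'e" +
  assumes page_module: "1 \<le> r \<Longrightarrow> left_module R (E r p q)"
    and differential_linear: "1 \<le> r \<Longrightarrow>
      d r p q \<in> linear_maps R (E r p q) (E r (p + int r) (q - int r + 1))"
    and differential_square: "1 \<le> r \<Longrightarrow> page_image E d r p q \<subseteq> page_kernel E d r p q"
    and next_page: "1 \<le> r \<Longrightarrow>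
      module_isos R (E (Suc r) p q)
        (subquotient (E r p q) (page_kernel E d r p q) (page_image E d r p q)) \<noteq> {}"

definition first_quadrant :: "(nat \<Rightarrow> int \<Rightarrow> int \<Rightarrow> ('r, 'e, 'x) module_scheme) \<Rightarrow> bool"
  where "first_quadrant E \<longleftrightarrow>
    (\<forall>r\<ge>1. \<forall>p q. p < 0 \<or> q < 0 \<longrightarrow> carrier (E r p q) = {\<zero>\<^bsub>E r p q\<^esub>})"

text \<open>Convergence of a first-quadrant spectral sequence to a graded module \<open>H\<close>. No nonzero differential
  starts or ends in bidegree \<open>(p, q)\<close> on the pages \<open>r > max p (q + 1)\<close>, so all of these are isomorphic
  to the limit term in this bidegree.\<close>

definition converges_to ::
    "('r, 's) ring_scheme \<Rightarrow> (nat \<Rightarrow> int \<Rightarrow> int \<Rightarrow> ('r, 'e, 'x) module_scheme) \<Rightarrow>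
     (nat \<Rightarrow> ('r, 'm, 'y) module_scheme) \<Rightarrow> bool"
  where "converges_to R E H \<longleftrightarrow>
    (\<exists>F :: nat \<Rightarrow> nat \<Rightarrow> 'm set.
      (\<forall>n p. submodule (F n p) R (H n) \<and> F n (Suc p) \<subseteq> F n p) \<and>
      (\<forall>n. F n 0 = carrier (H n) \<and> F n (Suc n) = {\<zero>\<^bsub>H n\<^esub>}) \<and>
      (\<forall>p q r. max p (q + 1) < r \<longrightarrow>
        module_isos R (E r (int p) (int q))
          (subquotient (H (p + q)) (F (p + q) p) (F (p + q) (Suc p))) \<noteq> {}))"

end

theory Submission imports Defs "HOL-Analysis.Urysohn" begin

text \<open>The spectral sequence comes from the double complex \<open>C\<^sup>p\<^sup>q\<close> of \<open>G\<close>-equivariant bounded functions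
  \<open>Q\<^sup>p\<^sup>+\<^sup>1 \<times> G\<^sup>q\<^sup>+\<^sup>1 \<rightarrow> A\<close>, filtered by \<open>p\<close>. Inserting \<open>\<pi> (g\<^sub>0)\<close> as a new \<open>Q\<close>-coordinate contracts the rows,
  so the total complex computes the bounded cohomology of \<open>G\<close>; the comparison map is the one of
  Alexander and Whitney. Restricting the columns to the kernel replaces them,
  up to a homotopy built from a \<open>G\<close>-equivariant family of retractions of \<open>G\<close> onto the fibres of \<open>\<pi>\<close>,
  by \<open>\<ell>\<^sup>\<infinity>(Q\<^sup>p, -)\<close> of the bounded cochains of the kernel. All that is needed for
  the expected \<open>E\<^sub>2\<close> is that bounded families of coboundaries have bounded families of primitives.
  Such families exist trivially when \<open>Q\<close> is finite or \<open>q = 0\<close>, and in the Banach case by the open mapping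
  theorem, since the seminorm of the cohomology is a norm only if the coboundaries are closed.\<close>

section \<open>Submodules and subquotients\<close>

text \<open>The obstacle is that bounded functions on an infinite set do not form an exact functor:
  a bounded family of coboundaries may have primitives of unbounded norm only. This is isolated in
  \<open>uniform_primitives\<close>, which is used directly at one point, the removal of the leading
  column of a cochain with vanishing class (\<open>kernel_\<Phi>\<close>). Convergence, in contrast,
  rests on an explicit contraction that preserves bounds. For the isometry it matters that a page is
  normed by the component in bidegree \<open>(p, q)\<close> alone, the leading one. The corrections
  in later columns that turn a first-page cycle into a second-page cycle then do not change the
  norm, and a lift with an arbitrarily small error \<open>e\<close> is good enough. Homogeneous
  functions carry all computations: there the differential is deletion of entries, conjugation
  becomes right translation, and prisms compare different translations. Inhomogeneous cochains occur
  only at the two ends, through \<open>hg\<close> and \<open>ih\<close>.\<close>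

lemma (in abelian_group) a_inv_zero: "\<ominus> \<zero> = \<zero>"
  by (simp add: minus_equality)

text \<open>Sets up the \<open>algebra\<close> method for additively written abelian groups; the
  rearrangements of sums and differences of cochains below are then single steps.\<close>

lemmas (in abelian_group) abelian_group_simprules
  [algebra abelian_group "ring.zero G" "ring.add G" "a_inv G" "a_minus G"] =
  a_closed zero_closed a_inv_closed minus_closed a_assoc l_zero l_neg a_comm minus_eq
  r_zero r_neg r_neg2 r_neg1 minus_add minus_minus a_inv_zero a_lcomm

lemma (in abelian_group) diff_add_cancel_right:
  "x \<in> carrier G \<Longrightarrow> y \<in> carrier G \<Longrightarrow> (x \<ominus> y) \<oplus> y = x"
  by algebra

lemma (in abelian_group) add_diff_cancel_right:
  "x \<in> carrier G \<Longrightarrow> y \<in> carrier G \<Longrightarrow> (x \<oplus> y) \<ominus> y = x"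
  by algebra

context left_module
begin

lemma smult_zero: "a \<in> carrier R \<Longrightarrow> a \<odot>\<^bsub>M\<^esub> \<zero>\<^bsub>M\<^esub> = \<zero>\<^bsub>M\<^esub>"
  using smult_r_distr[of a "\<zero>\<^bsub>M\<^esub>" "\<zero>\<^bsub>M\<^esub>"] smult_closed[of a "\<zero>\<^bsub>M\<^esub>"]
  by (metis M.add.l_cancel_one M.l_zero M.zero_closed)

lemma smult_minus:
  assumes "a \<in> carrier R" "x \<in> carrier M"
  shows "a \<odot>\<^bsub>M\<^esub> (\<ominus>\<^bsub>M\<^esub> x) = \<ominus>\<^bsub>M\<^esub> (a \<odot>\<^bsub>M\<^esub> x)"
  using smult_r_distr[OF assms(1), of x "\<ominus>\<^bsub>M\<^esub> x"] smult_zero[OF assms(1)] assms smult_closed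
  by (metis M.a_inv_closed M.add.inv_equality M.r_neg M.a_comm)

lemma smult_diff:
  assumes "a \<in> carrier R" "x \<in> carrier M" "y \<in> carrier M"
  shows "a \<odot>\<^bsub>M\<^esub> (x \<ominus>\<^bsub>M\<^esub> y) = a \<odot>\<^bsub>M\<^esub> x \<ominus>\<^bsub>M\<^esub> a \<odot>\<^bsub>M\<^esub> y"
  using assms by (simp add: a_minus_def smult_r_distr smult_minus)

lemma submoduleI:
  assumes "H \<subseteq> carrier M" "\<zero>\<^bsub>M\<^esub> \<in> H"
    and "\<And>x. x \<in> H \<Longrightarrow> \<ominus>\<^bsub>M\<^esub> x \<in> H"
    and "\<And>x y. x \<in> H \<Longrightarrow> y \<in> H \<Longrightarrow> x \<oplus>\<^bsub>M\<^esub> y \<in> H"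
    and "\<And>a x. a \<in> carrier R \<Longrightarrow> x \<in> H \<Longrightarrow> a \<odot>\<^bsub>M\<^esub> x \<in> H"
  shows "submodule H R M"
  using assms by (auto intro!: submodule.intro subgroup.intro submodule_axioms.intro simp: a_inv_def)

lemma submodule_closed:
  assumes "submodule H R M"
  shows "x \<in> H \<Longrightarrow> x \<in> carrier M" "\<zero>\<^bsub>M\<^esub> \<in> H"
    and "x \<in> H \<Longrightarrow> \<ominus>\<^bsub>M\<^esub> x \<in> H"
    and "x \<in> H \<Longrightarrow> y \<in> H \<Longrightarrow> x \<oplus>\<^bsub>M\<^esub> y \<in> H"
    and "x \<in> H \<Longrightarrow> y \<in> H \<Longrightarrow> x \<ominus>\<^bsub>M\<^esub> y \<in> H"
    and "a \<in> carrier R \<Longrightarrow> x \<in> H \<Longrightarrow> a \<odot>\<^bsub>M\<^esub> x \<in> H"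
proof -
  interpret H: submodule H R M by fact
  show "\<zero>\<^bsub>M\<^esub> \<in> H" using H.one_closed by simp
  show "x \<in> H \<Longrightarrow> x \<in> carrier M" using H.subset by auto
  show n: "x \<in> H \<Longrightarrow> \<ominus>\<^bsub>M\<^esub> x \<in> H" for x using H.m_inv_closed by (simp add: a_inv_def)
  show a: "x \<in> H \<Longrightarrow> y \<in> H \<Longrightarrow> x \<oplus>\<^bsub>M\<^esub> y \<in> H" for x y using H.m_closed by simp
  show "x \<in> H \<Longrightarrow> y \<in> H \<Longrightarrow> x \<ominus>\<^bsub>M\<^esub> y \<in> H" using n a by (simp add: a_minus_def)
  show "a \<in> carrier R \<Longrightarrow> x \<in> H \<Longrightarrow> a \<odot>\<^bsub>M\<^esub> x \<in> H" using H.smult_closed by simp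
qed

lemma submodule_zero: "submodule {\<zero>\<^bsub>M\<^esub>} R M"
  by (rule submoduleI) (auto simp: smult_zero)

lemma submodule_sum:
  assumes HK: "submodule H R M" "submodule K R M"
  shows "submodule {x \<oplus>\<^bsub>M\<^esub> y | x y. x \<in> H \<and> y \<in> K} R M"
proof (rule submoduleI)
  note H = submodule_closed[OF HK(1)] and K = submodule_closed[OF HK(2)]
  show "{x \<oplus>\<^bsub>M\<^esub> y |x y. x \<in> H \<and> y \<in> K} \<subseteq> carrier M" using H(1) K(1) by auto
  show "\<zero>\<^bsub>M\<^esub> \<in> {x \<oplus>\<^bsub>M\<^esub> y |x y. x \<in> H \<and> y \<in> K}" using H(2) K(2) by force
  fix u assume "u \<in> {x \<oplus>\<^bsub>M\<^esub> y |x y. x \<in> H \<and> y \<in> K}"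
  then obtain x y where u: "u = x \<oplus>\<^bsub>M\<^esub> y" "x \<in> H" "y \<in> K" by auto
  then have c: "x \<in> carrier M" "y \<in> carrier M" using H(1) K(1) by auto
  have "\<ominus>\<^bsub>M\<^esub> u = \<ominus>\<^bsub>M\<^esub> x \<oplus>\<^bsub>M\<^esub> (\<ominus>\<^bsub>M\<^esub> y)" using c u by (simp add: M.minus_add)
  then show "\<ominus>\<^bsub>M\<^esub> u \<in> {x \<oplus>\<^bsub>M\<^esub> y |x y. x \<in> H \<and> y \<in> K}" using u(2,3) H(3) K(3) by blast
  {
    fix a assume a: "a \<in> carrier R"
    have "a \<odot>\<^bsub>M\<^esub> u = a \<odot>\<^bsub>M\<^esub> x \<oplus>\<^bsub>M\<^esub> a \<odot>\<^bsub>M\<^esub> y" using a c u by (simp add: smult_r_distr)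
    then show "a \<odot>\<^bsub>M\<^esub> u \<in> {x \<oplus>\<^bsub>M\<^esub> y |x y. x \<in> H \<and> y \<in> K}" using a u(2,3) H(6) K(6) by blast
  next
    fix v assume "v \<in> {x \<oplus>\<^bsub>M\<^esub> y |x y. x \<in> H \<and> y \<in> K}"
    then obtain x' y' where v: "v = x' \<oplus>\<^bsub>M\<^esub> y'" "x' \<in> H" "y' \<in> K" by auto
    then have c': "x' \<in> carrier M" "y' \<in> carrier M" using H(1) K(1) by auto
    have "u \<oplus>\<^bsub>M\<^esub> v = (x \<oplus>\<^bsub>M\<^esub> x') \<oplus>\<^bsub>M\<^esub> (y \<oplus>\<^bsub>M\<^esub> y')" using c c' u v by (simp add: M.a_ac)
    then show "u \<oplus>\<^bsub>M\<^esub> v \<in> {x \<oplus>\<^bsub>M\<^esub> y |x y. x \<in> H \<and> y \<in> K}" using u(2,3) v(2,3) H(4) K(4) by blast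
  }
qed

lemma coset_mem_iff:
  assumes "submodule B R M" "x \<in> carrier M"
  shows "z \<in> B +>\<^bsub>M\<^esub> x \<longleftrightarrow> z \<in> carrier M \<and> z \<ominus>\<^bsub>M\<^esub> x \<in> B"
proof
  note B = submodule_closed[OF assms(1)]
  assume "z \<in> B +>\<^bsub>M\<^esub> x"
  then obtain b where b: "b \<in> B" "z = b \<oplus>\<^bsub>M\<^esub> x" by (auto simp: a_r_coset_def')
  then have "z \<ominus>\<^bsub>M\<^esub> x = b" using B(1)[OF b(1)] assms(2) by algebra
  then show "z \<in> carrier M \<and> z \<ominus>\<^bsub>M\<^esub> x \<in> B" using b B assms by auto
next
  note B = submodule_closed[OF assms(1)]
  assume z: "z \<in> carrier M \<and> z \<ominus>\<^bsub>M\<^esub> x \<in> B"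
  then have "z = (z \<ominus>\<^bsub>M\<^esub> x) \<oplus>\<^bsub>M\<^esub> x" using assms(2) by algebra
  then show "z \<in> B +>\<^bsub>M\<^esub> x" using z by (auto simp: a_r_coset_def')
qed

lemma coset_self: "submodule B R M \<Longrightarrow> x \<in> carrier M \<Longrightarrow> x \<in> B +>\<^bsub>M\<^esub> x"
  by (simp add: coset_mem_iff M.r_neg a_minus_def submodule_closed)

lemma coset_eq_iff:
  assumes "submodule B R M" "x \<in> carrier M" "y \<in> carrier M"
  shows "B +>\<^bsub>M\<^esub> x = B +>\<^bsub>M\<^esub> y \<longleftrightarrow> x \<ominus>\<^bsub>M\<^esub> y \<in> B"
proof
  assume "B +>\<^bsub>M\<^esub> x = B +>\<^bsub>M\<^esub> y"
  then show "x \<ominus>\<^bsub>M\<^esub> y \<in> B" using coset_self[OF assms(1,2)] coset_mem_iff[OF assms(1,3)] by auto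
next
  note B = submodule_closed[OF assms(1)]
  assume d: "x \<ominus>\<^bsub>M\<^esub> y \<in> B"
  have "z \<ominus>\<^bsub>M\<^esub> x \<in> B \<longleftrightarrow> z \<ominus>\<^bsub>M\<^esub> y \<in> B" if z: "z \<in> carrier M" for z
  proof -
    have "z \<ominus>\<^bsub>M\<^esub> y = (z \<ominus>\<^bsub>M\<^esub> x) \<oplus>\<^bsub>M\<^esub> (x \<ominus>\<^bsub>M\<^esub> y)" using z assms(2,3) by algebra
    moreover have "z \<ominus>\<^bsub>M\<^esub> x = (z \<ominus>\<^bsub>M\<^esub> y) \<ominus>\<^bsub>M\<^esub> (x \<ominus>\<^bsub>M\<^esub> y)" using z assms(2,3) by algebra
    ultimately show ?thesis using B(4,5) d by metis
  qed
  then show "B +>\<^bsub>M\<^esub> x = B +>\<^bsub>M\<^esub> y" using coset_mem_iff assms by auto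
qed

lemma coset_zero: "submodule B R M \<Longrightarrow> B +>\<^bsub>M\<^esub> \<zero>\<^bsub>M\<^esub> = B"
  using submodule_closed by (simp add: M.a_coset_add_zero subsetI)

lemma coset_eq_sub_iff:
  assumes "submodule B R M" "x \<in> carrier M"
  shows "B +>\<^bsub>M\<^esub> x = B \<longleftrightarrow> x \<in> B"
  using coset_eq_iff[OF assms M.zero_closed] assms by (simp add: coset_zero a_minus_def M.a_inv_zero)

lemma coset_add:
  assumes "submodule B R M" "x \<in> carrier M" "y \<in> carrier M"
  shows "(B +>\<^bsub>M\<^esub> x) <+>\<^bsub>M\<^esub> (B +>\<^bsub>M\<^esub> y) = B +>\<^bsub>M\<^esub> (x \<oplus>\<^bsub>M\<^esub> y)"
proof -
  interpret B: abelian_subgroup B M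
    using assms(1) by (intro abelian_subgroupI3 M.abelian_group_axioms)
      (auto simp: additive_subgroup_def submodule_def)
  show ?thesis using B.a_rcos_sum assms by simp
qed

text \<open>All sets in this union coincide: members of one coset differ by an element of
  \<open>B\<close>, and so do their multiples. The union is a way to multiply a coset without
  choosing a representative.\<close>

lemma coset_smult:
  assumes "submodule B R M" "a \<in> carrier R" "x \<in> carrier M"
  shows "(\<Union>z\<in>B +>\<^bsub>M\<^esub> x. B +>\<^bsub>M\<^esub> (a \<odot>\<^bsub>M\<^esub> z)) = B +>\<^bsub>M\<^esub> (a \<odot>\<^bsub>M\<^esub> x)"
proof -
  note B = submodule_closed[OF assms(1)]
  have "B +>\<^bsub>M\<^esub> (a \<odot>\<^bsub>M\<^esub> z) = B +>\<^bsub>M\<^esub> (a \<odot>\<^bsub>M\<^esub> x)" if "z \<in> B +>\<^bsub>M\<^esub> x" for z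
  proof -
    have z: "z \<in> carrier M" "z \<ominus>\<^bsub>M\<^esub> x \<in> B" using that assms by (auto simp: coset_mem_iff)
    then have "a \<odot>\<^bsub>M\<^esub> z \<ominus>\<^bsub>M\<^esub> a \<odot>\<^bsub>M\<^esub> x \<in> B"
      using smult_diff[OF assms(2) z(1) assms(3)] B(6)[OF assms(2) z(2)] by simp
    then show ?thesis using coset_eq_iff[OF assms(1)] z assms smult_closed by blast
  qed
  then show ?thesis using coset_self[OF assms(1,3)] by blast
qed

end

text \<open>The pages of a spectral sequence may carry additional structure, such as a seminorm; this
  predicate only looks at the module structure.\<close>

definition is_subquotient ::
    "('r, 'm set, 'y) module_scheme \<Rightarrow> ('r, 'm, 'x) module_scheme \<Rightarrow> 'm set \<Rightarrow> 'm set \<Rightarrow> bool"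
  where "is_subquotient N M Z B \<longleftrightarrow>
    carrier N = (\<lambda>x. B +>\<^bsub>M\<^esub> x) ` Z \<and> ring.zero N = B \<and> ring.add N = set_add M \<and>
    module.smult N = (\<lambda>a c. (\<Union>x\<in>c. B +>\<^bsub>M\<^esub> (a \<odot>\<^bsub>M\<^esub> x)))"

lemma is_subquotient_subquotient: "is_subquotient (subquotient M Z B) M Z B"
  by (simp add: is_subquotient_def subquotient_def)

lemma is_subquotient_seminormed_subquotient:
  "is_subquotient (seminormed_subquotient M Z B) M Z B"
  by (simp add: is_subquotient_def seminormed_subquotient_def subquotient_def module.extend_def)

lemma seminorm_seminormed_subquotient:
  "seminorm (seminormed_subquotient M Z B) c = Inf (seminorm M ` c)"
  by (simp add: seminormed_subquotient_def module.extend_def seminormed_module.fields_def)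

locale subquotient_module = left_module R M
  for R :: "('r, 's) ring_scheme" and M :: "('r, 'm, 'x) module_scheme"
    and Z B :: "'m set" and N :: "('r, 'm set, 'y) module_scheme" +
  assumes Z: "submodule Z R M" and B: "submodule B R M" and N: "is_subquotient N M Z B"
begin

abbreviation cls where "cls x \<equiv> B +>\<^bsub>M\<^esub> x"

lemma Z_carrier: "z \<in> Z \<Longrightarrow> z \<in> carrier M"
  using submodule_closed[OF Z] by simp

lemma carrier_eq: "carrier N = cls ` Z"
  using N by (simp add: is_subquotient_def)

lemma cls_closed: "z \<in> Z \<Longrightarrow> cls z \<in> carrier N"
  by (simp add: carrier_eq)

lemma carrierE: assumes "c \<in> carrier N" obtains z where "z \<in> Z" "c = cls z"
  using assms carrier_eq by auto

lemma cls_add: "x \<in> Z \<Longrightarrow> y \<in> Z \<Longrightarrow> cls x \<oplus>\<^bsub>N\<^esub> cls y = cls (x \<oplus>\<^bsub>M\<^esub> y)"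
  using N by (simp add: is_subquotient_def coset_add[OF B] Z_carrier)

lemma cls_smult: "a \<in> carrier R \<Longrightarrow> x \<in> Z \<Longrightarrow> a \<odot>\<^bsub>N\<^esub> cls x = cls (a \<odot>\<^bsub>M\<^esub> x)"
  using N by (simp add: is_subquotient_def coset_smult[OF B] Z_carrier)

lemma zero_eq: "\<zero>\<^bsub>N\<^esub> = B"
  using N by (simp add: is_subquotient_def)

lemma cls_zero: "cls \<zero>\<^bsub>M\<^esub> = \<zero>\<^bsub>N\<^esub>"
  by (simp add: zero_eq coset_zero[OF B])

lemma cls_eq_iff: "x \<in> Z \<Longrightarrow> y \<in> Z \<Longrightarrow> cls x = cls y \<longleftrightarrow> x \<ominus>\<^bsub>M\<^esub> y \<in> B"
  by (simp add: coset_eq_iff[OF B] Z_carrier)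

lemma cls_eq_zero_iff: "x \<in> Z \<Longrightarrow> cls x = \<zero>\<^bsub>N\<^esub> \<longleftrightarrow> x \<in> B"
  by (simp add: zero_eq coset_eq_sub_iff[OF B] Z_carrier)

lemma left_module_N: "left_module R N"
proof -
  note Z' = submodule_closed[OF Z]
  have "abelian_group N"
  proof (rule abelian_groupI)
    show "\<zero>\<^bsub>N\<^esub> \<in> carrier N" using cls_closed[OF Z'(2)] cls_zero by simp
    fix c assume "c \<in> carrier N"
    then obtain x where x: "x \<in> Z" "c = cls x" by (rule carrierE)
    show "\<zero>\<^bsub>N\<^esub> \<oplus>\<^bsub>N\<^esub> c = c" using x cls_add[OF Z'(2) x(1)] cls_zero Z_carrier by simp
    show "\<exists>y\<in>carrier N. y \<oplus>\<^bsub>N\<^esub> c = \<zero>\<^bsub>N\<^esub>"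
      using x cls_add[OF Z'(3) x(1)] cls_zero cls_closed Z'(3) Z_carrier
      by (intro bexI[of _ "cls (\<ominus>\<^bsub>M\<^esub> x)"]) (auto simp: M.l_neg)
    fix c' assume "c' \<in> carrier N"
    then obtain y where y: "y \<in> Z" "c' = cls y" by (rule carrierE)
    show "c \<oplus>\<^bsub>N\<^esub> c' \<in> carrier N" using x y cls_add cls_closed Z' by simp
    show "c \<oplus>\<^bsub>N\<^esub> c' = c' \<oplus>\<^bsub>N\<^esub> c" using x y cls_add Z_carrier by (simp add: M.a_comm)
    fix c'' assume "c'' \<in> carrier N"
    then obtain z where z: "z \<in> Z" "c'' = cls z" by (rule carrierE)
    show "c \<oplus>\<^bsub>N\<^esub> c' \<oplus>\<^bsub>N\<^esub> c'' = c \<oplus>\<^bsub>N\<^esub> (c' \<oplus>\<^bsub>N\<^esub> c'')"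
      using x y z cls_add Z_carrier Z' by (simp add: M.a_assoc)
  qed
  then interpret N: abelian_group N .
  show ?thesis
  proof
    fix a c assume a: "a \<in> carrier R" and "c \<in> carrier N"
    then obtain x where x: "x \<in> Z" "c = cls x" by (auto elim: carrierE)
    show "a \<odot>\<^bsub>N\<^esub> c \<in> carrier N" using a x cls_smult cls_closed Z' by simp
    fix b assume b: "b \<in> carrier R"
    show "(a \<oplus>\<^bsub>R\<^esub> b) \<odot>\<^bsub>N\<^esub> c = a \<odot>\<^bsub>N\<^esub> c \<oplus>\<^bsub>N\<^esub> b \<odot>\<^bsub>N\<^esub> c"
      using a b x cls_smult cls_add Z' Z_carrier by (simp add: smult_l_distr)
    show "(a \<otimes>\<^bsub>R\<^esub> b) \<odot>\<^bsub>N\<^esub> c = a \<odot>\<^bsub>N\<^esub> (b \<odot>\<^bsub>N\<^esub> c)"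
      using a b x cls_smult Z' Z_carrier by (simp add: smult_assoc)
  next
    fix a c c' assume a: "a \<in> carrier R" and "c \<in> carrier N" "c' \<in> carrier N"
    then obtain x y where x: "x \<in> Z" "c = cls x" and y: "y \<in> Z" "c' = cls y"
      by (auto elim!: carrierE)
    show "a \<odot>\<^bsub>N\<^esub> (c \<oplus>\<^bsub>N\<^esub> c') = a \<odot>\<^bsub>N\<^esub> c \<oplus>\<^bsub>N\<^esub> a \<odot>\<^bsub>N\<^esub> c'"
      using a x y cls_smult cls_add Z' Z_carrier by (simp add: smult_r_distr)
  next
    fix c assume "c \<in> carrier N"
    then obtain x where x: "x \<in> Z" "c = cls x" by (auto elim: carrierE)
    then show "\<one>\<^bsub>R\<^esub> \<odot>\<^bsub>N\<^esub> c = c" using cls_smult Z_carrier by (simp add: smult_one)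
  qed
qed

lemma cls_minus: assumes "x \<in> Z" shows "\<ominus>\<^bsub>N\<^esub> cls x = cls (\<ominus>\<^bsub>M\<^esub> x)"
proof -
  interpret N: left_module R N by (rule left_module_N)
  note Z' = submodule_closed[OF Z]
  have "cls (\<ominus>\<^bsub>M\<^esub> x) \<oplus>\<^bsub>N\<^esub> cls x = \<zero>\<^bsub>N\<^esub>"
    using assms cls_add Z' Z_carrier cls_zero by (simp add: M.l_neg)
  then show ?thesis using N.M.minus_equality cls_closed Z' assms by auto
qed

lemma cls_diff: "x \<in> Z \<Longrightarrow> y \<in> Z \<Longrightarrow> cls x \<ominus>\<^bsub>N\<^esub> cls y = cls (x \<ominus>\<^bsub>M\<^esub> y)"
  using submodule_closed[OF Z] by (simp add: a_minus_def cls_minus cls_add)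

lemma submodule_image:
  assumes "submodule K R M" "K \<subseteq> Z"
  shows "submodule (cls ` K) R N"
proof -
  interpret N: left_module R N by (rule left_module_N)
  note K = submodule_closed[OF assms(1)]
  show ?thesis
  proof (rule N.submoduleI)
    show "cls ` K \<subseteq> carrier N" using assms by (auto simp: carrier_eq)
    show "\<zero>\<^bsub>N\<^esub> \<in> cls ` K" using K(2) cls_zero by (metis imageI)
    show "\<ominus>\<^bsub>N\<^esub> c \<in> cls ` K" if "c \<in> cls ` K" for c
      using that assms(2) K cls_minus by auto
    show "c \<oplus>\<^bsub>N\<^esub> c' \<in> cls ` K" if "c \<in> cls ` K" "c' \<in> cls ` K" for c c'
      using that assms(2) K cls_add by (smt (verit) image_iff subsetD)
    show "a \<odot>\<^bsub>N\<^esub> c \<in> cls ` K" if "a \<in> carrier R" "c \<in> cls ` K" for a c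
      using that assms(2) K cls_smult by (smt (verit) image_iff subsetD)
  qed
qed

end

text \<open>The common source of the isomorphisms below: next page, limit term and second page. The
  map is given on representatives only, and the conclusion keeps its formula on cosets, which the
  comparison of seminorms on the second page needs.\<close>

lemma subquotient_iso:
  assumes U: "subquotient_module R M Z B U" and V: "subquotient_module R M' Z' B' V"
    and BZ: "B \<subseteq> Z"
    and f: "\<And>z. z \<in> Z \<Longrightarrow> f z \<in> Z'"
    and f_add: "\<And>x y. x \<in> Z \<Longrightarrow> y \<in> Z \<Longrightarrow> f (x \<oplus>\<^bsub>M\<^esub> y) = f x \<oplus>\<^bsub>M'\<^esub> f y"
    and f_smult: "\<And>a x. a \<in> carrier R \<Longrightarrow> x \<in> Z \<Longrightarrow> f (a \<odot>\<^bsub>M\<^esub> x) = a \<odot>\<^bsub>M'\<^esub> f x"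
    and surj: "\<And>y. y \<in> Z' \<Longrightarrow> \<exists>z\<in>Z. y \<ominus>\<^bsub>M'\<^esub> f z \<in> B'"
    and ker: "\<And>z. z \<in> Z \<Longrightarrow> f z \<in> B' \<longleftrightarrow> z \<in> B"
  shows "\<exists>h\<in>module_isos R U V. \<forall>z\<in>Z. h (B +>\<^bsub>M\<^esub> z) = B' +>\<^bsub>M'\<^esub> f z"
proof -
  interpret U: subquotient_module R M Z B U by fact
  interpret V: subquotient_module R M' Z' B' V by fact
  note Zc = U.submodule_closed[OF U.Z]
  have f_diff: "f (x \<ominus>\<^bsub>M\<^esub> y) = f x \<ominus>\<^bsub>M'\<^esub> f y" if xy: "x \<in> Z" "y \<in> Z" for x y
  proof -
    have "f x = f ((x \<ominus>\<^bsub>M\<^esub> y) \<oplus>\<^bsub>M\<^esub> y)"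
      using xy U.Z_carrier by (simp add: U.M.diff_add_cancel_right)
    also have "\<dots> = f (x \<ominus>\<^bsub>M\<^esub> y) \<oplus>\<^bsub>M'\<^esub> f y" by (intro f_add Zc(5) xy)
    finally show ?thesis
      using V.M.add_diff_cancel_right[of "f (x \<ominus>\<^bsub>M\<^esub> y)" "f y"] V.Z_carrier f Zc(5) xy by simp
  qed
  \<comment> \<open>From left to right this makes the induced map well defined, from right to left
    injective.\<close>
  have inj: "U.cls x = U.cls y \<longleftrightarrow> V.cls (f x) = V.cls (f y)" if "x \<in> Z" "y \<in> Z" for x y
    using that ker[OF Zc(5)[OF that]] f_diff[OF that] by (simp add: U.cls_eq_iff V.cls_eq_iff f)
  define h where "h = (\<lambda>c. V.cls (f (SOME z. z \<in> Z \<and> c = U.cls z)))"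
  have h: "h (U.cls z) = V.cls (f z)" if "z \<in> Z" for z
  proof -
    let ?s = "SOME z'. z' \<in> Z \<and> U.cls z = U.cls z'"
    have "?s \<in> Z \<and> U.cls z = U.cls ?s"
      by (rule someI[of _ z]) (use that in simp)
    then have "V.cls (f ?s) = V.cls (f z)" using inj[of z ?s] that by simp
    then show ?thesis by (simp add: h_def)
  qed
  have "h \<in> module_isos R U V"
    unfolding module_isos_def linear_maps_def
  proof (intro CollectI conjI ballI)
    show "h \<in> carrier U \<rightarrow> carrier V" using h f by (auto simp: U.carrier_eq V.carrier_eq)
    fix c assume "c \<in> carrier U"
    then obtain x where x: "x \<in> Z" "c = U.cls x" by (rule U.carrierE)
    {
      fix c' assume "c' \<in> carrier U"
      then obtain y where y: "y \<in> Z" "c' = U.cls y" by (rule U.carrierE)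
      show "h (c \<oplus>\<^bsub>U\<^esub> c') = h c \<oplus>\<^bsub>V\<^esub> h c'"
        using x y by (simp add: U.cls_add V.cls_add h f f_add Zc)
    next
      fix a assume "a \<in> carrier R"
      then show "h (a \<odot>\<^bsub>U\<^esub> c) = a \<odot>\<^bsub>V\<^esub> h c"
        using x by (simp add: U.cls_smult V.cls_smult h f f_smult Zc)
    }
  next
    show "bij_betw h (carrier U) (carrier V)"
    proof (rule bij_betw_imageI)
      show "inj_on h (carrier U)" using inj h by (auto simp: inj_on_def U.carrier_eq)
      have "c \<in> h ` carrier U" if c: "c \<in> carrier V" for c
      proof -
        obtain y where y: "y \<in> Z'" "c = V.cls y" using c by (rule V.carrierE)
        obtain z where z: "z \<in> Z" "y \<ominus>\<^bsub>M'\<^esub> f z \<in> B'" using surj[OF y(1)] by auto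
        then have "c = h (U.cls z)" using y by (simp add: h f V.cls_eq_iff)
        then show ?thesis using z U.cls_closed by blast
      qed
      then show "h ` carrier U = carrier V" using h f by (auto simp: U.carrier_eq V.carrier_eq)
    qed
  qed
  then show ?thesis using h by blast
qed

section \<open>The spectral sequence of a filtered complex\<close>

text \<open>Degrees and filtration steps are submodules of a single module, so that one type carries
  the whole complex and \<open>D\<close> is one endomorphism. \<open>F_full\<close> and
  \<open>F_null\<close> confine the filtration in degree \<open>n\<close> to the range from 0 to
  \<open>n\<close>; this gives the first quadrant and convergence.\<close>

locale filtered_complex = left_module R M
  for R :: "('r, 's) ring_scheme" and M :: "('r, 'm, 'x) module_scheme" +
  fixes C F :: "int \<Rightarrow> 'm set" and D :: "'m \<Rightarrow> 'm"
  assumes C: "submodule (C n) R M" and F: "submodule (F p) R M"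
    and D_closed: "x \<in> carrier M \<Longrightarrow> D x \<in> carrier M"
    and D_add: "x \<in> carrier M \<Longrightarrow> y \<in> carrier M \<Longrightarrow> D (x \<oplus>\<^bsub>M\<^esub> y) = D x \<oplus>\<^bsub>M\<^esub> D y"
    and D_smult: "a \<in> carrier R \<Longrightarrow> x \<in> carrier M \<Longrightarrow> D (a \<odot>\<^bsub>M\<^esub> x) = a \<odot>\<^bsub>M\<^esub> D x"
    and D_D: "x \<in> carrier M \<Longrightarrow> D (D x) = \<zero>\<^bsub>M\<^esub>"
    and D_C: "x \<in> C n \<Longrightarrow> D x \<in> C (n + 1)"
    and D_F: "x \<in> F p \<Longrightarrow> D x \<in> F p"
    and F_antimono: "p \<le> p' \<Longrightarrow> F p' \<subseteq> F p"
    and F_full: "p \<le> 0 \<Longrightarrow> C n \<subseteq> F p"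
    and F_null: "n < p \<Longrightarrow> C n \<inter> F p \<subseteq> {\<zero>\<^bsub>M\<^esub>}"
begin

lemmas C_closed = submodule_closed[OF C] and F_closed = submodule_closed[OF F]

lemma D_zero: "D \<zero>\<^bsub>M\<^esub> = \<zero>\<^bsub>M\<^esub>"
  using D_add[of "\<zero>\<^bsub>M\<^esub>" "\<zero>\<^bsub>M\<^esub>"] D_closed[of "\<zero>\<^bsub>M\<^esub>"] by (metis M.add.l_cancel_one M.l_zero M.zero_closed)

lemma D_minus: "x \<in> carrier M \<Longrightarrow> D (\<ominus>\<^bsub>M\<^esub> x) = \<ominus>\<^bsub>M\<^esub> D x"
  using D_add[of "\<ominus>\<^bsub>M\<^esub> x" x] D_zero D_closed by (simp add: M.l_neg M.minus_equality)

lemma D_diff: "x \<in> carrier M \<Longrightarrow> y \<in> carrier M \<Longrightarrow> D (x \<ominus>\<^bsub>M\<^esub> y) = D x \<ominus>\<^bsub>M\<^esub> D y"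
  by (simp add: a_minus_def D_add D_minus)

definition cyc :: "int \<Rightarrow> int \<Rightarrow> int \<Rightarrow> 'm set"
  where "cyc r p n = {x \<in> C n \<inter> F p. D x \<in> F (p + r)}"

text \<open>The classical closed form of the pages: \<open>cyc r p\<close> is \<open>Z_r^p\<close>
  and \<open>bdy r p\<close> is \<open>Z_{r-1}^{p+1} + D Z_{r-1}^{p-r+1}\<close>, both in total
  degree \<open>n\<close>, and their quotient is \<open>E_r^p\<close>. No page is built from the
  previous one; the passage to the next page is a theorem.\<close>

definition bdy :: "int \<Rightarrow> int \<Rightarrow> int \<Rightarrow> 'm set"
  where "bdy r p n = {x \<oplus>\<^bsub>M\<^esub> y | x y. x \<in> cyc (r - 1) (p + 1) n \<and> y \<in> D ` cyc (r - 1) (p - r + 1) (n - 1)}"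

lemma submodule_cyc: "submodule (cyc r p n) R M"
proof (rule submoduleI)
  show "cyc r p n \<subseteq> carrier M" using C_closed(1) by (auto simp: cyc_def)
  show "\<zero>\<^bsub>M\<^esub> \<in> cyc r p n" using C_closed(2) F_closed(2) by (auto simp: cyc_def D_zero)
  fix x assume "x \<in> cyc r p n"
  then have x: "x \<in> C n" "x \<in> F p" "D x \<in> F (p + r)" by (auto simp: cyc_def)
  show "\<ominus>\<^bsub>M\<^esub> x \<in> cyc r p n"
    using x C_closed(1,3)[OF x(1)] F_closed(3)[OF x(2)] F_closed(3)[OF x(3)] by (simp add: cyc_def D_minus)
  {
    fix y assume "y \<in> cyc r p n"
    then have y: "y \<in> C n" "y \<in> F p" "D y \<in> F (p + r)" by (auto simp: cyc_def)
    show "x \<oplus>\<^bsub>M\<^esub> y \<in> cyc r p n"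
      using x y C_closed(1)[OF x(1)] C_closed(1)[OF y(1)] C_closed(4)[OF x(1) y(1)]
        F_closed(4)[OF x(2) y(2)] F_closed(4)[OF x(3) y(3)] by (simp add: cyc_def D_add)
  next
    fix a assume a: "a \<in> carrier R"
    show "a \<odot>\<^bsub>M\<^esub> x \<in> cyc r p n"
      using a x C_closed(1)[OF x(1)] C_closed(6)[OF a x(1)]
        F_closed(6)[OF a x(2)] F_closed(6)[OF a x(3)] by (simp add: cyc_def D_smult)
  }
qed

lemma cyc_carrier: "x \<in> cyc r p n \<Longrightarrow> x \<in> carrier M"
  using submodule_closed(1)[OF submodule_cyc] .

lemma submodule_image_D:
  assumes "submodule K R M" shows "submodule (D ` K) R M"
proof (rule submoduleI)
  note K = submodule_closed[OF assms]
  show "D ` K \<subseteq> carrier M" using K(1) D_closed by auto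
  show "\<zero>\<^bsub>M\<^esub> \<in> D ` K" using K(2) D_zero by (metis imageI)
  show "\<ominus>\<^bsub>M\<^esub> x \<in> D ` K" if "x \<in> D ` K" for x
    using that K(1,3) by (auto simp flip: D_minus)
  show "x \<oplus>\<^bsub>M\<^esub> y \<in> D ` K" if "x \<in> D ` K" "y \<in> D ` K" for x y
    using that K(1,4) by (auto simp flip: D_add)
  show "a \<odot>\<^bsub>M\<^esub> x \<in> D ` K" if "a \<in> carrier R" "x \<in> D ` K" for a x
    using that K(1,6) by (auto simp flip: D_smult)
qed

lemma submodule_bdy: "submodule (bdy r p n) R M"
  unfolding bdy_def by (intro submodule_sum submodule_cyc submodule_image_D)

lemma bdyE:
  assumes "x \<in> bdy r p n"
  obtains y z where "x = y \<oplus>\<^bsub>M\<^esub> D z" "y \<in> cyc (r - 1) (p + 1) n" "z \<in> cyc (r - 1) (p - r + 1) (n - 1)"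
    "y \<in> carrier M" "z \<in> carrier M"
  using assms cyc_carrier by (auto simp: bdy_def)

lemma bdyI:
  "y \<in> cyc (r - 1) (p + 1) n \<Longrightarrow> z \<in> cyc (r - 1) (p - r + 1) (n - 1) \<Longrightarrow> y \<oplus>\<^bsub>M\<^esub> D z \<in> bdy r p n"
  by (auto simp: bdy_def)

lemma bdyI1: "y \<in> cyc (r - 1) (p + 1) n \<Longrightarrow> y \<in> bdy r p n"
  using bdyI[of y r p n "\<zero>\<^bsub>M\<^esub>"] submodule_closed(2)[OF submodule_cyc] cyc_carrier
  by (simp add: D_zero)

lemma bdyI2: "z \<in> cyc (r - 1) (p - r + 1) (n - 1) \<Longrightarrow> D z \<in> bdy r p n"
  using bdyI[of "\<zero>\<^bsub>M\<^esub>" r p n z] submodule_closed(2)[OF submodule_cyc] cyc_carrier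
  by (simp add: D_closed)

lemma cyc_mono: "r' \<le> r \<Longrightarrow> p' \<le> p \<Longrightarrow> p' + r' \<le> p + r \<Longrightarrow> cyc r p n \<subseteq> cyc r' p' n"
  using F_antimono unfolding cyc_def by blast

text \<open>\<open>D (D x)\<close> is zero and hence in every filtration step, which is why the
  order \<open>s\<close> is arbitrary.\<close>

lemma D_cyc:
  assumes "x \<in> cyc r p n" shows "D x \<in> cyc s (p + r) (n + 1)"
  using assms D_C F_closed(2) cyc_carrier[OF assms] by (auto simp: cyc_def D_D)

lemma bdy_subset_cyc: "1 \<le> r \<Longrightarrow> bdy r p n \<subseteq> cyc r p n"
proof
  fix x assume r: "1 \<le> r" and "x \<in> bdy r p n"
  then obtain y z where x: "x = y \<oplus>\<^bsub>M\<^esub> D z" "y \<in> cyc (r - 1) (p + 1) n"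
    "z \<in> cyc (r - 1) (p - r + 1) (n - 1)" by (auto elim: bdyE)
  have "y \<in> cyc r p n" using x(2) cyc_mono[of r r p "p + 1" n] F_antimono[of p "p + 1"] by (auto simp: cyc_def)
  moreover have "D z \<in> cyc r p n" using D_cyc[OF x(3), of r] by simp
  ultimately show "x \<in> cyc r p n" using x(1) submodule_closed(4)[OF submodule_cyc] by simp
qed

end

locale filtered_complex_pages = filtered_complex R M C F D
  for R :: "('r, 's) ring_scheme" and M :: "('r, 'm, 'x) module_scheme" and C F D +
  fixes E :: "nat \<Rightarrow> int \<Rightarrow> int \<Rightarrow> ('r, 'm set, 'y) module_scheme"
  assumes pages: "is_subquotient (E r p q) M (cyc (int r) p (p + q)) (bdy (int r) p (p + q))"
begin

sublocale page: subquotient_module R M "cyc (int r) p (p + q)" "bdy (int r) p (p + q)" "E r p q" for r p q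
  by (intro subquotient_module.intro subquotient_module_axioms.intro left_module_axioms
      submodule_cyc submodule_bdy pages)

definition differential :: "nat \<Rightarrow> int \<Rightarrow> int \<Rightarrow> 'm set \<Rightarrow> 'm set"
  where "differential r p q c = (\<Union>x\<in>c. bdy (int r) (p + int r) (p + q + 1) +>\<^bsub>M\<^esub> D x)"

text \<open>Another representative differs by \<open>y \<oplus> D z\<close>, so its image differs by
  \<open>D y\<close> alone. Since \<open>y\<close> is a cycle of order \<open>r - 1\<close> in step
  \<open>p + 1\<close>, and \<open>p + 1 = (p + r) - r + 1\<close>, this is one of the boundaries
  divided out in the target.\<close>

lemma differential_cls:
  assumes "1 \<le> r" "x \<in> cyc (int r) p (p + q)"
  shows "differential r p q (bdy (int r) p (p + q) +>\<^bsub>M\<^esub> x) = bdy (int r) (p + int r) (p + q + 1) +>\<^bsub>M\<^esub> D x"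
proof -
  let ?B = "bdy (int r) p (p + q)" and ?B' = "bdy (int r) (p + int r) (p + q + 1)"
  have x: "x \<in> carrier M" using cyc_carrier[OF assms(2)] .
  have "?B' +>\<^bsub>M\<^esub> D u = ?B' +>\<^bsub>M\<^esub> D x" if "u \<in> ?B +>\<^bsub>M\<^esub> x" for u
  proof -
    have u: "u \<in> carrier M" "u \<ominus>\<^bsub>M\<^esub> x \<in> ?B"
      using that coset_mem_iff[OF submodule_bdy x] by auto
    then obtain y z where yz: "u \<ominus>\<^bsub>M\<^esub> x = y \<oplus>\<^bsub>M\<^esub> D z" "y \<in> cyc (int r - 1) (p + 1) (p + q)"
      "y \<in> carrier M" "z \<in> carrier M" by (auto elim: bdyE)
    have "D u \<ominus>\<^bsub>M\<^esub> D x = D (y \<oplus>\<^bsub>M\<^esub> D z)" using yz(1) D_diff[OF u(1) x] by simp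
    also have "\<dots> = D y" using yz by (simp add: D_add D_D D_closed)
    also have "D y \<in> ?B'" using yz(2) by (intro bdyI2) (simp add: algebra_simps)
    finally show ?thesis using coset_eq_iff[OF submodule_bdy] u x D_closed by simp
  qed
  then show ?thesis using coset_self[OF submodule_bdy x] unfolding differential_def by blast
qed

lemma page_kernel_eq:
  assumes "1 \<le> r"
  shows "page_kernel E differential r p q =
    (\<lambda>x. bdy (int r) p (p + q) +>\<^bsub>M\<^esub> x) ` {x \<in> cyc (int r) p (p + q). D x \<in> bdy (int r) (p + int r) (p + q + 1)}"
proof -
  have e: "p + int r + (q - int r + 1) = p + q + 1" by simp
  have "differential r p q (bdy (int r) p (p + q) +>\<^bsub>M\<^esub> x) = \<zero>\<^bsub>E r (p + int r) (q - int r + 1)\<^esub> \<longleftrightarrow>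
      D x \<in> bdy (int r) (p + int r) (p + q + 1)" if "x \<in> cyc (int r) p (p + q)" for x
    using coset_eq_sub_iff[OF submodule_bdy D_closed[OF cyc_carrier[OF that]]]
    unfolding page.zero_eq differential_cls[OF assms that] e .
  then show ?thesis unfolding page_kernel_def page.carrier_eq by blast
qed

lemma page_image_eq:
  assumes "1 \<le> r"
  shows "page_image E differential r p q =
    (\<lambda>x. bdy (int r) p (p + q) +>\<^bsub>M\<^esub> D x) ` cyc (int r) (p - int r) (p + q - 1)"
proof -
  have e: "p - int r + (q + int r - 1) = p + q - 1" by simp
  have "differential r (p - int r) (q + int r - 1) (bdy (int r) (p - int r) (p + q - 1) +>\<^bsub>M\<^esub> x) =
      bdy (int r) p (p + q) +>\<^bsub>M\<^esub> D x" if "x \<in> cyc (int r) (p - int r) (p + q - 1)" for x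
    using differential_cls[OF assms, of x "p - int r" "q + int r - 1"] that by (simp add: e)
  then show ?thesis
    unfolding page_image_def page.carrier_eq image_image e by (intro image_cong refl) auto
qed

theorem spectral_sequence: "spectral_sequence R E differential"
proof (intro spectral_sequence.intro spectral_sequence_axioms.intro R.ring_axioms)
  fix r p q assume r: "1 \<le> (r :: nat)"
  have e: "p + int r + (q - int r + 1) = p + q + 1" by simp
  let ?Z = "cyc (int r) p (p + q)" and ?B = "bdy (int r) p (p + q)"
  let ?Z' = "cyc (int r) (p + int r) (p + q + 1)" and ?B' = "bdy (int r) (p + int r) (p + q + 1)"
  let ?Z2 = "cyc (int (Suc r)) p (p + q)" and ?B2 = "bdy (int (Suc r)) p (p + q)"
  let ?K = "{x \<in> ?Z. D x \<in> ?B'}"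
  show "left_module R (E r p q)" by (rule page.left_module_N)
  interpret N: left_module R "E r p q" by (rule page.left_module_N)
  interpret S: subquotient_module R M ?Z' ?B' "E r (p + int r) (q - int r + 1)"
    using page.subquotient_module_axioms[of r "p + int r" "q - int r + 1"] by (simp only: e)
  note Z = submodule_closed[OF submodule_cyc] and B = submodule_closed[OF submodule_bdy]
  have DZ: "D x \<in> ?Z'" if "x \<in> ?Z" for x using D_cyc[OF that] .
  note d = differential_cls[OF r]
  show "differential r p q \<in> linear_maps R (E r p q) (E r (p + int r) (q - int r + 1))"
    unfolding linear_maps_def
  proof (intro CollectI conjI ballI)
    show "differential r p q \<in> carrier (E r p q) \<rightarrow> carrier (E r (p + int r) (q - int r + 1))"
      using DZ by (auto simp: page.carrier_eq d S.carrier_eq simp flip: e)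
    fix c assume "c \<in> carrier (E r p q)"
    then obtain x where x: "x \<in> ?Z" "c = ?B +>\<^bsub>M\<^esub> x" by (rule page.carrierE)
    {
      fix c' assume "c' \<in> carrier (E r p q)"
      then obtain y where y: "y \<in> ?Z" "c' = ?B +>\<^bsub>M\<^esub> y" by (rule page.carrierE)
      show "differential r p q (c \<oplus>\<^bsub>E r p q\<^esub> c') =
          differential r p q c \<oplus>\<^bsub>E r (p + int r) (q - int r + 1)\<^esub> differential r p q c'"
        using x y Z(4)[OF x(1) y(1)] DZ
        by (simp add: page.cls_add d S.cls_add D_add cyc_carrier)
    next
      fix a assume a: "a \<in> carrier R"
      show "differential r p q (a \<odot>\<^bsub>E r p q\<^esub> c) =
          a \<odot>\<^bsub>E r (p + int r) (q - int r + 1)\<^esub> differential r p q c"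
        using a x Z(6)[OF a x(1)] DZ by (simp add: page.cls_smult d S.cls_smult D_smult cyc_carrier)
    }
  qed
  have im: "page_image E differential r p q =
      (\<lambda>x. ?B +>\<^bsub>M\<^esub> x) ` (D ` cyc (int r) (p - int r) (p + q - 1))" (is "_ = _ ` ?I")
    by (simp add: page_image_eq[OF r] image_image)
  have I_sub: "?I \<subseteq> ?Z" using D_cyc[of _ "int r" "p - int r" "p + q - 1" "int r"] by auto
  have K: "submodule ?K R M"
  proof (rule submoduleI)
    show "?K \<subseteq> carrier M" using cyc_carrier by auto
    show "\<zero>\<^bsub>M\<^esub> \<in> ?K" using Z(2) B(2) by (simp add: D_zero)
    show "\<ominus>\<^bsub>M\<^esub> x \<in> ?K" if "x \<in> ?K" for x
      using that Z(3) B(3) cyc_carrier by (auto simp: D_minus)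
    show "x \<oplus>\<^bsub>M\<^esub> y \<in> ?K" if "x \<in> ?K" "y \<in> ?K" for x y
      using that Z(4) B(4) cyc_carrier by (auto simp: D_add)
    show "a \<odot>\<^bsub>M\<^esub> x \<in> ?K" if "a \<in> carrier R" "x \<in> ?K" for a x
      using that Z(6) B(6) cyc_carrier by (auto simp: D_smult)
  qed
  show "page_image E differential r p q \<subseteq> page_kernel E differential r p q"
    unfolding im page_kernel_eq[OF r]
    using I_sub B(2) cyc_carrier by (intro image_mono) (auto simp: D_D)
  have ker: "submodule (page_kernel E differential r p q) R (E r p q)"
    unfolding page_kernel_eq[OF r] using K by (rule page.submodule_image) auto
  have im_sub: "submodule (page_image E differential r p q) R (E r p q)"
    unfolding im by (rule page.submodule_image[OF submodule_image_D[OF submodule_cyc] I_sub])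
  have Z2_Z: "?Z2 \<subseteq> ?Z" by (rule cyc_mono) auto
  \<comment> \<open>The isomorphism is induced by the identity on representatives: a cycle of order
    \<open>r + 1\<close> is sent to its class on page \<open>r\<close>, which is a cycle
    there.\<close>
  have "\<exists>h\<in>module_isos R (E (Suc r) p q)
        (subquotient (E r p q) (page_kernel E differential r p q) (page_image E differential r p q)).
      \<forall>z\<in>?Z2. h (?B2 +>\<^bsub>M\<^esub> z) = page_image E differential r p q +>\<^bsub>E r p q\<^esub> (?B +>\<^bsub>M\<^esub> z)"
  proof (rule subquotient_iso)
    show "subquotient_module R M ?Z2 ?B2 (E (Suc r) p q)" by (rule page.subquotient_module_axioms)
    show "subquotient_module R (E r p q) (page_kernel E differential r p q) (page_image E differential r p q)
        (subquotient (E r p q) (page_kernel E differential r p q) (page_image E differential r p q))"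
      by (intro subquotient_module.intro subquotient_module_axioms.intro N.left_module_axioms
          ker im_sub is_subquotient_subquotient)
    show "?B2 \<subseteq> ?Z2" by (rule bdy_subset_cyc) simp
    show "?B +>\<^bsub>M\<^esub> z \<in> page_kernel E differential r p q" if z: "z \<in> ?Z2" for z
    proof -
      have "D z \<in> cyc (int r - 1) (p + int r + 1) (p + q + 1)"
        using D_cyc[OF z, of "int r - 1"] by (simp add: algebra_simps)
      then show ?thesis using bdyI1 z Z2_Z unfolding page_kernel_eq[OF r] by blast
    qed
    show "?B +>\<^bsub>M\<^esub> (x \<oplus>\<^bsub>M\<^esub> y) = (?B +>\<^bsub>M\<^esub> x) \<oplus>\<^bsub>E r p q\<^esub> (?B +>\<^bsub>M\<^esub> y)" if "x \<in> ?Z2" "y \<in> ?Z2" for x y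
      using that subsetD[OF Z2_Z] by (simp only: page.cls_add)
    show "?B +>\<^bsub>M\<^esub> (a \<odot>\<^bsub>M\<^esub> x) = a \<odot>\<^bsub>E r p q\<^esub> (?B +>\<^bsub>M\<^esub> x)" if "a \<in> carrier R" "x \<in> ?Z2" for a x
      using that subsetD[OF Z2_Z] by (simp only: page.cls_smult)
    show "\<exists>z\<in>?Z2. c \<ominus>\<^bsub>E r p q\<^esub> (?B +>\<^bsub>M\<^esub> z) \<in> page_image E differential r p q"
      if "c \<in> page_kernel E differential r p q" for c
    proof -
      obtain x where x: "x \<in> ?Z" "c = ?B +>\<^bsub>M\<^esub> x" "D x \<in> ?B'"
        using \<open>c \<in> _\<close> unfolding page_kernel_eq[OF r] by auto
      \<comment> \<open>The part \<open>z\<close> of the boundary \<open>D x\<close> lies in the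
        denominator of page \<open>r\<close>. Passing from \<open>x\<close> to
        \<open>x \<ominus> z\<close> keeps the class and leaves \<open>y\<close> as differential,
        which is one filtration step deeper than required.\<close>
      obtain y z where yz: "D x = y \<oplus>\<^bsub>M\<^esub> D z" "y \<in> cyc (int r - 1) (p + int r + 1) (p + q + 1)"
        "z \<in> cyc (int r - 1) (p + 1) (p + q)" "y \<in> carrier M" "z \<in> carrier M"
        using x(3) by (auto elim!: bdyE)
      have zB: "z \<in> ?B" using yz(3) by (rule bdyI1)
      have zZ: "z \<in> ?Z" using zB bdy_subset_cyc[of "int r"] r by auto
      have "D (x \<ominus>\<^bsub>M\<^esub> z) = y"
        using yz D_diff[OF cyc_carrier[OF x(1)] yz(5)] D_closed
        by (simp add: M.add_diff_cancel_right)
      then have "x \<ominus>\<^bsub>M\<^esub> z \<in> ?Z2"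
        using Z(5)[OF x(1) zZ] yz(2) by (simp add: cyc_def add.assoc) (simp add: add.commute)
      moreover have "c = ?B +>\<^bsub>M\<^esub> (x \<ominus>\<^bsub>M\<^esub> z)"
      proof -
        have "x \<ominus>\<^bsub>M\<^esub> (x \<ominus>\<^bsub>M\<^esub> z) = z" using cyc_carrier[OF x(1)] yz(5) by algebra
        then show ?thesis using zB x Z(5)[OF x(1) zZ] by (simp add: page.cls_eq_iff)
      qed
      moreover have "c \<ominus>\<^bsub>E r p q\<^esub> c \<in> page_image E differential r p q"
        using N.submodule_closed(2)[OF im_sub] x page.cls_closed
        by (simp add: a_minus_def N.M.r_neg)
      ultimately show ?thesis by metis
    qed
    show "?B +>\<^bsub>M\<^esub> z \<in> page_image E differential r p q \<longleftrightarrow> z \<in> ?B2" if z: "z \<in> ?Z2" for z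
    proof
      assume "?B +>\<^bsub>M\<^esub> z \<in> page_image E differential r p q"
      then obtain w where w: "w \<in> cyc (int r) (p - int r) (p + q - 1)" "?B +>\<^bsub>M\<^esub> z = ?B +>\<^bsub>M\<^esub> D w"
        unfolding im by auto
      then have "z \<ominus>\<^bsub>M\<^esub> D w \<in> ?B" using page.cls_eq_iff I_sub z Z2_Z by blast
      then obtain y v where yv: "z \<ominus>\<^bsub>M\<^esub> D w = y \<oplus>\<^bsub>M\<^esub> D v" "y \<in> cyc (int r - 1) (p + 1) (p + q)"
        "v \<in> cyc (int r - 1) (p - int r + 1) (p + q - 1)" "y \<in> carrier M" "v \<in> carrier M" by (rule bdyE)
      have c: "w \<in> carrier M" "z \<in> carrier M" "D w \<in> carrier M" "D v \<in> carrier M" "D z \<in> carrier M"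
        using w z yv cyc_carrier D_closed by auto
      \<comment> \<open>Seen from the larger step \<open>p - r\<close>, the element \<open>v\<close>
        gains one in its order, so it can be absorbed into \<open>w\<close>.\<close>
      have "v \<in> cyc (int r) (p - int r) (p + q - 1)" using yv(3) F_antimono[of "p - int r" "p - int r + 1"] by (auto simp: cyc_def)
      then have wv: "w \<oplus>\<^bsub>M\<^esub> v \<in> cyc (int r) (p - int r) (p + q - 1)" using Z(4) w by simp
      have y: "z = y \<oplus>\<^bsub>M\<^esub> D (w \<oplus>\<^bsub>M\<^esub> v)"
      proof -
        have "z = (z \<ominus>\<^bsub>M\<^esub> D w) \<oplus>\<^bsub>M\<^esub> D w" using c by algebra
        also have "\<dots> = (y \<oplus>\<^bsub>M\<^esub> D v) \<oplus>\<^bsub>M\<^esub> D w" using yv by simp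
        also have "\<dots> = y \<oplus>\<^bsub>M\<^esub> (D w \<oplus>\<^bsub>M\<^esub> D v)" using yv(4) c by algebra
        finally show ?thesis using c yv by (simp add: D_add)
      qed
      \<comment> \<open>The order of \<open>z\<close> is \<open>r + 1\<close> in step
        \<open>p\<close>; as \<open>y\<close> has the same differential but lies in step
        \<open>p + 1\<close>, its order there is \<open>r\<close>.\<close>
      have "D z = D y" using arg_cong[OF y, of D] c yv by (simp add: D_add D_D D_closed)
      then have "y \<in> cyc (int r) (p + 1) (p + q)" using z yv(2) by (simp add: cyc_def add.assoc)
      then show "z \<in> ?B2" unfolding y using wv by (intro bdyI) (auto simp: algebra_simps)
    next
      assume "z \<in> ?B2"
      then obtain y w where yw: "z = y \<oplus>\<^bsub>M\<^esub> D w" "y \<in> cyc (int r) (p + 1) (p + q)"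
        "w \<in> cyc (int r) (p - int r) (p + q - 1)" "y \<in> carrier M" "w \<in> carrier M"
        by (auto elim!: bdyE simp: algebra_simps)
      have "y \<in> cyc (int r - 1) (p + 1) (p + q)" using yw(2) cyc_mono[of "int r - 1" "int r" "p + 1" "p + 1"] by auto
      moreover have "z \<ominus>\<^bsub>M\<^esub> D w = y" using yw D_closed by (simp add: M.add_diff_cancel_right)
      ultimately have "z \<ominus>\<^bsub>M\<^esub> D w \<in> ?B" using bdyI1 by simp
      then have "?B +>\<^bsub>M\<^esub> z = ?B +>\<^bsub>M\<^esub> D w" using page.cls_eq_iff I_sub z Z2_Z yw(3) by blast
      then show "?B +>\<^bsub>M\<^esub> z \<in> page_image E differential r p q" using yw unfolding im by blast
    qed
  qed
  then show "module_isos R (E (Suc r) p q)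
        (subquotient (E r p q) (page_kernel E differential r p q) (page_image E differential r p q)) \<noteq> {}"
    by blast
qed

text \<open>For \<open>p < 0\<close> a cycle already lies in \<open>F (p + 1)\<close> by
  \<open>F_full\<close> and thus in the denominator. For \<open>p \<ge> 0\<close> and
  \<open>q < 0\<close> the total degree is below \<open>p\<close>, and \<open>F_null\<close> leaves
  only zero.\<close>

lemma first_quadrant: "first_quadrant E"
  unfolding first_quadrant_def
proof (intro allI impI)
  fix r :: nat and p q :: int assume r: "1 \<le> r" and pq: "p < 0 \<or> q < 0"
  have "cyc (int r) p (p + q) \<subseteq> bdy (int r) p (p + q)"
  proof
    fix x assume x: "x \<in> cyc (int r) p (p + q)"
    show "x \<in> bdy (int r) p (p + q)"
    proof (cases "p < 0")
      case True
      then have "x \<in> cyc (int r - 1) (p + 1) (p + q)"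
        using x F_full[of "p + 1" "p + q"] by (auto simp: cyc_def)
      then show ?thesis by (rule bdyI1)
    next
      case False
      then have "x = \<zero>\<^bsub>M\<^esub>" using pq x F_null[of "p + q" p] by (auto simp: cyc_def)
      then show ?thesis using submodule_closed(2)[OF submodule_bdy] by simp
    qed
  qed
  then have "bdy (int r) p (p + q) +>\<^bsub>M\<^esub> x = bdy (int r) p (p + q)" if "x \<in> cyc (int r) p (p + q)" for x
    using that coset_eq_sub_iff[OF submodule_bdy cyc_carrier[OF that]] by blast
  then have "(\<lambda>x. bdy (int r) p (p + q) +>\<^bsub>M\<^esub> x) ` cyc (int r) p (p + q) = {bdy (int r) p (p + q)}"
    using submodule_closed(2)[OF submodule_cyc] by blast
  then show "carrier (E r p q) = {\<zero>\<^bsub>E r p q\<^esub>}" by (simp add: page.carrier_eq page.zero_eq)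
qed

text \<open>The hypotheses say, on the level of cocycles, that \<open>\<Psi>\<close> identifies the
  cohomology of the complex with \<open>H\<close>. The filtration of \<open>H n\<close> consists of
  the classes represented by cocycles in \<open>F p\<close>.\<close>

theorem converges:
  fixes H :: "nat \<Rightarrow> ('r, 'h, 'z) module_scheme" and \<Psi> :: "nat \<Rightarrow> 'm \<Rightarrow> 'h"
  assumes H: "\<And>n. left_module R (H n)"
    and \<Psi>: "\<And>n x. x \<in> C (int n) \<Longrightarrow> D x = \<zero>\<^bsub>M\<^esub> \<Longrightarrow> \<Psi> n x \<in> carrier (H n)"
    and \<Psi>_add: "\<And>n x y. x \<in> C (int n) \<Longrightarrow> D x = \<zero>\<^bsub>M\<^esub> \<Longrightarrow> y \<in> C (int n) \<Longrightarrow> D y = \<zero>\<^bsub>M\<^esub> \<Longrightarrow>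
      \<Psi> n (x \<oplus>\<^bsub>M\<^esub> y) = \<Psi> n x \<oplus>\<^bsub>H n\<^esub> \<Psi> n y"
    and \<Psi>_smult: "\<And>n a x. a \<in> carrier R \<Longrightarrow> x \<in> C (int n) \<Longrightarrow> D x = \<zero>\<^bsub>M\<^esub> \<Longrightarrow>
      \<Psi> n (a \<odot>\<^bsub>M\<^esub> x) = a \<odot>\<^bsub>H n\<^esub> \<Psi> n x"
    and surj: "\<And>n c. c \<in> carrier (H n) \<Longrightarrow> \<exists>x\<in>C (int n). D x = \<zero>\<^bsub>M\<^esub> \<and> \<Psi> n x = c"
    and ker: "\<And>n x. x \<in> C (int n) \<Longrightarrow> D x = \<zero>\<^bsub>M\<^esub> \<Longrightarrow>
      \<Psi> n x = \<zero>\<^bsub>H n\<^esub> \<longleftrightarrow> (\<exists>w\<in>C (int n - 1). x = D w)"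
  shows "converges_to R E H"
proof -
  define Z where "Z n p = {x \<in> C (int n) \<inter> F (int p). D x = \<zero>\<^bsub>M\<^esub>}" for n p :: nat
  \<comment> \<open>The differential of such a cycle has degree \<open>n + 1\<close> and lies beyond
    filtration step \<open>n + 1\<close>, so it is zero by \<open>F_null\<close>.\<close>
  have Zcyc: "Z n p = cyc r (int p) (int n)" if r: "r > int n + 1 - int p" for n p r
  proof -
    have "D x = \<zero>\<^bsub>M\<^esub>" if "x \<in> C (int n)" "D x \<in> F (int p + r)" for x
    proof -
      have "int n + 1 < int p + r" using r by simp
      then show ?thesis using F_null that(2) D_C[OF that(1)] by blast
    qed
    then show ?thesis using F_closed(2)[of "int p + r"] unfolding Z_def cyc_def by (metis (no_types, lifting) IntD1)
  qed
  have Z_sub: "submodule (Z n p) R M" for n p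
    using submodule_cyc[of "int n + 2" "int p" "int n"] Zcyc[of n p "int n + 2"] by simp
  note Zc = submodule_closed[OF Z_sub]
  define G where "G n p = \<Psi> n ` Z n p" for n p
  have G: "submodule (G n p) R (H n)" for n p
  proof -
    interpret H: left_module R "H n" by (rule H)
    have Zm: "z \<in> C (int n)" "D z = \<zero>\<^bsub>M\<^esub>" if "z \<in> Z n p" for z using that by (auto simp: Z_def)
    have \<Psi>0: "\<Psi> n \<zero>\<^bsub>M\<^esub> = \<zero>\<^bsub>H n\<^esub>"
      using \<Psi>_add[of "\<zero>\<^bsub>M\<^esub>" n "\<zero>\<^bsub>M\<^esub>"] \<Psi>[of "\<zero>\<^bsub>M\<^esub>" n] Zm[OF Zc(2)]
      by (metis H.M.add.l_cancel_one M.l_zero M.zero_closed)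
    show ?thesis
    proof (rule H.submoduleI)
      show "G n p \<subseteq> carrier (H n)" using \<Psi> by (auto simp: G_def Z_def)
      show "\<zero>\<^bsub>H n\<^esub> \<in> G n p" unfolding G_def using \<Psi>0 Zc(2) by (metis imageI)
      show "\<ominus>\<^bsub>H n\<^esub> u \<in> G n p" if u: "u \<in> G n p" for u
      proof -
        obtain x where x: "x \<in> Z n p" "u = \<Psi> n x" using u by (auto simp: G_def)
        have "\<Psi> n (\<ominus>\<^bsub>M\<^esub> x) \<oplus>\<^bsub>H n\<^esub> \<Psi> n x = \<zero>\<^bsub>H n\<^esub>"
          using \<Psi>_add[OF Zm[OF Zc(3)[OF x(1)]] Zm[OF x(1)]] \<Psi>0 Zc(1)[OF x(1)] by (simp add: M.l_neg)
        then have "\<ominus>\<^bsub>H n\<^esub> u = \<Psi> n (\<ominus>\<^bsub>M\<^esub> x)"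
          using x \<Psi> Zm[OF Zc(3)[OF x(1)]] Zm[OF x(1)] by (simp add: H.M.minus_equality)
        then show ?thesis using Zc(3)[OF x(1)] by (simp add: G_def)
      qed
      show "u \<oplus>\<^bsub>H n\<^esub> v \<in> G n p" if "u \<in> G n p" "v \<in> G n p" for u v
        using that Zc(4) Zm by (auto simp: G_def simp flip: \<Psi>_add)
      show "a \<odot>\<^bsub>H n\<^esub> u \<in> G n p" if "a \<in> carrier R" "u \<in> G n p" for a u
        using that Zc(6) Zm by (auto simp: G_def simp flip: \<Psi>_smult)
    qed
  qed
  show ?thesis
    unfolding converges_to_def
  proof (intro exI[of _ G] conjI allI impI)
    fix n p
    show "submodule (G n p) R (H n)" by (rule G)
    show "G n (Suc p) \<subseteq> G n p"
      using F_antimono[of "int p" "int (Suc p)"] by (auto simp: G_def Z_def)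
    show "G n 0 = carrier (H n)"
      using surj[of _ n] \<Psi>[of _ n] F_full[of 0 "int n"] by (fastforce simp: G_def Z_def)
    show "G n (Suc n) = {\<zero>\<^bsub>H n\<^esub>}"
    proof -
      have z: "Z n (Suc n) = {\<zero>\<^bsub>M\<^esub>}"
        using F_null[of "int n" "int (Suc n)"] Zc(2)[of n "Suc n"] by (auto simp: Z_def)
      have "\<exists>w\<in>C (int n - 1). \<zero>\<^bsub>M\<^esub> = D w" using C_closed(2) D_zero by metis
      then have "\<Psi> n \<zero>\<^bsub>M\<^esub> = \<zero>\<^bsub>H n\<^esub>" using ker[of "\<zero>\<^bsub>M\<^esub>" n] C_closed(2) D_zero by simp
      then show ?thesis by (simp add: G_def z)
    qed
  next
    fix p q r :: nat assume r: "max p (q + 1) < r"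
    let ?n = "p + q"
    interpret H: left_module R "H ?n" by (rule H)
    have Zp: "cyc (int r) (int p) (int p + int q) = Z ?n p" using r Zcyc[of ?n p "int r"] by simp
    \<comment> \<open>The two parts of the bound on \<open>r\<close> are used here.
      \<open>q + 1 < r\<close> turns the cycles of order \<open>r - 1\<close> in step
      \<open>p + 1\<close> into cocycles. \<open>p < r\<close> makes \<open>F (p - r + 1)\<close>
      all of the complex, so that every coboundary lying in \<open>F p\<close> is divided
      out.\<close>
    have Bm: "z \<in> bdy (int r) (int p) (int p + int q) \<longleftrightarrow>
        (\<exists>y\<in>Z ?n (Suc p). \<exists>w\<in>C (int ?n - 1). z = y \<oplus>\<^bsub>M\<^esub> D w)" if z: "z \<in> Z ?n p" for z
    proof
      assume "z \<in> bdy (int r) (int p) (int p + int q)"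
      then obtain y w where yw: "z = y \<oplus>\<^bsub>M\<^esub> D w" "y \<in> cyc (int r - 1) (int p + 1) (int p + int q)"
        "w \<in> cyc (int r - 1) (int p - int r + 1) (int p + int q - 1)" by (rule bdyE)
      have "y \<in> Z ?n (Suc p)" using yw(2) r by (subst Zcyc[of ?n "Suc p" "int r - 1"]) (auto simp: add.commute)
      moreover have "w \<in> C (int ?n - 1)" using yw(3) by (simp add: cyc_def)
      ultimately show "\<exists>y\<in>Z ?n (Suc p). \<exists>w\<in>C (int ?n - 1). z = y \<oplus>\<^bsub>M\<^esub> D w" using yw(1) by blast
    next
      assume "\<exists>y\<in>Z ?n (Suc p). \<exists>w\<in>C (int ?n - 1). z = y \<oplus>\<^bsub>M\<^esub> D w"
      then obtain y w where yw: "z = y \<oplus>\<^bsub>M\<^esub> D w" "y \<in> Z ?n (Suc p)" "w \<in> C (int ?n - 1)" by blast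
      have y: "y \<in> cyc (int r - 1) (int p + 1) (int p + int q)"
        using yw(2) r Zcyc[of ?n "Suc p" "int r - 1"] by (auto simp: add.commute)
      have w: "w \<in> carrier M" using C_closed(1) yw by blast
      have "y \<in> F (int p)" using yw(2) F_antimono[of "int p" "int (Suc p)"] by (auto simp: Z_def)
      moreover have "D w = z \<ominus>\<^bsub>M\<^esub> y"
      proof -
        have "D w = (y \<oplus>\<^bsub>M\<^esub> D w) \<ominus>\<^bsub>M\<^esub> y" using D_closed[OF w] Zc(1)[OF yw(2)] by algebra
        then show ?thesis using yw by simp
      qed
      ultimately have "D w \<in> F (int p)" using F_closed(5) z by (simp add: Z_def)
      then have "w \<in> cyc (int r - 1) (int p - int r + 1) (int p + int q - 1)"
        using yw(3) F_full[of "int p - int r + 1" "int ?n - 1"] r by (auto simp: cyc_def)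
      then show "z \<in> bdy (int r) (int p) (int p + int q)" using yw(1) y bdyI by simp
    qed
    have "\<exists>h\<in>module_isos R (E r (int p) (int q)) (subquotient (H ?n) (G ?n p) (G ?n (Suc p))).
      \<forall>z\<in>cyc (int r) (int p) (int p + int q). h (bdy (int r) (int p) (int p + int q) +>\<^bsub>M\<^esub> z) =
        G ?n (Suc p) +>\<^bsub>H ?n\<^esub> \<Psi> ?n z"
    proof (rule subquotient_iso)
      show "subquotient_module R M (cyc (int r) (int p) (int p + int q)) (bdy (int r) (int p) (int p + int q))
        (E r (int p) (int q))" by (rule page.subquotient_module_axioms)
      show "subquotient_module R (H ?n) (G ?n p) (G ?n (Suc p)) (subquotient (H ?n) (G ?n p) (G ?n (Suc p)))"
        by (intro subquotient_module.intro subquotient_module_axioms.intro H G is_subquotient_subquotient)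
      show "bdy (int r) (int p) (int p + int q) \<subseteq> cyc (int r) (int p) (int p + int q)"
        using r by (intro bdy_subset_cyc) auto
      show "\<Psi> ?n z \<in> G ?n p" if "z \<in> cyc (int r) (int p) (int p + int q)" for z
        using that by (simp add: Zp G_def)
      show "\<Psi> ?n (x \<oplus>\<^bsub>M\<^esub> y) = \<Psi> ?n x \<oplus>\<^bsub>H ?n\<^esub> \<Psi> ?n y"
        if "x \<in> cyc (int r) (int p) (int p + int q)" "y \<in> cyc (int r) (int p) (int p + int q)" for x y
        using that by (intro \<Psi>_add) (auto simp: Zp Z_def)
      show "\<Psi> ?n (a \<odot>\<^bsub>M\<^esub> x) = a \<odot>\<^bsub>H ?n\<^esub> \<Psi> ?n x"
        if "a \<in> carrier R" "x \<in> cyc (int r) (int p) (int p + int q)" for a x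
        using that by (intro \<Psi>_smult) (auto simp: Zp Z_def)
      show "\<exists>z\<in>cyc (int r) (int p) (int p + int q). c \<ominus>\<^bsub>H ?n\<^esub> \<Psi> ?n z \<in> G ?n (Suc p)" if c: "c \<in> G ?n p" for c
      proof -
        obtain z where z: "z \<in> Z ?n p" "c = \<Psi> ?n z" using c by (auto simp: G_def)
        have "c \<ominus>\<^bsub>H ?n\<^esub> \<Psi> ?n z = \<zero>\<^bsub>H ?n\<^esub>"
          using z H.submodule_closed(1)[OF G c] by (simp add: a_minus_def H.M.r_neg)
        then have "c \<ominus>\<^bsub>H ?n\<^esub> \<Psi> ?n z \<in> G ?n (Suc p)" using H.submodule_closed(2)[OF G] by simp
        then show ?thesis using z(1) unfolding Zp by blast
      qed
      show "\<Psi> ?n z \<in> G ?n (Suc p) \<longleftrightarrow> z \<in> bdy (int r) (int p) (int p + int q)"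
        if "z \<in> cyc (int r) (int p) (int p + int q)" for z
      proof -
        have z: "z \<in> Z ?n p" using that by (simp add: Zp)
        have zc: "z \<in> carrier M" "z \<in> C (int ?n)" "D z = \<zero>\<^bsub>M\<^esub>" using z Zc(1)[OF z] by (auto simp: Z_def)
        have "\<Psi> ?n z = \<Psi> ?n y \<longleftrightarrow> (\<exists>w\<in>C (int ?n - 1). z = y \<oplus>\<^bsub>M\<^esub> D w)" if y: "y \<in> Z ?n (Suc p)" for y
        proof -
          have yc: "y \<in> carrier M" "y \<in> C (int ?n)" "D y = \<zero>\<^bsub>M\<^esub>" using y Zc(1)[OF y] by (auto simp: Z_def)
          have d: "z \<ominus>\<^bsub>M\<^esub> y \<in> C (int ?n)" "D (z \<ominus>\<^bsub>M\<^esub> y) = \<zero>\<^bsub>M\<^esub>"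
            using C_closed(5)[OF zc(2) yc(2)] D_diff[OF zc(1) yc(1)] zc yc by (simp_all add: a_minus_def M.a_inv_zero)
          have "\<Psi> ?n z = \<Psi> ?n (z \<ominus>\<^bsub>M\<^esub> y) \<oplus>\<^bsub>H ?n\<^esub> \<Psi> ?n y"
            using \<Psi>_add[OF d yc(2,3)] zc(1) yc(1) by (simp add: M.diff_add_cancel_right)
          then have "\<Psi> ?n z = \<Psi> ?n y \<longleftrightarrow> \<Psi> ?n (z \<ominus>\<^bsub>M\<^esub> y) = \<zero>\<^bsub>H ?n\<^esub>"
            using \<Psi>[OF d] \<Psi>[OF yc(2,3)] by (metis H.M.add.l_cancel_one' H.M.add.r_cancel_one)
          also have "\<dots> \<longleftrightarrow> (\<exists>w\<in>C (int ?n - 1). z \<ominus>\<^bsub>M\<^esub> y = D w)" by (rule ker[OF d])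
          also have "\<dots> \<longleftrightarrow> (\<exists>w\<in>C (int ?n - 1). z = y \<oplus>\<^bsub>M\<^esub> D w)"
          proof (intro bex_cong refl)
            fix w assume "w \<in> C (int ?n - 1)"
            then have w: "D w \<in> carrier M" using C_closed(1) D_closed by blast
            show "z \<ominus>\<^bsub>M\<^esub> y = D w \<longleftrightarrow> z = y \<oplus>\<^bsub>M\<^esub> D w"
              using M.diff_add_cancel_right[OF zc(1) yc(1)] M.add_diff_cancel_right[OF w yc(1)] w yc(1)
              by (metis M.a_comm)
          qed
          finally show ?thesis .
        qed
        then show ?thesis unfolding Bm[OF z] by (auto simp: G_def image_iff)
      qed
    qed
    then show "module_isos R (E r (int p) (int q)) (subquotient (H ?n) (G ?n p) (G ?n (Suc p))) \<noteq> {}"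
      by blast
  qed
qed

end

section \<open>Simplicial cochains as functions on lists\<close>

text \<open>The alternating sum of \<open>f\<close> over all lists that arise from the argument by deleting one entry.
  Recursion on the list replaces all manipulations of alternating sums.\<close>

primrec dl :: "('v, 'x) ring_scheme \<Rightarrow> ('c list \<Rightarrow> 'v) \<Rightarrow> 'c list \<Rightarrow> 'v" where
  "dl A f [] = \<zero>\<^bsub>A\<^esub>"
| "dl A f (x # xs) = f xs \<ominus>\<^bsub>A\<^esub> dl A (\<lambda>ys. f (x # ys)) xs"

text \<open>The prism operator of simplicial homotopy, the sum over \<open>i\<close> of
  \<open>(-1)^i f [s x_0, ..., s x_i, t x_i, ..., t x_n]\<close>.\<close>

primrec prism :: "('v, 'x) ring_scheme \<Rightarrow> ('b \<Rightarrow> 'c) \<Rightarrow> ('b \<Rightarrow> 'c) \<Rightarrow> ('c list \<Rightarrow> 'v) \<Rightarrow> 'b list \<Rightarrow> 'v" where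
  "prism A s t f [] = \<zero>\<^bsub>A\<^esub>"
| "prism A s t f (x # xs) = f (s x # t x # map t xs) \<ominus>\<^bsub>A\<^esub> prism A s t (\<lambda>ys. f (s x # ys)) xs"

text \<open>The Alexander--Whitney map
  \<open>F \<mapsto> (\<lambda>[x\<^sub>0, \<dots>, x\<^sub>n]. \<Sum>\<^sub>p F [\<pi> x\<^sub>0, \<dots>, \<pi> x\<^sub>p] [x\<^sub>p, \<dots>, x\<^sub>n])\<close>.\<close>

primrec aw :: "('v, 'x) ring_scheme \<Rightarrow> ('c \<Rightarrow> 'b) \<Rightarrow> ('b list \<Rightarrow> 'c list \<Rightarrow> 'v) \<Rightarrow> 'c list \<Rightarrow> 'v" where
  "aw A \<pi> F [] = \<zero>\<^bsub>A\<^esub>"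
| "aw A \<pi> F (x # xs) = F [\<pi> x] (x # xs) \<oplus>\<^bsub>A\<^esub> aw A \<pi> (\<lambda>ys. F (\<pi> x # ys)) xs"

text \<open>The total differential of the double complex. A list \<open>xs\<close> with
  \<open>p + 1\<close> entries belongs to column \<open>p\<close>, where the vertical part carries
  the sign \<open>(-1)^p\<close>; this makes the two directions anticommute.\<close>

definition dd :: "('v, 'x) ring_scheme \<Rightarrow> ('b list \<Rightarrow> 'c list \<Rightarrow> 'v) \<Rightarrow> 'b list \<Rightarrow> 'c list \<Rightarrow> 'v"
  where "dd A F xs gs = dl A (\<lambda>ys. F ys gs) xs \<oplus>\<^bsub>A\<^esub> alt_sign A (Suc (length xs)) (dl A (F xs) gs)"

text \<open>The partial products \<open>[a, a g\<^sub>1, a g\<^sub>1 g\<^sub>2, \<dots>]\<close>, which translate inhomogeneous into homogeneous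
  cochains.\<close>

primrec pp :: "('g, 'h) monoid_scheme \<Rightarrow> 'g \<Rightarrow> 'g list \<Rightarrow> 'g list" where
  "pp G a [] = [a]"
| "pp G a (g # gs) = a # pp G (a \<otimes>\<^bsub>G\<^esub> g) gs"

lemma length_pp [simp]: "length (pp G a gs) = Suc (length gs)"
  by (induction gs arbitrary: a) auto

lemma hd_pp [simp]: "hd (pp G a gs) = a"
  by (cases gs) auto

lemma pp_neq_Nil [simp]: "pp G a gs \<noteq> []"
  by (cases gs) auto

lemma (in monoid) pp_closed: "a \<in> carrier G \<Longrightarrow> set gs \<subseteq> carrier G \<Longrightarrow> set (pp G a gs) \<subseteq> carrier G"
  by (induction gs arbitrary: a) auto

lemma (in monoid) map_mult_pp:
  "b \<in> carrier G \<Longrightarrow> a \<in> carrier G \<Longrightarrow> set gs \<subseteq> carrier G \<Longrightarrow>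
    map (\<lambda>x. b \<otimes> x) (pp G a gs) = pp G (b \<otimes> a) gs"
  by (induction gs arbitrary: a) (auto simp: m_assoc)

lemma merge_Suc: "1 \<le> i \<Longrightarrow> i < length gs \<Longrightarrow> merge G (Suc i) (g # gs) = g # merge G i gs"
  by (cases i) (auto simp: merge_def)

lemma merge_1: "merge G (Suc 0) (g # h # hs) = (g \<otimes>\<^bsub>G\<^esub> h) # hs"
  by (simp add: merge_def)

lemma length_merge: "1 \<le> i \<Longrightarrow> i < length gs \<Longrightarrow> Suc (length (merge G i gs)) = length gs"
  by (simp add: merge_def)

lemma (in monoid) merge_closed:
  assumes "set gs \<subseteq> carrier G" "1 \<le> i" "i < length gs"
  shows "set (merge G i gs) \<subseteq> carrier G"
proof -
  have "gs ! (i - 1) \<in> carrier G" "gs ! i \<in> carrier G"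
    using assms nth_mem[of "i - 1" gs] nth_mem[of i gs] by auto
  then show ?thesis
    using assms(1) set_take_subset[of "i - 1" gs] set_drop_subset[of "i + 1" gs]
    unfolding merge_def by auto
qed

section \<open>Identities for face sums, prisms and the Alexander-Whitney map\<close>

context abelian_group
begin

lemma alt_sign_closed [simp]: "x \<in> carrier G \<Longrightarrow> alt_sign G i x \<in> carrier G"
  by (simp add: alt_sign_def)

lemma alt_sign_Suc: "x \<in> carrier G \<Longrightarrow> alt_sign G (Suc i) x = \<ominus> alt_sign G i x"
  by (simp add: alt_sign_def)

lemma alt_sign_zero [simp]: "alt_sign G i \<zero> = \<zero>"
  by (simp add: alt_sign_def a_inv_zero)

lemma alt_sign_add: "x \<in> carrier G \<Longrightarrow> y \<in> carrier G \<Longrightarrow>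
    alt_sign G i (x \<oplus> y) = alt_sign G i x \<oplus> alt_sign G i y"
  by (simp add: alt_sign_def minus_add)

lemma alt_sign_alt_sign: "x \<in> carrier G \<Longrightarrow> alt_sign G i (alt_sign G i x) = x"
  by (simp add: alt_sign_def)

lemma dl_closed [simp]: "(\<And>ys. f ys \<in> carrier G) \<Longrightarrow> dl G f xs \<in> carrier G"
  by (induction xs arbitrary: f) auto

lemma dl_cong:
  "(\<And>ys. set ys \<subseteq> set xs \<Longrightarrow> Suc (length ys) = length xs \<Longrightarrow> f ys = g ys) \<Longrightarrow> dl G f xs = dl G g xs"
proof (induction xs arbitrary: f g)
  case (Cons x xs)
  have "dl G (\<lambda>ys. f (x # ys)) xs = dl G (\<lambda>ys. g (x # ys)) xs"
    by (rule Cons.IH) (rule Cons.prems; auto)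
  moreover have "f xs = g xs" by (rule Cons.prems) auto
  ultimately show ?case by simp
qed simp

lemma dl_zero: "(\<And>ys. set ys \<subseteq> set xs \<Longrightarrow> Suc (length ys) = length xs \<Longrightarrow> f ys = \<zero>) \<Longrightarrow> dl G f xs = \<zero>"
proof -
  assume "\<And>ys. set ys \<subseteq> set xs \<Longrightarrow> Suc (length ys) = length xs \<Longrightarrow> f ys = \<zero>"
  then have "dl G f xs = dl G (\<lambda>_. \<zero>) xs" by (rule dl_cong)
  also have "\<dots> = \<zero>" by (induction xs) (auto simp: a_minus_def r_neg)
  finally show ?thesis .
qed

lemma dl_map: "dl G (\<lambda>ys. f (map s ys)) xs = dl G f (map s xs)"
proof (induction xs arbitrary: f)
  case (Cons x xs)
  show ?case using Cons.IH[of "\<lambda>ys. f (s x # ys)"] by simp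
qed simp

lemma dl_hom:
  assumes A: "abelian_group A" and h: "\<And>x y. x \<in> carrier G \<Longrightarrow> y \<in> carrier G \<Longrightarrow> h (x \<oplus> y) = h x \<oplus>\<^bsub>A\<^esub> h y"
    and hc: "\<And>x. x \<in> carrier G \<Longrightarrow> h x \<in> carrier A"
    and f: "\<And>ys. f ys \<in> carrier G"
  shows "h (dl G f xs) = dl A (\<lambda>ys. h (f ys)) xs"
proof -
  interpret A: abelian_group A by fact
  have h0: "h \<zero> = \<zero>\<^bsub>A\<^esub>"
    using h[of \<zero> \<zero>] hc[of \<zero>] by (metis A.add.l_cancel_one l_zero zero_closed)
  have hm: "h (\<ominus> x) = \<ominus>\<^bsub>A\<^esub> h x" if "x \<in> carrier G" for x
    using h[of "\<ominus> x" x] that h0 hc by (simp add: l_neg A.minus_equality)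
  show ?thesis
    using f by (induction xs arbitrary: f) (simp_all add: h0 a_minus_def hm h)
qed

lemma dl_add:
  assumes "\<And>ys. f ys \<in> carrier G" "\<And>ys. g ys \<in> carrier G"
  shows "dl G (\<lambda>ys. f ys \<oplus> g ys) xs = dl G f xs \<oplus> dl G g xs"
  using assms
proof (induction xs arbitrary: f g)
  case (Cons x xs)
  have c: "f xs \<in> carrier G" "g xs \<in> carrier G" "dl G (\<lambda>ys. f (x # ys)) xs \<in> carrier G"
    "dl G (\<lambda>ys. g (x # ys)) xs \<in> carrier G" using Cons.prems by auto
  have "(u \<oplus> v) \<ominus> (u' \<oplus> v') = (u \<ominus> u') \<oplus> (v \<ominus> v')"
    if "u \<in> carrier G" "v \<in> carrier G" "u' \<in> carrier G" "v' \<in> carrier G" for u v u' v'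
    using that by algebra
  then show ?case using c Cons by simp
qed simp

lemma dl_a_inv: "(\<And>ys. f ys \<in> carrier G) \<Longrightarrow> dl G (\<lambda>ys. \<ominus> f ys) xs = \<ominus> dl G f xs"
  using dl_hom[OF abelian_group_axioms, of "\<lambda>x. \<ominus> x" f xs] by (simp add: minus_add)

lemma dl_alt_sign: "(\<And>ys. f ys \<in> carrier G) \<Longrightarrow> dl G (\<lambda>ys. alt_sign G i (f ys)) xs = alt_sign G i (dl G f xs)"
  by (simp add: alt_sign_def dl_a_inv)

lemma dl_diff:
  assumes "\<And>ys. f ys \<in> carrier G" "\<And>ys. g ys \<in> carrier G"
  shows "dl G (\<lambda>ys. f ys \<ominus> g ys) xs = dl G f xs \<ominus> dl G g xs"
  using assms by (simp add: a_minus_def dl_add dl_a_inv)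

text \<open>The usual cancellation in pairs is one recursion step: the terms in which the head is
  deleted first or second cancel, and what is left is the same statement for the tail.\<close>

lemma dl_dl:
  assumes "\<And>ys. f ys \<in> carrier G" shows "dl G (dl G f) xs = \<zero>"
  using assms
proof (induction xs arbitrary: f)
  case (Cons x xs)
  have "dl G (dl G f) (x # xs) = dl G f xs \<ominus> (dl G f xs \<ominus> dl G (dl G (\<lambda>ys. f (x # ys))) xs)"
    using Cons.prems by (simp add: dl_diff)
  then show ?case using Cons by (simp add: a_minus_def a_inv_zero r_neg)
qed simp

lemma dl_commute:
  assumes "\<And>xs ys. F xs ys \<in> carrier G"
  shows "dl G (\<lambda>ys. dl G (F ys) gs) xs = dl G (\<lambda>hs. dl G (\<lambda>ys. F ys hs) xs) gs"
  using assms
proof (induction xs arbitrary: F)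
  case Nil
  then show ?case by (simp add: dl_zero)
next
  case (Cons x xs)
  then show ?case by (simp add: dl_diff)
qed

lemma prism_closed [simp]: "(\<And>ys. f ys \<in> carrier G) \<Longrightarrow> prism G s t f xs \<in> carrier G"
  by (induction xs arbitrary: f) auto

lemma prism_diff:
  assumes "\<And>ys. f ys \<in> carrier G" "\<And>ys. g ys \<in> carrier G"
  shows "prism G s t (\<lambda>ys. f ys \<ominus> g ys) xs = prism G s t f xs \<ominus> prism G s t g xs"
  using assms
proof (induction xs arbitrary: f g)
  case Nil
  then show ?case by (simp add: a_minus_def a_inv_zero)
next
  case (Cons x xs)
  let ?l = "s x # t x # map t xs"
  have c: "f ?l \<in> carrier G" "g ?l \<in> carrier G" "prism G s t (\<lambda>ys. f (s x # ys)) xs \<in> carrier G"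
    "prism G s t (\<lambda>ys. g (s x # ys)) xs \<in> carrier G" using Cons.prems by auto
  have "(u \<ominus> v) \<ominus> (u' \<ominus> v') = (u \<ominus> u') \<ominus> (v \<ominus> v')"
    if "u \<in> carrier G" "v \<in> carrier G" "u' \<in> carrier G" "v' \<in> carrier G" for u v u' v'
    using that by algebra
  then show ?case using c Cons by simp
qed

lemma prism_zero:
  "(\<And>ys. set ys \<subseteq> s ` set xs \<union> t ` set xs \<Longrightarrow> length ys = Suc (length xs) \<Longrightarrow> f ys = \<zero>) \<Longrightarrow>
    prism G s t f xs = \<zero>"
proof (induction xs arbitrary: f)
  case (Cons x xs)
  have "prism G s t (\<lambda>ys. f (s x # ys)) xs = \<zero>"
    by (rule Cons.IH) (rule Cons.prems; auto)
  moreover have "f (s x # t x # map t xs) = \<zero>" by (rule Cons.prems) auto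
  ultimately show ?case by (simp add: a_minus_def a_inv_zero)
qed simp

text \<open>Unfolding the head produces two pairs of equal terms with opposite signs
  (\<open>p\<close> and \<open>q\<close> in the algebraic identity below). The remainder is the
  induction hypothesis for the tail with first entry \<open>s x\<close> fixed, and it telescopes
  with the exchange of \<open>s x\<close> for \<open>t x\<close> in front.\<close>

lemma prism_homotopy:
  assumes "\<And>ys. f ys \<in> carrier G"
  shows "dl G (prism G s t f) xs \<oplus> prism G s t (dl G f) xs = f (map t xs) \<ominus> f (map s xs)"
  using assms
proof (induction xs arbitrary: f)
  case Nil
  then show ?case by (simp add: a_minus_def r_neg)
next
  case (Cons x xs)
  let ?fs = "\<lambda>ys. f (s x # ys)" and ?ft = "\<lambda>ys. f (s x # t x # ys)" and ?l = "map t xs"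
  have c [simp]: "f ys \<in> carrier G" for ys by (rule Cons.prems)
  have 1: "prism G s t (dl G f) (x # xs) =
      (f (t x # ?l) \<ominus> (f (s x # ?l) \<ominus> dl G ?ft ?l)) \<ominus> (prism G s t f xs \<ominus> prism G s t (dl G ?fs) xs)"
    by (simp add: prism_diff)
  have 2: "dl G (prism G s t f) (x # xs) =
      prism G s t f xs \<ominus> (dl G ?ft ?l \<ominus> dl G (prism G s t ?fs) xs)"
    by (simp add: dl_diff dl_map[of ?ft])
  have IH: "dl G (prism G s t ?fs) xs \<oplus> prism G s t (dl G ?fs) xs = f (s x # ?l) \<ominus> f (s x # map s xs)"
    by (rule Cons.IH) simp
  have "(p \<ominus> (q \<ominus> u)) \<oplus> ((v \<ominus> (w \<ominus> q)) \<ominus> (p \<ominus> u')) = (v \<ominus> w) \<oplus> (u \<oplus> u')"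
    if "p \<in> carrier G" "q \<in> carrier G" "u \<in> carrier G" "u' \<in> carrier G" "v \<in> carrier G" "w \<in> carrier G"
    for p q u u' v w using that by algebra
  then have "dl G (prism G s t f) (x # xs) \<oplus> prism G s t (dl G f) (x # xs) =
      (f (t x # ?l) \<ominus> f (s x # ?l)) \<oplus> (dl G (prism G s t ?fs) xs \<oplus> prism G s t (dl G ?fs) xs)"
    unfolding 1 2 by simp
  also have "\<dots> = (f (t x # ?l) \<ominus> f (s x # ?l)) \<oplus> (f (s x # ?l) \<ominus> f (s x # map s xs))"
    by (simp add: IH)
  also have "(v \<ominus> w) \<oplus> (w \<ominus> u) = v \<ominus> u" if "u \<in> carrier G" "v \<in> carrier G" "w \<in> carrier G" for u v w
    using that by algebra
  finally show ?case by simp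
qed

lemma aw_closed [simp]: "(\<And>xs ys. F xs ys \<in> carrier G) \<Longrightarrow> aw G \<pi> F gs \<in> carrier G"
  by (induction gs arbitrary: F) auto

lemma aw_diff:
  assumes "\<And>xs ys. F xs ys \<in> carrier G" "\<And>xs ys. F' xs ys \<in> carrier G"
  shows "aw G \<pi> (\<lambda>xs ys. F xs ys \<ominus> F' xs ys) gs = aw G \<pi> F gs \<ominus> aw G \<pi> F' gs"
  using assms
proof (induction gs arbitrary: F F')
  case Nil
  then show ?case by (simp add: a_minus_def a_inv_zero)
next
  case (Cons g gs)
  have "(u \<ominus> v) \<oplus> (u' \<ominus> v') = (u \<oplus> u') \<ominus> (v \<oplus> v')"
    if "u \<in> carrier G" "v \<in> carrier G" "u' \<in> carrier G" "v' \<in> carrier G" for u v u' v'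
    using that by algebra
  then show ?case using Cons by simp
qed

lemma aw_hom:
  assumes A: "abelian_group A" and h: "\<And>x y. x \<in> carrier G \<Longrightarrow> y \<in> carrier G \<Longrightarrow> h (x \<oplus> y) = h x \<oplus>\<^bsub>A\<^esub> h y"
    and hc: "\<And>x. x \<in> carrier G \<Longrightarrow> h x \<in> carrier A"
    and F: "\<And>xs ys. F xs ys \<in> carrier G"
  shows "h (aw G \<pi> F gs) = aw A \<pi> (\<lambda>xs ys. h (F xs ys)) gs"
proof -
  interpret A: abelian_group A by fact
  have h0: "h \<zero> = \<zero>\<^bsub>A\<^esub>"
    using h[of \<zero> \<zero>] hc[of \<zero>] by (metis A.add.l_cancel_one l_zero zero_closed)
  show ?thesis
    using F by (induction gs arbitrary: F) (simp_all add: h0 h)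
qed

lemma aw_add:
  assumes "\<And>xs ys. F xs ys \<in> carrier G" "\<And>xs ys. F' xs ys \<in> carrier G"
  shows "aw G \<pi> (\<lambda>xs ys. F xs ys \<oplus> F' xs ys) gs = aw G \<pi> F gs \<oplus> aw G \<pi> F' gs"
  using assms
proof (induction gs arbitrary: F F')
  case (Cons g gs)
  have "(u \<oplus> v) \<oplus> (u' \<oplus> v') = (u \<oplus> u') \<oplus> (v \<oplus> v')"
    if "u \<in> carrier G" "v \<in> carrier G" "u' \<in> carrier G" "v' \<in> carrier G" for u v u' v'
    using that by algebra
  then show ?case using Cons by simp
qed simp

lemma aw_cong:
  "(\<And>xs ys. xs \<noteq> [] \<Longrightarrow> ys \<noteq> [] \<Longrightarrow> set xs \<subseteq> \<pi> ` set gs \<Longrightarrow> set ys \<subseteq> set gs \<Longrightarrow>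
      length xs + length ys = Suc (length gs) \<Longrightarrow> F xs ys = F' xs ys) \<Longrightarrow>
    aw G \<pi> F gs = aw G \<pi> F' gs"
proof (induction gs arbitrary: F F')
  case (Cons g gs)
  have "aw G \<pi> (\<lambda>ys. F (\<pi> g # ys)) gs = aw G \<pi> (\<lambda>ys. F' (\<pi> g # ys)) gs"
    by (rule Cons.IH) (rule Cons.prems; auto)
  moreover have "F [\<pi> g] (g # gs) = F' [\<pi> g] (g # gs)" by (rule Cons.prems) auto
  ultimately show ?case by simp
qed simp

lemma dd_closed [simp]: "(\<And>xs ys. F xs ys \<in> carrier G) \<Longrightarrow> dd G F xs gs \<in> carrier G"
  by (simp add: dd_def)

lemma dd_Cons:
  assumes "\<And>xs ys. F xs ys \<in> carrier G"
  shows "dd G F (x # xs) gs = F xs gs \<ominus> dd G (\<lambda>ys. F (x # ys)) xs gs"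
proof -
  have "(u \<ominus> v) \<oplus> w = u \<ominus> (v \<oplus> \<ominus> w)" if "u \<in> carrier G" "v \<in> carrier G" "w \<in> carrier G" for u v w
    using that by algebra
  then show ?thesis using assms by (simp add: dd_def alt_sign_Suc)
qed

text \<open>The Alexander-Whitney map respects the differentials up to the term
  \<open>F [] gs\<close>, which arises when a list with one entry loses it. Cochains of the double
  complex vanish on empty lists, so there the term disappears.\<close>

lemma aw_dd:
  assumes "\<And>xs ys. F xs ys \<in> carrier G" "\<And>xs. F xs [] = \<zero>"
  shows "aw G \<pi> (dd G F) gs = F [] gs \<oplus> dl G (aw G \<pi> F) gs"
  using assms
proof (induction gs arbitrary: F)
  case (Cons g gs)
  let ?F = "\<lambda>ys. F (\<pi> g # ys)"
  have c [simp]: "F xs ys \<in> carrier G" for xs ys by (rule Cons.prems)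
  have IH: "aw G \<pi> (dd G ?F) gs = F [\<pi> g] gs \<oplus> dl G (aw G \<pi> ?F) gs"
    by (rule Cons.IH) (auto simp: Cons.prems)
  have 1: "dd G F [\<pi> g] (g # gs) = F [] (g # gs) \<oplus> (F [\<pi> g] gs \<ominus> dl G (\<lambda>ys. F [\<pi> g] (g # ys)) gs)"
    by (simp add: dd_def alt_sign_def a_minus_def a_inv_zero)
  have 2: "aw G \<pi> (\<lambda>ys. dd G F (\<pi> g # ys)) gs = aw G \<pi> F gs \<ominus> (F [\<pi> g] gs \<oplus> dl G (aw G \<pi> ?F) gs)"
  proof -
    have "(\<lambda>ys. dd G F (\<pi> g # ys)) = (\<lambda>ys hs. F ys hs \<ominus> dd G ?F ys hs)"
      by (intro ext dd_Cons) simp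
    then show ?thesis by (simp add: aw_diff IH)
  qed
  have "(u \<oplus> (v \<ominus> w)) \<oplus> (p \<ominus> (v \<oplus> q)) = u \<oplus> (p \<ominus> (w \<oplus> q))"
    if "p \<in> carrier G" "q \<in> carrier G" "u \<in> carrier G" "v \<in> carrier G" "w \<in> carrier G"
    for p q u v w using that by algebra
  then show ?case by (simp add: 1 2 dl_add)
qed (simp add: assms)

text \<open>Deleting an entry of \<open>xs\<close> flips the sign of the vertical part, so the two
  mixed terms, equal by \<open>dl_commute\<close>, cancel.\<close>

lemma dd_dd:
  assumes "\<And>xs ys. F xs ys \<in> carrier G" shows "dd G (dd G F) xs gs = \<zero>"
proof -
  note [simp] = assms
  let ?n = "Suc (length xs)"
  have 1: "dl G (\<lambda>ys. alt_sign G (Suc (length ys)) (dl G (F ys) gs)) xs =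
      \<ominus> alt_sign G ?n (dl G (\<lambda>ys. dl G (F ys) gs) xs)"
  proof -
    have "dl G (\<lambda>ys. alt_sign G (Suc (length ys)) (dl G (F ys) gs)) xs =
        dl G (\<lambda>ys. \<ominus> alt_sign G ?n (dl G (F ys) gs)) xs"
      by (rule dl_cong) (simp add: alt_sign_def)
    then show ?thesis by (simp add: dl_a_inv dl_alt_sign)
  qed
  let ?u = "dl G (\<lambda>ys. dl G (F ys) gs) xs"
  have 2: "dl G (\<lambda>ys. dd G F ys gs) xs = \<ominus> alt_sign G ?n ?u"
  proof -
    have "dl G (\<lambda>ys. dd G F ys gs) xs = dl G (dl G (\<lambda>ys. F ys gs)) xs \<oplus>
        dl G (\<lambda>ys. alt_sign G (Suc (length ys)) (dl G (F ys) gs)) xs"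
      unfolding dd_def by (rule dl_add) simp_all
    then show ?thesis using 1 by (simp add: dl_dl)
  qed
  have 3: "dl G (dd G F xs) gs = ?u"
  proof -
    have "dl G (dd G F xs) gs = dl G (\<lambda>hs. dl G (\<lambda>ys. F ys hs) xs) gs \<oplus>
        dl G (\<lambda>hs. alt_sign G ?n (dl G (F xs) hs)) gs"
      unfolding dd_def[abs_def] by (rule dl_add) simp_all
    also have "dl G (\<lambda>hs. alt_sign G ?n (dl G (F xs) hs)) gs = alt_sign G ?n (dl G (dl G (F xs)) gs)"
      by (rule dl_alt_sign) simp
    also have "dl G (\<lambda>hs. dl G (\<lambda>ys. F ys hs) xs) gs = ?u" by (rule dl_commute[symmetric]) simp
    finally show ?thesis by (simp add: dl_dl)
  qed
  show ?thesis unfolding dd_def[of G "dd G F"] 2 3 by (simp add: l_neg)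
qed

lemma finsum_atLeastAtMost_Suc_shift:
  assumes "\<And>i. f i \<in> carrier G"
  shows "(\<Oplus>i\<in>{Suc 0..Suc m}. f i) = f (Suc 0) \<oplus> (\<Oplus>i\<in>{Suc 0..m}. f (Suc i))"
proof (induction m)
  case (Suc m)
  have s: "{Suc 0..Suc n} = insert (Suc n) {Suc 0..n}" for n by auto
  have "(\<Oplus>i\<in>{Suc 0..Suc (Suc m)}. f i) = f (Suc (Suc m)) \<oplus> (f (Suc 0) \<oplus> (\<Oplus>i\<in>{Suc 0..m}. f (Suc i)))"
    unfolding s[of "Suc m"] using assms Suc by (subst finsum_insert) auto
  also have "\<dots> = f (Suc 0) \<oplus> (\<Oplus>i\<in>{Suc 0..Suc m}. f (Suc i))"
    unfolding s[of m] using assms by (subst finsum_insert) (auto simp: a_lcomm)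
  finally show ?case .
qed (use assms in simp)

lemma finsum_a_inv:
  assumes "\<And>i. f i \<in> carrier G"
  shows "(\<Oplus>i\<in>I. \<ominus> f i) = \<ominus> (\<Oplus>i\<in>I. f i)"
proof (cases "finite I")
  case True
  then show ?thesis by (induction I) (use assms in \<open>auto simp: a_inv_zero minus_add finsum_insert\<close>)
qed (simp add: finsum_infinite a_inv_zero)

text \<open>The dictionary between homogeneous and inhomogeneous differentials. Deleting an entry
  from the partial products moves the base point (first entry), multiplies two neighbouring group
  elements (inner entry) or drops the last element (last entry).\<close>

lemma dl_pp:
  assumes "monoid H" "\<And>ys. c ys \<in> carrier G" "a \<in> carrier H" "set hs \<subseteq> carrier H" "length hs = Suc n"
  shows "dl G c (pp H a hs) = c (pp H (a \<otimes>\<^bsub>H\<^esub> hd hs) (tl hs)) \<oplus>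
    (\<Oplus>i\<in>{1..n}. alt_sign G i (c (pp H a (merge H i hs)))) \<oplus>
    alt_sign G (Suc n) (c (pp H a (butlast hs)))"
  using assms(2-)
proof (induction n arbitrary: c a hs)
  case 0
  then obtain g where "hs = [g]" by (cases hs) auto
  then show ?case using 0 by (simp add: alt_sign_def a_minus_def a_inv_zero)
next
  case (Suc n)
  interpret H: monoid H by fact
  obtain g h hs' where hs: "hs = g # h # hs'" using Suc.prems(4) by (cases hs; cases "tl hs") auto
  let ?c = "\<lambda>ys. c (a # ys)" and ?a = "a \<otimes>\<^bsub>H\<^esub> g"
  have mem: "g \<in> carrier H" "h \<in> carrier H" "set hs' \<subseteq> carrier H" "a \<in> carrier H" and len: "length hs' = n"
    using Suc.prems hs by auto
  have c [simp]: "c ys \<in> carrier G" for ys by (rule Suc.prems)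
  define S where "S = (\<Oplus>i\<in>{1..n}. alt_sign G i (?c (pp H ?a (merge H i (h # hs')))))"
  define B where "B = alt_sign G (Suc n) (?c (pp H ?a (butlast (h # hs'))))"
  define u where "u = ?c (pp H (?a \<otimes>\<^bsub>H\<^esub> h) hs')"
  have cl: "S \<in> carrier G" "B \<in> carrier G" "u \<in> carrier G" unfolding S_def B_def u_def by auto
  have IH: "dl G ?c (pp H ?a (h # hs')) = u \<oplus> S \<oplus> B"
    unfolding S_def B_def u_def using Suc.IH[of ?c ?a "h # hs'"] mem len by simp
  have S': "(\<Oplus>i\<in>{1..Suc n}. alt_sign G i (c (pp H a (merge H i hs)))) = \<ominus> u \<oplus> \<ominus> S"
  proof -
    have "(\<Oplus>i\<in>{1..n}. alt_sign G (Suc i) (c (pp H a (merge H (Suc i) hs)))) =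
        (\<Oplus>i\<in>{1..n}. \<ominus> alt_sign G i (?c (pp H ?a (merge H i (h # hs')))))"
      using len by (intro finsum_cong) (auto simp: hs merge_Suc alt_sign_Suc simp_implies_def)
    then show ?thesis
      using mem by (simp add: finsum_atLeastAtMost_Suc_shift finsum_a_inv S_def hs merge_1 u_def
          alt_sign_def[of G "Suc 0"] H.m_assoc)
  qed
  have B': "alt_sign G (Suc (Suc n)) (c (pp H a (butlast hs))) = \<ominus> B"
    by (simp add: B_def hs alt_sign_Suc[symmetric])
  have "v \<ominus> (u \<oplus> S \<oplus> B) = v \<oplus> (\<ominus> u \<oplus> \<ominus> S) \<oplus> \<ominus> B" if "v \<in> carrier G" for v
    using cl that by algebra
  then show ?case unfolding S' B' using IH by (simp add: hs)
qed

end

section \<open>Seminorms\<close>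

context seminormed_module
begin

lemma ring_R: "ring R"
  by (rule normed_ring.axioms(1)[OF normed_ring_axioms])

lemma R_one_closed: "\<one>\<^bsub>R\<^esub> \<in> carrier R"
  by (rule ring.ring_simprules(6)[OF ring_R])

lemma seminorm_smult:
  assumes "a \<in> carrier R" "x \<in> carrier M"
  shows "seminorm M (a \<odot>\<^bsub>M\<^esub> x) \<le> absval R a * seminorm M x"
  using seminorm_smult_add[OF assms M.zero_closed] assms smult_closed by (simp add: seminorm_zero)

lemma seminorm_diff:
  assumes "x \<in> carrier M" "y \<in> carrier M"
  shows "seminorm M (x \<ominus>\<^bsub>M\<^esub> y) \<le> seminorm M x + seminorm M y"
  using seminorm_triangle[of x "\<ominus>\<^bsub>M\<^esub> y"] seminorm_minus[of y] assms by (simp add: a_minus_def)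

lemma seminorm_diff_commute:
  assumes "x \<in> carrier M" "y \<in> carrier M"
  shows "seminorm M (x \<ominus>\<^bsub>M\<^esub> y) = seminorm M (y \<ominus>\<^bsub>M\<^esub> x)"
proof -
  have "\<ominus>\<^bsub>M\<^esub> (y \<ominus>\<^bsub>M\<^esub> x) = x \<ominus>\<^bsub>M\<^esub> y" using assms by algebra
  then show ?thesis using seminorm_minus[of "y \<ominus>\<^bsub>M\<^esub> x"] assms by simp
qed

lemma seminorm_alt_sign: "x \<in> carrier M \<Longrightarrow> seminorm M (alt_sign M i x) = seminorm M x"
  by (simp add: alt_sign_def seminorm_minus)

text \<open>This and the next two estimates bound an operator by its number of summands. Since that
  number is fixed in each degree, all constructions below send bounded cochains to bounded
  cochains.\<close>

lemma seminorm_dl: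
  assumes "\<And>ys. f ys \<in> carrier M" "\<And>ys. Suc (length ys) = length xs \<Longrightarrow> seminorm M (f ys) \<le> b"
  shows "seminorm M (dl M f xs) \<le> real (length xs) * b"
  using assms
proof (induction xs arbitrary: f)
  case (Cons x xs)
  have "seminorm M (dl M f (x # xs)) \<le> seminorm M (f xs) + seminorm M (dl M (\<lambda>ys. f (x # ys)) xs)"
    using Cons.prems by (simp add: seminorm_diff)
  also have "\<dots> \<le> b + real (length xs) * b"
    by (intro add_mono Cons.prems Cons.IH) auto
  finally show ?case by (simp add: algebra_simps)
qed (simp add: seminorm_zero)

lemma seminorm_prism:
  assumes "\<And>ys. f ys \<in> carrier M" "\<And>ys. length ys = Suc (length xs) \<Longrightarrow> seminorm M (f ys) \<le> b"
  shows "seminorm M (prism M s t f xs) \<le> real (length xs) * b"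
  using assms
proof (induction xs arbitrary: f)
  case (Cons x xs)
  have "seminorm M (prism M s t f (x # xs)) \<le>
      seminorm M (f (s x # t x # map t xs)) + seminorm M (prism M s t (\<lambda>ys. f (s x # ys)) xs)"
    using Cons.prems by (simp add: seminorm_diff)
  also have "\<dots> \<le> b + real (length xs) * b"
    by (intro add_mono Cons.prems Cons.IH) auto
  finally show ?case by (simp add: algebra_simps)
qed (simp add: seminorm_zero)

lemma seminorm_aw:
  assumes "\<And>xs ys. F xs ys \<in> carrier M"
    "\<And>xs ys. length xs + length ys = Suc (length gs) \<Longrightarrow> seminorm M (F xs ys) \<le> b"
  shows "seminorm M (aw M \<pi> F gs) \<le> real (length gs) * b"
  using assms
proof (induction gs arbitrary: F)
  case (Cons g gs)
  have "seminorm M (aw M \<pi> F (g # gs)) \<le>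
      seminorm M (F [\<pi> g] (g # gs)) + seminorm M (aw M \<pi> (\<lambda>ys. F (\<pi> g # ys)) gs)"
    using Cons.prems by (simp add: seminorm_triangle)
  also have "\<dots> \<le> b + real (length gs) * b"
    by (intro add_mono Cons.prems Cons.IH) auto
  finally show ?case by (simp add: algebra_simps)
qed (simp add: seminorm_zero)

lemma linear_mapD:
  assumes "f \<in> linear_maps R M N"
  shows "x \<in> carrier M \<Longrightarrow> f x \<in> carrier N"
    and "x \<in> carrier M \<Longrightarrow> y \<in> carrier M \<Longrightarrow> f (x \<oplus>\<^bsub>M\<^esub> y) = f x \<oplus>\<^bsub>N\<^esub> f y"
    and "a \<in> carrier R \<Longrightarrow> x \<in> carrier M \<Longrightarrow> f (a \<odot>\<^bsub>M\<^esub> x) = a \<odot>\<^bsub>N\<^esub> f x"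
  using assms by (auto simp: linear_maps_def)

end

locale seminormed_subquotient_module =
  seminormed_module R M + subquotient_module R M Z B N
  for R :: "('r, 's) normed_ring_scheme" and M :: "('r, 'm, 'x) seminormed_module_scheme"
    and Z B :: "'m set" and N :: "('r, 'm set, 'y) seminormed_module_scheme" +
  assumes seminorm_N: "seminorm N c = Inf (seminorm M ` c)"
begin

lemma seminorm_cls_le:
  assumes "x \<in> Z" "y \<in> cls x" shows "seminorm N (cls x) \<le> seminorm M y"
  unfolding seminorm_N
proof (rule cInf_lower)
  show "bdd_below (seminorm M ` cls x)"
    using seminorm_nonneg coset_mem_iff[OF B Z_carrier[OF assms(1)]] by (intro bdd_belowI[of _ 0]) auto
qed (use assms in auto)

lemma cls_nonempty: "x \<in> Z \<Longrightarrow> cls x \<noteq> {}"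
  using coset_self[OF B Z_carrier] by auto

lemma seminorm_cls_ge:
  assumes "x \<in> Z" "\<And>y. y \<in> cls x \<Longrightarrow> b \<le> seminorm M y" shows "b \<le> seminorm N (cls x)"
  unfolding seminorm_N by (rule cInf_greatest) (use cls_nonempty assms in auto)

lemma seminorm_cls_approx:
  assumes "x \<in> Z" "seminorm N (cls x) < b"
  obtains y where "y \<in> cls x" "seminorm M y < b"
  using seminorm_cls_ge[OF assms(1), of b] assms(2) by force

lemma seminorm_cls_le': "x \<in> Z \<Longrightarrow> seminorm N (cls x) \<le> seminorm M x"
  using seminorm_cls_le coset_self[OF B Z_carrier] by blast

lemma cls_memD: 
  assumes "x \<in> Z" "y \<in> cls x" shows "y \<in> carrier M" "y \<ominus>\<^bsub>M\<^esub> x \<in> B"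
  using assms coset_mem_iff[OF B Z_carrier[OF assms(1)]] by auto

lemma cls_memI:
  assumes "x \<in> Z" "y \<in> carrier M" "y \<ominus>\<^bsub>M\<^esub> x \<in> B" shows "y \<in> cls x"
  using assms coset_mem_iff[OF B Z_carrier[OF assms(1)]] by auto

theorem seminormed_module_N: "seminormed_module R N"
proof -
  interpret N: left_module R N by (rule left_module_N)
  note Z' = submodule_closed[OF Z] and B' = submodule_closed[OF B]
  \<comment> \<open>The factor is a parameter \<open>t\<close> because the absolute value of the
    unit may exceed 1: the unit with \<open>t = 1\<close> gives the triangle inequality, and
    \<open>t = absval R a\<close> the inequality for scalars.\<close>
  have smult_add: "seminorm N (a \<odot>\<^bsub>N\<^esub> c \<oplus>\<^bsub>N\<^esub> c') \<le> t * seminorm N c + seminorm N c'"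
    if a: "a \<in> carrier R" and t: "0 \<le> t" and c: "c \<in> carrier N" and c': "c' \<in> carrier N"
      and le: "\<And>u v. u \<in> carrier M \<Longrightarrow> v \<in> carrier M \<Longrightarrow>
        seminorm M (a \<odot>\<^bsub>M\<^esub> u \<oplus>\<^bsub>M\<^esub> v) \<le> t * seminorm M u + seminorm M v" for a t c c'
  proof (rule field_le_epsilon)
    fix e :: real assume "0 < e"
    \<comment> \<open>Near-optimal representatives of both classes with error \<open>d\<close> add
      up to an error of \<open>t * d + d = e\<close>.\<close>
    define d where "d = e / (t + 1)"
    have d: "0 < d" using \<open>0 < e\<close> t by (simp add: d_def)
    obtain x y where x: "x \<in> Z" "c = cls x" and y: "y \<in> Z" "c' = cls y"
      using c c' by (auto elim!: carrierE)
    obtain u where u: "u \<in> cls x" "seminorm M u < seminorm N c + d"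
      using seminorm_cls_approx[OF x(1), of "seminorm N c + d"] d x by auto
    obtain v where v: "v \<in> cls y" "seminorm M v < seminorm N c' + d"
      using seminorm_cls_approx[OF y(1), of "seminorm N c' + d"] d y by auto
    note uc = cls_memD[OF x(1) u(1)] and vc = cls_memD[OF y(1) v(1)]
    have xc: "x \<in> carrier M" "y \<in> carrier M" using x y Z_carrier by auto
    have eq: "(a \<odot>\<^bsub>M\<^esub> u \<oplus>\<^bsub>M\<^esub> v) \<ominus>\<^bsub>M\<^esub> (a \<odot>\<^bsub>M\<^esub> x \<oplus>\<^bsub>M\<^esub> y) = a \<odot>\<^bsub>M\<^esub> (u \<ominus>\<^bsub>M\<^esub> x) \<oplus>\<^bsub>M\<^esub> (v \<ominus>\<^bsub>M\<^esub> y)"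
    proof -
      have "(p \<oplus>\<^bsub>M\<^esub> v) \<ominus>\<^bsub>M\<^esub> (q \<oplus>\<^bsub>M\<^esub> y) = (p \<ominus>\<^bsub>M\<^esub> q) \<oplus>\<^bsub>M\<^esub> (v \<ominus>\<^bsub>M\<^esub> y)" if "p \<in> carrier M" "q \<in> carrier M" for p q
        using that vc(1) xc by algebra
      then show ?thesis using a uc(1) xc smult_closed by (simp add: smult_diff)
    qed
    have Zs: "a \<odot>\<^bsub>M\<^esub> x \<oplus>\<^bsub>M\<^esub> y \<in> Z" using a x y Z' by simp
    have "a \<odot>\<^bsub>M\<^esub> u \<oplus>\<^bsub>M\<^esub> v \<in> cls (a \<odot>\<^bsub>M\<^esub> x \<oplus>\<^bsub>M\<^esub> y)"
      using Zs a uc vc B'(4,6) smult_closed by (intro cls_memI) (simp_all add: eq)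
    then have "seminorm N (cls (a \<odot>\<^bsub>M\<^esub> x \<oplus>\<^bsub>M\<^esub> y)) \<le> seminorm M (a \<odot>\<^bsub>M\<^esub> u \<oplus>\<^bsub>M\<^esub> v)"
      by (rule seminorm_cls_le[OF Zs])
    also have "\<dots> \<le> t * seminorm M u + seminorm M v" by (rule le[OF uc(1) vc(1)])
    also have "\<dots> \<le> t * (seminorm N c + d) + (seminorm N c' + d)"
      using u v t by (intro add_mono mult_left_mono) auto
    also have "\<dots> = t * seminorm N c + seminorm N c' + e"
      using t by (simp add: d_def field_simps add_nonneg_eq_0_iff)
    finally show "seminorm N (a \<odot>\<^bsub>N\<^esub> c \<oplus>\<^bsub>N\<^esub> c') \<le> t * seminorm N c + seminorm N c' + e"
      using a x y Z' by (simp add: cls_smult cls_add)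
  qed
  have triangle: "seminorm N (c \<oplus>\<^bsub>N\<^esub> c') \<le> seminorm N c + seminorm N c'"
    if "c \<in> carrier N" "c' \<in> carrier N" for c c'
    using smult_add[of "\<one>\<^bsub>R\<^esub>" 1 c c'] that seminorm_triangle by (simp add: smult_one N.smult_one)
  have nonneg: "0 \<le> seminorm N c" if c: "c \<in> carrier N" for c
    using c by (auto elim!: carrierE intro!: seminorm_cls_ge seminorm_nonneg dest: cls_memD)
  have zero: "seminorm N \<zero>\<^bsub>N\<^esub> = 0"
    using seminorm_cls_le'[OF Z'(2)] nonneg[OF N.M.zero_closed] by (simp add: cls_zero seminorm_zero)
  have minus_le: "seminorm N (\<ominus>\<^bsub>N\<^esub> c) \<le> seminorm N c" if c: "c \<in> carrier N" for c
  proof -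
    obtain x where x: "x \<in> Z" "c = cls x" using c by (rule carrierE)
    have "seminorm N (cls (\<ominus>\<^bsub>M\<^esub> x)) \<le> seminorm M y" if y: "y \<in> cls x" for y
    proof -
      note yc = cls_memD[OF x(1) y]
      have "\<ominus>\<^bsub>M\<^esub> y \<ominus>\<^bsub>M\<^esub> (\<ominus>\<^bsub>M\<^esub> x) = \<ominus>\<^bsub>M\<^esub> (y \<ominus>\<^bsub>M\<^esub> x)" using yc(1) Z_carrier[OF x(1)] by algebra
      then have "\<ominus>\<^bsub>M\<^esub> y \<in> cls (\<ominus>\<^bsub>M\<^esub> x)" using yc B'(3) Z'(3)[OF x(1)] by (intro cls_memI) auto
      then show ?thesis using seminorm_cls_le[OF Z'(3)[OF x(1)]] yc seminorm_minus by metis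
    qed
    then show ?thesis using x by (simp add: cls_minus seminorm_cls_ge)
  qed
  show ?thesis
  proof (intro seminormed_module.intro normed_ring_axioms N.left_module_axioms
      seminormed_module_axioms.intro)
    fix c assume c: "c \<in> carrier N"
    show "0 \<le> seminorm N c" by (rule nonneg[OF c])
    show "seminorm N (\<ominus>\<^bsub>N\<^esub> c) = seminorm N c"
      using minus_le[OF c] minus_le[OF N.M.a_inv_closed[OF c]] c by simp
    fix c' assume c': "c' \<in> carrier N"
    show "seminorm N (c \<oplus>\<^bsub>N\<^esub> c') \<le> seminorm N c + seminorm N c'" by (rule triangle[OF c c'])
    fix a assume a: "a \<in> carrier R"
    show "seminorm N (a \<odot>\<^bsub>N\<^esub> c \<oplus>\<^bsub>N\<^esub> c') \<le> absval R a * seminorm N c + seminorm N c'"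
      using smult_add[OF a absval_nonneg[OF a] c c'] seminorm_smult_add[OF a] by blast
  qed (rule zero)
qed

end

lemma (in seminormed_module) seminormed_subquotient_moduleI:
  assumes "submodule Z R M" "submodule B R M"
  shows "seminormed_subquotient_module R M Z B (seminormed_subquotient M Z B)"
  by (intro seminormed_subquotient_module.intro subquotient_module.intro seminormed_module_axioms
      left_module_axioms subquotient_module_axioms.intro seminormed_subquotient_module_axioms.intro
      assms is_subquotient_seminormed_subquotient seminorm_seminormed_subquotient)

section \<open>Bounded cochains and their homogeneous form\<close>

lemma bounded_cochains_simps:
  "carrier (bounded_cochains G A n) =
    {f \<in> tuples G n \<rightarrow>\<^sub>E carrier A. \<exists>b. \<forall>gs\<in>tuples G n. seminorm A (f gs) \<le> b}"
  "\<zero>\<^bsub>bounded_cochains G A n\<^esub> = (\<lambda>gs\<in>tuples G n. \<zero>\<^bsub>A\<^esub>)"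
  "f \<oplus>\<^bsub>bounded_cochains G A n\<^esub> f' = (\<lambda>gs\<in>tuples G n. f gs \<oplus>\<^bsub>A\<^esub> f' gs)"
  "a \<odot>\<^bsub>bounded_cochains G A n\<^esub> f = (\<lambda>gs\<in>tuples G n. a \<odot>\<^bsub>A\<^esub> f gs)"
  "seminorm (bounded_cochains G A n) f = (SUP gs\<in>tuples G n. seminorm A (f gs))"
  by (simp_all add: bounded_cochains_def)

lemma bounded_cochain_ext:
  assumes "f \<in> carrier (bounded_cochains G A n)" "f' \<in> carrier (bounded_cochains G A n)"
    "\<And>gs. gs \<in> tuples G n \<Longrightarrow> f gs = f' gs"
  shows "f = f'"
  using assms by (auto simp: bounded_cochains_simps intro: PiE_ext)

lemma bounded_cochain_closed:
  "f \<in> carrier (bounded_cochains G A n) \<Longrightarrow> gs \<in> tuples G n \<Longrightarrow> f gs \<in> carrier A"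
  by (auto simp: bounded_cochains_simps)

lemma bounded_cochainI:
  assumes "\<And>gs. gs \<in> tuples G n \<Longrightarrow> f gs \<in> carrier A" "\<And>gs. gs \<in> tuples G n \<Longrightarrow> seminorm A (f gs) \<le> b"
  shows "(\<lambda>gs\<in>tuples G n. f gs) \<in> carrier (bounded_cochains G A n)"
  using assms by (auto simp: bounded_cochains_simps)

context seminormed_group_module
begin

lemma tuples_nonempty: "tuples G n \<noteq> {}"
proof -
  have "replicate n \<one>\<^bsub>G\<^esub> \<in> tuples G n" by (auto simp: tuples_def)
  then show ?thesis by blast
qed

abbreviation "BC n \<equiv> bounded_cochains G A n"

lemma bdd_above_cochain:
  "f \<in> carrier (BC n) \<Longrightarrow> bdd_above ((\<lambda>gs. seminorm A (f gs)) ` tuples G n)"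
  unfolding bounded_cochains_simps by (auto intro: bdd_aboveI2)

lemma seminorm_cochain_ge:
  "f \<in> carrier (BC n) \<Longrightarrow> gs \<in> tuples G n \<Longrightarrow> seminorm A (f gs) \<le> seminorm (BC n) f"
  unfolding bounded_cochains_simps(5) by (intro cSUP_upper bdd_above_cochain)

lemma seminorm_cochain_le:
  "(\<And>gs. gs \<in> tuples G n \<Longrightarrow> seminorm A (f gs) \<le> b) \<Longrightarrow> seminorm (BC n) f \<le> b"
  unfolding bounded_cochains_simps(5) by (intro cSUP_least tuples_nonempty)

lemma cochain_a_inv_closed:
  assumes "f \<in> carrier (BC n)"
  shows "(\<lambda>gs\<in>tuples G n. \<ominus>\<^bsub>A\<^esub> f gs) \<in> carrier (BC n)"
  using bounded_cochain_closed[OF assms] seminorm_cochain_ge[OF assms]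
  by (intro bounded_cochainI) (auto simp: seminorm_minus)

lemma cochain_smult_add_closed:
  assumes "f \<in> carrier (BC n)" "f' \<in> carrier (BC n)" "a \<in> carrier R"
  shows "(\<lambda>gs\<in>tuples G n. a \<odot>\<^bsub>A\<^esub> f gs \<oplus>\<^bsub>A\<^esub> f' gs) \<in> carrier (BC n)"
proof (rule bounded_cochainI)
  fix gs assume gs: "gs \<in> tuples G n"
  note c = bounded_cochain_closed[OF assms(1) gs] bounded_cochain_closed[OF assms(2) gs]
  show "a \<odot>\<^bsub>A\<^esub> f gs \<oplus>\<^bsub>A\<^esub> f' gs \<in> carrier A" using c assms smult_closed by simp
  have "seminorm A (a \<odot>\<^bsub>A\<^esub> f gs \<oplus>\<^bsub>A\<^esub> f' gs) \<le> absval R a * seminorm A (f gs) + seminorm A (f' gs)"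
    using c assms by (intro seminorm_smult_add)
  also have "\<dots> \<le> absval R a * seminorm (BC n) f + seminorm (BC n) f'"
    using assms gs by (intro add_mono mult_left_mono seminorm_cochain_ge absval_nonneg)
  finally show "seminorm A (a \<odot>\<^bsub>A\<^esub> f gs \<oplus>\<^bsub>A\<^esub> f' gs) \<le>
    absval R a * seminorm (BC n) f + seminorm (BC n) f'" .
qed

lemma cochain_add_closed:
  assumes "f \<in> carrier (BC n)" "f' \<in> carrier (BC n)"
  shows "(\<lambda>gs\<in>tuples G n. f gs \<oplus>\<^bsub>A\<^esub> f' gs) \<in> carrier (BC n)"
proof -
  have "(\<lambda>gs\<in>tuples G n. f gs \<oplus>\<^bsub>A\<^esub> f' gs) = (\<lambda>gs\<in>tuples G n. \<one>\<^bsub>R\<^esub> \<odot>\<^bsub>A\<^esub> f gs \<oplus>\<^bsub>A\<^esub> f' gs)"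
    using bounded_cochain_closed[OF assms(1)] by (intro restrict_ext) (simp add: smult_one)
  then show ?thesis using cochain_smult_add_closed[OF assms] by simp
qed

lemma cochain_zero_closed: "(\<lambda>gs\<in>tuples G n. \<zero>\<^bsub>A\<^esub>) \<in> carrier (BC n)"
  by (rule bounded_cochainI[where b = 0]) (auto simp: seminorm_zero)

lemma cochain_smult_closed:
  assumes "f \<in> carrier (BC n)" "a \<in> carrier R"
  shows "(\<lambda>gs\<in>tuples G n. a \<odot>\<^bsub>A\<^esub> f gs) \<in> carrier (BC n)"
proof -
  have "(\<lambda>gs\<in>tuples G n. a \<odot>\<^bsub>A\<^esub> f gs) =
      (\<lambda>gs\<in>tuples G n. a \<odot>\<^bsub>A\<^esub> f gs \<oplus>\<^bsub>A\<^esub> (\<lambda>gs\<in>tuples G n. \<zero>\<^bsub>A\<^esub>) gs)"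
    using bounded_cochain_closed[OF assms(1)] assms(2) smult_closed by (intro restrict_ext) simp
  then show ?thesis using cochain_smult_add_closed[OF assms(1) cochain_zero_closed assms(2)] by simp
qed

lemma abelian_group_cochains: "abelian_group (BC n)"
proof (rule abelian_groupI)
  show "\<zero>\<^bsub>BC n\<^esub> \<in> carrier (BC n)" using cochain_zero_closed by (simp add: bounded_cochains_simps(2))
  fix f assume f: "f \<in> carrier (BC n)"
  note fc = bounded_cochain_closed[OF f]
  show "\<zero>\<^bsub>BC n\<^esub> \<oplus>\<^bsub>BC n\<^esub> f = f"
    using cochain_add_closed[OF cochain_zero_closed f] f fc
    by (intro bounded_cochain_ext[of _ G A n]) (auto simp: bounded_cochains_simps(2,3))
  show "\<exists>f'\<in>carrier (BC n). f' \<oplus>\<^bsub>BC n\<^esub> f = \<zero>\<^bsub>BC n\<^esub>"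
    using cochain_a_inv_closed[OF f] fc
    by (intro bexI[of _ "\<lambda>gs\<in>tuples G n. \<ominus>\<^bsub>A\<^esub> f gs"])
      (auto simp: bounded_cochains_simps(2,3) M.l_neg intro!: restrict_ext)
  fix f' assume f': "f' \<in> carrier (BC n)"
  note fc' = bounded_cochain_closed[OF f']
  show "f \<oplus>\<^bsub>BC n\<^esub> f' \<in> carrier (BC n)" using cochain_add_closed[OF f f'] by (simp add: bounded_cochains_simps(3))
  show "f \<oplus>\<^bsub>BC n\<^esub> f' = f' \<oplus>\<^bsub>BC n\<^esub> f"
    using fc fc' by (auto simp: bounded_cochains_simps(3) M.a_comm intro!: restrict_ext)
  fix f'' assume f'': "f'' \<in> carrier (BC n)"
  show "f \<oplus>\<^bsub>BC n\<^esub> f' \<oplus>\<^bsub>BC n\<^esub> f'' = f \<oplus>\<^bsub>BC n\<^esub> (f' \<oplus>\<^bsub>BC n\<^esub> f'')"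
    using fc fc' bounded_cochain_closed[OF f'']
    by (auto simp: bounded_cochains_simps(3) M.a_assoc intro!: restrict_ext)
qed

lemma cochain_a_inv:
  assumes f: "f \<in> carrier (BC n)"
  shows "\<ominus>\<^bsub>BC n\<^esub> f = (\<lambda>gs\<in>tuples G n. \<ominus>\<^bsub>A\<^esub> f gs)"
proof -
  interpret C: abelian_group "BC n" by (rule abelian_group_cochains)
  have "(\<lambda>gs\<in>tuples G n. \<ominus>\<^bsub>A\<^esub> f gs) \<oplus>\<^bsub>BC n\<^esub> f = \<zero>\<^bsub>BC n\<^esub>"
    using bounded_cochain_closed[OF f] by (auto simp: bounded_cochains_simps(2,3) M.l_neg intro!: restrict_ext)
  then show ?thesis using C.minus_equality f cochain_a_inv_closed[OF f] by blast
qed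

lemma cochain_diff:
  assumes "f \<in> carrier (BC n)" "f' \<in> carrier (BC n)"
  shows "f \<ominus>\<^bsub>BC n\<^esub> f' = (\<lambda>gs\<in>tuples G n. f gs \<ominus>\<^bsub>A\<^esub> f' gs)"
  unfolding a_minus_def cochain_a_inv[OF assms(2)] bounded_cochains_simps(3)
  by (intro restrict_ext) simp

lemma seminormed_module_cochains: "seminormed_module R (BC n)"
proof -
  interpret C: abelian_group "BC n" by (rule abelian_group_cochains)
  note fc = bounded_cochain_closed[of _ G A n]
  show ?thesis
  proof (intro seminormed_module.intro left_module.intro normed_ring_axioms ring_R
      C.abelian_group_axioms left_module_axioms.intro seminormed_module_axioms.intro)
    fix f assume f: "f \<in> carrier (BC n)"
    show "\<one>\<^bsub>R\<^esub> \<odot>\<^bsub>BC n\<^esub> f = f"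
      using f fc[OF f] cochain_smult_closed[OF f R_one_closed]
      by (intro bounded_cochain_ext[of _ G A n]) (auto simp: bounded_cochains_simps(4) smult_one)
    obtain gs where gs: "gs \<in> tuples G n" using tuples_nonempty by blast
    have "0 \<le> seminorm A (f gs)" using fc[OF f gs] by (rule seminorm_nonneg)
    also have "\<dots> \<le> seminorm (BC n) f" using f gs by (rule seminorm_cochain_ge)
    finally show "0 \<le> seminorm (BC n) f" .
    show "seminorm (BC n) (\<ominus>\<^bsub>BC n\<^esub> f) = seminorm (BC n) f"
      unfolding cochain_a_inv[OF f] bounded_cochains_simps(5)
      using fc[OF f] by (intro SUP_cong refl) (simp add: seminorm_minus)
    {
      fix a assume a: "a \<in> carrier R"
      show "a \<odot>\<^bsub>BC n\<^esub> f \<in> carrier (BC n)"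
        using cochain_smult_closed[OF f a] by (simp add: bounded_cochains_simps(4))
      fix b assume b: "b \<in> carrier R"
      show "(a \<oplus>\<^bsub>R\<^esub> b) \<odot>\<^bsub>BC n\<^esub> f = a \<odot>\<^bsub>BC n\<^esub> f \<oplus>\<^bsub>BC n\<^esub> b \<odot>\<^bsub>BC n\<^esub> f"
        using a b fc[OF f] by (auto simp: bounded_cochains_simps(3,4) smult_l_distr intro!: restrict_ext)
      show "(a \<otimes>\<^bsub>R\<^esub> b) \<odot>\<^bsub>BC n\<^esub> f = a \<odot>\<^bsub>BC n\<^esub> (b \<odot>\<^bsub>BC n\<^esub> f)"
        using a b fc[OF f] by (auto simp: bounded_cochains_simps(4) smult_assoc intro!: restrict_ext)
    }
    fix f' assume f': "f' \<in> carrier (BC n)"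
    show "seminorm (BC n) (f \<oplus>\<^bsub>BC n\<^esub> f') \<le> seminorm (BC n) f + seminorm (BC n) f'"
    proof (rule seminorm_cochain_le)
      fix gs assume gs: "gs \<in> tuples G n"
      have "seminorm A (f gs \<oplus>\<^bsub>A\<^esub> f' gs) \<le> seminorm A (f gs) + seminorm A (f' gs)"
        using fc f f' gs by (intro seminorm_triangle) auto
      also have "\<dots> \<le> seminorm (BC n) f + seminorm (BC n) f'"
        using f f' gs by (intro add_mono seminorm_cochain_ge)
      finally show "seminorm A ((f \<oplus>\<^bsub>BC n\<^esub> f') gs) \<le> seminorm (BC n) f + seminorm (BC n) f'"
        using gs by (simp add: bounded_cochains_simps(3))
    qed
    fix a assume a: "a \<in> carrier R"
    show "a \<odot>\<^bsub>BC n\<^esub> (f \<oplus>\<^bsub>BC n\<^esub> f') = a \<odot>\<^bsub>BC n\<^esub> f \<oplus>\<^bsub>BC n\<^esub> a \<odot>\<^bsub>BC n\<^esub> f'"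
      using a fc[OF f] fc[OF f'] by (auto simp: bounded_cochains_simps(3,4) smult_r_distr intro!: restrict_ext)
    show "seminorm (BC n) (a \<odot>\<^bsub>BC n\<^esub> f \<oplus>\<^bsub>BC n\<^esub> f') \<le> absval R a * seminorm (BC n) f + seminorm (BC n) f'"
    proof (rule seminorm_cochain_le)
      fix gs assume gs: "gs \<in> tuples G n"
      have "seminorm A (a \<odot>\<^bsub>A\<^esub> f gs \<oplus>\<^bsub>A\<^esub> f' gs) \<le> absval R a * seminorm A (f gs) + seminorm A (f' gs)"
        using fc f f' gs a by (intro seminorm_smult_add) auto
      also have "\<dots> \<le> absval R a * seminorm (BC n) f + seminorm (BC n) f'"
        using f f' gs a by (intro add_mono mult_left_mono seminorm_cochain_ge absval_nonneg)
      finally show "seminorm A ((a \<odot>\<^bsub>BC n\<^esub> f \<oplus>\<^bsub>BC n\<^esub> f') gs) \<le>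
          absval R a * seminorm (BC n) f + seminorm (BC n) f'"
        using gs by (simp add: bounded_cochains_simps(3,4))
    qed
  next
    show "seminorm (BC n) \<zero>\<^bsub>BC n\<^esub> = 0"
      unfolding bounded_cochains_simps(2,5) using tuples_nonempty by (simp add: seminorm_zero cong: SUP_cong_simp)
  qed
qed

lemma act_closed: "g \<in> carrier G \<Longrightarrow> x \<in> carrier A \<Longrightarrow> act g x \<in> carrier A"
  and act_add: "g \<in> carrier G \<Longrightarrow> x \<in> carrier A \<Longrightarrow> y \<in> carrier A \<Longrightarrow>
    act g (x \<oplus>\<^bsub>A\<^esub> y) = act g x \<oplus>\<^bsub>A\<^esub> act g y"
  and act_smult: "g \<in> carrier G \<Longrightarrow> a \<in> carrier R \<Longrightarrow> x \<in> carrier A \<Longrightarrow>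
    act g (a \<odot>\<^bsub>A\<^esub> x) = a \<odot>\<^bsub>A\<^esub> act g x"
  using linear_mapD[OF act_linear] by auto

lemma act_zero: "g \<in> carrier G \<Longrightarrow> act g \<zero>\<^bsub>A\<^esub> = \<zero>\<^bsub>A\<^esub>"
  using act_add[of g "\<zero>\<^bsub>A\<^esub>" "\<zero>\<^bsub>A\<^esub>"] act_closed[of g "\<zero>\<^bsub>A\<^esub>"]
  by (metis M.add.l_cancel_one M.l_zero M.zero_closed)

lemma act_a_inv: "g \<in> carrier G \<Longrightarrow> x \<in> carrier A \<Longrightarrow> act g (\<ominus>\<^bsub>A\<^esub> x) = \<ominus>\<^bsub>A\<^esub> act g x"
  using act_add[of g "\<ominus>\<^bsub>A\<^esub> x" x] act_closed[of g] act_zero[of g]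
  by (simp add: M.l_neg M.minus_equality)

lemma act_diff: "g \<in> carrier G \<Longrightarrow> x \<in> carrier A \<Longrightarrow> y \<in> carrier A \<Longrightarrow>
    act g (x \<ominus>\<^bsub>A\<^esub> y) = act g x \<ominus>\<^bsub>A\<^esub> act g y"
  by (simp add: a_minus_def act_add act_a_inv)

lemma act_dl: "g \<in> carrier G \<Longrightarrow> (\<And>ys. f ys \<in> carrier A) \<Longrightarrow>
    act g (dl A f xs) = dl A (\<lambda>ys. act g (f ys)) xs"
  using M.dl_hom[OF M.abelian_group_axioms, of "act g" f xs] act_add act_closed by blast

end

text \<open>The inverse of \<open>pp\<close>: a nonempty list is determined by its head and its
  successive quotients, and left translation changes only the head.\<close>

fun diffs :: "('g, 'h) monoid_scheme \<Rightarrow> 'g list \<Rightarrow> 'g list" where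
  "diffs G (u # v # us) = (inv\<^bsub>G\<^esub> u \<otimes>\<^bsub>G\<^esub> v) # diffs G (v # us)"
| "diffs G us = []"

lemma diffs_Cons: "us \<noteq> [] \<Longrightarrow> diffs G (u # us) = (inv\<^bsub>G\<^esub> u \<otimes>\<^bsub>G\<^esub> hd us) # diffs G us"
  by (cases us) auto

lemma length_diffs: "length (diffs G us) = length us - 1"
  by (induction us rule: induct_list012) auto

context group
begin

lemma diffs_closed: "set us \<subseteq> carrier G \<Longrightarrow> set (diffs G us) \<subseteq> carrier G"
  by (induction us rule: induct_list012) auto

lemma diffs_pp: "a \<in> carrier G \<Longrightarrow> set gs \<subseteq> carrier G \<Longrightarrow> diffs G (pp G a gs) = gs"
proof (induction gs arbitrary: a)
  case (Cons g gs)
  then show ?case by (simp add: diffs_Cons inv_solve_left m_assoc[symmetric])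
qed simp

lemma pp_diffs: "us \<noteq> [] \<Longrightarrow> set us \<subseteq> carrier G \<Longrightarrow> pp G (hd us) (diffs G us) = us"
proof (induction us rule: induct_list012)
  case (3 u v us)
  then show ?case by (simp add: m_assoc[symmetric])
qed auto

lemma diffs_map_mult:
  "b \<in> carrier G \<Longrightarrow> set us \<subseteq> carrier G \<Longrightarrow> diffs G (map (\<lambda>x. b \<otimes> x) us) = diffs G us"
proof (induction us rule: induct_list012)
  case (3 u v us)
  have "inv (b \<otimes> u) \<otimes> (b \<otimes> v) = inv u \<otimes> (inv b \<otimes> b \<otimes> v)"
    using 3 by (simp only: inv_mult_group m_assoc m_closed inv_closed list.set insert_subset)
  also have "inv b \<otimes> b \<otimes> v = v" using 3 by simp
  finally show ?case using 3 by simp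
qed auto

end

context seminormed_group_module
begin

lemma monoid_G: "monoid G"
  by (rule group.is_monoid[OF group_axioms])

lemmas pp_closed_G = monoid.pp_closed[OF monoid_G] and map_mult_pp_G = monoid.map_mult_pp[OF monoid_G]

lemma dl_equivariant:
  assumes "h \<in> carrier G" "\<And>ys. f ys \<in> carrier A"
    "\<And>ys. set ys \<subseteq> set us \<Longrightarrow> Suc (length ys) = length us \<Longrightarrow> f' (map k ys) = act h (f ys)"
  shows "dl A f' (map k us) = act h (dl A f us)"
proof -
  have "dl A f' (map k us) = dl A (\<lambda>ys. f' (map k ys)) us" by (simp add: M.dl_map)
  also have "\<dots> = dl A (\<lambda>ys. act h (f ys)) us" using assms(3) by (rule M.dl_cong)
  finally show ?thesis using act_dl[OF assms(1), of f us] assms(2) by simp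
qed

text \<open>\<open>T\<close> is the set on which equivariance of \<open>f\<close> is known. It will
  be a fibre of \<open>\<pi>\<close> in one application and the whole group in others.\<close>

lemma prism_equivariant:
  assumes "h \<in> carrier G" "\<And>ys. f ys \<in> carrier A"
    "\<And>ys. set ys \<subseteq> T \<Longrightarrow> length ys = Suc (length us) \<Longrightarrow> f' (map k ys) = act h (f ys)"
    "\<And>u. u \<in> set us \<Longrightarrow> s u \<in> T \<and> t u \<in> T \<and> s' (j u) = k (s u) \<and> t' (j u) = k (t u)"
  shows "prism A s' t' f' (map j us) = act h (prism A s t f us)"
  using assms(2-)
proof (induction us arbitrary: f f')
  case Nil
  then show ?case using assms(1) by (simp add: act_zero)
next
  case (Cons u us)
  note c = Cons.prems(1)
  have st: "s u \<in> T" "t u \<in> T" "s' (j u) = k (s u)" "t' (j u) = k (t u)" "t ` set us \<subseteq> T"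
    using Cons.prems(3) by auto
  have m: "map t' (map j us) = map k (map t us)" using Cons.prems(3) by auto
  have "prism A s' t' (\<lambda>ys. f' (k (s u) # ys)) (map j us) = act h (prism A s t (\<lambda>ys. f (s u # ys)) us)"
  proof (rule Cons.IH)
    show "f' (k (s u) # map k ys) = act h (f (s u # ys))" if "set ys \<subseteq> T" "length ys = Suc (length us)" for ys
      using Cons.prems(2)[of "s u # ys"] st that by simp
  qed (use Cons.prems in auto)
  moreover have "f' (k (s u) # k (t u) # map t' (map j us)) = act h (f (s u # t u # map t us))"
    unfolding m using Cons.prems(2)[of "s u # t u # map t us"] st by simp
  ultimately show ?case
    using c assms(1) st by (simp add: act_diff)
qed

end

text \<open>Three instances occur: \<open>sub\<close> for the kernel \<open>L\<close> inside
  \<open>G\<close>, \<open>whole\<close> for \<open>G\<close> inside itself, and \<open>coef\<close>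
  for \<open>Q\<close> inside itself with coefficients in the cohomology of \<open>L\<close>. The
  last two make the comparison of homogeneous and inhomogeneous cochains available for a single
  group.\<close>

locale subgroup_module = seminormed_group_module R G A act + S: group S
  for R :: "('r, 's) normed_ring_scheme" and G :: "('g, 'h) monoid_scheme"
    and A :: "('r, 'a, 'x) seminormed_module_scheme" and act :: "'g \<Rightarrow> 'a \<Rightarrow> 'a"
    and S :: "('l, 'lx) monoid_scheme" and \<phi> :: "'l \<Rightarrow> 'g" +
  assumes \<phi>: "\<phi> \<in> mon S G"
begin

lemma \<phi>_closed: "s \<in> carrier S \<Longrightarrow> \<phi> s \<in> carrier G"
  and \<phi>_mult: "s \<in> carrier S \<Longrightarrow> t \<in> carrier S \<Longrightarrow> \<phi> (s \<otimes>\<^bsub>S\<^esub> t) = \<phi> s \<otimes>\<^bsub>G\<^esub> \<phi> t"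
  and \<phi>_inj: "inj_on \<phi> (carrier S)"
  using \<phi> by (auto simp: mon_def hom_def)

lemma \<phi>_one: "\<phi> \<one>\<^bsub>S\<^esub> = \<one>\<^bsub>G\<^esub>"
  using \<phi> hom_one[OF _ S.group_axioms group_axioms] by (auto simp: mon_def)

sublocale res: seminormed_group_module R S A "act \<circ> \<phi>"
proof (intro seminormed_group_module.intro S.group_axioms seminormed_module_axioms
    seminormed_group_module_axioms.intro)
qed (auto simp: act_linear \<phi>_closed \<phi>_one \<phi>_mult act_one act_mult act_isometric)

definition \<psi> :: "'g \<Rightarrow> 'l" where "\<psi> = inv_into (carrier S) \<phi>"

lemma \<psi>_\<phi>: "s \<in> carrier S \<Longrightarrow> \<psi> (\<phi> s) = s"
  by (simp add: \<psi>_def \<phi>_inj)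

lemma \<psi>_closed: "u \<in> \<phi> ` carrier S \<Longrightarrow> \<psi> u \<in> carrier S"
  and \<phi>_\<psi>: "u \<in> \<phi> ` carrier S \<Longrightarrow> \<phi> (\<psi> u) = u"
  unfolding \<psi>_def by (auto intro: inv_into_into f_inv_into_f)

lemma map_\<phi>_tuples: "ls \<in> tuples S n \<Longrightarrow> map \<phi> ls \<in> tuples G n"
  using \<phi>_closed by (auto simp: tuples_def)

lemma map_\<psi>_\<phi>: "ls \<in> tuples S n \<Longrightarrow> map \<psi> (map \<phi> ls) = ls"
  using \<psi>_\<phi> by (auto simp: tuples_def intro!: map_idI)

lemma pp_\<phi>_closed: "a \<in> carrier G \<Longrightarrow> ls \<in> tuples S n \<Longrightarrow> set (pp G a (map \<phi> ls)) \<subseteq> carrier G"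
  using pp_closed_G[of a "map \<phi> ls"] map_\<phi>_tuples by (auto simp: tuples_def)

lemma pp_\<phi>: "a \<in> carrier S \<Longrightarrow> set ls \<subseteq> carrier S \<Longrightarrow> pp G (\<phi> a) (map \<phi> ls) = map \<phi> (pp S a ls)"
  by (induction ls arbitrary: a) (auto simp flip: \<phi>_mult)

lemma pp_\<phi>_mult:
  assumes "a \<in> carrier G" "ls \<in> tuples S n"
  shows "pp G a (map \<phi> ls) = map (\<lambda>x. a \<otimes>\<^bsub>G\<^esub> x) (pp G \<one>\<^bsub>G\<^esub> (map \<phi> ls))"
proof -
  have "map (\<lambda>x. a \<otimes>\<^bsub>G\<^esub> x) (pp G \<one>\<^bsub>G\<^esub> (map \<phi> ls)) = pp G (a \<otimes>\<^bsub>G\<^esub> \<one>\<^bsub>G\<^esub>) (map \<phi> ls)"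
    using assms map_\<phi>_tuples[OF assms(2)] by (intro map_mult_pp_G) (auto simp: tuples_def)
  then show ?thesis using assms(1) by simp
qed

lemma map_merge: "1 \<le> i \<Longrightarrow> i < length ls \<Longrightarrow> set ls \<subseteq> carrier S \<Longrightarrow>
    merge G i (map \<phi> ls) = map \<phi> (merge S i ls)"
  by (subst merge_def, subst merge_def) (auto simp: take_map drop_map \<phi>_mult subset_iff)

text \<open>The list lies in a single left coset of the image of \<open>S\<close>. It is stated
  through the coordinates \<open>a\<close> and \<open>ls\<close> because every evaluation of
  \<open>hg\<close> needs them.\<close>

definition lies_in_coset :: "nat \<Rightarrow> 'g list \<Rightarrow> bool"
  where "lies_in_coset n us \<longleftrightarrow> (\<exists>a\<in>carrier G. \<exists>ls\<in>tuples S n. us = pp G a (map \<phi> ls))"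

lemma lies_in_coset_pp: "a \<in> carrier G \<Longrightarrow> ls \<in> tuples S n \<Longrightarrow> lies_in_coset n (pp G a (map \<phi> ls))"
  by (auto simp: lies_in_coset_def)

lemma lies_in_coset_iff:
  "lies_in_coset n us \<longleftrightarrow> set us \<subseteq> carrier G \<and> length us = Suc n \<and> set (diffs G us) \<subseteq> \<phi> ` carrier S"
proof
  assume "lies_in_coset n us"
  then obtain a ls where als: "a \<in> carrier G" "ls \<in> tuples S n" "us = pp G a (map \<phi> ls)"
    by (auto simp: lies_in_coset_def)
  then show "set us \<subseteq> carrier G \<and> length us = Suc n \<and> set (diffs G us) \<subseteq> \<phi> ` carrier S"
    using pp_\<phi>_closed[OF als(1,2)] map_\<phi>_tuples[OF als(2)] by (auto simp: tuples_def diffs_pp)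
next
  assume us: "set us \<subseteq> carrier G \<and> length us = Suc n \<and> set (diffs G us) \<subseteq> \<phi> ` carrier S"
  then have ne: "us \<noteq> []" by auto
  have "map \<phi> (map \<psi> (diffs G us)) = diffs G us" using us \<phi>_\<psi> by (auto intro!: map_idI)
  then have "us = pp G (hd us) (map \<phi> (map \<psi> (diffs G us)))" using pp_diffs[OF ne] us by simp
  moreover have "map \<psi> (diffs G us) \<in> tuples S n"
    using us \<psi>_closed by (auto simp: tuples_def length_diffs)
  moreover have "hd us \<in> carrier G" using us ne by (auto simp: subset_iff)
  ultimately show "lies_in_coset n us" unfolding lies_in_coset_def by blast
qed

text \<open>The homogeneous function of an inhomogeneous cochain on \<open>S\<close>, defined on all left cosets of \<open>S\<close> in
  \<open>G\<close> (and \<open>0\<close> outside), and the inhomogeneous cochain on \<open>S\<close> of a homogeneous function on \<open>G\<close>.\<close>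

definition hg :: "nat \<Rightarrow> ('l list \<Rightarrow> 'a) \<Rightarrow> 'g list \<Rightarrow> 'a"
  where "hg n f us = (if lies_in_coset n us then act (hd us) (f (map \<psi> (diffs G us))) else \<zero>\<^bsub>A\<^esub>)"

definition ih :: "nat \<Rightarrow> ('g list \<Rightarrow> 'a) \<Rightarrow> 'l list \<Rightarrow> 'a"
  where "ih n c = (\<lambda>ls\<in>tuples S n. c (pp G \<one>\<^bsub>G\<^esub> (map \<phi> ls)))"

abbreviation "cob n \<equiv> coboundary S A (act \<circ> \<phi>) n"

lemma hg_pp: "a \<in> carrier G \<Longrightarrow> ls \<in> tuples S n \<Longrightarrow> hg n f (pp G a (map \<phi> ls)) = act a (f ls)"
  using lies_in_coset_pp[of a ls n] map_\<phi>_tuples[of ls n] map_\<psi>_\<phi>[of ls n]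
  by (simp add: hg_def diffs_pp tuples_def)

lemma hg_cases:
  obtains (pp) a ls where "a \<in> carrier G" "ls \<in> tuples S n" "us = pp G a (map \<phi> ls)"
  | (zero) "\<not> lies_in_coset n us" "\<And>f. hg n f us = \<zero>\<^bsub>A\<^esub>"
  by (cases "lies_in_coset n us") (auto simp: lies_in_coset_def hg_def)

lemma hg_closed: "f \<in> carrier (res.BC n) \<Longrightarrow> hg n f us \<in> carrier A"
  by (rule hg_cases[of n us]) (auto simp: hg_pp act_closed bounded_cochain_closed)

lemma hg_add: "f \<in> carrier (res.BC n) \<Longrightarrow> f' \<in> carrier (res.BC n) \<Longrightarrow>
    hg n (f \<oplus>\<^bsub>res.BC n\<^esub> f') us = hg n f us \<oplus>\<^bsub>A\<^esub> hg n f' us"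
  by (rule hg_cases[of n us])
    (auto simp: hg_pp act_add bounded_cochain_closed bounded_cochains_simps(3))

lemma hg_smult: "a \<in> carrier R \<Longrightarrow> f \<in> carrier (res.BC n) \<Longrightarrow>
    hg n (a \<odot>\<^bsub>res.BC n\<^esub> f) us = a \<odot>\<^bsub>A\<^esub> hg n f us"
  by (rule hg_cases[of n us])
    (auto simp: hg_pp act_smult smult_zero bounded_cochain_closed bounded_cochains_simps(4))

lemma hg_zero: "hg n \<zero>\<^bsub>res.BC n\<^esub> us = \<zero>\<^bsub>A\<^esub>"
  by (rule hg_cases[of n us]) (auto simp: hg_pp act_zero bounded_cochains_simps(2))

lemma lies_in_coset_mult:
  assumes "b \<in> carrier G" "set us \<subseteq> carrier G"
  shows "lies_in_coset n (map (\<lambda>x. b \<otimes>\<^bsub>G\<^esub> x) us) \<longleftrightarrow> lies_in_coset n us"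
  using assms by (auto simp: lies_in_coset_iff diffs_map_mult)

lemma hg_mult:
  assumes "f \<in> carrier (res.BC n)" "b \<in> carrier G" "set us \<subseteq> carrier G"
  shows "hg n f (map (\<lambda>x. b \<otimes>\<^bsub>G\<^esub> x) us) = act b (hg n f us)"
proof (rule hg_cases[of n us])
  fix a ls assume *: "a \<in> carrier G" "ls \<in> tuples S n" "us = pp G a (map \<phi> ls)"
  then have "map (\<lambda>x. b \<otimes>\<^bsub>G\<^esub> x) us = pp G (b \<otimes>\<^bsub>G\<^esub> a) (map \<phi> ls)"
    using assms map_\<phi>_tuples[OF *(2)] by (simp add: map_mult_pp_G tuples_def)
  then show ?thesis using * assms by (simp add: hg_pp act_mult bounded_cochain_closed)
qed (use assms in \<open>simp add: hg_def lies_in_coset_mult act_zero\<close>)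

lemma seminorm_hg:
  assumes "f \<in> carrier (res.BC n)" shows "seminorm A (hg n f us) \<le> seminorm (res.BC n) f"
proof -
  interpret C: seminormed_module R "res.BC n" by (rule res.seminormed_module_cochains)
  show ?thesis
    using C.seminorm_nonneg[OF assms] res.seminorm_cochain_ge[OF assms]
    by (cases rule: hg_cases[of n us])
      (auto simp: hg_pp act_isometric bounded_cochain_closed[OF assms] seminorm_zero)
qed

lemma ih_hg: "f \<in> carrier (res.BC n) \<Longrightarrow> ih n (hg n f) = f"
  by (rule bounded_cochain_ext[of _ S A n])
    (auto simp: ih_def hg_pp act_closed act_one act_isometric bounded_cochain_closed intro!: bounded_cochainI res.seminorm_cochain_ge)

lemma ih_closed:
  assumes "\<And>us. c us \<in> carrier A" "\<And>us. length us = Suc n \<Longrightarrow> seminorm A (c us) \<le> b"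
  shows "ih n c \<in> carrier (res.BC n)"
  unfolding ih_def using assms by (intro bounded_cochainI[where b = b]) (auto simp: tuples_def)

lemma ih_cong:
  "(\<And>ls. ls \<in> tuples S n \<Longrightarrow> c (pp G \<one>\<^bsub>G\<^esub> (map \<phi> ls)) = c' (pp G \<one>\<^bsub>G\<^esub> (map \<phi> ls))) \<Longrightarrow> ih n c = ih n c'"
  unfolding ih_def by (rule restrict_ext)

text \<open>In \<open>dl_pp\<close> only the first summand has a base point other than the unit, and
  equivariance turns it into the action term of the coboundary. Hence equivariance is demanded only
  for translations by \<open>S\<close> of lists that start at the unit.\<close>

lemma coboundary_ih:
  assumes c: "\<And>us. c us \<in> carrier A"
    and equiv: "\<And>s ls. s \<in> carrier S \<Longrightarrow> ls \<in> tuples S n \<Longrightarrow>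
      c (pp G (\<phi> s) (map \<phi> ls)) = act (\<phi> s) (c (pp G \<one>\<^bsub>G\<^esub> (map \<phi> ls)))"
  shows "cob n (ih n c) = ih (Suc n) (dl A c)"
  unfolding coboundary_def ih_def[of "Suc n"]
proof (rule restrict_ext)
  fix ls assume ls: "ls \<in> tuples S (Suc n)"
  then obtain l ls' where l: "ls = l # ls'" "l \<in> carrier S" "ls' \<in> tuples S n"
    by (cases ls) (auto simp: tuples_def)
  have set_ls: "set ls \<subseteq> carrier S" "length ls = Suc n" using ls by (auto simp: tuples_def)
  have merge: "merge S i ls \<in> tuples S n" "merge G i (map \<phi> ls) = map \<phi> (merge S i ls)" if "i \<in> {1..n}" for i
    using that set_ls length_merge[of i ls S] S.merge_closed[OF set_ls(1), of i] map_merge[of i ls]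
    by (auto simp: tuples_def)
  have butlast: "butlast ls \<in> tuples S n" using set_ls by (auto simp: tuples_def dest: in_set_butlastD)
  have "dl A c (pp G \<one>\<^bsub>G\<^esub> (map \<phi> ls)) = c (pp G (\<one>\<^bsub>G\<^esub> \<otimes>\<^bsub>G\<^esub> hd (map \<phi> ls)) (tl (map \<phi> ls))) \<oplus>\<^bsub>A\<^esub>
    (\<Oplus>\<^bsub>A\<^esub>i\<in>{1..n}. alt_sign A i (c (pp G \<one>\<^bsub>G\<^esub> (merge G i (map \<phi> ls))))) \<oplus>\<^bsub>A\<^esub>
    alt_sign A (Suc n) (c (pp G \<one>\<^bsub>G\<^esub> (butlast (map \<phi> ls))))"
    using map_\<phi>_tuples[OF ls] c by (intro M.dl_pp) (auto simp: tuples_def monoid_G)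
  also have "c (pp G (\<one>\<^bsub>G\<^esub> \<otimes>\<^bsub>G\<^esub> hd (map \<phi> ls)) (tl (map \<phi> ls))) = (act \<circ> \<phi>) (hd ls) (ih n c (tl ls))"
    using l equiv by (simp add: ih_def \<phi>_closed)
  also have "(\<Oplus>\<^bsub>A\<^esub>i\<in>{1..n}. alt_sign A i (c (pp G \<one>\<^bsub>G\<^esub> (merge G i (map \<phi> ls))))) =
      (\<Oplus>\<^bsub>A\<^esub>i\<in>{1..n}. alt_sign A i (ih n c (merge S i ls)))"
    using merge c by (intro M.finsum_cong) (auto simp: ih_def simp_implies_def)
  also have "c (pp G \<one>\<^bsub>G\<^esub> (butlast (map \<phi> ls))) = ih n c (butlast ls)"
    using butlast by (simp add: ih_def map_butlast)
  finally show "(act \<circ> \<phi>) (hd ls) (ih n c (tl ls)) \<oplus>\<^bsub>A\<^esub>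
      (\<Oplus>\<^bsub>A\<^esub>i\<in>{1..n}. alt_sign A i (ih n c (merge S i ls))) \<oplus>\<^bsub>A\<^esub>
      alt_sign A (Suc n) (ih n c (butlast ls)) = dl A c (pp G \<one>\<^bsub>G\<^esub> (map \<phi> ls))" by simp
qed

lemma cob_eq:
  assumes "f \<in> carrier (res.BC n)" shows "cob n f = ih (Suc n) (dl A (hg n f))"
proof -
  have "cob n (ih n (hg n f)) = ih (Suc n) (dl A (hg n f))"
    using assms by (intro coboundary_ih) (auto simp: hg_closed hg_pp \<phi>_closed act_one bounded_cochain_closed)
  then show ?thesis by (simp add: ih_hg assms)
qed

text \<open>Both sides are equivariant under left translation, so the base point may be moved to the
  unit, where \<open>cob_eq\<close> applies. The list has to lie in one coset: otherwise the right
  side is zero by definition, while deleting a stray entry on the left may leave a list inside a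
  coset.\<close>

lemma dl_hg:
  assumes f: "f \<in> carrier (res.BC n)" and us: "lies_in_coset (Suc n) us"
  shows "dl A (hg n f) us = hg (Suc n) (cob n f) us"
proof -
  obtain a ls where als: "a \<in> carrier G" "ls \<in> tuples S (Suc n)" "us = pp G a (map \<phi> ls)"
    using us by (auto simp: lies_in_coset_def)
  let ?u = "pp G \<one>\<^bsub>G\<^esub> (map \<phi> ls)"
  have "dl A (hg n f) us = act a (dl A (hg n f) ?u)"
    unfolding als(3) pp_\<phi>_mult[OF als(1,2)] using pp_\<phi>_closed[OF _ als(2), of "\<one>\<^bsub>G\<^esub>"] f als(1)
    by (intro dl_equivariant) (auto simp: hg_closed intro!: hg_mult)
  also have "dl A (hg n f) ?u = cob n f ls" using cob_eq[OF f] als(2) by (simp add: ih_def)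
  finally show ?thesis using als by (simp add: hg_pp)
qed

text \<open>The constant \<open>n + 2\<close> is the number of entries of a homogeneous list in
  degree \<open>n + 1\<close>.\<close>

lemma cob_closed:
  assumes "f \<in> carrier (res.BC n)"
  shows "cob n f \<in> carrier (res.BC (Suc n))"
    and "seminorm (res.BC (Suc n)) (cob n f) \<le> real (n + 2) * seminorm (res.BC n) f"
proof -
  have c: "seminorm A (dl A (hg n f) us) \<le> real (length us) * seminorm (res.BC n) f" for us
    by (intro seminorm_dl hg_closed seminorm_hg assms)
  have le: "seminorm A (dl A (hg n f) (pp G \<one>\<^bsub>G\<^esub> (map \<phi> ls))) \<le> real (n + 2) * seminorm (res.BC n) f"
    if "ls \<in> tuples S (Suc n)" for ls
    using c[of "pp G \<one>\<^bsub>G\<^esub> (map \<phi> ls)"] that by (simp add: tuples_def)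
  show "cob n f \<in> carrier (res.BC (Suc n))"
    unfolding cob_eq[OF assms] ih_def using le assms by (intro bounded_cochainI) (auto simp: hg_closed)
  show "seminorm (res.BC (Suc n)) (cob n f) \<le> real (n + 2) * seminorm (res.BC n) f"
    unfolding cob_eq[OF assms] using le by (intro res.seminorm_cochain_le) (simp add: ih_def)
qed

lemma cob_add:
  assumes "f \<in> carrier (res.BC n)" "f' \<in> carrier (res.BC n)"
  shows "cob n (f \<oplus>\<^bsub>res.BC n\<^esub> f') = cob n f \<oplus>\<^bsub>res.BC (Suc n)\<^esub> cob n f'"
proof -
  interpret C: seminormed_module R "res.BC n" by (rule res.seminormed_module_cochains)
  have "hg n (f \<oplus>\<^bsub>res.BC n\<^esub> f') = (\<lambda>us. hg n f us \<oplus>\<^bsub>A\<^esub> hg n f' us)"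
    using assms by (intro ext hg_add)
  then show ?thesis
    using assms unfolding cob_eq[OF assms(1)] cob_eq[OF assms(2)] cob_eq[OF C.M.a_closed[OF assms]]
    by (auto simp: ih_def bounded_cochains_simps(3)[of S A "Suc n"] M.dl_add hg_closed intro!: restrict_ext)
qed

lemma cob_smult:
  assumes "a \<in> carrier R" "f \<in> carrier (res.BC n)"
  shows "cob n (a \<odot>\<^bsub>res.BC n\<^esub> f) = a \<odot>\<^bsub>res.BC (Suc n)\<^esub> cob n f"
proof -
  interpret C: seminormed_module R "res.BC n" by (rule res.seminormed_module_cochains)
  have "dl A (\<lambda>ys. a \<odot>\<^bsub>A\<^esub> hg n f ys) us = a \<odot>\<^bsub>A\<^esub> dl A (hg n f) us" for us
    using M.dl_hom[OF M.abelian_group_axioms, of "\<lambda>x. a \<odot>\<^bsub>A\<^esub> x" "hg n f" us] assms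
    by (simp add: smult_r_distr smult_closed hg_closed)
  moreover have "hg n (a \<odot>\<^bsub>res.BC n\<^esub> f) = (\<lambda>us. a \<odot>\<^bsub>A\<^esub> hg n f us)"
    using assms by (intro ext hg_smult)
  ultimately show ?thesis
    using assms unfolding cob_eq[OF assms(2)] cob_eq[OF C.smult_closed[OF assms]]
    by (auto simp: ih_def bounded_cochains_simps(4)[of S A "Suc n"] intro!: restrict_ext)
qed

lemma cob_zero: "cob n \<zero>\<^bsub>res.BC n\<^esub> = \<zero>\<^bsub>res.BC (Suc n)\<^esub>"
proof -
  interpret C: seminormed_module R "res.BC n" by (rule res.seminormed_module_cochains)
  show ?thesis
    unfolding cob_eq[OF C.M.zero_closed] ih_def bounded_cochains_simps(2)[of S A "Suc n"]
    by (intro restrict_ext M.dl_zero hg_zero)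
qed

lemma cob_diff:
  assumes "f \<in> carrier (res.BC n)" "f' \<in> carrier (res.BC n)"
  shows "cob n (f \<ominus>\<^bsub>res.BC n\<^esub> f') = cob n f \<ominus>\<^bsub>res.BC (Suc n)\<^esub> cob n f'"
proof -
  interpret C: seminormed_module R "res.BC n" by (rule res.seminormed_module_cochains)
  interpret C': seminormed_module R "res.BC (Suc n)" by (rule res.seminormed_module_cochains)
  have "cob n f = cob n ((f \<ominus>\<^bsub>res.BC n\<^esub> f') \<oplus>\<^bsub>res.BC n\<^esub> f')"
    using assms by (simp add: C.M.diff_add_cancel_right)
  also have "\<dots> = cob n (f \<ominus>\<^bsub>res.BC n\<^esub> f') \<oplus>\<^bsub>res.BC (Suc n)\<^esub> cob n f'"
    using assms by (intro cob_add) auto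
  finally show ?thesis using assms cob_closed(1) by (simp add: C'.M.add_diff_cancel_right)
qed

abbreviation "Zc n \<equiv> cocycles S A (act \<circ> \<phi>) n"
abbreviation "Bc n \<equiv> coboundaries S A (act \<circ> \<phi>) n"
abbreviation "Hc n \<equiv> bounded_cohomology S A (act \<circ> \<phi>) n"

lemma cocycle_iff: "f \<in> Zc n \<longleftrightarrow> f \<in> carrier (res.BC n) \<and> cob n f = \<zero>\<^bsub>res.BC (Suc n)\<^esub>"
  by (simp add: cocycles_def)

lemma submodule_cocycles: "submodule (Zc n) R (res.BC n)"
proof -
  interpret C: seminormed_module R "res.BC n" by (rule res.seminormed_module_cochains)
  interpret C': seminormed_module R "res.BC (Suc n)" by (rule res.seminormed_module_cochains)
  show ?thesis
  proof (rule C.submoduleI)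
    fix f assume f: "f \<in> Zc n"
    have "cob n (\<zero>\<^bsub>res.BC n\<^esub> \<ominus>\<^bsub>res.BC n\<^esub> f) = \<zero>\<^bsub>res.BC (Suc n)\<^esub>"
      using f cob_diff[OF C.M.zero_closed, of f]
      by (simp add: cocycle_iff cob_zero a_minus_def C'.M.a_inv_zero)
    then show "\<ominus>\<^bsub>res.BC n\<^esub> f \<in> Zc n" using f by (simp add: cocycle_iff a_minus_def)
  qed (auto simp: cocycle_iff cob_zero cob_add cob_smult C.smult_closed C'.smult_zero)
qed

lemma submodule_coboundaries: "submodule (Bc n) R (res.BC n)"
proof (cases n)
  case 0
  interpret C: seminormed_module R "res.BC n" by (rule res.seminormed_module_cochains)
  show ?thesis using C.submodule_zero 0 by simp
next
  case (Suc m)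
  interpret C: seminormed_module R "res.BC n" by (rule res.seminormed_module_cochains)
  interpret C': seminormed_module R "res.BC m" by (rule res.seminormed_module_cochains)
  show ?thesis
  proof (rule C.submoduleI)
    show "Bc n \<subseteq> carrier (res.BC n)" using Suc cob_closed(1) by auto
    show "\<zero>\<^bsub>res.BC n\<^esub> \<in> Bc n" using cob_zero[of m] Suc by (metis C'.M.zero_closed coboundaries.simps(2) imageI)
    fix f assume "f \<in> Bc n"
    then obtain u where u: "u \<in> carrier (res.BC m)" "f = cob m u" using Suc by auto
    have "cob m (\<zero>\<^bsub>res.BC m\<^esub> \<ominus>\<^bsub>res.BC m\<^esub> u) = \<ominus>\<^bsub>res.BC n\<^esub> f"
    proof -
      have "f \<in> carrier (res.BC n)" using u Suc cob_closed(1) by simp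
      then have "\<zero>\<^bsub>res.BC n\<^esub> \<ominus>\<^bsub>res.BC n\<^esub> f = \<ominus>\<^bsub>res.BC n\<^esub> f" by (simp add: a_minus_def)
      then show ?thesis using u Suc by (simp add: cob_diff cob_zero)
    qed
    then show "\<ominus>\<^bsub>res.BC n\<^esub> f \<in> Bc n" using Suc u by (auto intro!: image_eqI[where x = "\<zero>\<^bsub>res.BC m\<^esub> \<ominus>\<^bsub>res.BC m\<^esub> u"])
    {
      fix f' assume "f' \<in> Bc n"
      then obtain u' where "u' \<in> carrier (res.BC m)" "f' = cob m u'" using Suc by auto
      then show "f \<oplus>\<^bsub>res.BC n\<^esub> f' \<in> Bc n" using u Suc by (auto simp flip: cob_add)
    next
      fix a assume "a \<in> carrier R"
      then show "a \<odot>\<^bsub>res.BC n\<^esub> f \<in> Bc n" using u Suc C'.smult_closed by (auto simp flip: cob_smult)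
    }
  qed
qed

sublocale H: seminormed_subquotient_module R "res.BC n" "Zc n" "Bc n" "Hc n" for n
proof -
  interpret C: seminormed_module R "res.BC n" by (rule res.seminormed_module_cochains)
  show "seminormed_subquotient_module R (res.BC n) (Zc n) (Bc n) (Hc n)"
    unfolding bounded_cohomology_def
    by (intro C.seminormed_subquotient_moduleI submodule_cocycles submodule_coboundaries)
qed

text \<open>The primitive is the prism of \<open>c\<close> between \<open>\<xi>\<close> and
  \<open>\<eta>\<close>; left equivariance of both maps lets it descend to an inhomogeneous cochain.
  Cocycle condition and equivariance are required only on lists in \<open>T\<close>. Two uses:
  independence of the chosen lift, and equivariance of the restricted class.\<close>

lemma homotopic:
  assumes c: "\<And>us. c us \<in> carrier A"
    and b: "\<And>us. length us = Suc n \<Longrightarrow> seminorm A (c us) \<le> b"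
    and T: "\<And>s. s \<in> carrier S \<Longrightarrow> \<xi> (\<phi> s) \<in> T \<and> \<eta> (\<phi> s) \<in> T"
    and \<xi>: "\<And>s u. s \<in> carrier S \<Longrightarrow> u \<in> carrier S \<Longrightarrow> \<xi> (\<phi> s \<otimes>\<^bsub>G\<^esub> \<phi> u) = \<phi> s \<otimes>\<^bsub>G\<^esub> \<xi> (\<phi> u)"
    and \<eta>: "\<And>s u. s \<in> carrier S \<Longrightarrow> u \<in> carrier S \<Longrightarrow> \<eta> (\<phi> s \<otimes>\<^bsub>G\<^esub> \<phi> u) = \<phi> s \<otimes>\<^bsub>G\<^esub> \<eta> (\<phi> u)"
    and equiv: "\<And>s us. s \<in> carrier S \<Longrightarrow> set us \<subseteq> T \<Longrightarrow> length us = Suc n \<Longrightarrow>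
      c (map (\<lambda>x. \<phi> s \<otimes>\<^bsub>G\<^esub> x) us) = act (\<phi> s) (c us)"
    and cocycle: "\<And>us. set us \<subseteq> T \<Longrightarrow> length us = Suc (Suc n) \<Longrightarrow> dl A c us = \<zero>\<^bsub>A\<^esub>"
  shows "ih n (\<lambda>us. c (map \<eta> us)) \<ominus>\<^bsub>res.BC n\<^esub> ih n (\<lambda>us. c (map \<xi> us)) \<in> Bc n"
proof -
  let ?P = "prism A \<xi> \<eta>"
  have in_S: "\<exists>s\<in>carrier S. u = \<phi> s" if "ls \<in> tuples S m" "u \<in> set (pp G \<one>\<^bsub>G\<^esub> (map \<phi> ls))" for ls u m
    using that pp_\<phi>[of "\<one>\<^bsub>S\<^esub>" ls] S.pp_closed[of "\<one>\<^bsub>S\<^esub>" ls] by (auto simp: \<phi>_one tuples_def)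
  have "c (map \<eta> us) \<ominus>\<^bsub>A\<^esub> c (map \<xi> us) = dl A (?P c) us" if ls: "ls \<in> tuples S n" "us = pp G \<one>\<^bsub>G\<^esub> (map \<phi> ls)" for ls us
  proof -
    have "set us \<subseteq> \<phi> ` carrier S" "length us = Suc n" using in_S ls by (auto simp: tuples_def)
    moreover from this(1) have "\<xi> ` set us \<union> \<eta> ` set us \<subseteq> T" using T by blast
    ultimately have "?P (dl A c) us = \<zero>\<^bsub>A\<^esub>" by (intro M.prism_zero cocycle) (erule (1) order_trans | simp)+
    then show ?thesis using M.prism_homotopy[of c \<xi> \<eta> us] c by simp
  qed
  moreover have "ih n (\<lambda>us. c (map \<eta> us)) \<ominus>\<^bsub>res.BC n\<^esub> ih n (\<lambda>us. c (map \<xi> us)) =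
      ih n (\<lambda>us. c (map \<eta> us) \<ominus>\<^bsub>A\<^esub> c (map \<xi> us))"
  proof (subst res.cochain_diff)
    show "ih n (\<lambda>us. c (map \<eta> us)) \<in> carrier (res.BC n)" "ih n (\<lambda>us. c (map \<xi> us)) \<in> carrier (res.BC n)"
      using c b by (auto intro!: ih_closed[where b = b])
  qed (auto simp: ih_def intro!: restrict_ext)
  ultimately have eq: "ih n (\<lambda>us. c (map \<eta> us)) \<ominus>\<^bsub>res.BC n\<^esub> ih n (\<lambda>us. c (map \<xi> us)) = ih n (dl A (?P c))"
    by (auto intro: ih_cong)
  show ?thesis
  proof (cases n)
    case 0
    \<comment> \<open>In degree 0 only zero is a coboundary. The list has one entry here, and
      deleting it leaves the prism over the empty list, which is zero.\<close>
    have "ih 0 (dl A (?P c)) = \<zero>\<^bsub>res.BC 0\<^esub>"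
      unfolding ih_def bounded_cochains_simps(2)
      by (intro restrict_ext) (auto simp: tuples_def a_minus_def M.a_inv_zero)
    then show ?thesis using 0 eq by simp
  next
    case (Suc m)
    have "ih m (?P c) \<in> carrier (res.BC m)"
      using c Suc b by (intro ih_closed[where b = "real n * b"] M.prism_closed)
        (auto intro!: order_trans[OF seminorm_prism[where b = b]])
    moreover have "cob m (ih m (?P c)) = ih (Suc m) (dl A (?P c))"
    proof (rule coboundary_ih)
      fix s ls assume s: "s \<in> carrier S" and ls: "ls \<in> tuples S m"
      show "?P c (pp G (\<phi> s) (map \<phi> ls)) = act (\<phi> s) (?P c (pp G \<one>\<^bsub>G\<^esub> (map \<phi> ls)))"
        unfolding pp_\<phi>_mult[OF \<phi>_closed[OF s] ls]
      proof (rule prism_equivariant[where T = T])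
        show "c (map (\<lambda>x. \<phi> s \<otimes>\<^bsub>G\<^esub> x) ys) = act (\<phi> s) (c ys)"
          if "set ys \<subseteq> T" "length ys = Suc (length (pp G \<one>\<^bsub>G\<^esub> (map \<phi> ls)))" for ys
          using that ls Suc s by (intro equiv) (auto simp: tuples_def)
        show "\<xi> u \<in> T \<and> \<eta> u \<in> T \<and> \<xi> (\<phi> s \<otimes>\<^bsub>G\<^esub> u) = \<phi> s \<otimes>\<^bsub>G\<^esub> \<xi> u \<and> \<eta> (\<phi> s \<otimes>\<^bsub>G\<^esub> u) = \<phi> s \<otimes>\<^bsub>G\<^esub> \<eta> u"
          if "u \<in> set (pp G \<one>\<^bsub>G\<^esub> (map \<phi> ls))" for u
          using in_S[OF ls that] T \<xi>[OF s] \<eta>[OF s] by auto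
      qed (use s c \<phi>_closed in auto)
    qed (use c in simp)
    ultimately show ?thesis unfolding eq using Suc by (metis coboundaries.simps(2) imageI)
  qed
qed

end

section \<open>The action of the quotient group on bounded cohomology\<close>

locale extension_module = group_extension L \<iota> G \<pi> Q + seminormed_group_module R G A act
  for R :: "('r, 's) normed_ring_scheme"
    and L :: "('l, 'lx) monoid_scheme" and \<iota> :: "'l \<Rightarrow> 'g"
    and G :: "('g, 'gx) monoid_scheme" and \<pi> :: "'g \<Rightarrow> 'q"
    and Q :: "('q, 'qx) monoid_scheme"
    and A :: "('r, 'a, 'x) seminormed_module_scheme" and act :: "'g \<Rightarrow> 'a \<Rightarrow> 'a"
begin

sublocale sub: subgroup_module R G A act L \<iota>
  by (intro subgroup_module.intro seminormed_group_module_axioms L.group_axioms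
      subgroup_module_axioms.intro mon)

lemma \<pi>_closed: "g \<in> carrier G \<Longrightarrow> \<pi> g \<in> carrier Q"
  and \<pi>_mult: "g \<in> carrier G \<Longrightarrow> h \<in> carrier G \<Longrightarrow> \<pi> (g \<otimes>\<^bsub>G\<^esub> h) = \<pi> g \<otimes>\<^bsub>Q\<^esub> \<pi> h"
  and \<pi>_surj: "\<pi> ` carrier G = carrier Q"
  using epi by (auto simp: epi_def hom_def)

lemma \<pi>_one: "\<pi> \<one>\<^bsub>G\<^esub> = \<one>\<^bsub>Q\<^esub>"
  using epi hom_one[OF _ G.group_axioms Q.group_axioms] by (auto simp: epi_def)

lemma \<pi>_inv: "g \<in> carrier G \<Longrightarrow> \<pi> (inv\<^bsub>G\<^esub> g) = inv\<^bsub>Q\<^esub> \<pi> g"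
  using \<pi>_mult[of "inv\<^bsub>G\<^esub> g" g] \<pi>_one \<pi>_closed Q.inv_equality[of "\<pi> (inv\<^bsub>G\<^esub> g)" "\<pi> g"] by simp

lemma \<iota>_image_iff: "g \<in> carrier G \<Longrightarrow> g \<in> \<iota> ` carrier L \<longleftrightarrow> \<pi> g = \<one>\<^bsub>Q\<^esub>"
  using exact by (auto simp: kernel_def set_eq_iff)

lemma \<pi>_\<iota>: "l \<in> carrier L \<Longrightarrow> \<pi> (\<iota> l) = \<one>\<^bsub>Q\<^esub>"
  using \<iota>_image_iff sub.\<phi>_closed by blast

lemma lift_exists: "x \<in> carrier Q \<Longrightarrow> \<exists>g\<in>carrier G. \<pi> g = x"
  using \<pi>_surj by (metis imageE)

text \<open>The fibres of \<open>\<pi>\<close> are left cosets of the image of \<open>L\<close>: the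
  quotient of two neighbouring entries maps to the unit of \<open>Q\<close>.\<close>

lemma lies_in_cosetI:
  assumes "set us \<subseteq> carrier G" "length us = Suc n" "\<And>u. u \<in> set us \<Longrightarrow> \<pi> u = x"
  shows "sub.lies_in_coset n us"
proof -
  have "set (diffs G us) \<subseteq> \<iota> ` carrier L"
    using assms(1,3)
  proof (induction us rule: induct_list012)
    case (3 u v us)
    then have "inv\<^bsub>G\<^esub> u \<otimes>\<^bsub>G\<^esub> v \<in> \<iota> ` carrier L"
      using \<pi>_closed[of v] by (subst \<iota>_image_iff) (auto simp: \<pi>_mult \<pi>_inv)
    then show ?case using 3 by auto
  qed auto
  then show ?thesis using assms by (simp add: sub.lies_in_coset_iff)
qed

lemma \<pi>_pp_\<iota>:
  "a \<in> carrier G \<Longrightarrow> ls \<in> tuples L n \<Longrightarrow> u \<in> set (pp G a (map \<iota> ls)) \<Longrightarrow> \<pi> u = \<pi> a"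
proof (induction ls arbitrary: a n)
  case (Cons l ls)
  have l: "l \<in> carrier L" "ls \<in> tuples L (n - 1)" using Cons.prems by (auto simp: tuples_def)
  have "\<pi> u = \<pi> (a \<otimes>\<^bsub>G\<^esub> \<iota> l)" if "u \<in> set (pp G (a \<otimes>\<^bsub>G\<^esub> \<iota> l) (map \<iota> ls))"
    using Cons.IH[OF _ l(2) that] Cons.prems l sub.\<phi>_closed by auto
  then show ?case using Cons.prems l by (auto simp: \<pi>_mult \<pi>_\<iota> sub.\<phi>_closed \<pi>_closed)
qed simp

definition conj_elt :: "'g \<Rightarrow> 'l \<Rightarrow> 'l"
  where "conj_elt g l = sub.\<psi> (inv\<^bsub>G\<^esub> g \<otimes>\<^bsub>G\<^esub> \<iota> l \<otimes>\<^bsub>G\<^esub> g)"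

lemma conj_in_image:
  assumes "g \<in> carrier G" "l \<in> carrier L"
  shows "inv\<^bsub>G\<^esub> g \<otimes>\<^bsub>G\<^esub> \<iota> l \<otimes>\<^bsub>G\<^esub> g \<in> \<iota> ` carrier L"
  using assms sub.\<phi>_closed \<pi>_closed by (subst \<iota>_image_iff) (auto simp: \<pi>_mult \<pi>_inv \<pi>_\<iota>)

lemma conj_elt_closed: "g \<in> carrier G \<Longrightarrow> l \<in> carrier L \<Longrightarrow> conj_elt g l \<in> carrier L"
  unfolding conj_elt_def by (intro sub.\<psi>_closed conj_in_image)

lemma \<iota>_conj_elt: "g \<in> carrier G \<Longrightarrow> l \<in> carrier L \<Longrightarrow>
    \<iota> (conj_elt g l) = inv\<^bsub>G\<^esub> g \<otimes>\<^bsub>G\<^esub> \<iota> l \<otimes>\<^bsub>G\<^esub> g"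
  unfolding conj_elt_def by (intro sub.\<phi>_\<psi> conj_in_image)

lemma conj_elt_mult:
  assumes "g \<in> carrier G" "h \<in> carrier G" "l \<in> carrier L"
  shows "conj_elt (g \<otimes>\<^bsub>G\<^esub> h) l = conj_elt h (conj_elt g l)"
  using assms sub.\<phi>_closed[OF assms(3)]
  by (simp add: conj_elt_def[of "g \<otimes>\<^bsub>G\<^esub> h"] conj_elt_def[of h] \<iota>_conj_elt G.inv_mult_group G.m_assoc)

lemma conj_elt_one: "l \<in> carrier L \<Longrightarrow> conj_elt \<one>\<^bsub>G\<^esub> l = l"
  using sub.\<phi>_closed by (simp add: conj_elt_def sub.\<psi>_\<phi>)

lemma map_conj_elt_tuples: "g \<in> carrier G \<Longrightarrow> ls \<in> tuples L n \<Longrightarrow> map (conj_elt g) ls \<in> tuples L n"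
  using conj_elt_closed by (auto simp: tuples_def)

abbreviation "cj n g f \<equiv> conj_cochain L \<iota> G act n g f"

lemma cj_eq: "cj n g f = (\<lambda>ls\<in>tuples L n. act g (f (map (conj_elt g) ls)))"
  by (simp add: conj_cochain_def conj_elt_def[abs_def] sub.\<psi>_def)

lemma cj_closed:
  assumes "g \<in> carrier G" "f \<in> carrier (sub.res.BC n)"
  shows "cj n g f \<in> carrier (sub.res.BC n)" "seminorm (sub.res.BC n) (cj n g f) \<le> seminorm (sub.res.BC n) f"
proof -
  note m = map_conj_elt_tuples[OF assms(1)] and c = bounded_cochain_closed[OF assms(2)]
  show "cj n g f \<in> carrier (sub.res.BC n)"
    unfolding cj_eq using m c assms
    by (intro bounded_cochainI[where b = "seminorm (sub.res.BC n) f"])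
      (auto simp: act_closed act_isometric sub.res.seminorm_cochain_ge)
  show "seminorm (sub.res.BC n) (cj n g f) \<le> seminorm (sub.res.BC n) f"
    using m c assms by (intro sub.res.seminorm_cochain_le)
      (auto simp: cj_eq act_isometric sub.res.seminorm_cochain_ge)
qed

lemma cj_add:
  assumes "g \<in> carrier G" "f \<in> carrier (sub.res.BC n)" "f' \<in> carrier (sub.res.BC n)"
  shows "cj n g (f \<oplus>\<^bsub>sub.res.BC n\<^esub> f') = cj n g f \<oplus>\<^bsub>sub.res.BC n\<^esub> cj n g f'"
  using assms map_conj_elt_tuples[OF assms(1)]
  by (auto simp: cj_eq bounded_cochains_simps(3) act_add bounded_cochain_closed intro!: restrict_ext)

lemma cj_diff:
  assumes "g \<in> carrier G" "f \<in> carrier (sub.res.BC n)" "f' \<in> carrier (sub.res.BC n)"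
  shows "cj n g (f \<ominus>\<^bsub>sub.res.BC n\<^esub> f') = cj n g f \<ominus>\<^bsub>sub.res.BC n\<^esub> cj n g f'"
  unfolding sub.res.cochain_diff[OF assms(2,3)] sub.res.cochain_diff[OF cj_closed(1)[OF assms(1,2)] cj_closed(1)[OF assms(1,3)]]
  using assms map_conj_elt_tuples[OF assms(1)]
  by (auto simp: cj_eq act_diff bounded_cochain_closed intro!: restrict_ext)

lemma cj_smult:
  assumes "g \<in> carrier G" "a \<in> carrier R" "f \<in> carrier (sub.res.BC n)"
  shows "cj n g (a \<odot>\<^bsub>sub.res.BC n\<^esub> f) = a \<odot>\<^bsub>sub.res.BC n\<^esub> cj n g f"
  using assms map_conj_elt_tuples[OF assms(1)]
  by (auto simp: cj_eq bounded_cochains_simps(4) act_smult bounded_cochain_closed intro!: restrict_ext)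

lemma cj_zero: "g \<in> carrier G \<Longrightarrow> cj n g \<zero>\<^bsub>sub.res.BC n\<^esub> = \<zero>\<^bsub>sub.res.BC n\<^esub>"
  using map_conj_elt_tuples
  by (auto simp: cj_eq bounded_cochains_simps(2) act_zero intro!: restrict_ext)

lemma cj_mult:
  assumes "g \<in> carrier G" "h \<in> carrier G" "f \<in> carrier (sub.res.BC n)"
  shows "cj n (g \<otimes>\<^bsub>G\<^esub> h) f = cj n g (cj n h f)"
proof -
  have "map (conj_elt h) (map (conj_elt g) ls) = map (conj_elt (g \<otimes>\<^bsub>G\<^esub> h)) ls" if "ls \<in> tuples L n" for ls
    using that assms by (auto simp: tuples_def conj_elt_mult)
  then show ?thesis
    using assms map_conj_elt_tuples
    by (auto simp: cj_eq act_mult bounded_cochain_closed simp del: map_map intro!: restrict_ext)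
qed

lemma cj_one: "f \<in> carrier (sub.res.BC n) \<Longrightarrow> cj n \<one>\<^bsub>G\<^esub> f = f"
proof -
  assume f: "f \<in> carrier (sub.res.BC n)"
  have "map (conj_elt \<one>\<^bsub>G\<^esub>) ls = ls" if "ls \<in> tuples L n" for ls
    using that by (auto simp: tuples_def conj_elt_one intro!: map_idI)
  then show ?thesis
    using f cj_closed(1)[OF _ f, of "\<one>\<^bsub>G\<^esub>"]
    by (intro bounded_cochain_ext[of _ L A n]) (auto simp: cj_eq act_one bounded_cochain_closed)
qed

lemma cj_inv:
  assumes "g \<in> carrier G" "f \<in> carrier (sub.res.BC n)"
  shows "cj n g (cj n (inv\<^bsub>G\<^esub> g) f) = f" "cj n (inv\<^bsub>G\<^esub> g) (cj n g f) = f"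
  using assms cj_mult[of g "inv\<^bsub>G\<^esub> g" f n] cj_mult[of "inv\<^bsub>G\<^esub> g" g f n] cj_one by simp_all

text \<open>From \<open>a l g = (a g) (g\<^sup>-\<^sup>1 l g)\<close>: translating partial products
  on the right conjugates the steps. Through \<open>cj_hg\<close> the action on cochains thereby
  becomes right translation of the argument of a homogeneous function.\<close>

lemma map_mult_right_pp:
  assumes "g \<in> carrier G" "a \<in> carrier G" "ls \<in> tuples L n"
  shows "map (\<lambda>u. u \<otimes>\<^bsub>G\<^esub> g) (pp G a (map \<iota> ls)) = pp G (a \<otimes>\<^bsub>G\<^esub> g) (map \<iota> (map (conj_elt g) ls))"
  using assms(2,3)
proof (induction ls arbitrary: a n)
  case (Cons l ls)
  have l: "l \<in> carrier L" "ls \<in> tuples L (n - 1)" "\<iota> l \<in> carrier G"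
    using Cons.prems sub.\<phi>_closed by (auto simp: tuples_def)
  have "a \<otimes>\<^bsub>G\<^esub> g \<otimes>\<^bsub>G\<^esub> \<iota> (conj_elt g l) = a \<otimes>\<^bsub>G\<^esub> (g \<otimes>\<^bsub>G\<^esub> inv\<^bsub>G\<^esub> g) \<otimes>\<^bsub>G\<^esub> \<iota> l \<otimes>\<^bsub>G\<^esub> g"
    using Cons.prems l assms(1) by (simp only: \<iota>_conj_elt G.m_assoc G.m_closed G.inv_closed)
  then have "a \<otimes>\<^bsub>G\<^esub> g \<otimes>\<^bsub>G\<^esub> \<iota> (conj_elt g l) = a \<otimes>\<^bsub>G\<^esub> \<iota> l \<otimes>\<^bsub>G\<^esub> g"
    using Cons.prems l assms(1) by simp
  then show ?case using Cons.IH[of "a \<otimes>\<^bsub>G\<^esub> \<iota> l" "n - 1"] Cons.prems l by simp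
qed simp

lemma cj_hg:
  assumes "g \<in> carrier G" "f \<in> carrier (sub.res.BC n)"
  shows "cj n g f = sub.ih n (\<lambda>us. sub.hg n f (map (\<lambda>u. u \<otimes>\<^bsub>G\<^esub> g) us))"
  unfolding cj_eq sub.ih_def
  using assms map_conj_elt_tuples[OF assms(1)]
  by (intro restrict_ext) (simp add: map_mult_right_pp sub.hg_pp del: map_map)

lemma map_mult_mult:
  assumes "a \<in> carrier G" "g \<in> carrier G" "set us \<subseteq> carrier G"
  shows "map (\<lambda>u. u \<otimes>\<^bsub>G\<^esub> g) (map (\<lambda>u. a \<otimes>\<^bsub>G\<^esub> u) us) = map (\<lambda>u. a \<otimes>\<^bsub>G\<^esub> u) (map (\<lambda>u. u \<otimes>\<^bsub>G\<^esub> g) us)"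
  using assms by (auto simp: G.m_assoc)

text \<open>Right translation commutes with left translations and with the deletion of entries, so
  nothing has to be expanded once both sides are written homogeneously.\<close>

lemma cob_cj:
  assumes g: "g \<in> carrier G" and f: "f \<in> carrier (sub.res.BC n)"
  shows "sub.cob n (cj n g f) = cj (Suc n) g (sub.cob n f)"
proof -
  let ?c = "\<lambda>us. sub.hg n f (map (\<lambda>u. u \<otimes>\<^bsub>G\<^esub> g) us)"
  have "sub.cob n (cj n g f) = sub.ih (Suc n) (dl A ?c)"
    unfolding cj_hg[OF g f]
  proof (rule sub.coboundary_ih)
    fix s ls assume s: "s \<in> carrier L" and ls: "ls \<in> tuples L n"
    have u: "set (pp G \<one>\<^bsub>G\<^esub> (map \<iota> ls)) \<subseteq> carrier G" using ls by (intro sub.pp_\<phi>_closed) auto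
    show "?c (pp G (\<iota> s) (map \<iota> ls)) = act (\<iota> s) (?c (pp G \<one>\<^bsub>G\<^esub> (map \<iota> ls)))"
      unfolding sub.pp_\<phi>_mult[OF sub.\<phi>_closed[OF s] ls] map_mult_mult[OF sub.\<phi>_closed[OF s] g u]
      using u g s f by (intro sub.hg_mult sub.\<phi>_closed) auto
  qed (rule sub.hg_closed[OF f])
  also have "\<dots> = cj (Suc n) g (sub.cob n f)"
    unfolding cj_hg[OF g sub.cob_closed(1)[OF f]]
  proof (rule sub.ih_cong)
    fix ls assume ls: "ls \<in> tuples L (Suc n)"
    have "sub.lies_in_coset (Suc n) (map (\<lambda>u. u \<otimes>\<^bsub>G\<^esub> g) (pp G \<one>\<^bsub>G\<^esub> (map \<iota> ls)))"
      unfolding map_mult_right_pp[OF g G.one_closed ls]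
      using g ls by (intro sub.lies_in_coset_pp map_conj_elt_tuples) auto
    then show "dl A ?c (pp G \<one>\<^bsub>G\<^esub> (map \<iota> ls)) =
        sub.hg (Suc n) (sub.cob n f) (map (\<lambda>u. u \<otimes>\<^bsub>G\<^esub> g) (pp G \<one>\<^bsub>G\<^esub> (map \<iota> ls)))"
      unfolding M.dl_map by (rule sub.dl_hg[OF f])
  qed
  finally show ?thesis .
qed

lemma cj_cocycle: "g \<in> carrier G \<Longrightarrow> f \<in> sub.Zc n \<Longrightarrow> cj n g f \<in> sub.Zc n"
  by (simp add: sub.cocycle_iff cj_closed cob_cj cj_zero)

lemma cj_coboundary: "g \<in> carrier G \<Longrightarrow> f \<in> sub.Bc n \<Longrightarrow> cj n g f \<in> sub.Bc n"
  by (cases n) (auto simp: cj_zero cob_cj[symmetric] cj_closed)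

text \<open>Right translations by two lifts of one element of \<open>Q\<close> send the image of
  \<open>L\<close> into the same fibre of \<open>\<pi>\<close>. On lists in this fibre, a single
  coset, \<open>hg n f\<close> is an equivariant cocycle, so the prism between the two translations
  is available.\<close>

lemma cj_homotopic:
  assumes "g \<in> carrier G" "g' \<in> carrier G" "\<pi> g = \<pi> g'" "f \<in> sub.Zc n"
  shows "cj n g' f \<ominus>\<^bsub>sub.res.BC n\<^esub> cj n g f \<in> sub.Bc n"
proof -
  have f: "f \<in> carrier (sub.res.BC n)" "sub.cob n f = \<zero>\<^bsub>sub.res.BC (Suc n)\<^esub>"
    using assms(4) by (auto simp: sub.cocycle_iff)
  show ?thesis
    unfolding cj_hg[OF assms(1) f(1)] cj_hg[OF assms(2) f(1)]
  proof (rule sub.homotopic[where T = "{u \<in> carrier G. \<pi> u = \<pi> g}" and b = "seminorm (sub.res.BC n) f"])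
    show "sub.hg n f us \<in> carrier A" for us by (rule sub.hg_closed[OF f(1)])
    show "seminorm A (sub.hg n f us) \<le> seminorm (sub.res.BC n) f" for us by (rule sub.seminorm_hg[OF f(1)])
    show "\<iota> s \<otimes>\<^bsub>G\<^esub> g \<in> {u \<in> carrier G. \<pi> u = \<pi> g} \<and> \<iota> s \<otimes>\<^bsub>G\<^esub> g' \<in> {u \<in> carrier G. \<pi> u = \<pi> g}"
      if "s \<in> carrier L" for s
      using that assms sub.\<phi>_closed[OF that] \<pi>_closed by (simp add: \<pi>_mult \<pi>_\<iota>)
    show "sub.hg n f (map (\<lambda>x. \<iota> s \<otimes>\<^bsub>G\<^esub> x) us) = act (\<iota> s) (sub.hg n f us)"
      if "s \<in> carrier L" "set us \<subseteq> {u \<in> carrier G. \<pi> u = \<pi> g}" for s us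
      using that f sub.\<phi>_closed by (intro sub.hg_mult) auto
    show "dl A (sub.hg n f) us = \<zero>\<^bsub>A\<^esub>"
      if "set us \<subseteq> {u \<in> carrier G. \<pi> u = \<pi> g}" "length us = Suc (Suc n)" for us
    proof -
      have "sub.lies_in_coset (Suc n) us" using that by (intro lies_in_cosetI[where x = "\<pi> g"]) auto
      then show ?thesis by (simp add: sub.dl_hg[OF f(1)] f(2) sub.hg_zero)
    qed
  qed (use assms sub.\<phi>_closed in \<open>auto simp: G.m_assoc\<close>)
qed

abbreviation "qa n \<equiv> quotient_act L \<iota> G \<pi> act n"

text \<open>All lifts of \<open>\<pi> g\<close> enter the set on the left, and
  \<open>cj_homotopic\<close> places their contributions in one coset. Conversely, an element
  \<open>u\<close> of that coset is hit by the single lift \<open>g\<close>, applied to the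
  translate of \<open>u\<close> by its inverse.\<close>

lemma quotient_act_cls:
  assumes g: "g \<in> carrier G" and f: "f \<in> sub.Zc n"
  shows "qa n (\<pi> g) (sub.H.cls n f) = sub.H.cls n (cj n g f)"
proof -
  note Zf = cj_cocycle[OF g f]
  note B = sub.H.submodule_closed[OF sub.submodule_coboundaries]
  have fc: "f \<in> carrier (sub.res.BC n)" using f by (simp add: sub.cocycle_iff)
  show ?thesis
  proof (intro equalityI subsetI)
    fix u assume "u \<in> qa n (\<pi> g) (sub.H.cls n f)"
    then obtain h f' where h: "h \<in> carrier G" "\<pi> h = \<pi> g" "f' \<in> sub.H.cls n f" "u = cj n h f'"
      by (auto simp: quotient_act_def)
    note f' = sub.H.cls_memD[OF f h(3)]
    have 1: "cj n h f' \<ominus>\<^bsub>sub.res.BC n\<^esub> cj n h f \<in> sub.Bc n"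
      using cj_coboundary[OF h(1) f'(2)] cj_diff[OF h(1) f'(1) fc] by simp
    have 2: "cj n h f \<ominus>\<^bsub>sub.res.BC n\<^esub> cj n g f \<in> sub.Bc n" using cj_homotopic[OF g h(1) _ f] h by simp
    have c: "cj n h f' \<in> carrier (sub.res.BC n)" "cj n h f \<in> carrier (sub.res.BC n)" "cj n g f \<in> carrier (sub.res.BC n)"
      using cj_closed g h f' fc by auto
    have "cj n h f' \<ominus>\<^bsub>sub.res.BC n\<^esub> cj n g f =
        (cj n h f' \<ominus>\<^bsub>sub.res.BC n\<^esub> cj n h f) \<oplus>\<^bsub>sub.res.BC n\<^esub> (cj n h f \<ominus>\<^bsub>sub.res.BC n\<^esub> cj n g f)"
      using c by algebra
    then have "u \<ominus>\<^bsub>sub.res.BC n\<^esub> cj n g f \<in> sub.Bc n" using B(4)[OF 1 2] h by simp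
    then show "u \<in> sub.H.cls n (cj n g f)" using c h by (intro sub.H.cls_memI[OF Zf]) auto
  next
    fix u assume u: "u \<in> sub.H.cls n (cj n g f)"
    note u' = sub.H.cls_memD[OF Zf u]
    let ?f = "cj n (inv\<^bsub>G\<^esub> g) u"
    have "?f \<ominus>\<^bsub>sub.res.BC n\<^esub> f = cj n (inv\<^bsub>G\<^esub> g) (u \<ominus>\<^bsub>sub.res.BC n\<^esub> cj n g f)"
      using g fc u' cj_closed by (simp add: cj_diff cj_inv)
    also have "\<dots> \<in> sub.Bc n" using cj_coboundary g u' by simp
    finally have "?f \<in> sub.H.cls n f" using g u' cj_closed by (intro sub.H.cls_memI[OF f]) auto
    moreover have "u = cj n g ?f" using cj_inv g u' by simp
    ultimately show "u \<in> qa n (\<pi> g) (sub.H.cls n f)" using g unfolding quotient_act_def by blast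
  qed
qed

lemma seminorm_quotient_act_le:
  assumes g: "g \<in> carrier G" and f: "f \<in> sub.Zc n"
  shows "seminorm (sub.Hc n) (sub.H.cls n (cj n g f)) \<le> seminorm (sub.Hc n) (sub.H.cls n f)"
proof (rule sub.H.seminorm_cls_ge[OF f])
  fix y assume y: "y \<in> sub.H.cls n f"
  note y' = sub.H.cls_memD[OF f y]
  have fc: "f \<in> carrier (sub.res.BC n)" using f by (simp add: sub.cocycle_iff)
  have "cj n g y \<ominus>\<^bsub>sub.res.BC n\<^esub> cj n g f \<in> sub.Bc n"
    using cj_coboundary[OF g y'(2)] cj_diff[OF g y'(1) fc] by simp
  then have "cj n g y \<in> sub.H.cls n (cj n g f)"
    using g y' cj_closed by (intro sub.H.cls_memI[OF cj_cocycle[OF g f]])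
  then have "seminorm (sub.Hc n) (sub.H.cls n (cj n g f)) \<le> seminorm (sub.res.BC n) (cj n g y)"
    by (rule sub.H.seminorm_cls_le[OF cj_cocycle[OF g f]])
  also have "\<dots> \<le> seminorm (sub.res.BC n) y" using cj_closed g y' by simp
  finally show "seminorm (sub.Hc n) (sub.H.cls n (cj n g f)) \<le> seminorm (sub.res.BC n) y" .
qed

theorem seminormed_group_module_quotient: "seminormed_group_module R Q (sub.Hc n) (qa n)"
proof -
  interpret H: seminormed_module R "sub.Hc n" by (rule sub.H.seminormed_module_N)
  note Z = sub.H.submodule_closed[OF sub.submodule_cocycles]
  have fc: "f \<in> carrier (sub.res.BC n)" if "f \<in> sub.Zc n" for f using that by (simp add: sub.cocycle_iff)
  have eq: "\<exists>g\<in>carrier G. \<exists>f\<in>sub.Zc n. x = \<pi> g \<and> c = sub.H.cls n f"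
    if "x \<in> carrier Q" "c \<in> carrier (sub.Hc n)" for x c
    using lift_exists[OF that(1)] that(2) by (metis sub.H.carrierE)
  show ?thesis
  proof (intro seminormed_group_module.intro Q.group_axioms H.seminormed_module_axioms
      seminormed_group_module_axioms.intro)
    fix x assume x: "x \<in> carrier Q"
    obtain g where g: "g \<in> carrier G" "x = \<pi> g" using lift_exists[OF x] by auto
    show "qa n x \<in> linear_maps R (sub.Hc n) (sub.Hc n)"
      unfolding linear_maps_def
    proof (intro CollectI conjI ballI)
      show "qa n x \<in> carrier (sub.Hc n) \<rightarrow> carrier (sub.Hc n)"
        using g by (auto elim!: sub.H.carrierE simp: quotient_act_cls sub.H.cls_closed cj_cocycle)
      fix c assume "c \<in> carrier (sub.Hc n)"
      then obtain f where f: "f \<in> sub.Zc n" "c = sub.H.cls n f" by (rule sub.H.carrierE)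
      {
        fix c' assume "c' \<in> carrier (sub.Hc n)"
        then obtain f' where f': "f' \<in> sub.Zc n" "c' = sub.H.cls n f'" by (rule sub.H.carrierE)
        show "qa n x (c \<oplus>\<^bsub>sub.Hc n\<^esub> c') = qa n x c \<oplus>\<^bsub>sub.Hc n\<^esub> qa n x c'"
          using f f' g Z(4)[OF f(1) f'(1)] by (simp add: sub.H.cls_add quotient_act_cls cj_cocycle cj_add fc)
      next
        fix a assume a: "a \<in> carrier R"
        show "qa n x (a \<odot>\<^bsub>sub.Hc n\<^esub> c) = a \<odot>\<^bsub>sub.Hc n\<^esub> qa n x c"
          using f a g Z(6)[OF a f(1)] by (simp add: sub.H.cls_smult quotient_act_cls cj_cocycle cj_smult fc)
      }
    qed
    fix c assume c: "c \<in> carrier (sub.Hc n)"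
    obtain f where f: "f \<in> sub.Zc n" "c = sub.H.cls n f" using c by (rule sub.H.carrierE)
    \<comment> \<open>The one-sided estimate for \<open>g\<close> and for its inverse together give
      equality.\<close>
    show "seminorm (sub.Hc n) (qa n x c) = seminorm (sub.Hc n) c"
      using seminorm_quotient_act_le[OF g(1) f(1)]
        seminorm_quotient_act_le[OF G.inv_closed[OF g(1)] cj_cocycle[OF g(1) f(1)]] g f
      by (simp add: quotient_act_cls cj_inv fc)
    fix y assume y: "y \<in> carrier Q"
    obtain h where h: "h \<in> carrier G" "y = \<pi> h" using lift_exists[OF y] by auto
    show "qa n (x \<otimes>\<^bsub>Q\<^esub> y) c = qa n x (qa n y c)"
      using g h f by (simp add: quotient_act_cls cj_mult fc cj_cocycle flip: \<pi>_mult)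
  next
    fix c assume "c \<in> carrier (sub.Hc n)"
    then obtain f where f: "f \<in> sub.Zc n" "c = sub.H.cls n f" by (rule sub.H.carrierE)
    then show "qa n \<one>\<^bsub>Q\<^esub> c = c" using quotient_act_cls[OF G.one_closed f(1)] by (simp add: \<pi>_one cj_one fc)
  qed
qed

end

section \<open>The total complex\<close>

context extension_module
begin

definition supp :: "'q list \<Rightarrow> 'g list \<Rightarrow> bool"
  where "supp xs gs \<longleftrightarrow> xs \<noteq> [] \<and> gs \<noteq> [] \<and> set xs \<subseteq> carrier Q \<and> set gs \<subseteq> carrier G"

abbreviation "trQ g \<equiv> map (\<lambda>x. \<pi> g \<otimes>\<^bsub>Q\<^esub> x)"
abbreviation "trG g \<equiv> map (\<lambda>h. g \<otimes>\<^bsub>G\<^esub> h)"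

text \<open>\<open>G\<close>-equivariant functions on \<open>Q\<^sup>m \<times> G\<^sup>n\<close>, bounded for all \<open>m, n \<ge> 1\<close>. The bidegree of a function that
  is supported on \<open>Q\<^sup>m \<times> G\<^sup>n\<close> is \<open>(m - 1, n - 1)\<close>. Only the seminorm depends on \<open>p\<close> and \<open>q\<close>: it is the
  supremum norm of the component in this bidegree.\<close>

definition tot :: "nat \<Rightarrow> nat \<Rightarrow> ('r, 'q list \<Rightarrow> 'g list \<Rightarrow> 'a) seminormed_module"
  where "tot p q = \<lparr>
    carrier = {F. (\<forall>xs gs. F xs gs \<in> carrier A) \<and> (\<forall>xs gs. \<not> supp xs gs \<longrightarrow> F xs gs = \<zero>\<^bsub>A\<^esub>) \<and>
      (\<forall>g\<in>carrier G. \<forall>xs gs. supp xs gs \<longrightarrow> F (trQ g xs) (trG g gs) = act g (F xs gs)) \<and>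
      (\<forall>m n. \<exists>b. \<forall>xs gs. length xs = m \<longrightarrow> length gs = n \<longrightarrow> seminorm A (F xs gs) \<le> b)},
    monoid.mult = undefined,
    monoid.one = undefined,
    ring.zero = (\<lambda>_ _. \<zero>\<^bsub>A\<^esub>),
    ring.add = (\<lambda>F F' xs gs. F xs gs \<oplus>\<^bsub>A\<^esub> F' xs gs),
    module.smult = (\<lambda>a F xs gs. a \<odot>\<^bsub>A\<^esub> F xs gs),
    seminorm = (\<lambda>F. SUP z\<in>tuples Q (Suc p) \<times> tuples G (Suc q). seminorm A (F (fst z) (snd z)))\<rparr>"

abbreviation "TC \<equiv> tot 0 0"

lemma tot_simps:
  "\<zero>\<^bsub>tot p q\<^esub> = (\<lambda>_ _. \<zero>\<^bsub>A\<^esub>)"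
  "F \<oplus>\<^bsub>tot p q\<^esub> F' = (\<lambda>xs gs. F xs gs \<oplus>\<^bsub>A\<^esub> F' xs gs)"
  "a \<odot>\<^bsub>tot p q\<^esub> F = (\<lambda>xs gs. a \<odot>\<^bsub>A\<^esub> F xs gs)"
  "seminorm (tot p q) F = (SUP z\<in>tuples Q (Suc p) \<times> tuples G (Suc q). seminorm A (F (fst z) (snd z)))"
  by (simp_all add: tot_def)

lemma carrier_tot: "carrier (tot p q) = carrier TC"
  by (simp add: tot_def)

lemma add_monoid_tot: "add_monoid (tot p q) = add_monoid TC"
  by (simp add: tot_def)

lemma smult_tot: "module.smult (tot p q) = module.smult TC"
  by (simp_all add: tot_def)

lemma totI:
  assumes "\<And>xs gs. F xs gs \<in> carrier A" "\<And>xs gs. \<not> supp xs gs \<Longrightarrow> F xs gs = \<zero>\<^bsub>A\<^esub>"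
    "\<And>g xs gs. g \<in> carrier G \<Longrightarrow> supp xs gs \<Longrightarrow> F (trQ g xs) (trG g gs) = act g (F xs gs)"
    "\<And>m n. \<exists>b. \<forall>xs gs. length xs = m \<longrightarrow> length gs = n \<longrightarrow> seminorm A (F xs gs) \<le> b"
  shows "F \<in> carrier TC"
  using assms by (simp add: tot_def)

lemma tot_closed: "F \<in> carrier TC \<Longrightarrow> F xs gs \<in> carrier A"
  and tot_zero: "F \<in> carrier TC \<Longrightarrow> \<not> supp xs gs \<Longrightarrow> F xs gs = \<zero>\<^bsub>A\<^esub>"
  by (auto simp: tot_def)

lemma tot_bounded:
  assumes "F \<in> carrier TC"
  obtains b where "0 \<le> b" "\<And>xs gs. length xs = m \<Longrightarrow> length gs = n \<Longrightarrow> seminorm A (F xs gs) \<le> b"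
proof -
  obtain b where "\<And>xs gs. length xs = m \<Longrightarrow> length gs = n \<Longrightarrow> seminorm A (F xs gs) \<le> b"
    using assms by (fastforce simp: tot_def)
  then show thesis using that[of "max 0 b"] by (meson max.cobounded1 max.coboundedI2)
qed

lemma supp_tr:
  assumes "g \<in> carrier G" "set xs \<subseteq> carrier Q" "set gs \<subseteq> carrier G"
  shows "supp (trQ g xs) (trG g gs) \<longleftrightarrow> supp xs gs"
  using assms \<pi>_closed by (auto simp: supp_def)

lemma tot_equivariant:
  assumes "F \<in> carrier TC" "g \<in> carrier G" "set xs \<subseteq> carrier Q" "set gs \<subseteq> carrier G"
  shows "F (trQ g xs) (trG g gs) = act g (F xs gs)"
proof (cases "supp xs gs")
  case True
  then show ?thesis using assms(1,2) by (simp add: tot_def)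
next
  case False
  then show ?thesis using assms by (simp add: tot_zero supp_tr act_zero)
qed

lemma tot_smult_add_closed:
  assumes F: "F \<in> carrier TC" "F' \<in> carrier TC" and a: "a \<in> carrier R"
  shows "(\<lambda>xs gs. a \<odot>\<^bsub>A\<^esub> F xs gs \<oplus>\<^bsub>A\<^esub> F' xs gs) \<in> carrier TC"
proof (rule totI)
  note c = tot_closed[OF F(1)] tot_closed[OF F(2)]
  show "a \<odot>\<^bsub>A\<^esub> F xs gs \<oplus>\<^bsub>A\<^esub> F' xs gs \<in> carrier A" for xs gs using c a smult_closed by simp
  show "a \<odot>\<^bsub>A\<^esub> F xs gs \<oplus>\<^bsub>A\<^esub> F' xs gs = \<zero>\<^bsub>A\<^esub>" if "\<not> supp xs gs" for xs gs
    using that F a by (simp add: tot_zero smult_zero)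
  show "a \<odot>\<^bsub>A\<^esub> F (trQ g xs) (trG g gs) \<oplus>\<^bsub>A\<^esub> F' (trQ g xs) (trG g gs) =
      act g (a \<odot>\<^bsub>A\<^esub> F xs gs \<oplus>\<^bsub>A\<^esub> F' xs gs)" if "g \<in> carrier G" "supp xs gs" for g xs gs
    using that F a c smult_closed by (simp add: tot_equivariant act_add act_smult supp_def)
  show "\<exists>b. \<forall>xs gs. length xs = m \<longrightarrow> length gs = n \<longrightarrow> seminorm A (a \<odot>\<^bsub>A\<^esub> F xs gs \<oplus>\<^bsub>A\<^esub> F' xs gs) \<le> b" for m n
  proof -
    obtain b where b: "length xs = m \<Longrightarrow> length gs = n \<Longrightarrow> seminorm A (F xs gs) \<le> b" for xs gs
      by (rule tot_bounded[OF F(1), of m n]) blast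
    obtain b' where b': "length xs = m \<Longrightarrow> length gs = n \<Longrightarrow> seminorm A (F' xs gs) \<le> b'" for xs gs
      by (rule tot_bounded[OF F(2), of m n]) blast
    have "seminorm A (a \<odot>\<^bsub>A\<^esub> F xs gs \<oplus>\<^bsub>A\<^esub> F' xs gs) \<le> absval R a * b + b'"
      if "length xs = m" "length gs = n" for xs gs
      using seminorm_smult_add[OF a c(1,2)[of xs gs]] b[OF that] b'[OF that] absval_nonneg[OF a]
      by (smt (verit) mult_left_mono)
    then show ?thesis by blast
  qed
qed

lemma tot_zero_closed: "(\<lambda>_ _. \<zero>\<^bsub>A\<^esub>) \<in> carrier TC"
  by (rule totI) (auto simp: act_zero seminorm_zero)

lemma tot_add_closed:
  assumes "F \<in> carrier TC" "F' \<in> carrier TC"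
  shows "(\<lambda>xs gs. F xs gs \<oplus>\<^bsub>A\<^esub> F' xs gs) \<in> carrier TC"
  using tot_smult_add_closed[OF assms R_one_closed] tot_closed[OF assms(1)] by (simp add: smult_one)

lemma tot_smult_closed:
  assumes "F \<in> carrier TC" "a \<in> carrier R" shows "(\<lambda>xs gs. a \<odot>\<^bsub>A\<^esub> F xs gs) \<in> carrier TC"
  using tot_smult_add_closed[OF assms(1) tot_zero_closed assms(2)] tot_closed[OF assms(1)] assms(2) smult_closed
  by simp

lemma tot_a_inv_closed:
  assumes "F \<in> carrier TC" shows "(\<lambda>xs gs. \<ominus>\<^bsub>A\<^esub> F xs gs) \<in> carrier TC"
proof (rule totI)
  show "\<exists>b. \<forall>xs gs. length xs = m \<longrightarrow> length gs = n \<longrightarrow> seminorm A (\<ominus>\<^bsub>A\<^esub> F xs gs) \<le> b" for m n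
  proof -
    obtain b where b: "length xs = m \<Longrightarrow> length gs = n \<Longrightarrow> seminorm A (F xs gs) \<le> b" for xs gs
      by (rule tot_bounded[OF assms, of m n]) blast
    then show ?thesis using seminorm_minus[OF tot_closed[OF assms]] by auto
  qed
next
  show "\<ominus>\<^bsub>A\<^esub> F (trQ g xs) (trG g gs) = act g (\<ominus>\<^bsub>A\<^esub> F xs gs)" if "g \<in> carrier G" "supp xs gs" for g xs gs
    using that act_a_inv[OF that(1) tot_closed[OF assms]] tot_equivariant[OF assms that(1), of xs gs]
    by (simp add: supp_def)
qed (simp_all add: tot_closed[OF assms] tot_zero[OF assms] M.a_inv_zero)

lemma abelian_group_tot: "abelian_group (tot p q)"
proof (rule abelian_groupI; unfold carrier_tot[of p q] tot_simps)
  show "(\<lambda>_ _. \<zero>\<^bsub>A\<^esub>) \<in> carrier TC" by (rule tot_zero_closed)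
  fix F assume F: "F \<in> carrier TC"
  note c = tot_closed[OF F]
  show "(\<lambda>xs gs. \<zero>\<^bsub>A\<^esub> \<oplus>\<^bsub>A\<^esub> F xs gs) = F" using c by simp
  show "\<exists>F'\<in>carrier TC. (\<lambda>xs gs. F' xs gs \<oplus>\<^bsub>A\<^esub> F xs gs) = (\<lambda>_ _. \<zero>\<^bsub>A\<^esub>)"
    using c tot_a_inv_closed[OF F] by (intro bexI[of _ "\<lambda>xs gs. \<ominus>\<^bsub>A\<^esub> F xs gs"]) (auto simp: M.l_neg)
  fix F' assume F': "F' \<in> carrier TC"
  note c' = tot_closed[OF F']
  show "(\<lambda>xs gs. F xs gs \<oplus>\<^bsub>A\<^esub> F' xs gs) \<in> carrier TC" using F F' by (rule tot_add_closed)
  show "(\<lambda>xs gs. F xs gs \<oplus>\<^bsub>A\<^esub> F' xs gs) = (\<lambda>xs gs. F' xs gs \<oplus>\<^bsub>A\<^esub> F xs gs)"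
    using c c' by (simp add: M.a_comm)
  fix F'' assume F'': "F'' \<in> carrier TC"
  show "(\<lambda>xs gs. F xs gs \<oplus>\<^bsub>A\<^esub> F' xs gs \<oplus>\<^bsub>A\<^esub> F'' xs gs) =
      (\<lambda>xs gs. F xs gs \<oplus>\<^bsub>A\<^esub> (F' xs gs \<oplus>\<^bsub>A\<^esub> F'' xs gs))"
    using c c' tot_closed[OF F''] by (simp add: M.a_assoc)
qed

lemma tot_a_inv: "F \<in> carrier TC \<Longrightarrow> \<ominus>\<^bsub>tot p q\<^esub> F = (\<lambda>xs gs. \<ominus>\<^bsub>A\<^esub> F xs gs)"
  using abelian_group.minus_equality[OF abelian_group_tot[of p q], of "\<lambda>xs gs. \<ominus>\<^bsub>A\<^esub> F xs gs" F]
    tot_a_inv_closed[of F] by (simp add: tot_simps carrier_tot[of p q] tot_closed M.l_neg)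

lemma tot_diff: "F' \<in> carrier TC \<Longrightarrow>
    F \<ominus>\<^bsub>tot p q\<^esub> F' = (\<lambda>xs gs. F xs gs \<ominus>\<^bsub>A\<^esub> F' xs gs)"
  by (simp add: a_minus_def tot_a_inv tot_simps)

lemma seminorm_tot_ge:
  assumes "F \<in> carrier TC" "xs \<in> tuples Q (Suc p)" "gs \<in> tuples G (Suc q)"
  shows "seminorm A (F xs gs) \<le> seminorm (tot p q) F"
proof -
  obtain b where b: "length xs = Suc p \<Longrightarrow> length gs = Suc q \<Longrightarrow> seminorm A (F xs gs) \<le> b" for xs gs
    by (rule tot_bounded[OF assms(1), of "Suc p" "Suc q"]) blast
  have "bdd_above ((\<lambda>z. seminorm A (F (fst z) (snd z))) ` (tuples Q (Suc p) \<times> tuples G (Suc q)))"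
    using b by (intro bdd_aboveI2[where M = b]) (auto simp: tuples_def)
  from cSUP_upper[OF _ this, of "(xs, gs)"] show ?thesis using assms by (simp add: tot_simps)
qed

lemma tuples_Q_nonempty: "tuples Q n \<noteq> {}"
proof -
  have "replicate n \<one>\<^bsub>Q\<^esub> \<in> tuples Q n" by (auto simp: tuples_def)
  then show ?thesis by blast
qed

lemma seminorm_tot_le:
  assumes "\<And>xs gs. xs \<in> tuples Q (Suc p) \<Longrightarrow> gs \<in> tuples G (Suc q) \<Longrightarrow> seminorm A (F xs gs) \<le> b"
  shows "seminorm (tot p q) F \<le> b"
  unfolding tot_simps using assms tuples_nonempty tuples_Q_nonempty by (intro cSUP_least) auto

lemma seminormed_module_tot: "seminormed_module R (tot p q)"
proof (intro seminormed_module.intro left_module.intro normed_ring_axioms ring_R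
      abelian_group_tot left_module_axioms.intro seminormed_module_axioms.intro; (unfold carrier_tot[of p q])?)
  fix F assume F: "F \<in> carrier TC"
  note c = tot_closed[OF F]
  show "\<one>\<^bsub>R\<^esub> \<odot>\<^bsub>tot p q\<^esub> F = F" using c by (simp add: tot_simps smult_one)
  obtain xs gs where xg: "xs \<in> tuples Q (Suc p)" "gs \<in> tuples G (Suc q)"
    using tuples_nonempty tuples_Q_nonempty by blast
  show "0 \<le> seminorm (tot p q) F"
    using seminorm_tot_ge[OF F xg] seminorm_nonneg[OF c] order_trans by blast
  show "seminorm (tot p q) (\<ominus>\<^bsub>tot p q\<^esub> F) = seminorm (tot p q) F"
    using c by (simp add: tot_a_inv[OF F] tot_simps seminorm_minus)
  {
    fix a assume a: "a \<in> carrier R"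
    show "a \<odot>\<^bsub>tot p q\<^esub> F \<in> carrier TC" using tot_smult_closed[OF F a] by (simp add: tot_simps)
    fix b assume b: "b \<in> carrier R"
    show "(a \<oplus>\<^bsub>R\<^esub> b) \<odot>\<^bsub>tot p q\<^esub> F = a \<odot>\<^bsub>tot p q\<^esub> F \<oplus>\<^bsub>tot p q\<^esub> b \<odot>\<^bsub>tot p q\<^esub> F"
      using a b c by (simp add: tot_simps smult_l_distr)
    show "(a \<otimes>\<^bsub>R\<^esub> b) \<odot>\<^bsub>tot p q\<^esub> F = a \<odot>\<^bsub>tot p q\<^esub> (b \<odot>\<^bsub>tot p q\<^esub> F)"
      using a b c by (simp add: tot_simps smult_assoc)
  }
  fix F' assume F': "F' \<in> carrier TC"
  note c' = tot_closed[OF F']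
  show "seminorm (tot p q) (F \<oplus>\<^bsub>tot p q\<^esub> F') \<le> seminorm (tot p q) F + seminorm (tot p q) F'"
    using seminorm_triangle[OF c c'] seminorm_tot_ge[OF F] seminorm_tot_ge[OF F']
    by (intro seminorm_tot_le) (unfold tot_simps(2), smt (verit))
  fix a assume a: "a \<in> carrier R"
  show "a \<odot>\<^bsub>tot p q\<^esub> (F \<oplus>\<^bsub>tot p q\<^esub> F') = a \<odot>\<^bsub>tot p q\<^esub> F \<oplus>\<^bsub>tot p q\<^esub> a \<odot>\<^bsub>tot p q\<^esub> F'"
    using a c c' by (simp add: tot_simps smult_r_distr)
  show "seminorm (tot p q) (a \<odot>\<^bsub>tot p q\<^esub> F \<oplus>\<^bsub>tot p q\<^esub> F') \<le>
      absval R a * seminorm (tot p q) F + seminorm (tot p q) F'"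
  proof (rule seminorm_tot_le)
    fix xs gs assume xg: "xs \<in> tuples Q (Suc p)" "gs \<in> tuples G (Suc q)"
    have "seminorm A (a \<odot>\<^bsub>A\<^esub> F xs gs \<oplus>\<^bsub>A\<^esub> F' xs gs) \<le> absval R a * seminorm A (F xs gs) + seminorm A (F' xs gs)"
      by (rule seminorm_smult_add[OF a c c'])
    also have "\<dots> \<le> absval R a * seminorm (tot p q) F + seminorm (tot p q) F'"
      using xg F F' by (intro add_mono mult_left_mono seminorm_tot_ge absval_nonneg[OF a])
    finally show "seminorm A ((a \<odot>\<^bsub>tot p q\<^esub> F \<oplus>\<^bsub>tot p q\<^esub> F') xs gs) \<le>
        absval R a * seminorm (tot p q) F + seminorm (tot p q) F'" by (simp add: tot_simps)
  qed
next
  show "seminorm (tot p q) \<zero>\<^bsub>tot p q\<^esub> = 0"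
    using tuples_nonempty tuples_Q_nonempty by (simp add: tot_simps seminorm_zero)
qed

text \<open>The cut-off is needed to stay inside \<open>tot\<close>: if a list has one entry outside
  the group, deleting this entry can produce a list on which \<open>F\<close> is not zero. On lists
  with entries in the groups, empty ones included, the cut-off has no effect
  (\<open>D_eq\<close>).\<close>

definition D :: "('q list \<Rightarrow> 'g list \<Rightarrow> 'a) \<Rightarrow> 'q list \<Rightarrow> 'g list \<Rightarrow> 'a"
  where "D F xs gs = (if supp xs gs then dd A F xs gs else \<zero>\<^bsub>A\<^esub>)"

lemma dd_cong:
  assumes "\<And>ys. set ys \<subseteq> set xs \<Longrightarrow> Suc (length ys) = length xs \<Longrightarrow> F ys gs = F' ys gs"
    and "\<And>hs. set hs \<subseteq> set gs \<Longrightarrow> Suc (length hs) = length gs \<Longrightarrow> F xs hs = F' xs hs"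
  shows "dd A F xs gs = dd A F' xs gs"
proof -
  have "dl A (\<lambda>ys. F ys gs) xs = dl A (\<lambda>ys. F' ys gs) xs" by (rule M.dl_cong) (rule assms(1))
  moreover have "dl A (F xs) gs = dl A (F' xs) gs" by (rule M.dl_cong) (rule assms(2))
  ultimately show ?thesis by (simp add: dd_def)
qed

lemma dd_zero:
  assumes "\<And>ys. set ys \<subseteq> set xs \<Longrightarrow> Suc (length ys) = length xs \<Longrightarrow> F ys gs = \<zero>\<^bsub>A\<^esub>"
    and "\<And>hs. set hs \<subseteq> set gs \<Longrightarrow> Suc (length hs) = length gs \<Longrightarrow> F xs hs = \<zero>\<^bsub>A\<^esub>"
  shows "dd A F xs gs = \<zero>\<^bsub>A\<^esub>"
proof -
  have "dl A (\<lambda>ys. F ys gs) xs = \<zero>\<^bsub>A\<^esub>" by (rule M.dl_zero) (rule assms(1))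
  moreover have "dl A (F xs) gs = \<zero>\<^bsub>A\<^esub>" by (rule M.dl_zero) (rule assms(2))
  ultimately show ?thesis by (simp add: dd_def)
qed

lemma D_eq:
  assumes "F \<in> carrier TC" "set xs \<subseteq> carrier Q" "set gs \<subseteq> carrier G"
  shows "D F xs gs = dd A F xs gs"
proof (cases "supp xs gs")
  case False
  then have "xs = [] \<or> gs = []" using assms by (auto simp: supp_def)
  then have "dd A F xs gs = \<zero>\<^bsub>A\<^esub>"
    by (auto intro!: dd_zero tot_zero[OF assms(1)] simp: supp_def)
  then show ?thesis using False by (simp add: D_def)
qed (simp add: D_def)

lemma D_closed: assumes F: "F \<in> carrier TC" shows "D F \<in> carrier TC"
proof (rule totI)
  note c = tot_closed[OF F]
  show "D F xs gs \<in> carrier A" for xs gs using c by (simp add: D_def)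
  show "D F xs gs = \<zero>\<^bsub>A\<^esub>" if "\<not> supp xs gs" for xs gs using that by (simp add: D_def)
  show "D F (trQ g xs) (trG g gs) = act g (D F xs gs)" if g: "g \<in> carrier G" and s: "supp xs gs" for g xs gs
  proof -
    have s': "set xs \<subseteq> carrier Q" "set gs \<subseteq> carrier G" "supp (trQ g xs) (trG g gs)"
      using s supp_tr[OF g, of xs gs] by (simp_all add: supp_def)
    have 1: "dl A (\<lambda>ys. F ys (trG g gs)) (trQ g xs) = act g (dl A (\<lambda>ys. F ys gs) xs)"
      using s' by (intro dl_equivariant g c tot_equivariant[OF F g]) auto
    have 2: "dl A (F (trQ g xs)) (trG g gs) = act g (dl A (F xs) gs)"
      using s' by (intro dl_equivariant g c tot_equivariant[OF F g]) auto
    have "alt_sign A i (act g x) = act g (alt_sign A i x)" if "x \<in> carrier A" for i x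
      using that g by (simp add: alt_sign_def act_a_inv)
    then show ?thesis using s s'(3) c g by (simp add: D_def dd_def 1 2 act_add)
  qed
  show "\<exists>b. \<forall>xs gs. length xs = m \<longrightarrow> length gs = n \<longrightarrow> seminorm A (D F xs gs) \<le> b" for m n
  proof -
    obtain b where b: "0 \<le> b" "length xs = m - 1 \<Longrightarrow> length gs = n \<Longrightarrow> seminorm A (F xs gs) \<le> b" for xs gs
      by (rule tot_bounded[OF F, of "m - 1" n]) blast
    obtain b' where b': "0 \<le> b'" "length xs = m \<Longrightarrow> length gs = n - 1 \<Longrightarrow> seminorm A (F xs gs) \<le> b'" for xs gs
      by (rule tot_bounded[OF F, of m "n - 1"]) blast
    have "seminorm A (D F xs gs) \<le> real m * b + real n * b'" if "length xs = m" "length gs = n" for xs gs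
    proof (cases "supp xs gs")
      case True
      have "seminorm A (dd A F xs gs) \<le> seminorm A (dl A (\<lambda>ys. F ys gs) xs) + seminorm A (dl A (F xs) gs)"
        unfolding dd_def using c seminorm_triangle by (metis M.alt_sign_closed M.dl_closed seminorm_alt_sign)
      also have "\<dots> \<le> real (length xs) * b + real (length gs) * b'"
        using that by (intro add_mono seminorm_dl c b b') auto
      finally show ?thesis using True that by (simp add: D_def)
    qed (use b b' in \<open>simp add: D_def seminorm_zero\<close>)
    then show ?thesis by blast
  qed
qed

lemma D_add:
  assumes "F \<in> carrier TC" "F' \<in> carrier TC"
  shows "D (F \<oplus>\<^bsub>TC\<^esub> F') = D F \<oplus>\<^bsub>TC\<^esub> D F'"
proof (intro ext)
  fix xs gs
  have "(u \<oplus>\<^bsub>A\<^esub> v) \<oplus>\<^bsub>A\<^esub> (u' \<oplus>\<^bsub>A\<^esub> v') = (u \<oplus>\<^bsub>A\<^esub> u') \<oplus>\<^bsub>A\<^esub> (v \<oplus>\<^bsub>A\<^esub> v')"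
    if "u \<in> carrier A" "v \<in> carrier A" "u' \<in> carrier A" "v' \<in> carrier A" for u v u' v'
    using that by algebra
  then show "D (F \<oplus>\<^bsub>TC\<^esub> F') xs gs = (D F \<oplus>\<^bsub>TC\<^esub> D F') xs gs"
    using assms by (simp add: D_def dd_def tot_simps tot_closed M.dl_add M.alt_sign_add)
qed

lemma D_smult:
  assumes "a \<in> carrier R" "F \<in> carrier TC"
  shows "D (a \<odot>\<^bsub>TC\<^esub> F) = a \<odot>\<^bsub>TC\<^esub> D F"
proof (intro ext)
  fix xs gs
  have 1: "dl A (\<lambda>ys. a \<odot>\<^bsub>A\<^esub> f ys) us = a \<odot>\<^bsub>A\<^esub> dl A f us" if "\<And>ys. f ys \<in> carrier A" for f us
    using M.dl_hom[OF M.abelian_group_axioms, of "\<lambda>x. a \<odot>\<^bsub>A\<^esub> x" f us] that assms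
    by (simp add: smult_r_distr smult_closed)
  have 2: "alt_sign A i (a \<odot>\<^bsub>A\<^esub> x) = a \<odot>\<^bsub>A\<^esub> alt_sign A i x" if "x \<in> carrier A" for i x
    using that assms by (simp add: alt_sign_def smult_minus)
  show "D (a \<odot>\<^bsub>TC\<^esub> F) xs gs = (a \<odot>\<^bsub>TC\<^esub> D F) xs gs"
    using assms smult_closed by (simp add: D_def dd_def tot_simps tot_closed 1 2 smult_r_distr smult_zero)
qed

lemma D_D: assumes F: "F \<in> carrier TC" shows "D (D F) = \<zero>\<^bsub>TC\<^esub>"
proof (intro ext)
  fix xs gs
  have "dd A (D F) xs gs = \<zero>\<^bsub>A\<^esub>" if "supp xs gs"
  proof -
    have "set xs \<subseteq> carrier Q" "set gs \<subseteq> carrier G" using that by (auto simp: supp_def)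
    then have "dd A (D F) xs gs = dd A (dd A F) xs gs" by (intro dd_cong D_eq[OF F]) auto
    then show ?thesis using M.dd_dd[of F xs gs, OF tot_closed[OF F]] by simp
  qed
  then show "D (D F) xs gs = \<zero>\<^bsub>TC\<^esub> xs gs" by (simp add: D_def[of "D F"] tot_simps)
qed

definition Cn :: "int \<Rightarrow> ('q list \<Rightarrow> 'g list \<Rightarrow> 'a) set"
  where "Cn n = {F \<in> carrier TC. \<forall>xs gs. int (length xs) + int (length gs) \<noteq> n + 2 \<longrightarrow> F xs gs = \<zero>\<^bsub>A\<^esub>}"

text \<open>The filtration by columns: a list with \<open>p + 1\<close> entries belongs to column
  \<open>p\<close>, so the functions in \<open>Fl p\<close> vanish in all columns before
  \<open>p\<close>. The same shift, once for each list, is the \<open>+ 2\<close> in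
  \<open>Cn\<close>.\<close>

definition Fl :: "int \<Rightarrow> ('q list \<Rightarrow> 'g list \<Rightarrow> 'a) set"
  where "Fl p = {F \<in> carrier TC. \<forall>xs gs. int (length xs) \<le> p \<longrightarrow> F xs gs = \<zero>\<^bsub>A\<^esub>}"

lemma left_module_TC: "left_module R TC"
  using seminormed_module_tot by (simp add: seminormed_module_def)

lemma submodule_support:
  "submodule {F \<in> carrier TC. \<forall>xs gs. P xs gs \<longrightarrow> F xs gs = \<zero>\<^bsub>A\<^esub>} R TC"
proof -
  interpret T: left_module R TC by (rule left_module_TC)
  show ?thesis
  proof (rule T.submoduleI)
    show "\<zero>\<^bsub>TC\<^esub> \<in> {F \<in> carrier TC. \<forall>xs gs. P xs gs \<longrightarrow> F xs gs = \<zero>\<^bsub>A\<^esub>}"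
      using tot_zero_closed by (simp add: tot_simps)
    fix F assume F: "F \<in> {F \<in> carrier TC. \<forall>xs gs. P xs gs \<longrightarrow> F xs gs = \<zero>\<^bsub>A\<^esub>}"
    then have c: "F \<in> carrier TC" by simp
    show "\<ominus>\<^bsub>TC\<^esub> F \<in> {F \<in> carrier TC. \<forall>xs gs. P xs gs \<longrightarrow> F xs gs = \<zero>\<^bsub>A\<^esub>}"
      using F tot_a_inv_closed[OF c] by (simp add: tot_a_inv[OF c] M.a_inv_zero)
    {
      fix F' assume F': "F' \<in> {F \<in> carrier TC. \<forall>xs gs. P xs gs \<longrightarrow> F xs gs = \<zero>\<^bsub>A\<^esub>}"
      show "F \<oplus>\<^bsub>TC\<^esub> F' \<in> {F \<in> carrier TC. \<forall>xs gs. P xs gs \<longrightarrow> F xs gs = \<zero>\<^bsub>A\<^esub>}"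
        using F F' tot_add_closed[OF c, of F'] by (simp add: tot_simps)
    next
      fix a assume a: "a \<in> carrier R"
      show "a \<odot>\<^bsub>TC\<^esub> F \<in> {F \<in> carrier TC. \<forall>xs gs. P xs gs \<longrightarrow> F xs gs = \<zero>\<^bsub>A\<^esub>}"
        using F tot_smult_closed[OF c a] smult_zero[OF a] by (simp add: tot_simps)
    }
  qed auto
qed

sublocale tc: filtered_complex R TC Cn Fl D
proof (intro filtered_complex.intro left_module_TC filtered_complex_axioms.intro)
  show "submodule (Cn n) R TC" for n unfolding Cn_def by (rule submodule_support)
  show "submodule (Fl n) R TC" for n unfolding Fl_def by (rule submodule_support)
  show "D F \<in> carrier TC" if "F \<in> carrier TC" for F using that by (rule D_closed)
  show "D F \<in> Cn (n + 1)" if "F \<in> Cn n" for F n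
    using that D_closed[of F] by (auto simp: Cn_def D_def intro!: dd_zero)
  show "D F \<in> Fl p" if "F \<in> Fl p" for F p
    using that D_closed[of F] by (auto simp: Fl_def D_def intro!: dd_zero)
  show "Fl p' \<subseteq> Fl p" if "p \<le> p'" for p p' using that by (auto simp: Fl_def)
  show "Cn n \<subseteq> Fl p" if "p \<le> 0" for n p
  proof
    fix F assume F: "F \<in> Cn n"
    have "F xs gs = \<zero>\<^bsub>A\<^esub>" if "int (length xs) \<le> p" for xs gs
      using that \<open>p \<le> 0\<close> F by (intro tot_zero) (auto simp: Cn_def supp_def dest: order_trans)
    then show "F \<in> Fl p" using F by (simp add: Cn_def Fl_def)
  qed
  show "Cn n \<inter> Fl p \<subseteq> {\<zero>\<^bsub>TC\<^esub>}" if "n < p" for n p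
  proof
    fix F assume F: "F \<in> Cn n \<inter> Fl p"
    then have c: "F \<in> carrier TC" by (simp add: Cn_def)
    have "F xs gs = \<zero>\<^bsub>A\<^esub>" for xs gs
    proof (cases "supp xs gs \<and> int (length xs) + int (length gs) = n + 2")
      case True
      then have "length gs \<ge> 1" by (cases gs) (auto simp: supp_def)
      then have "int (length xs) \<le> p" using True that by linarith
      then show ?thesis using F by (simp add: Fl_def)
    qed (use F in \<open>auto simp: Cn_def tot_zero\<close>)
    then show "F \<in> {\<zero>\<^bsub>TC\<^esub>}" by (auto simp: tot_simps)
  qed
qed (simp_all add: D_add D_smult D_D)

text \<open>Different pages and bidegrees share one module and differ in the seminorm, which sees
  only the component in bidegree \<open>(p, q)\<close>. For a cycle in filtration \<open>p\<close>
  and total degree \<open>p + q\<close> this is the leading component; what happens in later columns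
  has no influence on its size. Negative indices are cut to 0, where the terms vanish
  anyway.\<close>

definition E :: "nat \<Rightarrow> int \<Rightarrow> int \<Rightarrow> ('r, ('q list \<Rightarrow> 'g list \<Rightarrow> 'a) set) seminormed_module"
  where "E r p q = seminormed_subquotient (tot (nat p) (nat q)) (tc.cyc (int r) p (p + q)) (tc.bdy (int r) p (p + q))"

lemma submodule_tot: "submodule H R (tot p q) \<longleftrightarrow> submodule H R TC"
  by (simp add: submodule_def submodule_axioms_def add_monoid_tot[of p q] smult_tot[of p q])

lemma seminormed_subquotient_module_E:
  "seminormed_subquotient_module R (tot (nat p) (nat q)) (tc.cyc (int r) p (p + q)) (tc.bdy (int r) p (p + q)) (E r p q)"
  unfolding E_def
  by (intro seminormed_module.seminormed_subquotient_moduleI seminormed_module_tot)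
    (simp_all only: submodule_tot[of _ "nat p" "nat q"] tc.submodule_cyc tc.submodule_bdy)

lemma coset_tot: "B +>\<^bsub>tot p q\<^esub> F = B +>\<^bsub>TC\<^esub> F"
  by (simp add: a_r_coset_def add_monoid_tot[of p q])

sublocale ss: filtered_complex_pages R TC Cn Fl D E
proof
  fix r p q
  have "is_subquotient (E r p q) (tot (nat p) (nat q)) (tc.cyc (int r) p (p + q)) (tc.bdy (int r) p (p + q))"
    unfolding E_def by (rule is_subquotient_seminormed_subquotient)
  then show "is_subquotient (E r p q) TC (tc.cyc (int r) p (p + q)) (tc.bdy (int r) p (p + q))"
    by (simp add: is_subquotient_def coset_tot[of "nat p" "nat q"] set_add_def
        add_monoid_tot[of "nat p" "nat q"] smult_tot[of "nat p" "nat q"])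
qed

end

section \<open>Convergence to the bounded cohomology of the group\<close>

lemma (in seminormed_group_module) aw_equivariant:
  assumes "h \<in> carrier G" "\<And>xs ys. F xs ys \<in> carrier A"
    "\<And>xs ys. set xs \<subseteq> \<pi> ` T \<Longrightarrow> set ys \<subseteq> T \<Longrightarrow> F' (map j xs) (map k ys) = act h (F xs ys)"
    "set us \<subseteq> T" "\<And>u. u \<in> T \<Longrightarrow> \<pi> (k u) = j (\<pi> u)"
  shows "aw A \<pi> F' (map k us) = act h (aw A \<pi> F us)"
  using assms(2-4)
proof (induction us arbitrary: F F')
  case Nil
  then show ?case using assms(1) by (simp add: act_zero)
next
  case (Cons u us)
  have u: "u \<in> T" "\<pi> (k u) = j (\<pi> u)" "set us \<subseteq> T" using Cons.prems assms(5) by auto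
  have "aw A \<pi> (\<lambda>ys. F' (j (\<pi> u) # ys)) (map k us) = act h (aw A \<pi> (\<lambda>ys. F (\<pi> u # ys)) us)"
  proof (rule Cons.IH)
    show "F' (j (\<pi> u) # map j xs) (map k ys) = act h (F (\<pi> u # xs) ys)"
      if "set xs \<subseteq> \<pi> ` T" "set ys \<subseteq> T" for xs ys
      using Cons.prems(2)[of "\<pi> u # xs" ys] that u by simp
  qed (use Cons.prems u in auto)
  moreover have "F' [j (\<pi> u)] (k u # map k us) = act h (F [\<pi> u] (u # us))"
    using Cons.prems(2)[of "[\<pi> u]" "u # us"] u by simp
  ultimately show ?case using Cons.prems(1) assms(1) u by (simp add: act_add)
qed

lemma (in abelian_group) aw_zero: "aw G \<pi> (\<lambda>_ _. \<zero>) gs = \<zero>"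
  by (induction gs) auto

section \<open>The Alexander-Whitney chain map to the cochains of the group\<close>

context extension_module
begin

sublocale whole: subgroup_module R G A act G id
  by (intro subgroup_module.intro seminormed_group_module_axioms G.group_axioms
      subgroup_module_axioms.intro) (auto simp: mon_def hom_def)

lemma whole_lies_in_coset: "whole.lies_in_coset n us \<longleftrightarrow> set us \<subseteq> carrier G \<and> length us = Suc n"
  using G.diffs_closed[of us] by (auto simp: whole.lies_in_coset_iff)

text \<open>Elements of \<open>tot\<close> are bounded in each bidegree separately, whereas the
  Alexander-Whitney sum mixes bidegrees. Only finitely many share a total length, and the sum of
  their nonnegative bounds dominates each.\<close>

lemma tot_bounded_total:
  assumes F: "F \<in> carrier TC"
  obtains b where "\<And>xs gs. length xs + length gs = N \<Longrightarrow> seminorm A (F xs gs) \<le> b"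
proof -
  have "\<exists>b. 0 \<le> b \<and> (\<forall>xs gs. length xs = i \<longrightarrow> length gs = N - i \<longrightarrow> seminorm A (F xs gs) \<le> b)" for i
    by (rule tot_bounded[OF F, of i "N - i"]) blast
  then obtain b where b: "\<And>i. 0 \<le> b i"
    "\<And>i xs gs. length xs = i \<Longrightarrow> length gs = N - i \<Longrightarrow> seminorm A (F xs gs) \<le> b i" by metis
  have "seminorm A (F xs gs) \<le> (\<Sum>i\<le>N. b i)" if "length xs + length gs = N" for xs gs
  proof -
    have "seminorm A (F xs gs) \<le> b (length xs)" using that by (intro b(2)) auto
    also have "\<dots> \<le> (\<Sum>i\<le>N. b i)" using that b(1) by (intro member_le_sum) auto
    finally show ?thesis .
  qed
  then show thesis by (rule that)
qed

definition ihaw :: "nat \<Rightarrow> ('q list \<Rightarrow> 'g list \<Rightarrow> 'a) \<Rightarrow> 'g list \<Rightarrow> 'a"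
  where "ihaw n F = whole.ih n (aw A \<pi> F)"

lemma ihaw_closed:
  assumes F: "F \<in> carrier TC" shows "ihaw n F \<in> carrier (whole.res.BC n)"
proof -
  obtain b where b: "\<And>xs gs. length xs + length gs = Suc (Suc n) \<Longrightarrow> seminorm A (F xs gs) \<le> b"
    by (rule tot_bounded_total[OF F, of "Suc (Suc n)"]) blast
  show ?thesis
    unfolding ihaw_def
  proof (rule whole.ih_closed)
    show "aw A \<pi> F us \<in> carrier A" for us by (intro M.aw_closed tot_closed[OF F])
    show "seminorm A (aw A \<pi> F us) \<le> real (Suc n) * b" if "length us = Suc n" for us
      using seminorm_aw[of F us b \<pi>] b tot_closed[OF F] that by simp
  qed
qed

lemma aw_D:
  assumes F: "F \<in> carrier TC" and gs: "set gs \<subseteq> carrier G"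
  shows "aw A \<pi> (D F) gs = dl A (aw A \<pi> F) gs"
proof -
  have "aw A \<pi> (D F) gs = aw A \<pi> (dd A F) gs"
  proof (rule M.aw_cong)
    fix xs ys assume "set xs \<subseteq> \<pi> ` set gs" "set ys \<subseteq> set gs"
    then show "D F xs ys = dd A F xs ys" using gs \<pi>_closed by (intro D_eq[OF F]) auto
  qed
  also have "\<dots> = F [] gs \<oplus>\<^bsub>A\<^esub> dl A (aw A \<pi> F) gs"
    by (rule M.aw_dd) (auto simp: tot_closed[OF F] tot_zero[OF F] supp_def)
  also have "\<dots> = dl A (aw A \<pi> F) gs" using tot_closed[OF F] by (simp add: tot_zero[OF F] supp_def)
  finally show ?thesis .
qed

lemma aw_tr:
  assumes F: "F \<in> carrier TC" and g: "g \<in> carrier G" and us: "set us \<subseteq> carrier G"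
  shows "aw A \<pi> F (trG g us) = act g (aw A \<pi> F us)"
proof (rule aw_equivariant[where T = "carrier G" and j = "\<lambda>x. \<pi> g \<otimes>\<^bsub>Q\<^esub> x"])
  show "F (trQ g xs) (trG g ys) = act g (F xs ys)" if "set xs \<subseteq> \<pi> ` carrier G" "set ys \<subseteq> carrier G" for xs ys
    using that \<pi>_closed by (intro tot_equivariant[OF F g]) auto
qed (use g us tot_closed[OF F] \<pi>_mult in auto)

lemma cob_ihaw:
  assumes F: "F \<in> carrier TC" shows "whole.cob n (ihaw n F) = ihaw (Suc n) (D F)"
proof -
  have pp_closed': "set (pp G \<one>\<^bsub>G\<^esub> ls) \<subseteq> carrier G" if "ls \<in> tuples G m" for ls m
    using that by (intro G.pp_closed) (auto simp: tuples_def)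
  have "whole.cob n (ihaw n F) = whole.ih (Suc n) (dl A (aw A \<pi> F))"
    unfolding ihaw_def
  proof (rule whole.coboundary_ih)
    fix s ls assume s: "s \<in> carrier G" and ls: "ls \<in> tuples G n"
    show "aw A \<pi> F (pp G (id s) (map id ls)) = act (id s) (aw A \<pi> F (pp G \<one>\<^bsub>G\<^esub> (map id ls)))"
      using aw_tr[OF F s pp_closed'[OF ls]] whole.pp_\<phi>_mult[OF s ls] by simp
  qed (use tot_closed[OF F] in simp)
  also have "\<dots> = ihaw (Suc n) (D F)"
    unfolding ihaw_def using pp_closed' by (intro whole.ih_cong) (simp add: aw_D[OF F])
  finally show ?thesis .
qed

lemma ihaw_add:
  assumes "F \<in> carrier TC" "F' \<in> carrier TC"
  shows "ihaw n (F \<oplus>\<^bsub>TC\<^esub> F') = ihaw n F \<oplus>\<^bsub>whole.res.BC n\<^esub> ihaw n F'"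
  using assms by (auto simp: ihaw_def whole.ih_def bounded_cochains_simps(3) tot_simps M.aw_add tot_closed
      intro!: restrict_ext)

lemma ihaw_smult:
  assumes "a \<in> carrier R" "F \<in> carrier TC"
  shows "ihaw n (a \<odot>\<^bsub>TC\<^esub> F) = a \<odot>\<^bsub>whole.res.BC n\<^esub> ihaw n F"
proof -
  have "a \<odot>\<^bsub>A\<^esub> aw A \<pi> F gs = aw A \<pi> (\<lambda>xs ys. a \<odot>\<^bsub>A\<^esub> F xs ys) gs" for gs
    using assms by (intro M.aw_hom M.abelian_group_axioms) (auto simp: smult_r_distr smult_closed tot_closed)
  then show ?thesis
    by (auto simp: ihaw_def whole.ih_def bounded_cochains_simps(4) tot_simps intro!: restrict_ext)
qed

lemma ihaw_zero: "ihaw n \<zero>\<^bsub>TC\<^esub> = \<zero>\<^bsub>whole.res.BC n\<^esub>"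
  by (auto simp: ihaw_def whole.ih_def bounded_cochains_simps(2) tot_simps M.aw_zero intro!: restrict_ext)

text \<open>Places a homogeneous cochain of \<open>G\<close> in column 0, constant in the
  \<open>Q\<close>-coordinate. It is a one-sided inverse of the Alexander-Whitney map
  (\<open>aw_eps\<close>), and up to coboundaries every cocycle has this form
  (\<open>cocycle_homologous_eps\<close>).\<close>

definition eps :: "('g list \<Rightarrow> 'a) \<Rightarrow> 'q list \<Rightarrow> 'g list \<Rightarrow> 'a"
  where "eps c xs gs = (if supp xs gs \<and> length xs = 1 then c gs else \<zero>\<^bsub>A\<^esub>)"

lemma eps_closed:
  assumes c: "\<And>gs. c gs \<in> carrier A"
    and equiv: "\<And>g gs. g \<in> carrier G \<Longrightarrow> set gs \<subseteq> carrier G \<Longrightarrow> c (trG g gs) = act g (c gs)"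
    and b: "\<And>n. \<exists>b. \<forall>gs. length gs = n \<longrightarrow> seminorm A (c gs) \<le> b"
  shows "eps c \<in> carrier TC"
proof (rule totI)
  show "eps c (trQ g xs) (trG g gs) = act g (eps c xs gs)" if "g \<in> carrier G" "supp xs gs" for g xs gs
  proof -
    have "supp (trQ g xs) (trG g gs)" "set gs \<subseteq> carrier G" using that supp_tr[OF that(1), of xs gs] by (simp_all add: supp_def)
    then show ?thesis using that equiv by (simp add: eps_def act_zero)
  qed
  show "\<exists>b. \<forall>xs gs. length xs = m \<longrightarrow> length gs = n \<longrightarrow> seminorm A (eps c xs gs) \<le> b" for m n
  proof -
    obtain b' where "\<forall>gs. length gs = n \<longrightarrow> seminorm A (c gs) \<le> b'" using b by blast
    then have "\<forall>xs gs. length xs = m \<longrightarrow> length gs = n \<longrightarrow> seminorm A (eps c xs gs) \<le> max 0 b'"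
      by (auto simp: eps_def seminorm_zero le_max_iff_disj)
    then show ?thesis by blast
  qed
qed (use c in \<open>auto simp: eps_def\<close>)

text \<open>In column 1 the horizontal part is a difference of two equal values, as
  \<open>eps c\<close> does not depend on the \<open>Q\<close>-coordinate. What remains is the
  vertical part in column 0, where its sign is positive.\<close>

lemma D_eps:
  assumes c: "\<And>gs. c gs \<in> carrier A" and c0: "c [] = \<zero>\<^bsub>A\<^esub>"
  shows "D (eps c) = eps (dl A c)"
proof (intro ext)
  fix xs gs
  have ec: "eps c ys hs \<in> carrier A" for ys hs using c by (simp add: eps_def)
  have "dd A (eps c) xs gs = (if length xs = 1 then dl A c gs else \<zero>\<^bsub>A\<^esub>)" if s: "supp xs gs"
  proof -
    have 1: "dl A (\<lambda>ys. eps c ys gs) xs = \<zero>\<^bsub>A\<^esub>"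
    proof (cases "length xs = 2")
      case True
      then obtain x y where xs: "xs = [x, y]" by (auto simp: length_Suc_conv numeral_2_eq_2)
      have "eps c [x] gs = eps c [y] gs" using s xs by (auto simp: eps_def supp_def)
      then show ?thesis using ec by (simp add: xs a_minus_def M.a_inv_zero M.r_neg)
    next
      case False
      then show ?thesis by (intro M.dl_zero) (auto simp: eps_def)
    qed
    have 2: "dl A (eps c xs) gs = (if length xs = 1 then dl A c gs else \<zero>\<^bsub>A\<^esub>)"
    proof (cases "length xs = 1")
      case True
      have "eps c xs hs = c hs" if "set hs \<subseteq> set gs" for hs
        using that s True c0 by (cases "hs = []") (auto simp: eps_def supp_def)
      then have "dl A (eps c xs) gs = dl A c gs" by (intro M.dl_cong)
      then show ?thesis using True by simp
    next
      case False
      then show ?thesis by (auto intro!: M.dl_zero simp: eps_def)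
    qed
    show ?thesis unfolding dd_def 1 2 using c by (auto simp: alt_sign_def M.a_inv_zero)
  qed
  then show "D (eps c) xs gs = eps (dl A c) xs gs" by (simp add: D_def eps_def[of "dl A c"])
qed

text \<open>In all summands except the first, the list of \<open>Q\<close>-coordinates has at least
  two entries, and there \<open>eps\<close> is zero.\<close>

lemma aw_eps:
  assumes c: "\<And>gs. c gs \<in> carrier A" and gs: "gs \<noteq> []" "set gs \<subseteq> carrier G"
  shows "aw A \<pi> (eps c) gs = c gs"
proof -
  obtain g gs' where g: "gs = g # gs'" using gs by (cases gs) auto
  have "aw A \<pi> (\<lambda>ys. eps c (\<pi> g # ys)) gs' = aw A \<pi> (\<lambda>_ _. \<zero>\<^bsub>A\<^esub>) gs'"
    by (rule M.aw_cong) (auto simp: eps_def)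
  moreover have "eps c [\<pi> g] gs = c gs" using gs g \<pi>_closed by (auto simp: eps_def supp_def)
  ultimately show ?thesis using g c by (simp add: M.aw_zero)
qed

lemma eps_hg_closed:
  assumes f: "f \<in> carrier (whole.res.BC n)"
  shows "eps (whole.hg n f) \<in> Cn (int n)"
proof -
  have "eps (whole.hg n f) \<in> carrier TC"
    using whole.hg_closed[OF f] whole.hg_mult[OF f] whole.seminorm_hg[OF f] by (intro eps_closed) blast+
  then show ?thesis by (auto simp: Cn_def eps_def whole.hg_def whole_lies_in_coset)
qed

lemma D_eps_hg:
  assumes f: "f \<in> carrier (whole.res.BC n)"
  shows "D (eps (whole.hg n f)) = eps (whole.hg (Suc n) (whole.cob n f))"
proof -
  have "D (eps (whole.hg n f)) = eps (dl A (whole.hg n f))"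
    by (rule D_eps) (rule whole.hg_closed[OF f], simp add: whole.hg_def whole_lies_in_coset)
  also have "\<dots> = eps (whole.hg (Suc n) (whole.cob n f))"
  proof (intro ext)
    fix xs gs
    have "dl A (whole.hg n f) gs = whole.hg (Suc n) (whole.cob n f) gs" if "set gs \<subseteq> carrier G"
    proof (cases "length gs = Suc (Suc n)")
      case True
      then show ?thesis using that by (intro whole.dl_hg[OF f]) (simp add: whole_lies_in_coset)
    next
      case False
      then have "dl A (whole.hg n f) gs = \<zero>\<^bsub>A\<^esub>"
        by (intro M.dl_zero) (auto simp: whole.hg_def whole_lies_in_coset)
      then show ?thesis using False by (simp add: whole.hg_def whole_lies_in_coset)
    qed
    then show "eps (dl A (whole.hg n f)) xs gs = eps (whole.hg (Suc n) (whole.cob n f)) xs gs"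
      by (auto simp: eps_def supp_def)
  qed
  finally show ?thesis .
qed

text \<open>The contraction of the rows of the double complex.\<close>

definition hop :: "('q list \<Rightarrow> 'g list \<Rightarrow> 'a) \<Rightarrow> 'q list \<Rightarrow> 'g list \<Rightarrow> 'a"
  where "hop F xs gs = (if supp xs gs then F (\<pi> (hd gs) # xs) gs else \<zero>\<^bsub>A\<^esub>)"

lemma hop_closed: assumes F: "F \<in> Cn n" shows "hop F \<in> Cn (n - 1)"
proof -
  have c: "F \<in> carrier TC" using F by (simp add: Cn_def)
  have "hop F \<in> carrier TC"
  proof (rule totI)
    show "hop F (trQ g xs) (trG g gs) = act g (hop F xs gs)" if "g \<in> carrier G" "supp xs gs" for g xs gs
    proof -
      have h: "hd gs \<in> carrier G" "gs \<noteq> []" using that by (auto simp: supp_def)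
      have "trQ g (\<pi> (hd gs) # xs) = \<pi> (hd (trG g gs)) # trQ g xs"
        using that h by (simp add: \<pi>_mult hd_map)
      then have "F (\<pi> (hd (trG g gs)) # trQ g xs) (trG g gs) = act g (F (\<pi> (hd gs) # xs) gs)"
        using tot_equivariant[OF c that(1), of "\<pi> (hd gs) # xs" gs] that(2) h \<pi>_closed
        by (simp add: supp_def)
      then show ?thesis using that supp_tr[OF that(1), of xs gs] by (simp add: hop_def supp_def)
    qed
    show "\<exists>b. \<forall>xs gs. length xs = m \<longrightarrow> length gs = k \<longrightarrow> seminorm A (hop F xs gs) \<le> b" for m k
    proof -
      obtain b where b: "0 \<le> b" "length xs = Suc m \<Longrightarrow> length gs = k \<Longrightarrow> seminorm A (F xs gs) \<le> b" for xs gs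
        by (rule tot_bounded[OF c, of "Suc m" k]) blast
      then show ?thesis by (intro exI[of _ b]) (auto simp: hop_def seminorm_zero)
    qed
  qed (auto simp: hop_def tot_closed[OF c])
  then show ?thesis using F by (auto simp: Cn_def hop_def)
qed

text \<open>Downward induction on the last column that \<open>F\<close> occupies. There
  \<open>D F = 0\<close>, evaluated with \<open>\<pi> (hd gs)\<close> prepended to
  \<open>xs\<close>, has no vertical part left, so it states that \<open>F\<close> equals the
  horizontal differential of \<open>hop F\<close>. Subtracting \<open>D (hop F)\<close> clears this
  column.\<close>

lemma reduce_to_first_column:
  assumes "F \<in> Cn n" "D F = \<zero>\<^bsub>TC\<^esub>" "\<And>xs gs. length xs > Suc k \<Longrightarrow> F xs gs = \<zero>\<^bsub>A\<^esub>"
  shows "\<exists>u\<in>Cn (n - 1). \<forall>xs gs. length xs > 1 \<longrightarrow> (F \<ominus>\<^bsub>TC\<^esub> D u) xs gs = \<zero>\<^bsub>A\<^esub>"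
  using assms
proof (induction k arbitrary: F)
  case 0
  have "F \<ominus>\<^bsub>TC\<^esub> D \<zero>\<^bsub>TC\<^esub> = F"
    using tc.C_closed(1)[OF 0(1)] by (simp add: tc.D_zero a_minus_def tc.M.a_inv_zero)
  then show ?case using 0 tc.C_closed(2) by (intro bexI[of _ "\<zero>\<^bsub>TC\<^esub>"]) auto
next
  case (Suc k)
  have c: "F \<in> carrier TC" using Suc.prems by (simp add: Cn_def)
  note h = hop_closed[OF Suc.prems(1)]
  have hc: "hop F \<in> carrier TC" using h by (simp add: Cn_def)
  have Dh: "D (hop F) \<in> Cn n" using tc.D_C[OF h] by simp
  let ?F = "F \<ominus>\<^bsub>TC\<^esub> D (hop F)"
  have F1: "?F \<in> Cn n" using tc.C_closed(5)[OF Suc.prems(1) Dh] .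
  have D1: "D ?F = \<zero>\<^bsub>TC\<^esub>"
    using c hc Suc.prems(2) by (simp add: tc.D_diff tc.D_closed tc.D_D) (simp add: a_minus_def tc.M.a_inv_zero)
  have z: "?F xs gs = \<zero>\<^bsub>A\<^esub>" if len: "length xs > Suc k" for xs gs
  proof (cases "supp xs gs")
    case True
    then have g: "gs \<noteq> []" "hd gs \<in> carrier G" by (auto simp: supp_def)
    let ?x = "\<pi> (hd gs)"
    \<comment> \<open>Every value of \<open>hop F\<close> in this column is a value of
      \<open>F\<close> one column further to the right, where \<open>F\<close> is zero.\<close>
    have 2: "dl A (hop F xs) gs = \<zero>\<^bsub>A\<^esub>"
      using len by (intro M.dl_zero) (auto simp: hop_def intro!: Suc.prems(3))
    have "dl A (\<lambda>ys. hop F ys gs) xs = dl A (\<lambda>ys. F (?x # ys) gs) xs"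
    proof (rule M.dl_cong)
      fix ys assume "set ys \<subseteq> set xs" "Suc (length ys) = length xs"
      then have "supp ys gs" using True len by (auto simp: supp_def)
      then show "hop F ys gs = F (?x # ys) gs" by (simp add: hop_def)
    qed
    also have "\<dots> = F xs gs \<ominus>\<^bsub>A\<^esub> dl A (\<lambda>ys. F ys gs) (?x # xs)"
    proof -
      have "v = u \<ominus>\<^bsub>A\<^esub> (u \<ominus>\<^bsub>A\<^esub> v)" if "u \<in> carrier A" "v \<in> carrier A" for u v using that by algebra
      then show ?thesis using tot_closed[OF c] by simp
    qed
    also have "dl A (\<lambda>ys. F ys gs) (?x # xs) = \<zero>\<^bsub>A\<^esub>"
    proof -
      have s: "supp (?x # xs) gs" using True g \<pi>_closed by (auto simp: supp_def)
      have "dl A (F (?x # xs)) gs = \<zero>\<^bsub>A\<^esub>"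
        using len by (intro M.dl_zero Suc.prems(3)) auto
      moreover have "dd A F (?x # xs) gs = \<zero>\<^bsub>A\<^esub>"
        using fun_cong[OF fun_cong[OF Suc.prems(2)], of "?x # xs" gs] s by (simp add: D_def tot_simps)
      ultimately show ?thesis
        using M.dl_closed[of "\<lambda>ys. F ys gs" "?x # xs"] tot_closed[OF c] by (simp add: dd_def del: dl.simps)
    qed
    finally have 1: "dl A (\<lambda>ys. hop F ys gs) xs = F xs gs"
      using tot_closed[OF c] by (simp add: a_minus_def M.a_inv_zero)
    show ?thesis
      unfolding tot_diff[OF tc.D_closed[OF hc]]
      using True tot_closed[OF c] by (simp add: D_def dd_def 1 2 a_minus_def M.r_neg)
  next
    case False
    then show ?thesis using F1 by (simp add: Cn_def tot_zero)
  qed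
  obtain u where u: "u \<in> Cn (n - 1)" "\<forall>xs gs. length xs > 1 \<longrightarrow> (?F \<ominus>\<^bsub>TC\<^esub> D u) xs gs = \<zero>\<^bsub>A\<^esub>"
    using Suc.IH[OF F1 D1 z] by blast
  have uc: "u \<in> carrier TC" using u by (simp add: Cn_def)
  have "?F \<ominus>\<^bsub>TC\<^esub> D u = F \<ominus>\<^bsub>TC\<^esub> D (hop F \<oplus>\<^bsub>TC\<^esub> u)"
  proof -
    have "(f \<ominus>\<^bsub>TC\<^esub> v) \<ominus>\<^bsub>TC\<^esub> w = f \<ominus>\<^bsub>TC\<^esub> (v \<oplus>\<^bsub>TC\<^esub> w)"
      if "f \<in> carrier TC" "v \<in> carrier TC" "w \<in> carrier TC" for f v w using that by algebra
    then show ?thesis using c hc uc by (simp add: tc.D_add tc.D_closed)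
  qed
  then show ?case using u tc.C_closed(4)[OF h u(1)] by metis
qed

text \<open>Once only column 0 is left, the cocycle condition in column 1 says precisely that the
  values do not depend on the \<open>Q\<close>-coordinate, which is the form
  \<open>eps c\<close>.\<close>

lemma cocycle_homologous_eps:
  assumes F: "F \<in> Cn n" "D F = \<zero>\<^bsub>TC\<^esub>"
  obtains u c where "u \<in> Cn (n - 1)" "F = D u \<oplus>\<^bsub>TC\<^esub> eps c" "\<And>gs. c gs \<in> carrier A"
    "\<And>g gs. g \<in> carrier G \<Longrightarrow> set gs \<subseteq> carrier G \<Longrightarrow> c (trG g gs) = act g (c gs)"
    "\<And>gs. int (length gs) \<noteq> n + 1 \<Longrightarrow> c gs = \<zero>\<^bsub>A\<^esub>" "c [] = \<zero>\<^bsub>A\<^esub>"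
proof -
  \<comment> \<open>In total degree \<open>n\<close> the two lists have \<open>n + 2\<close> entries
    together, so no later column is occupied.\<close>
  have "F xs gs = \<zero>\<^bsub>A\<^esub>" if "length xs > Suc (nat (n + 2))" for xs gs
    using F(1) that by (simp add: Cn_def)
  from reduce_to_first_column[OF F this] obtain u where
    u: "u \<in> Cn (n - 1)" "\<And>xs gs. length xs > 1 \<Longrightarrow> (F \<ominus>\<^bsub>TC\<^esub> D u) xs gs = \<zero>\<^bsub>A\<^esub>" by blast
  let ?F = "F \<ominus>\<^bsub>TC\<^esub> D u"
  have c: "F \<in> carrier TC" "u \<in> carrier TC" using F u by (auto simp: Cn_def)
  have Du: "D u \<in> Cn n" using tc.D_C[OF u(1)] by simp
  have F1: "?F \<in> Cn n" using tc.C_closed(5)[OF F(1) Du] .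
  have Fc: "?F \<in> carrier TC" using F1 by (simp add: Cn_def)
  have D1: "D ?F = \<zero>\<^bsub>TC\<^esub>"
    using c F(2) by (simp add: tc.D_diff tc.D_closed tc.D_D) (simp add: a_minus_def tc.M.a_inv_zero)
  have const: "?F [x] gs = ?F [y] gs" if "x \<in> carrier Q" "y \<in> carrier Q" "gs \<noteq> []" "set gs \<subseteq> carrier G" for x y gs
  proof -
    have s: "supp [x, y] gs" using that by (auto simp: supp_def)
    have "dd A ?F [x, y] gs = \<zero>\<^bsub>A\<^esub>"
      using fun_cong[OF fun_cong[OF D1], of "[x, y]" gs] s by (simp add: D_def tot_simps)
    moreover have "dl A (?F [x, y]) gs = \<zero>\<^bsub>A\<^esub>" by (rule M.dl_zero) (rule u(2), simp)
    ultimately have "?F [y] gs \<ominus>\<^bsub>A\<^esub> ?F [x] gs = \<zero>\<^bsub>A\<^esub>"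
      using tot_closed[OF Fc] by (simp add: dd_def a_minus_def M.a_inv_zero)
    then show ?thesis using M.diff_add_cancel_right[of "?F [y] gs" "?F [x] gs"] tot_closed[OF Fc] by simp
  qed
  define c where "c = ?F [\<one>\<^bsub>Q\<^esub>]"
  have cc: "c gs \<in> carrier A" for gs by (simp add: c_def tot_closed[OF Fc])
  have ceq: "c (trG g gs) = act g (c gs)" if g: "g \<in> carrier G" and gs: "set gs \<subseteq> carrier G" for g gs
  proof (cases "gs = []")
    case True
    then show ?thesis using g by (simp add: c_def tot_zero[OF Fc] supp_def act_zero)
  next
    case False
    \<comment> \<open>Translation by \<open>g\<close> moves the chosen \<open>Q\<close>-coordinate
      from the unit to \<open>\<pi> g\<close>; independence of this coordinate has to be used before
      equivariance.\<close>
    have "c (trG g gs) = ?F [\<pi> g] (trG g gs)"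
      unfolding c_def using g gs False \<pi>_closed by (intro const) auto
    also have "\<dots> = act g (c gs)"
      using tot_equivariant[OF Fc g, of "[\<one>\<^bsub>Q\<^esub>]" gs] gs g \<pi>_closed by (simp add: c_def)
    finally show ?thesis .
  qed
  have "?F = eps c"
  proof (intro ext)
    fix xs gs
    show "?F xs gs = eps c xs gs"
    proof (cases "supp xs gs \<and> length xs = 1")
      case True
      then obtain x where "xs = [x]" by (cases xs) auto
      then show ?thesis using True const[of x "\<one>\<^bsub>Q\<^esub>" gs] by (auto simp: eps_def c_def supp_def)
    next
      case False
      then have "\<not> supp xs gs \<or> length xs > 1" by (cases xs) (auto simp: supp_def)
      then show ?thesis using False u(2) tot_zero[OF Fc] by (auto simp: eps_def)
    qed
  qed
  then have "F = D u \<oplus>\<^bsub>TC\<^esub> eps c"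
    using tc.M.diff_add_cancel_right[OF c(1) tc.D_closed[OF c(2)]] Fc tc.D_closed[OF c(2)] tc.M.a_comm by metis
  moreover have "c gs = \<zero>\<^bsub>A\<^esub>" if "int (length gs) \<noteq> n + 1" for gs
    using F1 that by (simp add: c_def Cn_def)
  moreover have "c [] = \<zero>\<^bsub>A\<^esub>" by (simp add: c_def tot_zero[OF Fc] supp_def)
  ultimately show thesis using that[OF u(1)] cc ceq by blast
qed

definition \<Psi> :: "nat \<Rightarrow> ('q list \<Rightarrow> 'g list \<Rightarrow> 'a) \<Rightarrow> ('g list \<Rightarrow> 'a) set"
  where "\<Psi> n F = whole.H.cls n (ihaw n F)"

text \<open>Surjectivity holds because \<open>eps\<close> is a right inverse of the
  Alexander-Whitney map. For the kernel, write a cocycle as \<open>D u \<oplus> eps c\<close>: its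
  image is the coboundary of the image of \<open>u\<close> plus \<open>c\<close>. If the image is a
  coboundary, so is \<open>c\<close>, and a primitive of \<open>c\<close>, embedded by
  \<open>eps\<close>, corrects \<open>u\<close> to a primitive of the cocycle.\<close>

theorem converges_to_cohomology: "converges_to R E (bounded_cohomology G A (act \<circ> id))"
proof (rule ss.converges[where \<Psi> = \<Psi>])
  \<comment> \<open>The facts of \<open>whole\<close> speak of \<open>act \<circ> id\<close>;
    simplifying this to \<open>act\<close> would keep them from matching.\<close>
  note comp_id [simp del]
  fix n
  show "left_module R (whole.Hc n)" by (rule whole.H.left_module_N)
  have TCc: "F \<in> carrier TC" if "F \<in> Cn k" for F k using that by (simp add: Cn_def)
  have cyc: "ihaw n F \<in> whole.Zc n" if "F \<in> Cn (int n)" "D F = \<zero>\<^bsub>TC\<^esub>" for F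
    unfolding whole.cocycle_iff using that ihaw_closed[OF TCc] cob_ihaw[OF TCc] ihaw_zero by metis
  {
    fix F assume F: "F \<in> Cn (int n)" "D F = \<zero>\<^bsub>TC\<^esub>"
    note z = cyc[OF F]
    show "\<Psi> n F \<in> carrier (whole.Hc n)" using z by (simp add: \<Psi>_def whole.H.cls_closed)
    {
      fix F' assume F': "F' \<in> Cn (int n)" "D F' = \<zero>\<^bsub>TC\<^esub>"
      show "\<Psi> n (F \<oplus>\<^bsub>TC\<^esub> F') = \<Psi> n F \<oplus>\<^bsub>whole.Hc n\<^esub> \<Psi> n F'"
        using F F' z cyc[OF F'] TCc by (simp add: \<Psi>_def ihaw_add whole.H.cls_add)
    next
      fix a assume "a \<in> carrier R"
      then show "\<Psi> n (a \<odot>\<^bsub>TC\<^esub> F) = a \<odot>\<^bsub>whole.Hc n\<^esub> \<Psi> n F"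
        using F z TCc by (simp add: \<Psi>_def ihaw_smult whole.H.cls_smult)
    }
    have "\<Psi> n F = \<zero>\<^bsub>whole.Hc n\<^esub> \<longleftrightarrow> ihaw n F \<in> whole.Bc n"
      using z by (simp add: \<Psi>_def whole.H.cls_eq_zero_iff)
    also have "\<dots> \<longleftrightarrow> (\<exists>w\<in>Cn (int n - 1). F = D w)"
    proof
      assume "\<exists>w\<in>Cn (int n - 1). F = D w"
      then obtain w where w: "w \<in> Cn (int n - 1)" "F = D w" by blast
      show "ihaw n F \<in> whole.Bc n"
      proof (cases n)
        case 0
        \<comment> \<open>Supported lists are nonempty and have at least two entries together, so
          the total complex is zero in degree -1.\<close>
        have "w xs gs = \<zero>\<^bsub>A\<^esub>" for xs gs
        proof (cases "supp xs gs")
          case True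
          then have "length xs \<ge> 1 \<and> length gs \<ge> 1" by (cases xs; cases gs) (auto simp: supp_def)
          then show ?thesis using w(1) 0 by (simp add: Cn_def)
        qed (use tot_zero[OF TCc[OF w(1)]] in simp)
        then have "w = \<zero>\<^bsub>TC\<^esub>" by (auto simp: tot_simps)
        then show ?thesis using w 0 by (simp add: tc.D_zero ihaw_zero)
      next
        case (Suc m)
        have "ihaw n F = whole.cob m (ihaw m w)" using Suc w TCc by (simp add: cob_ihaw)
        then show ?thesis using Suc ihaw_closed[OF TCc[OF w(1)]] by simp
      qed
    next
      assume B: "ihaw n F \<in> whole.Bc n"
      obtain u c where uc: "u \<in> Cn (int n - 1)" "F = D u \<oplus>\<^bsub>TC\<^esub> eps c" and c: "\<And>gs. c gs \<in> carrier A"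
        and equiv: "\<And>g gs. g \<in> carrier G \<Longrightarrow> set gs \<subseteq> carrier G \<Longrightarrow> c (trG g gs) = act g (c gs)"
        and supp_c: "\<And>gs. int (length gs) \<noteq> int n + 1 \<Longrightarrow> c gs = \<zero>\<^bsub>A\<^esub>"
        by (rule cocycle_homologous_eps[OF F]) blast
      have ppc: "set (pp G \<one>\<^bsub>G\<^esub> ls) \<subseteq> carrier G" if "ls \<in> tuples G n" for ls
        using that by (intro G.pp_closed) (auto simp: tuples_def)
      \<comment> \<open>An equivariant function is recovered from its values on partial products
        that start at the unit.\<close>
      have c_pp: "c us = act (hd us) (c (pp G \<one>\<^bsub>G\<^esub> (diffs G us)))" if "set us \<subseteq> carrier G" "us \<noteq> []" for us
      proof -
        have h: "hd us \<in> carrier G" using that by (auto simp: subset_iff)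
        have d: "set (diffs G us) \<subseteq> carrier G" using that by (intro G.diffs_closed)
        have "us = trG (hd us) (pp G \<one>\<^bsub>G\<^esub> (diffs G us))"
          using G.pp_diffs[OF that(2,1)] G.map_mult_pp[OF h G.one_closed d] h by simp
        then show ?thesis using equiv[OF h G.pp_closed[OF G.one_closed d]] by simp
      qed
      have eq: "ihaw n F ls = dl A (aw A \<pi> u) (pp G \<one>\<^bsub>G\<^esub> ls) \<oplus>\<^bsub>A\<^esub> c (pp G \<one>\<^bsub>G\<^esub> ls)" if "ls \<in> tuples G n" for ls
      proof -
        have "aw A \<pi> F (pp G \<one>\<^bsub>G\<^esub> ls) = aw A \<pi> (D u) (pp G \<one>\<^bsub>G\<^esub> ls) \<oplus>\<^bsub>A\<^esub> aw A \<pi> (eps c) (pp G \<one>\<^bsub>G\<^esub> ls)"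
          unfolding uc(2) tot_simps using tot_closed[OF tc.D_closed[OF TCc[OF uc(1)]]] c
          by (intro M.aw_add) (auto simp: eps_def)
        then show ?thesis
          using that aw_D[OF TCc[OF uc(1)] ppc[OF that]] aw_eps[OF c pp_neq_Nil ppc[OF that]]
          by (simp add: ihaw_def whole.ih_def)
      qed
      have Du: "D u \<in> carrier TC" using tc.D_closed TCc[OF uc(1)] .
      show "\<exists>w\<in>Cn (int n - 1). F = D w"
      proof (cases n)
        case 0
        have "c us = \<zero>\<^bsub>A\<^esub>" if us: "set us \<subseteq> carrier G" for us
        proof (cases "length us = 1")
          case True
          have l: "[] \<in> tuples G n" using 0 by (simp add: tuples_def)
          have "ihaw n F [] = \<zero>\<^bsub>A\<^esub>" using B 0 by (simp add: bounded_cochains_simps(2) tuples_def)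
          then have "c [\<one>\<^bsub>G\<^esub>] = \<zero>\<^bsub>A\<^esub>" using eq[OF l] c by (simp add: a_minus_def M.a_inv_zero)
          moreover have "diffs G us = []" "us \<noteq> []" using True by (cases us; auto)+
          ultimately show ?thesis using c_pp[OF us] us by (auto simp: act_zero subset_iff)
        qed (use supp_c[of us] 0 in auto)
        then have "eps c = \<zero>\<^bsub>TC\<^esub>" by (intro ext) (simp add: eps_def supp_def tot_simps)
        then have "F = D u" using uc(2) Du by simp
        then show ?thesis using uc(1) by blast
      next
        case (Suc m)
        obtain f where f: "f \<in> carrier (whole.res.BC m)" "ihaw n F = whole.cob m f" using B Suc by auto
        let ?v = "ihaw m u"
        have v: "?v \<in> carrier (whole.res.BC m)" by (rule ihaw_closed[OF TCc[OF uc(1)]])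
        let ?f = "f \<ominus>\<^bsub>whole.res.BC m\<^esub> ?v"
        have fv: "?f \<in> carrier (whole.res.BC m)"
          using f v whole.H.M.minus_closed by blast
        \<comment> \<open>On partial products, \<open>c\<close> is the image of \<open>F\<close>
          minus that of \<open>D u\<close>, hence the coboundary of \<open>f\<close> minus the
          Alexander-Whitney image of \<open>u\<close>. Equivariance extends this to all
          lists.\<close>
        have "c us = whole.hg n (whole.cob m ?f) us" if us: "set us \<subseteq> carrier G" "length us = Suc n" for us
        proof -
          let ?ls = "diffs G us"
          have ne: "us \<noteq> []" using us by auto
          have ls: "?ls \<in> tuples G n" using us G.diffs_closed[OF us(1)] by (simp add: tuples_def length_diffs)
          have cobv: "whole.cob m ?v ?ls = dl A (aw A \<pi> u) (pp G \<one>\<^bsub>G\<^esub> ?ls)"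
            unfolding cob_ihaw[OF TCc[OF uc(1)]]
            using ls Suc ppc[OF ls] by (simp add: ihaw_def whole.ih_def aw_D[OF TCc[OF uc(1)]])
          have dlc: "dl A (aw A \<pi> u) (pp G \<one>\<^bsub>G\<^esub> ?ls) \<in> carrier A"
            using tot_closed[OF TCc[OF uc(1)]] by (intro M.dl_closed M.aw_closed)
          have "whole.cob m ?f ?ls = whole.cob m f ?ls \<ominus>\<^bsub>A\<^esub> whole.cob m ?v ?ls"
            using ls Suc by (simp add: whole.cob_diff[OF f(1) v]
                whole.res.cochain_diff[OF whole.cob_closed(1)[OF f(1)] whole.cob_closed(1)[OF v]])
          also have "\<dots> = c (pp G \<one>\<^bsub>G\<^esub> ?ls)"
          proof -
            have "(x \<oplus>\<^bsub>A\<^esub> y) \<ominus>\<^bsub>A\<^esub> x = y" if "x \<in> carrier A" "y \<in> carrier A" for x y using that by algebra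
            then show ?thesis using eq[OF ls] f(2) cobv dlc c by simp
          qed
          finally have "whole.hg n (whole.cob m ?f) (pp G (hd us) (map id ?ls)) = c us"
            using c_pp[OF us(1) ne] whole.hg_pp[OF _ ls, of "hd us"] us(1) ne by (auto simp: subset_iff)
          then show ?thesis using G.pp_diffs[OF ne us(1)] by simp
        qed
        moreover have "c us = whole.hg n (whole.cob m ?f) us" if "length us \<noteq> Suc n" for us
          using that supp_c[of us] by (simp add: whole.hg_def whole_lies_in_coset)
        ultimately have "eps c = eps (whole.hg n (whole.cob m ?f))"
          by (intro ext) (auto simp: eps_def supp_def)
        also have "\<dots> = D (eps (whole.hg m ?f))" using D_eps_hg[OF fv] Suc by simp
        finally have "F = D (u \<oplus>\<^bsub>TC\<^esub> eps (whole.hg m ?f))"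
          using uc TCc[OF uc(1)] TCc[OF eps_hg_closed[OF fv]] by (simp add: tc.D_add)
        moreover have "u \<oplus>\<^bsub>TC\<^esub> eps (whole.hg m ?f) \<in> Cn (int n - 1)"
          using tc.C_closed(4)[OF uc(1)] eps_hg_closed[OF fv] Suc by simp
        ultimately show ?thesis by blast
      qed
    qed
    finally show "\<Psi> n F = \<zero>\<^bsub>whole.Hc n\<^esub> \<longleftrightarrow> (\<exists>w\<in>Cn (int n - 1). F = D w)" .
  next
    fix k assume "k \<in> carrier (whole.Hc n)"
    then obtain f where f: "f \<in> whole.Zc n" "k = whole.H.cls n f" by (rule whole.H.carrierE)
    have fc: "f \<in> carrier (whole.res.BC n)" "whole.cob n f = \<zero>\<^bsub>whole.res.BC (Suc n)\<^esub>"
      using f(1) by (auto simp: whole.cocycle_iff)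
    have "D (eps (whole.hg n f)) = \<zero>\<^bsub>TC\<^esub>"
      unfolding D_eps_hg[OF fc(1)] fc(2) by (intro ext) (simp add: eps_def whole.hg_zero tot_simps)
    moreover have "ihaw n (eps (whole.hg n f)) = f"
    proof -
      have "ihaw n (eps (whole.hg n f)) = whole.ih n (whole.hg n f)"
        unfolding ihaw_def
      proof (rule whole.ih_cong)
        fix ls assume "ls \<in> tuples G n"
        then show "aw A \<pi> (eps (whole.hg n f)) (pp G \<one>\<^bsub>G\<^esub> (map id ls)) = whole.hg n f (pp G \<one>\<^bsub>G\<^esub> (map id ls))"
          by (intro aw_eps whole.hg_closed[OF fc(1)] pp_neq_Nil G.pp_closed) (auto simp: tuples_def)
      qed
      then show ?thesis using whole.ih_hg[OF fc(1)] by simp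
    qed
    ultimately show "\<exists>x\<in>Cn (int n). D x = \<zero>\<^bsub>TC\<^esub> \<and> \<Psi> n x = k"
      using eps_hg_closed[OF fc(1)] f by (auto simp: \<Psi>_def)
  }
qed

end

section \<open>The second page\<close>

context seminormed_subquotient_module
begin

lemma dl_cls:
  assumes "\<And>ys. f ys \<in> Z"
  shows "dl M f xs \<in> Z \<and> dl N (\<lambda>ys. cls (f ys)) xs = cls (dl M f xs)"
  using assms
proof (induction xs arbitrary: f)
  case Nil
  then show ?case using submodule_closed(2)[OF Z] cls_zero by simp
next
  case (Cons x xs)
  then show ?case using submodule_closed(5)[OF Z] by (simp add: cls_diff)
qed

end

lemma (in seminormed_group_module) dl_cochains_apply:
  assumes "\<And>ys. f ys \<in> carrier (BC n)" "gs \<in> tuples G n"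
  shows "dl (BC n) f xs gs = dl A (\<lambda>ys. f ys gs) xs"
  using assms(1)
proof (induction xs arbitrary: f)
  case Nil
  then show ?case using assms(2) by (simp add: bounded_cochains_simps(2))
next
  case (Cons x xs)
  have "dl (BC n) (\<lambda>ys. f (x # ys)) xs \<in> carrier (BC n)"
    using Cons.prems by (intro abelian_group.dl_closed[OF abelian_group_cochains])
  then show ?case using Cons assms(2) by (simp add: cochain_diff)
qed

section \<open>Vertical cycles and their restriction to the kernel of the extension\<close>

context extension_module
begin

sublocale coef: subgroup_module R Q "sub.Hc q" "qa q" Q id for q
  by (intro subgroup_module.intro seminormed_group_module_quotient Q.group_axioms
      subgroup_module_axioms.intro) (auto simp: mon_def hom_def)

context
  notes comp_id [simp del]
begin

text \<open>A set-theoretic section of \<open>\<pi>\<close>, normalised at the unit. The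
  normalisation makes \<open>retr\<close> at the unit of \<open>Q\<close> fix the image of
  \<open>L\<close>, so that extending a family of cochains and restricting it again returns exactly
  that family (\<open>lift_\<Phi>\<close>).\<close>

definition lift :: "'q \<Rightarrow> 'g"
  where "lift x = (if x = \<one>\<^bsub>Q\<^esub> then \<one>\<^bsub>G\<^esub> else SOME g. g \<in> carrier G \<and> \<pi> g = x)"

lemma lift_one: "lift \<one>\<^bsub>Q\<^esub> = \<one>\<^bsub>G\<^esub>"
  by (simp add: lift_def)

lemma lift: assumes "x \<in> carrier Q" shows "lift x \<in> carrier G" "\<pi> (lift x) = x"
proof -
  have "lift x \<in> carrier G \<and> \<pi> (lift x) = x"
    using lift_exists[OF assms] someI_ex[of "\<lambda>g. g \<in> carrier G \<and> \<pi> g = x"]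
    by (auto simp: lift_def \<pi>_one)
  then show "lift x \<in> carrier G" "\<pi> (lift x) = x" by auto
qed

text \<open>A \<open>G\<close>-equivariant family of retractions of \<open>G\<close> onto the fibres of \<open>\<pi>\<close>.\<close>

definition retr :: "'q \<Rightarrow> 'g \<Rightarrow> 'g"
  where "retr x g = g \<otimes>\<^bsub>G\<^esub> inv\<^bsub>G\<^esub> lift (inv\<^bsub>Q\<^esub> x \<otimes>\<^bsub>Q\<^esub> \<pi> g)"

lemma retr_closed: "x \<in> carrier Q \<Longrightarrow> g \<in> carrier G \<Longrightarrow> retr x g \<in> carrier G"
  and \<pi>_retr: "x \<in> carrier Q \<Longrightarrow> g \<in> carrier G \<Longrightarrow> \<pi> (retr x g) = x"
proof -
  assume x: "x \<in> carrier Q" and g: "g \<in> carrier G"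
  have y: "inv\<^bsub>Q\<^esub> x \<otimes>\<^bsub>Q\<^esub> \<pi> g \<in> carrier Q" using x g \<pi>_closed by simp
  show "retr x g \<in> carrier G" using g lift[OF y] by (simp add: retr_def)
  show "\<pi> (retr x g) = x"
    using x g lift[OF y] \<pi>_closed[OF g] by (simp add: retr_def \<pi>_mult \<pi>_inv Q.inv_mult_group flip: Q.m_assoc)
qed

text \<open>The argument of \<open>lift\<close> does not change when \<open>x\<close> and
  \<open>g\<close> are translated together, so only the left factor moves. This is the equivariance
  that a bare section of \<open>\<pi>\<close> would not provide.\<close>

lemma retr_mult:
  assumes "h \<in> carrier G" "x \<in> carrier Q" "g \<in> carrier G"
  shows "retr (\<pi> h \<otimes>\<^bsub>Q\<^esub> x) (h \<otimes>\<^bsub>G\<^esub> g) = h \<otimes>\<^bsub>G\<^esub> retr x g"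
proof -
  have "inv\<^bsub>Q\<^esub> (\<pi> h \<otimes>\<^bsub>Q\<^esub> x) \<otimes>\<^bsub>Q\<^esub> \<pi> (h \<otimes>\<^bsub>G\<^esub> g) =
      inv\<^bsub>Q\<^esub> x \<otimes>\<^bsub>Q\<^esub> (inv\<^bsub>Q\<^esub> \<pi> h \<otimes>\<^bsub>Q\<^esub> \<pi> h) \<otimes>\<^bsub>Q\<^esub> \<pi> g"
    using assms \<pi>_closed by (simp only: \<pi>_mult Q.inv_mult_group Q.m_assoc Q.m_closed Q.inv_closed)
  also have "\<dots> = inv\<^bsub>Q\<^esub> x \<otimes>\<^bsub>Q\<^esub> \<pi> g" using assms \<pi>_closed by simp
  finally show ?thesis
    using assms lift(1)[of "inv\<^bsub>Q\<^esub> x \<otimes>\<^bsub>Q\<^esub> \<pi> g"] \<pi>_closed by (simp add: retr_def G.m_assoc)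
qed

lemma retr_\<iota>: "l \<in> carrier L \<Longrightarrow> retr \<one>\<^bsub>Q\<^esub> (\<iota> l) = \<iota> l"
  by (simp add: retr_def \<pi>_\<iota> lift_one sub.\<phi>_closed)

lemma hd_closed: "xs \<noteq> [] \<Longrightarrow> set xs \<subseteq> S \<Longrightarrow> hd xs \<in> S"
  by (cases xs) auto

text \<open>Extends a family of cochains of \<open>L\<close>, indexed by the inhomogeneous
  \<open>Q\<close>-coordinates, to an equivariant function in bidegree \<open>(p, k)\<close>. The
  retraction moves \<open>gs\<close> into the fibre over the head of \<open>xs\<close>, which is one
  left coset of \<open>L\<close>, the domain on which \<open>hg\<close> is defined
  nontrivially.\<close>

definition extn :: "nat \<Rightarrow> nat \<Rightarrow> ('q list \<Rightarrow> 'l list \<Rightarrow> 'a) \<Rightarrow> 'q list \<Rightarrow> 'g list \<Rightarrow> 'a"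
  where "extn p k u xs gs = (if supp xs gs \<and> length xs = Suc p \<and> length gs = Suc k
    then sub.hg k (u (diffs Q xs)) (map (retr (hd xs)) gs) else \<zero>\<^bsub>A\<^esub>)"

lemma supp_diffs: "supp xs gs \<Longrightarrow> length xs = Suc p \<Longrightarrow> diffs Q xs \<in> tuples Q p"
  using Q.diffs_closed[of xs] by (auto simp: supp_def tuples_def length_diffs)

lemma map_retr_tr:
  assumes "g \<in> carrier G" "x \<in> carrier Q" "set gs \<subseteq> carrier G"
  shows "map (retr (\<pi> g \<otimes>\<^bsub>Q\<^esub> x)) (trG g gs) = trG g (map (retr x) gs)"
  using assms retr_mult by auto

lemma extn_closed:
  assumes u: "\<And>ys. ys \<in> tuples Q p \<Longrightarrow> u ys \<in> carrier (sub.res.BC k)"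
    and b: "\<And>ys. ys \<in> tuples Q p \<Longrightarrow> seminorm (sub.res.BC k) (u ys) \<le> b"
  shows "extn p k u \<in> Cn (int p + int k)" "extn p k u \<in> Fl (int p)"
    and "seminorm (tot p k) (extn p k u) \<le> b"
proof -
  have bound: "seminorm A (extn p k u xs gs) \<le> max 0 b" for xs gs
    using sub.seminorm_hg[OF u] order_trans[OF sub.seminorm_hg[OF u] b] supp_diffs[of xs gs p]
    by (auto simp: extn_def seminorm_zero le_max_iff_disj)
  have c: "extn p k u \<in> carrier TC"
  proof (rule totI)
    show "extn p k u xs gs \<in> carrier A" for xs gs
      using supp_diffs[of xs gs p] u by (auto simp: extn_def intro!: sub.hg_closed)
    show "extn p k u (trQ g xs) (trG g gs) = act g (extn p k u xs gs)" if "g \<in> carrier G" "supp xs gs" for g xs gs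
    proof -
      have s: "xs \<noteq> []" "set xs \<subseteq> carrier Q" "set gs \<subseteq> carrier G" "hd xs \<in> carrier Q"
        using that hd_closed by (auto simp: supp_def)
      have r: "map (retr (hd (trQ g xs))) (trG g gs) = trG g (map (retr (hd xs)) gs)"
        using map_retr_tr[OF that(1) s(4,3)] s(1) by (simp add: hd_map)
      have d: "diffs Q (trQ g xs) = diffs Q xs" using s that \<pi>_closed by (simp add: Q.diffs_map_mult)
      have "set (map (retr (hd xs)) gs) \<subseteq> carrier G" using s retr_closed by auto
      then have "sub.hg k (u (diffs Q xs)) (trG g (map (retr (hd xs)) gs)) =
          act g (sub.hg k (u (diffs Q xs)) (map (retr (hd xs)) gs))" if "length xs = Suc p"
        using that \<open>supp xs gs\<close> \<open>g \<in> carrier G\<close> u supp_diffs by (intro sub.hg_mult) auto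
      then show ?thesis using that supp_tr[OF that(1) s(2,3)] r d
        by (simp add: extn_def act_zero del: map_map)
    qed
    show "\<exists>b. \<forall>xs gs. length xs = m \<longrightarrow> length gs = n \<longrightarrow> seminorm A (extn p k u xs gs) \<le> b" for m n
      using bound by blast
  qed (auto simp: extn_def)
  show "extn p k u \<in> Cn (int p + int k)" "extn p k u \<in> Fl (int p)"
    using c by (auto simp: Cn_def Fl_def extn_def)
  show "seminorm (tot p k) (extn p k u) \<le> b"
  proof (rule seminorm_tot_le)
    fix xs gs assume "xs \<in> tuples Q (Suc p)" "gs \<in> tuples G (Suc k)"
    then have s: "supp xs gs" "length xs = Suc p" "length gs = Suc k" by (auto simp: supp_def tuples_def)
    then show "seminorm A (extn p k u xs gs) \<le> b"
      using order_trans[OF sub.seminorm_hg[OF u] b] supp_diffs[OF s(1,2)] by (simp add: extn_def)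
  qed
qed

text \<open>The retraction depends on \<open>hd xs\<close> only and therefore commutes with deleting
  entries of \<open>gs\<close>. The retracted list lies in one coset, so \<open>dl_hg\<close>
  applies.\<close>

lemma dl_extn:
  assumes u: "\<And>ys. ys \<in> tuples Q p \<Longrightarrow> u ys \<in> carrier (sub.res.BC k)"
    and xs: "set xs \<subseteq> carrier Q" "length xs = Suc p" and gs: "set gs \<subseteq> carrier G"
  shows "dl A (extn p k u xs) gs = (if length gs = Suc (Suc k)
    then sub.hg (Suc k) (sub.cob k (u (diffs Q xs))) (map (retr (hd xs)) gs) else \<zero>\<^bsub>A\<^esub>)"
proof (cases "length gs = Suc (Suc k)")
  case True
  have "xs \<noteq> []" using xs by auto
  then have x: "hd xs \<in> carrier Q" "xs \<noteq> []" using hd_closed[OF _ xs(1)] by auto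
  have d: "diffs Q xs \<in> tuples Q p" using xs Q.diffs_closed by (auto simp: tuples_def length_diffs)
  have "dl A (extn p k u xs) gs = dl A (\<lambda>hs. sub.hg k (u (diffs Q xs)) (map (retr (hd xs)) hs)) gs"
  proof (rule M.dl_cong)
    fix hs assume "set hs \<subseteq> set gs" "Suc (length hs) = length gs"
    then show "extn p k u xs hs = sub.hg k (u (diffs Q xs)) (map (retr (hd xs)) hs)"
      using True gs xs x by (auto simp: extn_def supp_def)
  qed
  also have "\<dots> = dl A (sub.hg k (u (diffs Q xs))) (map (retr (hd xs)) gs)" by (rule M.dl_map)
  also have "\<dots> = sub.hg (Suc k) (sub.cob k (u (diffs Q xs))) (map (retr (hd xs)) gs)"
    using True gs x retr_closed \<pi>_retr
    by (intro sub.dl_hg u d lies_in_cosetI[where x = "hd xs"]) auto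
  finally show ?thesis using True by simp
next
  case False
  then show ?thesis by (auto intro!: M.dl_zero simp: extn_def)
qed

text \<open>Cycles for the vertical differential in column \<open>p\<close>. For functions in
  \<open>Fl p\<close> this is equivalent to \<open>D F\<close> lying in \<open>Fl (p + 1)\<close>,
  the condition for a first-page cycle.\<close>

definition vcyc :: "nat \<Rightarrow> ('q list \<Rightarrow> 'g list \<Rightarrow> 'a) set"
  where "vcyc p = {F \<in> carrier TC. \<forall>xs gs. set xs \<subseteq> carrier Q \<longrightarrow> length xs = Suc p \<longrightarrow>
    set gs \<subseteq> carrier G \<longrightarrow> dl A (F xs) gs = \<zero>\<^bsub>A\<^esub>}"

lemma vcyc_carrier: "F \<in> vcyc p \<Longrightarrow> F \<in> carrier TC"
  by (simp add: vcyc_def)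

lemma vcycD: "F \<in> vcyc p \<Longrightarrow> set xs \<subseteq> carrier Q \<Longrightarrow> length xs = Suc p \<Longrightarrow> set gs \<subseteq> carrier G \<Longrightarrow>
    dl A (F xs) gs = \<zero>\<^bsub>A\<^esub>"
  by (simp add: vcyc_def)

lemma trQ_\<iota>: "l \<in> carrier L \<Longrightarrow> set xs \<subseteq> carrier Q \<Longrightarrow> trQ (\<iota> l) xs = xs"
  by (auto simp: \<pi>_\<iota> intro!: map_idI)

lemma tot_equivariant_L:
  assumes "F \<in> carrier TC" "l \<in> carrier L" "set xs \<subseteq> carrier Q" "set gs \<subseteq> carrier G"
  shows "F xs (trG (\<iota> l) gs) = act (\<iota> l) (F xs gs)"
  using tot_equivariant[OF assms(1) sub.\<phi>_closed[OF assms(2)] assms(3,4)] trQ_\<iota>[OF assms(2,3)] by simp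

lemma ih_tot_closed:
  assumes F: "F \<in> carrier TC" shows "sub.ih q (F xs) \<in> carrier (sub.res.BC q)"
proof -
  obtain b where "\<And>ys gs. length ys = length xs \<Longrightarrow> length gs = Suc q \<Longrightarrow> seminorm A (F ys gs) \<le> b"
    by (rule tot_bounded[OF F, of "length xs" "Suc q"]) blast
  then show ?thesis using tot_closed[OF F] by (intro sub.ih_closed[where b = b]) auto
qed

lemma cob_ih_tot:
  assumes F: "F \<in> carrier TC" and xs: "set xs \<subseteq> carrier Q"
  shows "sub.cob q (sub.ih q (F xs)) = sub.ih (Suc q) (dl A (F xs))"
proof (rule sub.coboundary_ih)
  fix s ls assume s: "s \<in> carrier L" and ls: "ls \<in> tuples L q"
  show "F xs (pp G (\<iota> s) (map \<iota> ls)) = act (\<iota> s) (F xs (pp G \<one>\<^bsub>G\<^esub> (map \<iota> ls)))"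
    using tot_equivariant_L[OF F s xs sub.pp_\<phi>_closed[OF _ ls]] sub.pp_\<phi>_mult[OF sub.\<phi>_closed[OF s] ls] by simp
qed (rule tot_closed[OF F])

lemma ih_vcyc:
  assumes F: "F \<in> vcyc p" and xs: "set xs \<subseteq> carrier Q" "length xs = Suc p"
  shows "sub.ih q (F xs) \<in> sub.Zc q"
proof -
  have "sub.ih (Suc q) (dl A (F xs)) = \<zero>\<^bsub>sub.res.BC (Suc q)\<^esub>"
    unfolding sub.ih_def bounded_cochains_simps(2)
    by (intro restrict_ext vcycD[OF F xs] sub.pp_\<phi>_closed) auto
  then show ?thesis
    using vcyc_carrier[OF F] xs by (simp add: sub.cocycle_iff ih_tot_closed cob_ih_tot)
qed

text \<open>Restricts each \<open>F xs\<close> to the kernel and takes its class. \<open>rc\<close>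
  is the homogeneous form in \<open>xs\<close>, extended by zero to keep all values in the carrier;
  \<open>\<Phi>\<close> below is the inhomogeneous form, the map that induces the isomorphism on the
  second page.\<close>

definition rc :: "nat \<Rightarrow> nat \<Rightarrow> ('q list \<Rightarrow> 'g list \<Rightarrow> 'a) \<Rightarrow> 'q list \<Rightarrow> ('l list \<Rightarrow> 'a) set"
  where "rc p q F xs = (if set xs \<subseteq> carrier Q \<and> length xs = Suc p
    then sub.H.cls q (sub.ih q (F xs)) else \<zero>\<^bsub>sub.Hc q\<^esub>)"

definition \<Phi> :: "nat \<Rightarrow> nat \<Rightarrow> ('q list \<Rightarrow> 'g list \<Rightarrow> 'a) \<Rightarrow> 'q list \<Rightarrow> ('l list \<Rightarrow> 'a) set"
  where "\<Phi> p q F = coef.ih p (rc p q F)"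

lemma H_zero_closed: "\<zero>\<^bsub>sub.Hc q\<^esub> \<in> carrier (sub.Hc q)"
  using sub.H.cls_closed[OF sub.H.submodule_closed(2)[OF sub.submodule_cocycles]] by (simp add: sub.H.cls_zero)

lemma rc_closed: "F \<in> vcyc p \<Longrightarrow> rc p q F xs \<in> carrier (sub.Hc q)"
  using H_zero_closed by (auto simp: rc_def intro!: sub.H.cls_closed ih_vcyc)

lemma seminorm_rc:
  assumes F: "F \<in> vcyc p" shows "seminorm (sub.Hc q) (rc p q F xs) \<le> seminorm (tot p q) F"
proof (cases "set xs \<subseteq> carrier Q \<and> length xs = Suc p")
  case True
  have "seminorm (sub.res.BC q) (sub.ih q (F xs)) \<le> seminorm (tot p q) F"
  proof (rule sub.res.seminorm_cochain_le)
    fix ls assume ls: "ls \<in> tuples L q"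
    then have "pp G \<one>\<^bsub>G\<^esub> (map \<iota> ls) \<in> tuples G (Suc q)"
      using sub.pp_\<phi>_closed[OF G.one_closed ls] by (simp add: tuples_def)
    then show "seminorm A (sub.ih q (F xs) ls) \<le> seminorm (tot p q) F"
      using True ls seminorm_tot_ge[OF vcyc_carrier[OF F]] by (simp add: sub.ih_def tuples_def)
  qed
  then show ?thesis using True order_trans[OF sub.H.seminorm_cls_le'[OF ih_vcyc[OF F, of xs q]]] by (simp add: rc_def)
next
  case False
  interpret T: seminormed_module R "tot p q" by (rule seminormed_module_tot)
  have "F \<in> carrier (tot p q)" using vcyc_carrier[OF F] carrier_tot[of p q] by simp
  then have "seminorm (sub.Hc q) \<zero>\<^bsub>sub.Hc q\<^esub> \<le> seminorm (tot p q) F"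
    using coef.seminorm_zero[of q] T.seminorm_nonneg by simp
  then show ?thesis using False by (auto simp: rc_def)
qed

text \<open>Equivariance of \<open>F\<close> turns the conjugation action of \<open>g\<close> on the
  restriction of \<open>F xs\<close> into right translation by \<open>g\<close> in the arguments of
  \<open>F\<close> at the translated \<open>xs\<close>. Since \<open>F\<close> is a vertical cycle
  on all of \<open>G\<close>, right translation is homotopic to the identity, so the classes
  agree.\<close>

lemma rc_equivariant:
  assumes F: "F \<in> vcyc p" and g: "g \<in> carrier G" and xs: "set xs \<subseteq> carrier Q" "length xs = Suc p"
  shows "rc p q F (trQ g xs) = qa q (\<pi> g) (rc p q F xs)"
proof -
  have Fc: "F \<in> carrier TC" using F by (rule vcyc_carrier)
  let ?xs = "trQ g xs"
  have xs': "set ?xs \<subseteq> carrier Q" "length ?xs = Suc p" using xs \<pi>_closed[OF g] by auto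
  obtain b where b: "length ys = length ?xs \<Longrightarrow> length gs = Suc q \<Longrightarrow> seminorm A (F ys gs) \<le> b" for ys gs
    by (rule tot_bounded[OF Fc, of "length ?xs" "Suc q"]) blast
  have eq: "cj q g (sub.ih q (F xs)) = sub.ih q (\<lambda>us. F ?xs (map (\<lambda>u. u \<otimes>\<^bsub>G\<^esub> g) us))"
    unfolding cj_eq sub.ih_def
  proof (rule restrict_ext)
    fix ls assume ls: "ls \<in> tuples L q"
    let ?ls = "map (conj_elt g) ls"
    have ls': "?ls \<in> tuples L q" by (rule map_conj_elt_tuples[OF g ls])
    have "map (\<lambda>u. u \<otimes>\<^bsub>G\<^esub> g) (pp G \<one>\<^bsub>G\<^esub> (map \<iota> ls)) = trG g (pp G \<one>\<^bsub>G\<^esub> (map \<iota> ?ls))"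
      using map_mult_right_pp[OF g G.one_closed ls] sub.pp_\<phi>_mult[OF g ls'] g by simp
    then show "act g ((\<lambda>ls\<in>tuples L q. F xs (pp G \<one>\<^bsub>G\<^esub> (map \<iota> ls))) ?ls) =
        F ?xs (map (\<lambda>u. u \<otimes>\<^bsub>G\<^esub> g) (pp G \<one>\<^bsub>G\<^esub> (map \<iota> ls)))"
      using tot_equivariant[OF Fc g xs(1) sub.pp_\<phi>_closed[OF G.one_closed ls']] ls' by (simp del: map_map)
  qed
  have "sub.ih q (\<lambda>us. F ?xs (map (\<lambda>u. u \<otimes>\<^bsub>G\<^esub> g) us)) \<ominus>\<^bsub>sub.res.BC q\<^esub>
      sub.ih q (\<lambda>us. F ?xs (map (\<lambda>u. u) us)) \<in> sub.Bc q"
  proof (rule sub.homotopic[where T = "carrier G" and b = b])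
    show "F ?xs us \<in> carrier A" for us by (rule tot_closed[OF Fc])
    show "seminorm A (F ?xs us) \<le> b" if "length us = Suc q" for us using b that by simp
    show "F ?xs (trG (\<iota> s) us) = act (\<iota> s) (F ?xs us)" if "s \<in> carrier L" "set us \<subseteq> carrier G" for s us
      using that by (intro tot_equivariant_L[OF Fc] xs')
    show "dl A (F ?xs) us = \<zero>\<^bsub>A\<^esub>" if "set us \<subseteq> carrier G" for us by (rule vcycD[OF F xs' that])
  qed (use g sub.\<phi>_closed in \<open>auto simp: G.m_assoc\<close>)
  then have "cj q g (sub.ih q (F xs)) \<ominus>\<^bsub>sub.res.BC q\<^esub> sub.ih q (F ?xs) \<in> sub.Bc q"
    by (simp add: eq)
  then have "sub.H.cls q (cj q g (sub.ih q (F xs))) = sub.H.cls q (sub.ih q (F ?xs))"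
    using cj_cocycle[OF g ih_vcyc[OF F xs]] ih_vcyc[OF F xs'] sub.H.cls_eq_iff by blast
  moreover have "qa q (\<pi> g) (rc p q F xs) = sub.H.cls q (cj q g (sub.ih q (F xs)))"
    using quotient_act_cls[OF g ih_vcyc[OF F xs]] xs by (simp add: rc_def)
  moreover have "rc p q F ?xs = sub.H.cls q (sub.ih q (F ?xs))" using xs' by (simp add: rc_def)
  ultimately show ?thesis by simp
qed

lemma dl_rc:
  assumes F: "F \<in> vcyc p" and xs: "set xs \<subseteq> carrier Q" "length xs = Suc (Suc p)"
  shows "dl (sub.Hc q) (rc p q F) xs = sub.H.cls q (sub.ih q (\<lambda>gs. dl A (\<lambda>ys. F ys gs) xs))"
    and "sub.ih q (\<lambda>gs. dl A (\<lambda>ys. F ys gs) xs) \<in> sub.Zc q"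
proof -
  \<comment> \<open>The extension by zero makes every value a cocycle, as \<open>dl_cls\<close>
    requires for passing to classes inside the alternating sum.\<close>
  define f where "f ys = (if set ys \<subseteq> carrier Q \<and> length ys = Suc p then sub.ih q (F ys) else \<zero>\<^bsub>sub.res.BC q\<^esub>)" for ys
  have f: "f ys \<in> sub.Zc q" for ys
    using ih_vcyc[OF F] sub.H.submodule_closed(2)[OF sub.submodule_cocycles] by (simp add: f_def)
  have fc: "f ys \<in> carrier (sub.res.BC q)" for ys using f by (simp add: sub.cocycle_iff)
  have rc: "rc p q F = (\<lambda>ys. sub.H.cls q (f ys))"
    by (intro ext) (simp add: rc_def f_def sub.H.cls_zero)
  have d: "dl (sub.res.BC q) f xs \<in> sub.Zc q" "dl (sub.Hc q) (rc p q F) xs = sub.H.cls q (dl (sub.res.BC q) f xs)"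
    unfolding rc using sub.H.dl_cls[where f = f and xs = xs and n = q, OF f] by blast+
  have "dl (sub.res.BC q) f xs = sub.ih q (\<lambda>gs. dl A (\<lambda>ys. F ys gs) xs)"
  proof (rule bounded_cochain_ext[of _ L A q])
    show "dl (sub.res.BC q) f xs \<in> carrier (sub.res.BC q)" using d(1) by (simp add: sub.cocycle_iff)
    show eq: "dl (sub.res.BC q) f xs ls = sub.ih q (\<lambda>gs. dl A (\<lambda>ys. F ys gs) xs) ls" if "ls \<in> tuples L q" for ls
    proof -
      have "f ys ls = F ys (pp G \<one>\<^bsub>G\<^esub> (map \<iota> ls))" if "set ys \<subseteq> set xs" "Suc (length ys) = length xs" for ys
        using xs \<open>ls \<in> _\<close> that subset_trans[OF that(1) xs(1)] by (simp add: f_def sub.ih_def)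
      then have "dl A (\<lambda>ys. f ys ls) xs = dl A (\<lambda>ys. F ys (pp G \<one>\<^bsub>G\<^esub> (map \<iota> ls))) xs"
        by (rule M.dl_cong)
      then show ?thesis
        unfolding sub.res.dl_cochains_apply[OF fc that] using that by (simp add: sub.ih_def)
    qed
    have "sub.ih q (\<lambda>gs. dl A (\<lambda>ys. F ys gs) xs) = (\<lambda>ls\<in>tuples L q. dl (sub.res.BC q) f xs ls)"
      using eq by (auto simp: sub.ih_def)
    also have "\<dots> \<in> carrier (sub.res.BC q)"
      using d(1) by (auto simp: sub.cocycle_iff bounded_cochains_simps(1))
    finally show "sub.ih q (\<lambda>gs. dl A (\<lambda>ys. F ys gs) xs) \<in> carrier (sub.res.BC q)" .
  qed
  then show "dl (sub.Hc q) (rc p q F) xs = sub.H.cls q (sub.ih q (\<lambda>gs. dl A (\<lambda>ys. F ys gs) xs))"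
    "sub.ih q (\<lambda>gs. dl A (\<lambda>ys. F ys gs) xs) \<in> sub.Zc q" using d by auto
qed

lemma \<Phi>_closed: "F \<in> vcyc p \<Longrightarrow> \<Phi> p q F \<in> carrier (coef.res.BC q p)"
  unfolding \<Phi>_def by (intro coef.ih_closed[where b = "seminorm (tot p q) F"] rc_closed seminorm_rc)

lemma pp_Q_closed: "ys \<in> tuples Q p \<Longrightarrow> set (pp Q \<one>\<^bsub>Q\<^esub> ys) \<subseteq> carrier Q \<and> length (pp Q \<one>\<^bsub>Q\<^esub> ys) = Suc p"
  using Q.pp_closed[of "\<one>\<^bsub>Q\<^esub>" ys] by (auto simp: tuples_def)

lemma \<Phi>_apply: "ys \<in> tuples Q p \<Longrightarrow> \<Phi> p q F ys = sub.H.cls q (sub.ih q (F (pp Q \<one>\<^bsub>Q\<^esub> ys)))"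
  using pp_Q_closed by (simp add: \<Phi>_def coef.ih_def rc_def)

lemma cob_\<Phi>:
  assumes F: "F \<in> vcyc p"
  shows "coef.cob q p (\<Phi> p q F) = coef.ih (Suc p) (dl (sub.Hc q) (rc p q F))"
  unfolding \<Phi>_def
proof (rule coef.coboundary_ih[OF rc_closed[OF F]])
  fix s ys assume s: "s \<in> carrier Q" and ys: "ys \<in> tuples Q p"
  have "pp Q s (map id ys) = trQ (lift s) (pp Q \<one>\<^bsub>Q\<^esub> (map id ys))"
    using Q.map_mult_pp[OF s Q.one_closed, of ys] lift[OF s] ys s by (simp add: tuples_def)
  then show "rc p q F (pp Q (id s) (map id ys)) = qa q (id s) (rc p q F (pp Q \<one>\<^bsub>Q\<^esub> (map id ys)))"
    using rc_equivariant[OF F lift(1)[OF s], of "pp Q \<one>\<^bsub>Q\<^esub> ys" q] pp_Q_closed[OF ys] lift(2)[OF s] by simp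
qed

lemma seminorm_\<Phi>: "F \<in> vcyc p \<Longrightarrow> seminorm (coef.res.BC q p) (\<Phi> p q F) \<le> seminorm (tot p q) F"
  by (intro coef.res.seminorm_cochain_le) (simp add: \<Phi>_def coef.ih_def seminorm_rc)

lemma \<Phi>_add:
  assumes "F \<in> vcyc p" "F' \<in> vcyc p"
  shows "\<Phi> p q (F \<oplus>\<^bsub>TC\<^esub> F') = \<Phi> p q F \<oplus>\<^bsub>coef.res.BC q p\<^esub> \<Phi> p q F'"
proof -
  have "sub.ih q ((F \<oplus>\<^bsub>TC\<^esub> F') xs) = sub.ih q (F xs) \<oplus>\<^bsub>sub.res.BC q\<^esub> sub.ih q (F' xs)" for xs
    by (auto simp: sub.ih_def tot_simps bounded_cochains_simps(3) intro!: restrict_ext)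
  then have "\<Phi> p q (F \<oplus>\<^bsub>TC\<^esub> F') ys = \<Phi> p q F ys \<oplus>\<^bsub>sub.Hc q\<^esub> \<Phi> p q F' ys" if "ys \<in> tuples Q p" for ys
    using that pp_Q_closed[OF that] ih_vcyc[OF assms(1)] ih_vcyc[OF assms(2)]
    by (simp add: \<Phi>_apply sub.H.cls_add)
  then show ?thesis unfolding bounded_cochains_simps(3) \<Phi>_def[of p q "F \<oplus>\<^bsub>TC\<^esub> F'"] coef.ih_def
    by (intro restrict_ext) (simp add: \<Phi>_def coef.ih_def)
qed

lemma \<Phi>_smult:
  assumes "a \<in> carrier R" "F \<in> vcyc p"
  shows "\<Phi> p q (a \<odot>\<^bsub>TC\<^esub> F) = a \<odot>\<^bsub>coef.res.BC q p\<^esub> \<Phi> p q F"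
proof -
  have "sub.ih q ((a \<odot>\<^bsub>TC\<^esub> F) xs) = a \<odot>\<^bsub>sub.res.BC q\<^esub> sub.ih q (F xs)" for xs
    by (auto simp: sub.ih_def tot_simps bounded_cochains_simps(4) intro!: restrict_ext)
  then have "\<Phi> p q (a \<odot>\<^bsub>TC\<^esub> F) ys = a \<odot>\<^bsub>sub.Hc q\<^esub> \<Phi> p q F ys" if "ys \<in> tuples Q p" for ys
    using that pp_Q_closed[OF that] ih_vcyc[OF assms(2)] assms(1)
    by (simp add: \<Phi>_apply sub.H.cls_smult)
  then show ?thesis unfolding bounded_cochains_simps(4) \<Phi>_def[of p q "a \<odot>\<^bsub>TC\<^esub> F"] coef.ih_def
    by (intro restrict_ext) (simp add: \<Phi>_def coef.ih_def)
qed

end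

end

lemma (in abelian_group) alt_sign_eq_zero_iff: "x \<in> carrier G \<Longrightarrow> alt_sign G i x = \<zero> \<longleftrightarrow> x = \<zero>"
  using minus_minus[of x] a_inv_zero by (auto simp: alt_sign_def)

section \<open>Exactness and lifting in the leading column\<close>

context extension_module
begin

context
  notes comp_id [simp del]
begin

text \<open>On lists inside one coset the coboundary is \<open>dl\<close> of the homogeneous form,
  and sublists stay in this coset; the claim is then \<open>dl_dl\<close>.\<close>

lemma cob_cob:
  assumes u: "u \<in> carrier (sub.res.BC k)" shows "sub.cob k u \<in> sub.Zc (Suc k)"
proof -
  have "dl A (sub.hg (Suc k) (sub.cob k u)) (pp G \<one>\<^bsub>G\<^esub> (map \<iota> ls)) = \<zero>\<^bsub>A\<^esub>" if ls: "ls \<in> tuples L (Suc (Suc k))" for ls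
  proof -
    let ?us = "pp G \<one>\<^bsub>G\<^esub> (map \<iota> ls)"
    have "dl A (sub.hg (Suc k) (sub.cob k u)) ?us = dl A (dl A (sub.hg k u)) ?us"
    proof (rule M.dl_cong)
      fix ys assume ys: "set ys \<subseteq> set ?us" "Suc (length ys) = length ?us"
      have "set ys \<subseteq> carrier G" using sub.pp_\<phi>_closed[OF G.one_closed ls] ys(1) by (rule subset_trans[rotated])
      moreover have "length ys = Suc (Suc k)" using ys(2) ls by (simp add: tuples_def)
      ultimately have "sub.lies_in_coset (Suc k) ys"
        using \<pi>_pp_\<iota>[OF G.one_closed ls] ys(1) by (intro lies_in_cosetI[where x = "\<pi> \<one>\<^bsub>G\<^esub>"]) auto
      then show "sub.hg (Suc k) (sub.cob k u) ys = dl A (sub.hg k u) ys" by (rule sub.dl_hg[OF u, symmetric])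
    qed
    then show ?thesis using M.dl_dl[of "sub.hg k u", OF sub.hg_closed[OF u]] by simp
  qed
  then show ?thesis
    unfolding sub.cocycle_iff sub.cob_eq[OF sub.cob_closed(1)[OF u]] sub.ih_def bounded_cochains_simps(2)
    using sub.cob_closed(1)[OF u] by (auto intro!: restrict_ext)
qed

lemma coboundaries_subset_cocycles: "sub.Bc q \<subseteq> sub.Zc q"
  using cob_cob sub.H.submodule_closed(2)[OF sub.submodule_cocycles] by (cases q) auto

text \<open>This replaces the exactness of \<open>\<ell>\<^sup>\<infinity>(Q\<^sup>p, -)\<close>, which fails in general: primitives of a
  bounded family of coboundaries can be chosen boundedly.\<close>

definition uniform_primitives :: "nat \<Rightarrow> bool"
  where "uniform_primitives q \<longleftrightarrow> (\<forall>k p b \<beta>. q = Suc k \<longrightarrow>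
    (\<forall>ys\<in>tuples Q p. b ys \<in> sub.Bc q \<and> seminorm (sub.res.BC q) (b ys) \<le> \<beta>) \<longrightarrow>
    (\<exists>u \<gamma>. \<forall>ys\<in>tuples Q p. u ys \<in> carrier (sub.res.BC k) \<and> seminorm (sub.res.BC k) (u ys) \<le> \<gamma> \<and>
      sub.cob k (u ys) = b ys))"

lemma Fl_iff: "F \<in> Fl p \<longleftrightarrow> F \<in> carrier TC \<and> (\<forall>xs gs. int (length xs) \<le> p \<longrightarrow> F xs gs = \<zero>\<^bsub>A\<^esub>)"
  by (simp add: Fl_def)

lemma Cn_iff: "F \<in> Cn n \<longleftrightarrow> F \<in> carrier TC \<and>
    (\<forall>xs gs. int (length xs) + int (length gs) \<noteq> n + 2 \<longrightarrow> F xs gs = \<zero>\<^bsub>A\<^esub>)"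
  by (simp add: Cn_def)

text \<open>In the leading column the horizontal part of \<open>D F\<close> comes from the column
  before, where \<open>F\<close> vanishes. Only the vertical part with the sign of column
  \<open>p\<close> survives.\<close>

lemma D_Fl_apply:
  assumes F: "F \<in> Fl (int p)" and xs: "set xs \<subseteq> carrier Q" "length xs = Suc p" and gs: "set gs \<subseteq> carrier G"
  shows "D F xs gs = alt_sign A p (dl A (F xs) gs)"
proof -
  have c: "F \<in> carrier TC" using F by (simp add: Fl_iff)
  have "dl A (\<lambda>ys. F ys gs) xs = \<zero>\<^bsub>A\<^esub>" using F xs by (intro M.dl_zero) (simp add: Fl_iff)
  then show ?thesis
    using D_eq[OF c xs(1) gs] tot_closed[OF c] xs(2) by (simp add: dd_def alt_sign_def[of A "Suc (Suc p)"] alt_sign_def[of A p])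
qed

lemma vcyc_if_D_Fl:
  assumes F: "F \<in> Fl (int p)" and DF: "D F \<in> Fl (int p + 1)"
  shows "F \<in> vcyc p"
proof -
  have c: "F \<in> carrier TC" using F by (simp add: Fl_iff)
  have "dl A (F xs) gs = \<zero>\<^bsub>A\<^esub>" if xs: "set xs \<subseteq> carrier Q" "length xs = Suc p" "set gs \<subseteq> carrier G" for xs gs
    using DF xs D_Fl_apply[OF F xs] M.alt_sign_eq_zero_iff[of "dl A (F xs) gs" p] tot_closed[OF c]
    by (simp add: Fl_iff)
  then show ?thesis using c by (simp add: vcyc_def)
qed

lemma D_Fl_if_vcyc:
  assumes F: "F \<in> Fl (int p)" "F \<in> vcyc p" shows "D F \<in> Fl (int p + 1)"
proof -
  have c: "F \<in> carrier TC" using F by (simp add: Fl_iff)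
  have "D F xs gs = \<zero>\<^bsub>A\<^esub>" if "int (length xs) \<le> int p + 1" for xs gs
  proof (cases "supp xs gs \<and> length xs = Suc p")
    case True
    then have s: "set xs \<subseteq> carrier Q" "length xs = Suc p" "set gs \<subseteq> carrier G" by (auto simp: supp_def)
    then show ?thesis using D_Fl_apply[OF F(1) s] vcycD[OF F(2) s] by simp
  next
    case False
    then have "\<not> supp xs gs \<or> length xs \<le> p" using that by auto
    then show ?thesis using tc.D_F[OF F(1)] tot_zero[OF D_closed[OF c]] by (auto simp: Fl_iff)
  qed
  then show ?thesis using D_closed[OF c] by (simp add: Fl_iff)
qed

lemma ih_dl_coboundary:
  assumes F: "F \<in> carrier TC" and xs: "set xs \<subseteq> carrier Q"
  shows "sub.ih q (dl A (F xs)) \<in> sub.Bc q"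
proof (cases q)
  case 0
  \<comment> \<open>Deleting the only entry leaves the empty list, on which \<open>F\<close> is
    zero; this matches the convention that only zero is a coboundary in degree 0.\<close>
  have "F xs [] = \<zero>\<^bsub>A\<^esub>" by (simp add: tot_zero[OF F] supp_def)
  then have "sub.ih 0 (dl A (F xs)) = \<zero>\<^bsub>sub.res.BC 0\<^esub>"
    unfolding sub.ih_def bounded_cochains_simps(2)
    by (intro restrict_ext) (auto simp: tuples_def a_minus_def M.a_inv_zero)
  then show ?thesis using 0 by simp
next
  case (Suc k)
  then show ?thesis using cob_ih_tot[OF F xs, of k] ih_tot_closed[OF F, of k xs] by (metis coboundaries.simps(2) imageI)
qed

lemma ih_alt_sign_coboundary:
  assumes F: "F \<in> carrier TC" and xs: "set xs \<subseteq> carrier Q"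
  shows "sub.ih q (\<lambda>gs. alt_sign A i (dl A (F xs) gs)) \<in> sub.Bc q"
proof (cases "even i")
  case True
  then show ?thesis using ih_dl_coboundary[OF assms] by (simp add: alt_sign_def)
next
  case False
  have "(\<lambda>gs. alt_sign A i (dl A (F xs) gs)) = dl A ((\<ominus>\<^bsub>TC\<^esub> F) xs)"
    using False tot_closed[OF F] by (intro ext) (simp add: alt_sign_def tot_a_inv[OF F] M.dl_a_inv)
  then have "sub.ih q (\<lambda>gs. alt_sign A i (dl A (F xs) gs)) = sub.ih q (dl A ((\<ominus>\<^bsub>TC\<^esub> F) xs))"
    by simp
  also have "\<dots> \<in> sub.Bc q" using ih_dl_coboundary[OF _ xs] tc.M.a_inv_closed[OF F] by blast
  finally show ?thesis .
qed

lemma H_cls_eq: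
  assumes "f \<in> carrier (sub.res.BC q)" "f' \<in> carrier (sub.res.BC q)" "f \<ominus>\<^bsub>sub.res.BC q\<^esub> f' \<in> sub.Bc q"
  shows "sub.H.cls q f = sub.H.cls q f'"
  using sub.H.coset_eq_iff[OF sub.submodule_coboundaries assms(1,2)] assms(3) by simp

text \<open>On retracted lists \<open>F\<close> is determined by its restriction to the kernel. The
  first entry \<open>a\<close> of the retracted list satisfies \<open>\<pi> a = hd xs\<close>, so
  translation by \<open>a\<close> carries a list in the image of \<open>L\<close> and partial
  products from the unit of \<open>Q\<close> to the given pair.\<close>

lemma retr_apply:
  assumes F: "F \<in> carrier TC" and xs: "set xs \<subseteq> carrier Q" "length xs = Suc p"
    and gs: "set gs \<subseteq> carrier G" "length gs = Suc q"
  shows "F xs (map (retr (hd xs)) gs) =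
    sub.hg q (sub.ih q (F (pp Q \<one>\<^bsub>Q\<^esub> (diffs Q xs)))) (map (retr (hd xs)) gs)"
proof -
  let ?us = "map (retr (hd xs)) gs"
  have ne: "xs \<noteq> []" using xs by auto
  have x: "hd xs \<in> carrier Q" by (rule hd_closed[OF ne xs(1)])
  have us: "set ?us \<subseteq> carrier G" "\<And>u. u \<in> set ?us \<Longrightarrow> \<pi> u = hd xs"
    using gs x retr_closed \<pi>_retr by auto
  then have "sub.lies_in_coset q ?us" using gs by (intro lies_in_cosetI) auto
  then obtain a ls where als: "a \<in> carrier G" "ls \<in> tuples L q" "?us = pp G a (map \<iota> ls)"
    by (auto simp: sub.lies_in_coset_def)
  have a: "\<pi> a = hd xs"
  proof -
    have "hd ?us = a" by (simp add: als(3) del: hd_map)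
    moreover have "hd ?us \<in> set ?us" using gs by (intro hd_in_set) auto
    ultimately show ?thesis using us(2) by metis
  qed
  have d: "diffs Q xs \<in> tuples Q p" using xs Q.diffs_closed by (auto simp: tuples_def length_diffs)
  have "xs = trQ a (pp Q \<one>\<^bsub>Q\<^esub> (diffs Q xs))"
    using Q.map_mult_pp[OF x Q.one_closed, of "diffs Q xs"] Q.pp_diffs[OF ne xs(1)] d x
    by (simp add: a tuples_def)
  moreover have "?us = trG a (pp G \<one>\<^bsub>G\<^esub> (map \<iota> ls))" using als sub.pp_\<phi>_mult[OF als(1,2)] by simp
  ultimately have "F xs ?us = act a (F (pp Q \<one>\<^bsub>Q\<^esub> (diffs Q xs)) (pp G \<one>\<^bsub>G\<^esub> (map \<iota> ls)))"
    using tot_equivariant[OF F als(1) _ sub.pp_\<phi>_closed[OF G.one_closed als(2)], of "pp Q \<one>\<^bsub>Q\<^esub> (diffs Q xs)"]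
      pp_Q_closed[OF d] by metis
  also have "\<dots> = sub.hg q (sub.ih q (F (pp Q \<one>\<^bsub>Q\<^esub> (diffs Q xs)))) ?us"
    unfolding als(3) by (simp add: sub.hg_pp[OF als(1,2)] sub.ih_def als(2))
  finally show ?thesis .
qed

text \<open>The prism from the retraction over \<open>hd xs\<close> to the identity. A prism
  lengthens its argument by one entry, so values of \<open>F\<close> in row \<open>q\<close> yield a
  function on lists with \<open>q\<close> entries, that is in row \<open>q - 1\<close>.\<close>

definition htpy :: "nat \<Rightarrow> nat \<Rightarrow> ('q list \<Rightarrow> 'g list \<Rightarrow> 'a) \<Rightarrow> 'q list \<Rightarrow> 'g list \<Rightarrow> 'a"
  where "htpy p q F xs gs = (if supp xs gs \<and> length xs = Suc p \<and> length gs = q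
    then prism A (retr (hd xs)) (\<lambda>g. g) (F xs) gs else \<zero>\<^bsub>A\<^esub>)"

lemma htpy_closed:
  assumes F: "F \<in> carrier TC"
  shows "htpy p q F \<in> Cn (int p + int q - 1)" "htpy p q F \<in> Fl (int p)"
proof -
  note c = tot_closed[OF F]
  have "htpy p q F \<in> carrier TC"
  proof (rule totI)
    show "htpy p q F (trQ g xs) (trG g gs) = act g (htpy p q F xs gs)" if g: "g \<in> carrier G" and s: "supp xs gs" for g xs gs
    proof -
      have s': "xs \<noteq> []" "set xs \<subseteq> carrier Q" "set gs \<subseteq> carrier G" "hd xs \<in> carrier Q"
        using s hd_closed by (auto simp: supp_def)
      have "prism A (retr (hd (trQ g xs))) (\<lambda>g. g) (F (trQ g xs)) (trG g gs) =
          act g (prism A (retr (hd xs)) (\<lambda>g. g) (F xs) gs)"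
      proof (rule prism_equivariant[OF g c, where T = "carrier G"])
        show "F (trQ g xs) (trG g ys) = act g (F xs ys)" if "set ys \<subseteq> carrier G" for ys
          by (rule tot_equivariant[OF F g s'(2) that])
        show "retr (hd xs) u \<in> carrier G \<and> u \<in> carrier G \<and>
            retr (hd (trQ g xs)) (g \<otimes>\<^bsub>G\<^esub> u) = g \<otimes>\<^bsub>G\<^esub> retr (hd xs) u \<and> g \<otimes>\<^bsub>G\<^esub> u = g \<otimes>\<^bsub>G\<^esub> u"
          if "u \<in> set gs" for u
          using that s' retr_closed retr_mult[OF g s'(4)] by (auto simp: hd_map)
      qed
      then show ?thesis using s supp_tr[OF g s'(2,3)] g by (simp add: htpy_def act_zero)
    qed
    show "\<exists>b. \<forall>xs gs. length xs = m \<longrightarrow> length gs = n \<longrightarrow> seminorm A (htpy p q F xs gs) \<le> b" for m n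
    proof -
      obtain b where b: "0 \<le> b" "length xs = m \<Longrightarrow> length gs = Suc n \<Longrightarrow> seminorm A (F xs gs) \<le> b" for xs gs
        by (rule tot_bounded[OF F, of m "Suc n"]) blast
      have "seminorm A (htpy p q F xs gs) \<le> real n * b" if "length xs = m" "length gs = n" for xs gs
        using seminorm_prism[of "F xs" gs b "retr (hd xs)" "\<lambda>g. g"] c b that
        by (auto simp: htpy_def seminorm_zero)
      then show ?thesis by blast
    qed
  qed (use c in \<open>auto simp: htpy_def\<close>)
  then show "htpy p q F \<in> Cn (int p + int q - 1)" "htpy p q F \<in> Fl (int p)"
    by (auto simp: Cn_iff Fl_iff htpy_def)
qed

text \<open>As \<open>F\<close> is a vertical cycle, the prism of its differential vanishes, and
  \<open>prism_homotopy\<close> reduces to a statement about the differential of the prism.\<close>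

lemma dl_htpy:
  assumes F: "F \<in> vcyc p" and xs: "set xs \<subseteq> carrier Q" "length xs = Suc p"
    and gs: "set gs \<subseteq> carrier G" "length gs = Suc q"
  shows "dl A (htpy p q F xs) gs = F xs gs \<ominus>\<^bsub>A\<^esub> F xs (map (retr (hd xs)) gs)"
proof -
  note c = tot_closed[OF vcyc_carrier[OF F]]
  have ne: "xs \<noteq> []" using xs by auto
  have x: "hd xs \<in> carrier Q" by (rule hd_closed[OF ne xs(1)])
  let ?P = "prism A (retr (hd xs)) (\<lambda>g. g)"
  have "dl A (htpy p q F xs) gs = dl A (?P (F xs)) gs"
  proof (rule M.dl_cong)
    fix hs assume hs: "set hs \<subseteq> set gs" "Suc (length hs) = length gs"
    then have "set hs \<subseteq> carrier G" using gs(1) by (rule_tac subset_trans)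
    then show "htpy p q F xs hs = ?P (F xs) hs"
      using hs gs xs ne by (cases "hs = []") (auto simp: htpy_def supp_def)
  qed
  moreover have "?P (dl A (F xs)) gs = \<zero>\<^bsub>A\<^esub>"
  proof (rule M.prism_zero)
    fix ys assume "set ys \<subseteq> retr (hd xs) ` set gs \<union> (\<lambda>g. g) ` set gs"
    moreover have "retr (hd xs) ` set gs \<union> (\<lambda>g. g) ` set gs \<subseteq> carrier G" using gs x retr_closed by auto
    ultimately show "dl A (F xs) ys = \<zero>\<^bsub>A\<^esub>" by (intro vcycD[OF F xs]) (rule subset_trans)
  qed
  ultimately show ?thesis
    using M.prism_homotopy[of "F xs" "retr (hd xs)" "\<lambda>g. g" gs] c by simp
qed

text \<open>If the classes vanish, the restrictions of \<open>F\<close> to the kernel form a family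
  of coboundaries bounded by the supremum of \<open>F\<close> in bidegree \<open>(p, q)\<close>.
  Uniform primitives of this family extend to a bounded cochain whose vertical differential is
  \<open>F\<close> after retraction, and \<open>htpy\<close> supplies the difference between
  \<open>F\<close> and its retraction.\<close>

lemma kernel_\<Phi>:
  assumes up: "uniform_primitives q" and F: "F \<in> Cn (int p + int q)" "F \<in> Fl (int p)" "F \<in> vcyc p"
    and zero: "\<Phi> p q F = \<zero>\<^bsub>coef.res.BC q p\<^esub>"
  obtains w where "w \<in> Cn (int p + int q - 1)" "w \<in> Fl (int p)" "F \<ominus>\<^bsub>TC\<^esub> D w \<in> Fl (int p + 1)"
proof -
  have Fc: "F \<in> carrier TC" using F(3) by (rule vcyc_carrier)
  note c = tot_closed[OF Fc]
  define b where "b ys = sub.ih q (F (pp Q \<one>\<^bsub>Q\<^esub> ys))" for ys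
  obtain \<beta> where \<beta>: "length xs = Suc p \<Longrightarrow> length gs = Suc q \<Longrightarrow> seminorm A (F xs gs) \<le> \<beta>" for xs gs
    by (rule tot_bounded[OF Fc, of "Suc p" "Suc q"]) blast
  have b: "b ys \<in> sub.Bc q" "seminorm (sub.res.BC q) (b ys) \<le> \<beta>" if ys: "ys \<in> tuples Q p" for ys
  proof -
    have "sub.H.cls q (b ys) = \<zero>\<^bsub>sub.Hc q\<^esub>"
      using fun_cong[OF zero, of ys] ys by (simp add: b_def \<Phi>_apply bounded_cochains_simps(2))
    then show "b ys \<in> sub.Bc q"
      unfolding b_def using ih_vcyc[OF F(3)] pp_Q_closed[OF ys] by (simp add: sub.H.cls_eq_zero_iff)
    show "seminorm (sub.res.BC q) (b ys) \<le> \<beta>"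
      using ys \<beta> by (intro sub.res.seminorm_cochain_le) (simp add: b_def sub.ih_def tuples_def)
  qed
  have "\<exists>w\<in>Cn (int p + int q - 1) \<inter> Fl (int p). \<forall>xs gs. set xs \<subseteq> carrier Q \<longrightarrow> length xs = Suc p \<longrightarrow>
      set gs \<subseteq> carrier G \<longrightarrow> length gs = Suc q \<longrightarrow>
      dl A (w xs) gs = sub.hg q (b (diffs Q xs)) (map (retr (hd xs)) gs)"
  proof (cases q)
    case 0
    \<comment> \<open>For \<open>q = 0\<close> a coboundary is zero, so zero serves as
      primitive.\<close>
    have "sub.hg q (b (diffs Q xs)) us = \<zero>\<^bsub>A\<^esub>" if xs: "set xs \<subseteq> carrier Q" "length xs = Suc p" for xs us
    proof -
      have "diffs Q xs \<in> tuples Q p" using xs Q.diffs_closed by (auto simp: tuples_def length_diffs)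
      then have "b (diffs Q xs) = \<zero>\<^bsub>sub.res.BC q\<^esub>" using b(1) 0 by simp
      then show ?thesis by (simp add: sub.hg_zero)
    qed
    moreover have "dl A (\<zero>\<^bsub>TC\<^esub> xs) gs = \<zero>\<^bsub>A\<^esub>" for xs gs by (rule M.dl_zero) (simp add: tot_simps)
    ultimately show ?thesis using tc.C_closed(2) tc.F_closed(2) by (intro bexI[of _ "\<zero>\<^bsub>TC\<^esub>"]) auto
  next
    case (Suc k)
    have "\<exists>u \<gamma>. \<forall>ys\<in>tuples Q p. u ys \<in> carrier (sub.res.BC k) \<and> seminorm (sub.res.BC k) (u ys) \<le> \<gamma> \<and>
        sub.cob k (u ys) = b ys"
      using up Suc b unfolding uniform_primitives_def by blast
    then obtain u \<gamma> where u: "\<And>ys. ys \<in> tuples Q p \<Longrightarrow> u ys \<in> carrier (sub.res.BC k)"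
      "\<And>ys. ys \<in> tuples Q p \<Longrightarrow> seminorm (sub.res.BC k) (u ys) \<le> \<gamma>"
      "\<And>ys. ys \<in> tuples Q p \<Longrightarrow> sub.cob k (u ys) = b ys" by blast
    have "dl A (extn p k u xs) gs = sub.hg q (b (diffs Q xs)) (map (retr (hd xs)) gs)"
      if xs: "set xs \<subseteq> carrier Q" "length xs = Suc p" "set gs \<subseteq> carrier G" "length gs = Suc q" for xs gs
    proof -
      have "diffs Q xs \<in> tuples Q p" using xs Q.diffs_closed by (auto simp: tuples_def length_diffs)
      then show ?thesis using dl_extn[OF u(1) xs(1-3)] u(3) xs Suc by simp
    qed
    then show ?thesis using extn_closed(1,2)[of p u k, OF u(1,2)] Suc by (intro bexI[of _ "extn p k u"]) auto
  qed
  then obtain w1 where w1: "w1 \<in> Cn (int p + int q - 1)" "w1 \<in> Fl (int p)"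
    and dw1: "\<And>xs gs. set xs \<subseteq> carrier Q \<Longrightarrow> length xs = Suc p \<Longrightarrow> set gs \<subseteq> carrier G \<Longrightarrow> length gs = Suc q \<Longrightarrow>
      dl A (w1 xs) gs = sub.hg q (b (diffs Q xs)) (map (retr (hd xs)) gs)" by blast
  note h = htpy_closed[OF Fc, of p q]
  define w2 where "w2 = w1 \<oplus>\<^bsub>TC\<^esub> htpy p q F"
  have w2: "w2 \<in> Cn (int p + int q - 1)" "w2 \<in> Fl (int p)"
    unfolding w2_def using tc.C_closed(4)[OF w1(1) h(1)] tc.F_closed(4)[OF w1(2) h(2)] by auto
  \<comment> \<open>The sign cancels the factor \<open>(-1)^p\<close> that the vertical part of
    \<open>D\<close> carries in column \<open>p\<close>.\<close>
  define w where "w = (if even p then w2 else \<ominus>\<^bsub>TC\<^esub> w2)"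
  have w: "w \<in> Cn (int p + int q - 1)" "w \<in> Fl (int p)"
    unfolding w_def using w2 tc.C_closed(3)[OF w2(1)] tc.F_closed(3)[OF w2(2)] by auto
  have tcs: "w1 \<in> carrier TC" "htpy p q F \<in> carrier TC" "w2 \<in> carrier TC" "w \<in> carrier TC"
    using w1 h w2 w by (auto simp: Fl_iff)
  have Dw: "D w xs gs = F xs gs" if xs: "set xs \<subseteq> carrier Q" "length xs = Suc p" "set gs \<subseteq> carrier G" "length gs = Suc q" for xs gs
  proof -
    have "dl A (w2 xs) gs = F xs (map (retr (hd xs)) gs) \<oplus>\<^bsub>A\<^esub> (F xs gs \<ominus>\<^bsub>A\<^esub> F xs (map (retr (hd xs)) gs))"
      unfolding w2_def tot_simps using tot_closed[OF tcs(1)] tot_closed[OF tcs(2)] xs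
      by (simp add: M.dl_add dw1 dl_htpy[OF F(3)] retr_apply[OF Fc] b_def)
    also have "\<dots> = F xs gs"
    proof -
      have "u \<oplus>\<^bsub>A\<^esub> (v \<ominus>\<^bsub>A\<^esub> u) = v" if "u \<in> carrier A" "v \<in> carrier A" for u v using that by algebra
      then show ?thesis using c by simp
    qed
    finally have "dl A (w2 xs) gs = F xs gs" .
    moreover have "dl A (w xs) gs = alt_sign A p (dl A (w2 xs) gs)"
      using tot_closed[OF tcs(3)] by (simp add: w_def alt_sign_def tot_a_inv[OF tcs(3)] M.dl_a_inv)
    ultimately show ?thesis using D_Fl_apply[OF w(2) xs(1-3)] c by (simp add: M.alt_sign_alt_sign)
  qed
  have Dwc: "D w \<in> Cn (int p + int q)" "D w \<in> Fl (int p)" using tc.D_C[OF w(1)] tc.D_F[OF w(2)] by simp_all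
  have DwTC: "D w \<in> carrier TC" using Dwc by (simp add: Fl_iff)
  have "(F \<ominus>\<^bsub>TC\<^esub> D w) xs gs = \<zero>\<^bsub>A\<^esub>" if "int (length xs) \<le> int p + 1" for xs gs
  proof -
    have "F xs gs = D w xs gs"
    proof (cases "length xs = Suc p \<and> length gs = Suc q \<and> supp xs gs")
      case True
      then show ?thesis using Dw[of xs gs] by (simp add: supp_def)
    next
      case False
      then have "int (length xs) \<le> int p \<or> int (length xs) + int (length gs) \<noteq> int p + int q + 2 \<or> \<not> supp xs gs"
        using that by auto
      then show ?thesis
      proof (elim disjE)
        assume "int (length xs) \<le> int p"
        then show ?thesis using F(2) Dwc(2) by (simp add: Fl_iff)
      next
        assume "int (length xs) + int (length gs) \<noteq> int p + int q + 2"
        then show ?thesis using F(1) Dwc(1) by (simp add: Cn_iff)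
      next
        assume "\<not> supp xs gs"
        then show ?thesis using tot_zero[OF Fc] tot_zero[OF DwTC] by simp
      qed
    qed
    then show ?thesis
      unfolding tot_diff[OF DwTC] using tot_closed[OF DwTC] by (simp add: a_minus_def M.r_neg)
  qed
  moreover have "F \<ominus>\<^bsub>TC\<^esub> D w \<in> carrier TC" using Fc DwTC by simp
  ultimately show thesis using that w by (simp add: Fl_iff)
qed

text \<open>Every value of \<open>c\<close> has seminorm strictly below the norm of \<open>c\<close>
  plus \<open>e\<close>, so it has a representing cocycle below this common bound; such a family can
  be extended by \<open>extn\<close>. Restricted again, it is unchanged, since the retraction at the
  unit of \<open>Q\<close> fixes the image of \<open>L\<close>.\<close>

lemma lift_\<Phi>:
  assumes c: "c \<in> carrier (coef.res.BC q p)" and e: "0 < (e :: real)"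
  obtains z where "z \<in> Cn (int p + int q)" "z \<in> Fl (int p)" "z \<in> vcyc p" "\<Phi> p q z = c"
    "seminorm (tot p q) z \<le> seminorm (coef.res.BC q p) c + e"
proof -
  have "\<exists>f. f \<in> sub.Zc q \<and> c ys = sub.H.cls q f \<and>
      seminorm (sub.res.BC q) f \<le> seminorm (coef.res.BC q p) c + e" if ys: "ys \<in> tuples Q p" for ys
  proof -
    have "c ys \<in> carrier (sub.Hc q)" using bounded_cochain_closed[OF c ys] .
    then obtain x where x: "x \<in> sub.Zc q" "c ys = sub.H.cls q x" by (rule sub.H.carrierE)
    have "seminorm (sub.Hc q) (sub.H.cls q x) < seminorm (coef.res.BC q p) c + e"
      using coef.res.seminorm_cochain_ge[OF c ys] e x by simp
    then obtain f where f: "f \<in> sub.H.cls q x" "seminorm (sub.res.BC q) f < seminorm (coef.res.BC q p) c + e"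
      by (rule sub.H.seminorm_cls_approx[OF x(1)])
    note f' = sub.H.cls_memD[OF x(1) f(1)]
    have xc: "x \<in> carrier (sub.res.BC q)" using x by (simp add: sub.cocycle_iff)
    have "(f \<ominus>\<^bsub>sub.res.BC q\<^esub> x) \<oplus>\<^bsub>sub.res.BC q\<^esub> x \<in> sub.Zc q"
      using f'(2) x(1) coboundaries_subset_cocycles sub.H.submodule_closed(4)[OF sub.submodule_cocycles] by blast
    then have "f \<in> sub.Zc q" using f'(1) xc by (simp add: sub.H.M.diff_add_cancel_right)
    moreover have "c ys = sub.H.cls q f" using H_cls_eq[OF f'(1) xc f'(2)] x by simp
    ultimately show ?thesis using f(2) by auto
  qed
  then obtain f where f: "\<And>ys. ys \<in> tuples Q p \<Longrightarrow> f ys \<in> sub.Zc q"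
    "\<And>ys. ys \<in> tuples Q p \<Longrightarrow> c ys = sub.H.cls q (f ys)"
    "\<And>ys. ys \<in> tuples Q p \<Longrightarrow> seminorm (sub.res.BC q) (f ys) \<le> seminorm (coef.res.BC q p) c + e" by metis
  have fc: "f ys \<in> carrier (sub.res.BC q)" "sub.cob q (f ys) = \<zero>\<^bsub>sub.res.BC (Suc q)\<^esub>" if "ys \<in> tuples Q p" for ys
    using f(1)[OF that] by (auto simp: sub.cocycle_iff)
  let ?z = "extn p q f"
  note z = extn_closed[of p f q, OF fc(1) f(3)]
  have zc: "?z \<in> carrier TC" using z(2) by (simp add: Fl_iff)
  have vz: "?z \<in> vcyc p"
  proof -
    have "dl A (?z xs) gs = \<zero>\<^bsub>A\<^esub>" if xs: "set xs \<subseteq> carrier Q" "length xs = Suc p" "set gs \<subseteq> carrier G" for xs gs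
    proof -
      have "diffs Q xs \<in> tuples Q p" using xs Q.diffs_closed by (auto simp: tuples_def length_diffs)
      then show ?thesis using dl_extn[OF fc(1) xs] fc(2) by (simp add: sub.hg_zero)
    qed
    then show ?thesis using zc by (simp add: vcyc_def)
  qed
  have "\<Phi> p q ?z = c"
  proof (rule bounded_cochain_ext[OF \<Phi>_closed[OF vz] c])
    fix ys assume ys: "ys \<in> tuples Q p"
    have ysc: "set ys \<subseteq> carrier Q" using ys by (simp add: tuples_def)
    let ?xs = "pp Q \<one>\<^bsub>Q\<^esub> ys"
    have "sub.ih q (?z ?xs) = sub.ih q (sub.hg q (f ys))"
    proof (rule sub.ih_cong)
      fix ls assume ls: "ls \<in> tuples L q"
      let ?us = "pp G \<one>\<^bsub>G\<^esub> (map \<iota> ls)"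
      have "?us = map \<iota> (pp L \<one>\<^bsub>L\<^esub> ls)" using sub.pp_\<phi>[OF L.one_closed, of ls] ls by (simp add: sub.\<phi>_one tuples_def)
      moreover have "set (pp L \<one>\<^bsub>L\<^esub> ls) \<subseteq> carrier L" using L.pp_closed[OF L.one_closed, of ls] ls by (simp add: tuples_def)
      ultimately have "map (retr \<one>\<^bsub>Q\<^esub>) ?us = ?us" using retr_\<iota> by (auto simp: subset_iff)
      moreover have "supp ?xs ?us" "length ?us = Suc q"
        using pp_Q_closed[OF ys] sub.pp_\<phi>_closed[OF G.one_closed ls] ls by (auto simp: supp_def tuples_def)
      ultimately show "?z ?xs ?us = sub.hg q (f ys) ?us"
        using ys ysc by (simp add: extn_def Q.diffs_pp tuples_def)
    qed
    then show "\<Phi> p q ?z ys = c ys" using ys f(2)[OF ys] by (simp add: \<Phi>_apply sub.ih_hg[OF fc(1)[OF ys]])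
  qed
  then show thesis using that z vz by blast
qed

text \<open>Restricted to the kernel, the vertical part of \<open>D z\<close> is a coboundary. Its
  class disappears, and the horizontal part becomes the coboundary over \<open>Q\<close>.\<close>

lemma \<Phi>_D:
  assumes z: "z \<in> vcyc p"
  shows "\<Phi> (Suc p) q (D z) = coef.cob q p (\<Phi> p q z)"
proof -
  have zc: "z \<in> carrier TC" using z by (rule vcyc_carrier)
  note c = tot_closed[OF zc]
  have "sub.H.cls q (sub.ih q (D z xs)) = dl (sub.Hc q) (rc p q z) xs"
    if xs: "set xs \<subseteq> carrier Q" "length xs = Suc (Suc p)" for xs
  proof -
    let ?d = "sub.ih q (\<lambda>gs. dl A (\<lambda>ys. z ys gs) xs)"
    let ?v = "sub.ih q (\<lambda>gs. alt_sign A (Suc (length xs)) (dl A (z xs) gs))"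
    have v: "?v \<in> sub.Bc q" by (rule ih_alt_sign_coboundary[OF zc xs(1)])
    have vc: "?v \<in> carrier (sub.res.BC q)" using sub.H.submodule_closed(1)[OF sub.submodule_coboundaries v] .
    have dc: "?d \<in> carrier (sub.res.BC q)" using dl_rc(2)[OF z xs] by (simp add: sub.cocycle_iff)
    have "sub.ih q (D z xs) = ?d \<oplus>\<^bsub>sub.res.BC q\<^esub> ?v"
      using D_eq[OF zc xs(1) sub.pp_\<phi>_closed[OF G.one_closed]]
      by (auto simp: sub.ih_def bounded_cochains_simps(3) dd_def intro!: restrict_ext)
    moreover have "(?d \<oplus>\<^bsub>sub.res.BC q\<^esub> ?v) \<ominus>\<^bsub>sub.res.BC q\<^esub> ?d = ?v"
      using dc vc sub.H.M.add_diff_cancel_right[OF vc dc] by (simp add: sub.H.M.a_comm)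
    ultimately have "sub.H.cls q (sub.ih q (D z xs)) = sub.H.cls q ?d"
      using v vc dc by (intro H_cls_eq) simp_all
    then show ?thesis using dl_rc(1)[OF z xs] by simp
  qed
  then show ?thesis
    unfolding cob_\<Phi>[OF z] unfolding \<Phi>_def
    using pp_Q_closed by (intro coef.ih_cong) (simp add: rc_def)
qed

end

end

section \<open>Isometric identification of the second page\<close>

context extension_module
begin

context
  notes comp_id [simp del]
begin

lemma vcyc_diff: "F \<in> vcyc p \<Longrightarrow> F' \<in> vcyc p \<Longrightarrow> F \<ominus>\<^bsub>TC\<^esub> F' \<in> vcyc p"
  using vcyc_carrier[of F p] vcyc_carrier[of F' p]
  by (simp add: vcyc_def tot_diff tot_closed M.dl_diff del: tc.M.minus_closed)
    (simp add: a_minus_def M.a_inv_zero tot_add_closed tot_a_inv_closed)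

lemma vcyc_if_Fl:
  assumes F: "F \<in> Fl (int p + 1)" shows "F \<in> vcyc p"
proof -
  have "F \<in> Fl (int p)" using tc.F_antimono[of "int p" "int p + 1"] F by auto
  then show ?thesis using tc.D_F[OF F] by (rule vcyc_if_D_Fl)
qed

lemma \<Phi>_Fl:
  assumes F: "F \<in> Fl (int p + 1)" shows "\<Phi> p q F = \<zero>\<^bsub>coef.res.BC q p\<^esub>"
proof -
  have v: "F \<in> vcyc p" by (rule vcyc_if_Fl[OF F])
  have "\<Phi> p q F ys = \<zero>\<^bsub>sub.Hc q\<^esub>" if ys: "ys \<in> tuples Q p" for ys
  proof -
    have "sub.ih q (F (pp Q \<one>\<^bsub>Q\<^esub> ys)) = \<zero>\<^bsub>sub.res.BC q\<^esub>"
      unfolding sub.ih_def bounded_cochains_simps(2) using F pp_Q_closed[OF ys]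
      by (intro restrict_ext) (simp add: Fl_iff)
    then show ?thesis using ys by (simp add: \<Phi>_apply sub.H.cls_zero)
  qed
  then show ?thesis
    using \<Phi>_closed[OF v, of q] unfolding bounded_cochains_simps(2)
    by (intro bounded_cochain_ext[OF _ coef.res.cochain_zero_closed[of q p]]) auto
qed

lemma \<Phi>_diff:
  assumes F: "F \<in> vcyc p" and F': "F' \<in> vcyc p"
  shows "\<Phi> p q (F \<ominus>\<^bsub>TC\<^esub> F') = \<Phi> p q F \<ominus>\<^bsub>coef.res.BC q p\<^esub> \<Phi> p q F'"
proof -
  note d = vcyc_diff[OF F F']
  have "(F \<ominus>\<^bsub>TC\<^esub> F') \<oplus>\<^bsub>TC\<^esub> F' = F"
    by (rule tc.M.diff_add_cancel_right[OF vcyc_carrier[OF F] vcyc_carrier[OF F']])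
  then have "\<Phi> p q F = \<Phi> p q (F \<ominus>\<^bsub>TC\<^esub> F') \<oplus>\<^bsub>coef.res.BC q p\<^esub> \<Phi> p q F'"
    using \<Phi>_add[OF d F'] by simp
  then show ?thesis
    using coef.H.M.add_diff_cancel_right[OF \<Phi>_closed[OF d] \<Phi>_closed[OF F']] by simp
qed

text \<open>Lift a primitive of \<open>\<Phi> p q F\<close> to a vertical cycle \<open>z\<close> in
  column \<open>p - 1\<close>. Then \<open>F \<ominus> D z\<close> has vanishing classes, and
  \<open>kernel_\<Phi>\<close> removes its leading column by some \<open>D w\<close>. The sum
  \<open>z \<oplus> w\<close> is only in filtration \<open>p - 1\<close>, but its differential is in
  filtration \<open>p\<close>, as a second-page boundary demands.\<close>

lemma \<Phi>_coboundary_imp: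
  assumes up: "uniform_primitives q" and F: "F \<in> Cn (int p + int q)" "F \<in> Fl (int p)" "F \<in> vcyc p"
    and B: "\<Phi> p q F \<in> coef.Bc q p"
  obtains v where "v \<in> Cn (int p + int q - 1)" "v \<in> Fl (int p - 1)" "D v \<in> Fl (int p)"
    "F \<ominus>\<^bsub>TC\<^esub> D v \<in> Fl (int p + 1)"
proof (cases p)
  case 0
  then have "\<Phi> p q F = \<zero>\<^bsub>coef.res.BC q p\<^esub>" using B by simp
  from kernel_\<Phi>[OF up F this] obtain w where w: "w \<in> Cn (int p + int q - 1)" "w \<in> Fl (int p)"
    "F \<ominus>\<^bsub>TC\<^esub> D w \<in> Fl (int p + 1)" by blast
  then show thesis using that tc.D_F[OF w(2)] tc.F_antimono[of "int p - 1" "int p"] by auto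
next
  case (Suc p')
  obtain c where c: "c \<in> carrier (coef.res.BC q p')" "\<Phi> p q F = coef.cob q p' c"
    using B Suc by auto
  obtain z where z: "z \<in> Cn (int p' + int q)" "z \<in> Fl (int p')" "z \<in> vcyc p'" "\<Phi> p' q z = c"
    \<comment> \<open>The size of this lift is irrelevant, so 1 is an arbitrary positive
      error.\<close>
    by (rule lift_\<Phi>[OF c(1), of 1]) auto
  have zc: "z \<in> carrier TC" using z by (simp add: Fl_iff)
  have Fc: "F \<in> carrier TC" using F by (simp add: Fl_iff)
  have Dz: "D z \<in> Cn (int p + int q)" "D z \<in> Fl (int p)"
    using tc.D_C[OF z(1)] D_Fl_if_vcyc[OF z(2,3)] Suc by (simp_all add: algebra_simps)
  have "D (D z) \<in> Fl (int p + 1)" using tc.F_closed(2) zc by (simp add: tc.D_D)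
  then have Dzv: "D z \<in> vcyc p" using Dz by (intro vcyc_if_D_Fl)
  let ?F = "F \<ominus>\<^bsub>TC\<^esub> D z"
  have F1: "?F \<in> Cn (int p + int q)" "?F \<in> Fl (int p)" "?F \<in> vcyc p"
    using tc.C_closed(5)[OF F(1) Dz(1)] tc.F_closed(5)[OF F(2) Dz(2)] vcyc_diff[OF F(3) Dzv] by auto
  have "\<Phi> p q (D z) = \<Phi> p q F" using \<Phi>_D[OF z(3), of q] z(4) c(2) Suc by simp
  then have "\<Phi> p q ?F = \<zero>\<^bsub>coef.res.BC q p\<^esub>"
    using \<Phi>_diff[OF F(3) Dzv, of q] \<Phi>_closed[OF F(3), of q] by (simp add: a_minus_def coef.H.M.r_neg)
  from kernel_\<Phi>[OF up F1 this] obtain w where w: "w \<in> Cn (int p + int q - 1)" "w \<in> Fl (int p)"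
    "?F \<ominus>\<^bsub>TC\<^esub> D w \<in> Fl (int p + 1)" by blast
  have wc: "w \<in> carrier TC" using w by (simp add: Fl_iff)
  have Dv: "D (z \<oplus>\<^bsub>TC\<^esub> w) = D z \<oplus>\<^bsub>TC\<^esub> D w" using zc wc by (simp add: tc.D_add)
  have "?F \<ominus>\<^bsub>TC\<^esub> D w = F \<ominus>\<^bsub>TC\<^esub> D (z \<oplus>\<^bsub>TC\<^esub> w)"
  proof -
    have "(f \<ominus>\<^bsub>TC\<^esub> a) \<ominus>\<^bsub>TC\<^esub> b = f \<ominus>\<^bsub>TC\<^esub> (a \<oplus>\<^bsub>TC\<^esub> b)"
      if "f \<in> carrier TC" "a \<in> carrier TC" "b \<in> carrier TC" for f a b using that by algebra
    then show ?thesis using Fc zc wc tc.D_closed by (simp add: Dv)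
  qed
  moreover have "z \<oplus>\<^bsub>TC\<^esub> w \<in> Cn (int p + int q - 1)" using z(1) w(1) Suc by (intro tc.C_closed(4)) simp_all
  moreover have "z \<oplus>\<^bsub>TC\<^esub> w \<in> Fl (int p - 1)"
    using z(2) w(2) Suc tc.F_antimono[of "int p - 1" "int p"] by (intro tc.F_closed(4)) auto
  moreover have "D (z \<oplus>\<^bsub>TC\<^esub> w) \<in> Fl (int p)"
    unfolding Dv using Dz(2) tc.D_F[OF w(2)] by (rule tc.F_closed(4))
  ultimately show thesis using that w(3) by simp
qed

abbreviation "Z2 p q \<equiv> tc.cyc 2 (int p) (int p + int q)"
abbreviation "B2 p q \<equiv> tc.bdy 2 (int p) (int p + int q)"

lemma Z2D:
  assumes "F \<in> Z2 p q"
  shows "F \<in> Cn (int p + int q)" "F \<in> Fl (int p)" "D F \<in> Fl (int p + 2)" "F \<in> vcyc p" "F \<in> carrier TC"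
proof -
  show *: "F \<in> Cn (int p + int q)" "F \<in> Fl (int p)" "D F \<in> Fl (int p + 2)" using assms by (auto simp: tc.cyc_def)
  then show "F \<in> vcyc p" using tc.F_antimono[of "int p + 1" "int p + 2"] by (intro vcyc_if_D_Fl) auto
  then show "F \<in> carrier TC" by (rule vcyc_carrier)
qed

text \<open>The order 2 of the cycle enters here: \<open>D F\<close> vanishes in column
  \<open>p + 1\<close>, where \<open>\<Phi>_D\<close> identifies its image with the coboundary of
  \<open>\<Phi> p q F\<close>.\<close>

lemma \<Phi>_Z2: assumes F: "F \<in> Z2 p q" shows "\<Phi> p q F \<in> coef.Zc q p"
proof -
  note v = Z2D[OF F]
  have "D F \<in> Fl (int (Suc p) + 1)" using v(3) by (simp add: algebra_simps)
  then show ?thesis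
    using \<Phi>_D[OF v(4), of q] \<Phi>_Fl[of "D F" "Suc p" q] \<Phi>_closed[OF v(4)] by (simp add: coef.cocycle_iff)
qed

lemma D_B2:
  assumes v: "v \<in> Cn (int p + int q - 1)" "v \<in> Fl (int p - 1)" "D v \<in> Fl (int p)"
  shows "D v \<in> B2 p q"
  using v by (intro tc.bdyI2) (simp add: tc.cyc_def)

text \<open>The summand from filtration \<open>p + 1\<close> is invisible to \<open>\<Phi>\<close>.
  The other one is \<open>D z\<close> with \<open>z\<close> a vertical cycle in column
  \<open>p - 1\<close>, so that \<open>\<Phi>_D\<close> exhibits a coboundary.\<close>

lemma \<Phi>_B2: assumes F: "F \<in> B2 p q" shows "\<Phi> p q F \<in> coef.Bc q p"
proof -
  obtain y z where F_eq: "F = y \<oplus>\<^bsub>TC\<^esub> D z" and y: "y \<in> tc.cyc (2 - 1) (int p + 1) (int p + int q)"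
    and z: "z \<in> tc.cyc (2 - 1) (int p - 2 + 1) (int p + int q - 1)" by (rule tc.bdyE[OF F])
  have BZ: "B2 p q \<subseteq> Z2 p q" by (rule tc.bdy_subset_cyc) simp
  have yB: "y \<in> B2 p q" using y by (rule tc.bdyI1)
  have zB: "D z \<in> B2 p q" using z by (rule tc.bdyI2)
  have yv: "y \<in> vcyc p" "D z \<in> vcyc p" using yB zB BZ Z2D(4) by blast+
  have y0: "\<Phi> p q y = \<zero>\<^bsub>coef.res.BC q p\<^esub>" using y by (intro \<Phi>_Fl) (simp add: tc.cyc_def)
  have zz: "z \<in> Cn (int p + int q - 1)" "z \<in> Fl (int p - 1)" "D z \<in> Fl (int p)" using z by (auto simp: tc.cyc_def)
  have "\<Phi> p q (D z) \<in> coef.Bc q p"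
  proof (cases p)
    case 0
    \<comment> \<open>There is no column before 0: \<open>z\<close> lies in filtration 0, its
      differential is vertical there, and the restriction to the kernel is a coboundary, hence of
      class zero.\<close>
    have z0: "z \<in> Fl (int p)" using zz(1) tc.F_full[of "int p" "int p + int q - 1"] 0 by auto
    have zc: "z \<in> carrier TC" using z0 by (simp add: Fl_iff)
    have "\<Phi> p q (D z) ys = \<zero>\<^bsub>sub.Hc q\<^esub>" if ys: "ys \<in> tuples Q p" for ys
    proof -
      let ?xs = "pp Q \<one>\<^bsub>Q\<^esub> ys"
      note xs = pp_Q_closed[OF ys]
      have "sub.ih q (D z ?xs) = sub.ih q (\<lambda>gs. alt_sign A p (dl A (z ?xs) gs))"
        using xs by (intro sub.ih_cong D_Fl_apply[OF z0] sub.pp_\<phi>_closed) auto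
      then have "sub.ih q (D z ?xs) \<in> sub.Bc q" using ih_alt_sign_coboundary[OF zc] xs by simp
      then show ?thesis
        using ys ih_vcyc[OF yv(2)] xs by (simp add: \<Phi>_apply sub.H.cls_eq_zero_iff)
    qed
    then have "\<Phi> p q (D z) = \<zero>\<^bsub>coef.res.BC q p\<^esub>"
      using \<Phi>_closed[OF yv(2), of q] unfolding bounded_cochains_simps(2)
      by (intro bounded_cochain_ext[OF _ coef.res.cochain_zero_closed[of q p]]) auto
    then show ?thesis using 0 by simp
  next
    case (Suc p')
    have "z \<in> vcyc p'" using zz Suc by (intro vcyc_if_D_Fl) (simp_all add: algebra_simps)
    then have "\<Phi> p q (D z) = coef.cob q p' (\<Phi> p' q z)" "\<Phi> p' q z \<in> carrier (coef.res.BC q p')"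
      using \<Phi>_D \<Phi>_closed Suc by auto
    then show ?thesis using Suc by simp
  qed
  then show ?thesis
    unfolding F_eq using \<Phi>_add[OF yv, of q] y0 \<Phi>_closed[OF yv(2), of q] by simp
qed

text \<open>The isomorphism is induced by \<open>\<Phi>\<close>. It does not increase seminorms
  because restriction does not. For the reverse estimate, a representative \<open>c\<close> is
  lifted to \<open>z'\<close> with almost the same norm. This \<open>z'\<close> need not be a
  second-page cycle, but modulo boundaries it has the same leading component as \<open>z\<close>,
  and the leading component alone determines the seminorm.\<close>

theorem second_page:
  assumes up: "uniform_primitives q"
  shows "isometrically_isomorphic R (E 2 (int p) (int q)) (coef.Hc q p)"
proof -
  have page: "subquotient_module R TC (Z2 p q) (B2 p q) (E 2 (int p) (int q))"
    using ss.page.subquotient_module_axioms[of 2 "int p" "int q"] by simp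
  have norm_page: "seminormed_subquotient_module R (tot p q) (Z2 p q) (B2 p q) (E 2 (int p) (int q))"
    using seminormed_subquotient_module_E[of "int p" "int q" 2] by simp
  have BZ: "B2 p q \<subseteq> Z2 p q" by (rule tc.bdy_subset_cyc) simp
  have "\<exists>h\<in>module_isos R (E 2 (int p) (int q)) (coef.Hc q p).
      \<forall>z\<in>Z2 p q. h (B2 p q +>\<^bsub>TC\<^esub> z) = coef.Bc q p +>\<^bsub>coef.res.BC q p\<^esub> \<Phi> p q z"
  proof (rule subquotient_iso[OF page coef.H.subquotient_module_axioms BZ])
    show "\<Phi> p q F \<in> coef.Zc q p" if "F \<in> Z2 p q" for F using that by (rule \<Phi>_Z2)
    show "\<Phi> p q (F \<oplus>\<^bsub>TC\<^esub> F') = \<Phi> p q F \<oplus>\<^bsub>coef.res.BC q p\<^esub> \<Phi> p q F'" if "F \<in> Z2 p q" "F' \<in> Z2 p q" for F F'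
      using that Z2D(4) by (intro \<Phi>_add)
    show "\<Phi> p q (a \<odot>\<^bsub>TC\<^esub> F) = a \<odot>\<^bsub>coef.res.BC q p\<^esub> \<Phi> p q F" if "a \<in> carrier R" "F \<in> Z2 p q" for a F
      using that Z2D(4) by (intro \<Phi>_smult)
    show "\<Phi> p q F \<in> coef.Bc q p \<longleftrightarrow> F \<in> B2 p q" if F: "F \<in> Z2 p q" for F
    proof
      assume "\<Phi> p q F \<in> coef.Bc q p"
      from \<Phi>_coboundary_imp[OF up Z2D(1,2,4)[OF F] this] obtain v where
        v: "v \<in> Cn (int p + int q - 1)" "v \<in> Fl (int p - 1)" "D v \<in> Fl (int p)" "F \<ominus>\<^bsub>TC\<^esub> D v \<in> Fl (int p + 1)"
        by blast
      have vc: "v \<in> carrier TC" using v by (simp add: Fl_iff)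
      have Dv: "D v \<in> B2 p q" by (rule D_B2[OF v(1-3)])
      have "D (F \<ominus>\<^bsub>TC\<^esub> D v) = D F"
        using Z2D(5)[OF F] vc tc.D_closed by (simp add: tc.D_diff tc.D_D) (simp add: a_minus_def tc.M.a_inv_zero)
      moreover have "D v \<in> Cn (int p + int q)" using tc.D_C[OF v(1)] by simp
      ultimately have "F \<ominus>\<^bsub>TC\<^esub> D v \<in> tc.cyc (2 - 1) (int p + 1) (int p + int q)"
        using v(4) Z2D(1,3)[OF F] tc.C_closed(5) by (simp add: tc.cyc_def algebra_simps)
      then have "F \<ominus>\<^bsub>TC\<^esub> D v \<in> B2 p q" by (rule tc.bdyI1)
      then have "(F \<ominus>\<^bsub>TC\<^esub> D v) \<oplus>\<^bsub>TC\<^esub> D v \<in> B2 p q" using Dv by (rule tc.submodule_closed(4)[OF tc.submodule_bdy])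
      then show "F \<in> B2 p q"
        using tc.M.diff_add_cancel_right[OF Z2D(5)[OF F] tc.D_closed[OF vc]] by simp
    qed (rule \<Phi>_B2)
    show "\<exists>F\<in>Z2 p q. c \<ominus>\<^bsub>coef.res.BC q p\<^esub> \<Phi> p q F \<in> coef.Bc q p" if c: "c \<in> coef.Zc q p" for c
    proof -
      have cc: "c \<in> carrier (coef.res.BC q p)" "coef.cob q p c = \<zero>\<^bsub>coef.res.BC q (Suc p)\<^esub>"
        using c by (auto simp: coef.cocycle_iff)
      obtain z where z: "z \<in> Cn (int p + int q)" "z \<in> Fl (int p)" "z \<in> vcyc p" "\<Phi> p q z = c"
        by (rule lift_\<Phi>[OF cc(1), of 1]) auto
      have zc: "z \<in> carrier TC" using z by (simp add: Fl_iff)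
      have Dz: "D z \<in> Cn (int (Suc p) + int q)" "D z \<in> Fl (int (Suc p))"
        using tc.D_C[OF z(1)] D_Fl_if_vcyc[OF z(2,3)] by (simp_all add: algebra_simps)
      have "D (D z) \<in> Fl (int (Suc p) + 1)" using tc.F_closed(2) zc by (simp add: tc.D_D)
      then have Dzv: "D z \<in> vcyc (Suc p)" using Dz by (intro vcyc_if_D_Fl)
      have "\<Phi> (Suc p) q (D z) = \<zero>\<^bsub>coef.res.BC q (Suc p)\<^esub>" using \<Phi>_D[OF z(3), of q] z(4) cc(2) by simp
      \<comment> \<open>A lift of a cocycle is at first only a vertical cycle. The image of
        \<open>D z\<close> vanishes, so column \<open>p + 1\<close> of \<open>D z\<close> is cleared
        by some \<open>D w\<close> with \<open>w\<close> in filtration \<open>p + 1\<close>; then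
        \<open>z \<ominus> w\<close> has order 2 and the same image as \<open>z\<close>.\<close>
      from kernel_\<Phi>[OF up Dz Dzv this] obtain w where w: "w \<in> Cn (int p + int q)" "w \<in> Fl (int p + 1)"
        "D z \<ominus>\<^bsub>TC\<^esub> D w \<in> Fl (int p + 2)" by (auto simp: algebra_simps)
      have wc: "w \<in> carrier TC" using w by (simp add: Fl_iff)
      have wv: "w \<in> vcyc p" by (rule vcyc_if_Fl[OF w(2)])
      have wF: "w \<in> Fl (int p)" using w(2) tc.F_antimono[of "int p" "int p + 1"] by auto
      have "z \<ominus>\<^bsub>TC\<^esub> w \<in> Z2 p q"
        using tc.C_closed(5)[OF z(1) w(1)] tc.F_closed(5)[OF z(2) wF] w(3) zc wc by (simp add: tc.cyc_def tc.D_diff)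
      moreover have "\<Phi> p q (z \<ominus>\<^bsub>TC\<^esub> w) = c"
        using \<Phi>_diff[OF z(3) wv, of q] \<Phi>_Fl[OF w(2), of q] z(4) cc(1) by (simp add: a_minus_def coef.H.M.a_inv_zero)
      moreover have "c \<ominus>\<^bsub>coef.res.BC q p\<^esub> c \<in> coef.Bc q p"
        using cc(1) coef.H.submodule_closed(2)[OF coef.submodule_coboundaries] by (simp add: a_minus_def coef.H.M.r_neg)
      ultimately show ?thesis by metis
    qed
  qed
  then obtain h where h: "h \<in> module_isos R (E 2 (int p) (int q)) (coef.Hc q p)"
    "\<And>z. z \<in> Z2 p q \<Longrightarrow> h (B2 p q +>\<^bsub>TC\<^esub> z) = coef.H.cls q p (\<Phi> p q z)" by blast
  interpret P: subquotient_module R TC "Z2 p q" "B2 p q" "E 2 (int p) (int q)" by (rule page)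
  interpret T: seminormed_subquotient_module R "tot p q" "Z2 p q" "B2 p q" "E 2 (int p) (int q)" by (rule norm_page)
  have diff_tot: "F \<ominus>\<^bsub>tot p q\<^esub> F' = F \<ominus>\<^bsub>TC\<^esub> F'" if "F' \<in> carrier TC" for F F'
    using that by (simp add: tot_diff)
  have "seminorm (coef.Hc q p) (coef.H.cls q p (\<Phi> p q z)) = seminorm (E 2 (int p) (int q)) (B2 p q +>\<^bsub>tot p q\<^esub> z)"
    if z: "z \<in> Z2 p q" for z
  proof (rule antisym)
    note zz = Z2D[OF z] and \<Phi>z = \<Phi>_Z2[OF z]
    have \<Phi>zc: "\<Phi> p q z \<in> carrier (coef.res.BC q p)" by (rule \<Phi>_closed[OF zz(4)])
    show "seminorm (coef.Hc q p) (coef.H.cls q p (\<Phi> p q z)) \<le> seminorm (E 2 (int p) (int q)) (B2 p q +>\<^bsub>tot p q\<^esub> z)"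
    proof (rule T.seminorm_cls_ge[OF z])
      fix y assume y: "y \<in> B2 p q +>\<^bsub>tot p q\<^esub> z"
      have yc: "y \<in> carrier TC" "y \<ominus>\<^bsub>TC\<^esub> z \<in> B2 p q"
        using T.cls_memD[OF z y] diff_tot[OF zz(5)] carrier_tot[of p q] by auto
      have "(y \<ominus>\<^bsub>TC\<^esub> z) \<oplus>\<^bsub>TC\<^esub> z \<in> Z2 p q"
        using yc(2) BZ z by (intro tc.submodule_closed(4)[OF tc.submodule_cyc]) auto
      then have yZ: "y \<in> Z2 p q" using tc.M.diff_add_cancel_right[OF yc(1) zz(5)] by simp
      have "\<Phi> p q y \<ominus>\<^bsub>coef.res.BC q p\<^esub> \<Phi> p q z \<in> coef.Bc q p"
        using \<Phi>_diff[OF Z2D(4)[OF yZ] zz(4), of q] \<Phi>_B2[OF yc(2)] by simp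
      then have "\<Phi> p q y \<in> coef.H.cls q p (\<Phi> p q z)"
        using \<Phi>_closed[OF Z2D(4)[OF yZ]] by (intro coef.H.cls_memI[OF \<Phi>z])
      then have "seminorm (coef.Hc q p) (coef.H.cls q p (\<Phi> p q z)) \<le> seminorm (coef.res.BC q p) (\<Phi> p q y)"
        by (rule coef.H.seminorm_cls_le[OF \<Phi>z])
      also have "\<dots> \<le> seminorm (tot p q) y" by (rule seminorm_\<Phi>[OF Z2D(4)[OF yZ]])
      finally show "seminorm (coef.Hc q p) (coef.H.cls q p (\<Phi> p q z)) \<le> seminorm (tot p q) y" .
    qed
    show "seminorm (E 2 (int p) (int q)) (B2 p q +>\<^bsub>tot p q\<^esub> z) \<le> seminorm (coef.Hc q p) (coef.H.cls q p (\<Phi> p q z))"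
    proof (rule coef.H.seminorm_cls_ge[OF \<Phi>z])
      fix c assume c: "c \<in> coef.H.cls q p (\<Phi> p q z)"
      note c' = coef.H.cls_memD[OF \<Phi>z c]
      show "seminorm (E 2 (int p) (int q)) (B2 p q +>\<^bsub>tot p q\<^esub> z) \<le> seminorm (coef.res.BC q p) c"
      proof (rule field_le_epsilon)
        fix e :: real assume e: "0 < e"
        obtain z' where z': "z' \<in> Cn (int p + int q)" "z' \<in> Fl (int p)" "z' \<in> vcyc p" "\<Phi> p q z' = c"
          "seminorm (tot p q) z' \<le> seminorm (coef.res.BC q p) c + e" by (rule lift_\<Phi>[OF c'(1) e])
        have z'c: "z' \<in> carrier TC" using z' by (simp add: Fl_iff)
        have "\<ominus>\<^bsub>coef.res.BC q p\<^esub> (c \<ominus>\<^bsub>coef.res.BC q p\<^esub> \<Phi> p q z) \<in> coef.Bc q p"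
          using c'(2) by (rule coef.H.submodule_closed(3)[OF coef.submodule_coboundaries])
        moreover have "\<ominus>\<^bsub>coef.res.BC q p\<^esub> (c \<ominus>\<^bsub>coef.res.BC q p\<^esub> \<Phi> p q z) = \<Phi> p q z \<ominus>\<^bsub>coef.res.BC q p\<^esub> c"
          using c'(1) \<Phi>zc by (simp add: a_minus_def coef.H.M.minus_add coef.H.M.a_comm)
        ultimately have "\<Phi> p q (z \<ominus>\<^bsub>TC\<^esub> z') \<in> coef.Bc q p" using \<Phi>_diff[OF zz(4) z'(3), of q] z'(4) by simp
        from \<Phi>_coboundary_imp[OF up tc.C_closed(5)[OF zz(1) z'(1)] tc.F_closed(5)[OF zz(2) z'(2)]
            vcyc_diff[OF zz(4) z'(3)] this]
        obtain v where v: "v \<in> Cn (int p + int q - 1)" "v \<in> Fl (int p - 1)" "D v \<in> Fl (int p)"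
          "(z \<ominus>\<^bsub>TC\<^esub> z') \<ominus>\<^bsub>TC\<^esub> D v \<in> Fl (int p + 1)" by blast
        have vc: "v \<in> carrier TC" using v by (simp add: Fl_iff)
        have Dvc: "D v \<in> carrier TC" by (rule tc.D_closed[OF vc])
        \<comment> \<open>The difference of \<open>z \<ominus> D v\<close> and \<open>z'\<close>
          lies in filtration \<open>p + 1\<close>. Hence this representative of the class of
          \<open>z\<close> has the component of \<open>z'\<close> in bidegree \<open>(p, q)\<close>,
          and thus its seminorm.\<close>
        let ?y = "z \<ominus>\<^bsub>TC\<^esub> D v"
        have yc: "?y \<in> carrier TC" using zz(5) Dvc by simp
        have "?y \<ominus>\<^bsub>TC\<^esub> z = \<ominus>\<^bsub>TC\<^esub> D v" using zz(5) Dvc by algebra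
        then have "?y \<ominus>\<^bsub>tot p q\<^esub> z \<in> B2 p q"
          using tc.submodule_closed(3)[OF tc.submodule_bdy D_B2[OF v(1-3)]] diff_tot[OF zz(5)] by simp
        then have "?y \<in> B2 p q +>\<^bsub>tot p q\<^esub> z"
          using yc carrier_tot[of p q] by (intro T.cls_memI[OF z]) simp_all
        then have "seminorm (E 2 (int p) (int q)) (B2 p q +>\<^bsub>tot p q\<^esub> z) \<le> seminorm (tot p q) ?y"
          by (rule T.seminorm_cls_le[OF z])
        also have "\<dots> \<le> seminorm (tot p q) z'"
        proof (rule seminorm_tot_le)
          fix xs gs assume xg: "xs \<in> tuples Q (Suc p)" "gs \<in> tuples G (Suc q)"
          have "(z \<ominus>\<^bsub>TC\<^esub> z') \<ominus>\<^bsub>TC\<^esub> D v = ?y \<ominus>\<^bsub>TC\<^esub> z'" using zz(5) Dvc z'c by algebra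
          then have "(?y \<ominus>\<^bsub>TC\<^esub> z') xs gs = \<zero>\<^bsub>A\<^esub>" using v(4) xg by (simp add: Fl_iff tuples_def)
          then have "?y xs gs \<ominus>\<^bsub>A\<^esub> z' xs gs = \<zero>\<^bsub>A\<^esub>" unfolding tot_diff[OF z'c] .
          then have "?y xs gs = z' xs gs"
            using M.diff_add_cancel_right[OF tot_closed[OF yc] tot_closed[OF z'c], of xs gs xs gs] tot_closed[OF z'c] by simp
          then show "seminorm A (?y xs gs) \<le> seminorm (tot p q) z'" using seminorm_tot_ge[OF z'c xg] by simp
        qed
        finally show "seminorm (E 2 (int p) (int q)) (B2 p q +>\<^bsub>tot p q\<^esub> z) \<le> seminorm (coef.res.BC q p) c + e"
          using z'(5) by simp
      qed
    qed
  qed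
  then have "seminorm (coef.Hc q p) (h u) = seminorm (E 2 (int p) (int q)) u" if "u \<in> carrier (E 2 (int p) (int q))" for u
    using that h(2) coset_tot[of p q] by (auto simp: P.carrier_eq)
  then show ?thesis using h(1) unfolding isometrically_isomorphic_def by blast
qed

end

end

section \<open>The open mapping theorem\<close>

text \<open>Transports the reals into \<open>R\<close> along the inverse of the isometric
  isomorphism; the open mapping argument uses these scalars to rescale vectors.\<close>

lemma real_scalars:
  assumes "normed_ring R" "is_real_normed_ring R"
  obtains sc :: "real \<Rightarrow> 'r" where "\<And>t. sc t \<in> carrier R" "\<And>t. absval R (sc t) = \<bar>t\<bar>"
    "\<And>s t. sc s \<otimes>\<^bsub>R\<^esub> sc t = sc (s * t)" "sc 1 = \<one>\<^bsub>R\<^esub>"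
proof -
  interpret normed_ring R by fact
  obtain \<phi> where \<phi>: "\<phi> \<in> ring_iso R (ring_of_type_algebra :: real ring)"
    "\<And>a. a \<in> carrier R \<Longrightarrow> absval R a = \<bar>\<phi> a\<bar>" using assms(2) by (auto simp: is_real_normed_ring_def)
  have bij: "bij_betw \<phi> (carrier R) UNIV" and mult: "\<And>a b. a \<in> carrier R \<Longrightarrow> b \<in> carrier R \<Longrightarrow> \<phi> (a \<otimes>\<^bsub>R\<^esub> b) = \<phi> a * \<phi> b"
    and one: "\<phi> \<one>\<^bsub>R\<^esub> = 1"
    using \<phi>(1) by (auto simp: ring_iso_def ring_hom_def ring_of_type_algebra_def)
  define sc where "sc = inv_into (carrier R) \<phi>"
  have sc: "sc t \<in> carrier R" "\<phi> (sc t) = t" for t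
    using bij by (auto simp: sc_def bij_betw_def intro: inv_into_into f_inv_into_f)
  have inj: "a = b" if "\<phi> a = \<phi> b" "a \<in> carrier R" "b \<in> carrier R" for a b
    using bij that by (auto simp: bij_betw_def dest: inj_onD)
  show thesis
  proof (rule that)
    show "sc s \<otimes>\<^bsub>R\<^esub> sc t = sc (s * t)" for s t using sc by (intro inj) (auto simp: mult)
    show "sc 1 = \<one>\<^bsub>R\<^esub>" using sc by (intro inj) (auto simp: one)
  qed (use sc \<phi>(2) in auto)
qed

text \<open>The Banach-Schauder theorem for a bounded map onto its image, with \<open>closed\<close>
  expressing that the image is complete. The conclusion is put in the form needed for primitives:
  one bound \<open>\<gamma>\<close> serves all elements of the image of norm at most
  \<open>\<beta>\<close>.\<close>

lemma open_mapping:
  fixes M :: "('r, 'm, 'x) seminormed_module_scheme" and N :: "('r, 'n, 'y) seminormed_module_scheme"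
  assumes M: "seminormed_module R M" "complete_norm M" and N: "seminormed_module R N"
    and definite: "\<And>y. y \<in> carrier N \<Longrightarrow> seminorm N y = 0 \<Longrightarrow> y = \<zero>\<^bsub>N\<^esub>"
    and real: "is_real_normed_ring R"
    and T: "T \<in> linear_maps R M N" and K: "\<And>x. x \<in> carrier M \<Longrightarrow> seminorm N (T x) \<le> K * seminorm M x"
    and closed: "\<And>u. range u \<subseteq> T ` carrier M \<Longrightarrow> (\<forall>e>0. \<exists>k. \<forall>m\<ge>k. \<forall>n\<ge>k. seminorm N (u m \<ominus>\<^bsub>N\<^esub> u n) < e) \<Longrightarrow>
      \<exists>y\<in>T ` carrier M. (\<lambda>n. seminorm N (u n \<ominus>\<^bsub>N\<^esub> y)) \<longlonglongrightarrow> 0"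
  shows "\<exists>\<gamma>. \<forall>y\<in>T ` carrier M. seminorm N y \<le> \<beta> \<longrightarrow> (\<exists>x\<in>carrier M. T x = y \<and> seminorm M x \<le> \<gamma>)"
proof -
  interpret M: seminormed_module R M by fact
  interpret N: seminormed_module R N by fact
  note T_closed = M.linear_mapD(1)[OF T] and T_add = M.linear_mapD(2)[OF T] and T_smult = M.linear_mapD(3)[OF T]
  have T_diff: "T (x \<ominus>\<^bsub>M\<^esub> x') = T x \<ominus>\<^bsub>N\<^esub> T x'" if "x \<in> carrier M" "x' \<in> carrier M" for x x'
  proof -
    have "T x = T ((x \<ominus>\<^bsub>M\<^esub> x') \<oplus>\<^bsub>M\<^esub> x')" using that by (simp add: M.M.diff_add_cancel_right)
    also have "\<dots> = T (x \<ominus>\<^bsub>M\<^esub> x') \<oplus>\<^bsub>N\<^esub> T x'" using that by (intro T_add) auto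
    finally show ?thesis using that T_closed by (simp add: N.M.add_diff_cancel_right)
  qed
  have T_zero: "T \<zero>\<^bsub>M\<^esub> = \<zero>\<^bsub>N\<^esub>"
    using T_diff[of "\<zero>\<^bsub>M\<^esub>" "\<zero>\<^bsub>M\<^esub>"] T_closed by (simp add: a_minus_def M.M.a_inv_zero N.M.r_neg)
  obtain sc :: "real \<Rightarrow> _" where sc: "\<And>t. sc t \<in> carrier R" "\<And>t. absval R (sc t) = \<bar>t\<bar>"
    "\<And>s t. sc s \<otimes>\<^bsub>R\<^esub> sc t = sc (s * t)" "sc 1 = \<one>\<^bsub>R\<^esub>"
    using real_scalars[OF M.normed_ring_axioms real] by blast
  have sc_inv_N: "sc t \<odot>\<^bsub>N\<^esub> (sc (1 / t) \<odot>\<^bsub>N\<^esub> y) = y" if "t \<noteq> 0" "y \<in> carrier N" for t y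
    using that sc by (simp add: N.smult_one flip: N.smult_assoc)
  have norm_sc_M: "seminorm M (sc t \<odot>\<^bsub>M\<^esub> x) \<le> t * seminorm M x" if "0 \<le> t" "x \<in> carrier M" for t x
    using M.seminorm_smult[OF sc(1) that(2), of t] sc(2)[of t] that by simp
  have norm_sc_N: "seminorm N (sc t \<odot>\<^bsub>N\<^esub> x) \<le> t * seminorm N x" if "0 \<le> t" "x \<in> carrier N" for t x
    using N.seminorm_smult[OF sc(1) that(2), of t] sc(2)[of t] that by simp
  define Y where "Y = T ` carrier M"
  have Y: "y \<in> carrier N" if "y \<in> Y" for y using that T_closed by (auto simp: Y_def)
  have Y_diff: "y \<ominus>\<^bsub>N\<^esub> T x \<in> Y" if y: "y \<in> Y" and x: "x \<in> carrier M" for x y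
  proof -
    obtain x' where "x' \<in> carrier M" "y = T x'" using y by (auto simp: Y_def)
    then have "y \<ominus>\<^bsub>N\<^esub> T x = T (x' \<ominus>\<^bsub>M\<^esub> x)" using x by (simp add: T_diff)
    then show ?thesis unfolding Y_def using x \<open>x' \<in> _\<close> by blast
  qed
  have Y_smult: "sc t \<odot>\<^bsub>N\<^esub> y \<in> Y" if y: "y \<in> Y" for t y
  proof -
    obtain x' where "x' \<in> carrier M" "y = T x'" using y by (auto simp: Y_def)
    then show ?thesis unfolding Y_def using sc(1) M.smult_closed by (intro image_eqI[of _ _ "sc t \<odot>\<^bsub>M\<^esub> x'"]) (simp_all add: T_smult)
  qed
  \<comment> \<open>The value 0 outside \<open>Y\<close> is chosen because nonnegativity and
    symmetry of a \<open>Metric_space\<close> are demanded for all pairs of points.\<close>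
  define d where "d y y' = (if y \<in> Y \<and> y' \<in> Y then seminorm N (y \<ominus>\<^bsub>N\<^esub> y') else 0)" for y y'
  have triangle: "seminorm N (y \<ominus>\<^bsub>N\<^esub> y'') \<le> seminorm N (y \<ominus>\<^bsub>N\<^esub> y') + seminorm N (y' \<ominus>\<^bsub>N\<^esub> y'')"
    if "y \<in> carrier N" "y' \<in> carrier N" "y'' \<in> carrier N" for y y' y''
  proof -
    have "y \<ominus>\<^bsub>N\<^esub> y'' = (y \<ominus>\<^bsub>N\<^esub> y') \<oplus>\<^bsub>N\<^esub> (y' \<ominus>\<^bsub>N\<^esub> y'')" using that by algebra
    then show ?thesis using N.seminorm_triangle[of "y \<ominus>\<^bsub>N\<^esub> y'" "y' \<ominus>\<^bsub>N\<^esub> y''"] that by simp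
  qed
  interpret Ym: Metric_space Y d
  proof
    show "0 \<le> d y y'" for y y' using Y by (auto simp: d_def intro!: N.seminorm_nonneg)
    show "d y y' = d y' y" for y y' using Y N.seminorm_diff_commute by (auto simp: d_def)
    show "d y y' = 0 \<longleftrightarrow> y = y'" if y: "y \<in> Y" "y' \<in> Y" for y y'
    proof
      assume "d y y' = 0"
      then have "y \<ominus>\<^bsub>N\<^esub> y' = \<zero>\<^bsub>N\<^esub>" using y Y by (intro definite) (auto simp: d_def)
      then show "y = y'" using N.M.diff_add_cancel_right[OF Y[OF y(1)] Y[OF y(2)]] Y[OF y(2)] by simp
    next
      assume "y = y'"
      then show "d y y' = 0" using y Y by (simp add: d_def a_minus_def N.M.r_neg N.seminorm_zero)
    qed
    show "d y y'' \<le> d y y' + d y' y''" if "y \<in> Y" "y' \<in> Y" "y'' \<in> Y" for y y' y''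
      using that Y triangle by (simp add: d_def)
  qed
  have complete: Ym.mcomplete
    unfolding Ym.mcomplete_def
  proof (intro allI impI)
    fix u assume u: "Ym.MCauchy u"
    then have uY: "range u \<subseteq> Y" by (simp add: Ym.MCauchy_def)
    then have duu: "d (u m) (u n) = seminorm N (u m \<ominus>\<^bsub>N\<^esub> u n)" for m n by (auto simp: d_def)
    have "\<exists>y\<in>Y. (\<lambda>n. seminorm N (u n \<ominus>\<^bsub>N\<^esub> y)) \<longlonglongrightarrow> 0"
      using closed[folded Y_def, OF uY] u by (simp add: Ym.MCauchy_def duu)
    then obtain y where y: "y \<in> Y" "(\<lambda>n. seminorm N (u n \<ominus>\<^bsub>N\<^esub> y)) \<longlonglongrightarrow> 0" by blast
    have uYn: "u n \<in> Y" for n using uY by auto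
    then have "(\<lambda>n. d (u n) y) = (\<lambda>n. seminorm N (u n \<ominus>\<^bsub>N\<^esub> y))" using y by (simp add: d_def)
    then show "\<exists>y. limitin Ym.mtopology u y sequentially"
      using y uYn by (intro exI[of _ y]) (simp add: Ym.limitin_metric_dist_null)
  qed
  \<comment> \<open>The images of the balls of integer radius cover the complete space
    \<open>Y\<close>. By Baire's theorem the closure of one of them has an interior point.\<close>
  define V where "V n = T ` {x \<in> carrier M. seminorm M x \<le> real n}" for n :: nat
  have V_Y: "V n \<subseteq> Y" for n by (auto simp: V_def Y_def)
  have "\<exists>n. Ym.mtopology interior_of (Ym.mtopology closure_of V n) \<noteq> {}"
  proof (rule ccontr)
    assume "\<not> ?thesis"
    then have "Ym.mtopology interior_of \<Union>(range (\<lambda>n. Ym.mtopology closure_of V n)) = {}"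
      by (intro Ym.metric_Baire_category_alt complete) auto
    moreover have "\<Union>(range (\<lambda>n. Ym.mtopology closure_of V n)) = Y"
    proof
      show "\<Union>(range (\<lambda>n. Ym.mtopology closure_of V n)) \<subseteq> Y"
        using closure_of_subset_topspace[of Ym.mtopology] by auto
      show "Y \<subseteq> \<Union>(range (\<lambda>n. Ym.mtopology closure_of V n))"
      proof
        fix y assume "y \<in> Y"
        then obtain x where x: "x \<in> carrier M" "y = T x" by (auto simp: Y_def)
        obtain n :: nat where "seminorm M x \<le> real n" using real_arch_simple by blast
        then have "y \<in> V n" using x by (auto simp: V_def)
        then show "y \<in> \<Union>(range (\<lambda>n. Ym.mtopology closure_of V n))"
          using closure_of_subset[of "V n" Ym.mtopology] V_Y by auto
      qed
    qed
    moreover have "Ym.mtopology interior_of Y = Y" using interior_of_topspace[of Ym.mtopology] by simp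
    moreover have "T \<zero>\<^bsub>M\<^esub> \<in> Y" by (simp add: Y_def)
    ultimately show False by simp
  qed
  then obtain n y0 where y0: "y0 \<in> Ym.mtopology interior_of (Ym.mtopology closure_of V n)" by blast
  then obtain \<epsilon> where \<epsilon>: "0 < \<epsilon>" "Ym.mball y0 \<epsilon> \<subseteq> Ym.mtopology closure_of V n"
    using openin_interior_of[of Ym.mtopology] interior_of_subset[of Ym.mtopology]
    unfolding Ym.openin_mtopology by (metis subset_trans)
  have y0Y: "y0 \<in> Y"
    using y0 interior_of_subset_topspace[of Ym.mtopology] by auto
  have near: "\<exists>x\<in>carrier M. seminorm M x \<le> real n \<and> seminorm N (y \<ominus>\<^bsub>N\<^esub> T x) < \<delta>"
    if y: "y \<in> Y" "seminorm N (y0 \<ominus>\<^bsub>N\<^esub> y) < \<epsilon>" and \<delta>: "0 < \<delta>" for y \<delta>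
  proof -
    have "y \<in> Ym.mtopology closure_of V n" using \<epsilon>(2) y y0Y by (auto simp: d_def)
    then obtain v where "v \<in> V n" "d y v < \<delta>" using \<delta> by (auto simp: Ym.metric_closure_of)
    then show ?thesis using y V_Y by (auto simp: V_def d_def subset_iff)
  qed
  \<comment> \<open>The ball obtained is centred at \<open>y0\<close>, not at zero. Write
    \<open>y\<close> as the difference of \<open>y0\<close> and \<open>y0 \<ominus> y\<close>, both
    within \<open>\<epsilon>\<close> of the centre; the two approximations account for the factor 2
    and for the error split into halves.\<close>
  have approx: "\<exists>x\<in>carrier M. seminorm M x \<le> 2 * real n \<and> seminorm N (y \<ominus>\<^bsub>N\<^esub> T x) < \<delta>"
    if y: "y \<in> Y" "seminorm N y < \<epsilon>" and \<delta>: "0 < \<delta>" for y \<delta>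
  proof -
    have c: "y \<in> carrier N" "y0 \<in> carrier N" using y y0Y Y by auto
    let ?y = "y0 \<ominus>\<^bsub>N\<^esub> y"
    obtain x' where x': "x' \<in> carrier M" "T x' = y" using y by (auto simp: Y_def)
    have yY: "?y \<in> Y" using Y_diff[OF y0Y x'(1)] x'(2) by simp
    have "y0 \<ominus>\<^bsub>N\<^esub> ?y = y" "y0 \<ominus>\<^bsub>N\<^esub> y0 = \<zero>\<^bsub>N\<^esub>" using c by algebra+
    then have e: "seminorm N (y0 \<ominus>\<^bsub>N\<^esub> ?y) < \<epsilon>" "seminorm N (y0 \<ominus>\<^bsub>N\<^esub> y0) < \<epsilon>"
      using y(2) \<epsilon>(1) by (simp_all add: N.seminorm_zero)
    obtain x1 where x1: "x1 \<in> carrier M" "seminorm M x1 \<le> real n" "seminorm N (y0 \<ominus>\<^bsub>N\<^esub> T x1) < \<delta> / 2"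
      using near[OF y0Y e(2), of "\<delta> / 2"] \<delta> by auto
    obtain x2 where x2: "x2 \<in> carrier M" "seminorm M x2 \<le> real n" "seminorm N (?y \<ominus>\<^bsub>N\<^esub> T x2) < \<delta> / 2"
      using near[OF yY e(1), of "\<delta> / 2"] \<delta> by auto
    have Tc: "T x1 \<in> carrier N" "T x2 \<in> carrier N" using x1 x2 T_closed by auto
    have "y \<ominus>\<^bsub>N\<^esub> T (x1 \<ominus>\<^bsub>M\<^esub> x2) = (y0 \<ominus>\<^bsub>N\<^esub> T x1) \<ominus>\<^bsub>N\<^esub> (?y \<ominus>\<^bsub>N\<^esub> T x2)"
      unfolding T_diff[OF x1(1) x2(1)] using c Tc by algebra
    then have "seminorm N (y \<ominus>\<^bsub>N\<^esub> T (x1 \<ominus>\<^bsub>M\<^esub> x2)) < \<delta>"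
      using N.seminorm_diff[of "y0 \<ominus>\<^bsub>N\<^esub> T x1" "?y \<ominus>\<^bsub>N\<^esub> T x2"] c Tc x1(3) x2(3) by simp
    moreover have "seminorm M (x1 \<ominus>\<^bsub>M\<^esub> x2) \<le> 2 * real n"
      using M.seminorm_diff[OF x1(1) x2(1)] x1(2) x2(2) by simp
    ultimately show ?thesis using x1(1) x2(1) by blast
  qed
  \<comment> \<open>The previous approximation with error \<open>\<epsilon> / 2\<close>, rescaled by
    \<open>2 ^ k\<close>.\<close>
  have step: "\<exists>x\<in>carrier M. seminorm M x \<le> 2 * real n / 2 ^ k \<and> seminorm N (y \<ominus>\<^bsub>N\<^esub> T x) < \<epsilon> / 2 ^ Suc k"
    if y: "y \<in> Y" "seminorm N y < \<epsilon> / 2 ^ k" for y k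
  proof -
    let ?t = "2 ^ k :: real"
    have yc: "y \<in> carrier N" using y Y by simp
    have "seminorm N (sc ?t \<odot>\<^bsub>N\<^esub> y) < \<epsilon>"
      using norm_sc_N[of ?t y] y(2) yc by (simp add: field_simps)
    then obtain x where x: "x \<in> carrier M" "seminorm M x \<le> 2 * real n"
      "seminorm N (sc ?t \<odot>\<^bsub>N\<^esub> y \<ominus>\<^bsub>N\<^esub> T x) < \<epsilon> / 2"
      using approx[OF Y_smult[OF y(1)], of ?t "\<epsilon> / 2"] \<epsilon>(1) by auto
    let ?x = "sc (1 / ?t) \<odot>\<^bsub>M\<^esub> x"
    have Tx: "T x \<in> carrier N" using x T_closed by simp
    have "y = sc (1 / ?t) \<odot>\<^bsub>N\<^esub> (sc ?t \<odot>\<^bsub>N\<^esub> y)" using sc_inv_N[of "1 / ?t" y] yc by simp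
    then have "y \<ominus>\<^bsub>N\<^esub> T ?x = sc (1 / ?t) \<odot>\<^bsub>N\<^esub> (sc ?t \<odot>\<^bsub>N\<^esub> y \<ominus>\<^bsub>N\<^esub> T x)"
      using sc(1) yc Tx N.smult_closed x(1) by (simp add: T_smult N.smult_diff)
    then have "seminorm N (y \<ominus>\<^bsub>N\<^esub> T ?x) \<le> 1 / ?t * seminorm N (sc ?t \<odot>\<^bsub>N\<^esub> y \<ominus>\<^bsub>N\<^esub> T x)"
      using norm_sc_N[of "1 / ?t" "sc ?t \<odot>\<^bsub>N\<^esub> y \<ominus>\<^bsub>N\<^esub> T x"] sc(1) yc Tx N.smult_closed by simp
    also have "\<dots> < 1 / ?t * (\<epsilon> / 2)" using x(3) by (intro mult_strict_left_mono) auto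
    finally have "seminorm N (y \<ominus>\<^bsub>N\<^esub> T ?x) < \<epsilon> / 2 ^ Suc k" by (simp add: field_simps)
    moreover have "seminorm M ?x \<le> 2 * real n / ?t"
      using norm_sc_M[of "1 / ?t" x] x(1,2) divide_right_mono[OF x(2), of ?t] by simp
    ultimately show ?thesis using M.smult_closed sc(1) x(1) by blast
  qed
  \<comment> \<open>Successive approximation: the corrections have norm at most
    \<open>2 * n / 2 ^ k\<close>, with sum at most \<open>4 * n\<close>; the additional 1 pays for
    passing from a partial sum to the limit.\<close>
  have small: "\<exists>x\<in>carrier M. T x = y \<and> seminorm M x \<le> 4 * real n + 1"
    if y: "y \<in> Y" "seminorm N y < \<epsilon>" for y
  proof -
    have yc: "y \<in> carrier N" using y Y by simp
    define P where "P k s \<longleftrightarrow> s \<in> carrier M \<and> seminorm N (y \<ominus>\<^bsub>N\<^esub> T s) < \<epsilon> / 2 ^ k" for k :: nat and s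
    have "\<exists>s. \<forall>k. P k (s k) \<and> seminorm M (s (Suc k) \<ominus>\<^bsub>M\<^esub> s k) \<le> 2 * real n / 2 ^ k \<and> (k = 0 \<longrightarrow> s k = \<zero>\<^bsub>M\<^esub>)"
    proof -
      have "\<exists>s. \<forall>k. (P k (s k) \<and> (k = 0 \<longrightarrow> s k = \<zero>\<^bsub>M\<^esub>)) \<and>
          seminorm M (s (Suc k) \<ominus>\<^bsub>M\<^esub> s k) \<le> 2 * real n / 2 ^ k"
      proof (rule dependent_nat_choice)
        show "\<exists>x. P 0 x \<and> (0 = (0 :: nat) \<longrightarrow> x = \<zero>\<^bsub>M\<^esub>)"
          using y yc by (auto simp: P_def T_zero a_minus_def N.M.a_inv_zero)
        fix s k assume s: "P k s \<and> (k = 0 \<longrightarrow> s = \<zero>\<^bsub>M\<^esub>)"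
        then have sc': "s \<in> carrier M" "T s \<in> carrier N" using T_closed by (auto simp: P_def)
        obtain x where x: "x \<in> carrier M" "seminorm M x \<le> 2 * real n / 2 ^ k"
          "seminorm N ((y \<ominus>\<^bsub>N\<^esub> T s) \<ominus>\<^bsub>N\<^esub> T x) < \<epsilon> / 2 ^ Suc k"
          using step[OF Y_diff[OF y(1) sc'(1)], of k] s by (auto simp: P_def)
        have Tx: "T x \<in> carrier N" using x T_closed by simp
        have "y \<ominus>\<^bsub>N\<^esub> (T s \<oplus>\<^bsub>N\<^esub> T x) = (y \<ominus>\<^bsub>N\<^esub> T s) \<ominus>\<^bsub>N\<^esub> T x" using yc sc' Tx by algebra
        then have "P (Suc k) (s \<oplus>\<^bsub>M\<^esub> x)" using x sc' by (simp add: P_def T_add)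
        moreover have "(s \<oplus>\<^bsub>M\<^esub> x) \<ominus>\<^bsub>M\<^esub> s = x" using sc'(1) x(1) by algebra
        ultimately show "\<exists>s'. (P (Suc k) s' \<and> (Suc k = 0 \<longrightarrow> s' = \<zero>\<^bsub>M\<^esub>)) \<and>
            seminorm M (s' \<ominus>\<^bsub>M\<^esub> s) \<le> 2 * real n / 2 ^ k" using x(2) by (intro exI[of _ "s \<oplus>\<^bsub>M\<^esub> x"]) simp
      qed
      then show ?thesis by blast
    qed
    then obtain s where s: "\<And>k. s k \<in> carrier M" "\<And>k. seminorm N (y \<ominus>\<^bsub>N\<^esub> T (s k)) < \<epsilon> / 2 ^ k"
      "\<And>k. seminorm M (s (Suc k) \<ominus>\<^bsub>M\<^esub> s k) \<le> 2 * real n / 2 ^ k" "s 0 = \<zero>\<^bsub>M\<^esub>"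
      unfolding P_def by metis
    have triangle_M: "seminorm M (a \<ominus>\<^bsub>M\<^esub> c) \<le> seminorm M (a \<ominus>\<^bsub>M\<^esub> b) + seminorm M (b \<ominus>\<^bsub>M\<^esub> c)"
      if "a \<in> carrier M" "b \<in> carrier M" "c \<in> carrier M" for a b c
    proof -
      have "a \<ominus>\<^bsub>M\<^esub> c = (a \<ominus>\<^bsub>M\<^esub> b) \<oplus>\<^bsub>M\<^esub> (b \<ominus>\<^bsub>M\<^esub> c)" using that by algebra
      then show ?thesis using M.seminorm_triangle[of "a \<ominus>\<^bsub>M\<^esub> b" "b \<ominus>\<^bsub>M\<^esub> c"] that by simp
    qed
    \<comment> \<open>The bound is the geometric sum of \<open>2 * n / 2 ^ i\<close> over the
      \<open>j\<close> indices starting at \<open>k\<close>.\<close>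
    have tail: "seminorm M (s (k + j) \<ominus>\<^bsub>M\<^esub> s k) \<le> 4 * real n / 2 ^ k * (1 - 1 / 2 ^ j)" for k j
    proof (induction j)
      case 0
      then show ?case using s(1) by (simp add: a_minus_def M.M.r_neg M.seminorm_zero)
    next
      case (Suc j)
      have "seminorm M (s (k + Suc j) \<ominus>\<^bsub>M\<^esub> s k) \<le> 2 * real n / 2 ^ (k + j) + 4 * real n / 2 ^ k * (1 - 1 / 2 ^ j)"
        using triangle_M[of "s (k + Suc j)" "s (k + j)" "s k"] s(1) s(3)[of "k + j"] Suc by simp
      also have "\<dots> = 4 * real n / 2 ^ k * (1 - 1 / 2 ^ Suc j)" by (simp add: field_simps power_add)
      finally show ?case .
    qed
    have tail': "seminorm M (s m \<ominus>\<^bsub>M\<^esub> s k) \<le> 4 * real n / 2 ^ k" if "k \<le> m" for k m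
    proof -
      have "4 * real n / 2 ^ k * (1 - 1 / 2 ^ (m - k)) \<le> 4 * real n / 2 ^ k * 1" by (intro mult_left_mono) auto
      then show ?thesis using tail[of k "m - k"] that by simp
    qed
    have lim0: "(\<lambda>k. c / 2 ^ k) \<longlonglongrightarrow> 0" for c :: real
      using tendsto_mult[OF tendsto_const[of c] LIMSEQ_power_zero[of "1 / 2 :: real"]] by (simp add: power_divide)
    have "\<exists>x\<in>carrier M. (\<lambda>k. seminorm M (s k \<ominus>\<^bsub>M\<^esub> x)) \<longlonglongrightarrow> 0"
    proof -
      have "\<exists>k. \<forall>m\<ge>k. \<forall>l\<ge>k. seminorm M (s m \<ominus>\<^bsub>M\<^esub> s l) < e" if e: "0 < e" for e
      proof -
        have "\<forall>\<^sub>F k in sequentially. 4 * real n / 2 ^ k < e / 2" using lim0 e by (intro order_tendstoD(2)) auto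
        then obtain k where k: "4 * real n / 2 ^ k < e / 2" by (auto simp: eventually_sequentially)
        have "seminorm M (s m \<ominus>\<^bsub>M\<^esub> s l) < e" if ml: "k \<le> m" "k \<le> l" for m l
          using triangle_M[of "s m" "s k" "s l"] s(1) tail'[OF ml(1)] tail'[OF ml(2)]
            M.seminorm_diff_commute[of "s k" "s l"] k by fastforce
        then show ?thesis by blast
      qed
      moreover have "range s \<subseteq> carrier M" using s(1) by auto
      ultimately show ?thesis using M(2) by (auto simp: complete_norm_def)
    qed
    then obtain x where x: "x \<in> carrier M" "(\<lambda>k. seminorm M (s k \<ominus>\<^bsub>M\<^esub> x)) \<longlonglongrightarrow> 0" by blast
    have Tx: "T x \<in> carrier N" using x T_closed by simp
    \<comment> \<open>The residue of the approximation and the distance to the limit, the latter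
      transported by the bounded map \<open>T\<close>, both tend to zero.\<close>
    have "seminorm N (y \<ominus>\<^bsub>N\<^esub> T x) \<le> 0"
    proof (rule LIMSEQ_le_const)
      show "(\<lambda>k. \<epsilon> / 2 ^ k + K * seminorm M (s k \<ominus>\<^bsub>M\<^esub> x)) \<longlonglongrightarrow> 0"
        using tendsto_add[OF lim0[of \<epsilon>] tendsto_mult[OF tendsto_const[of K] x(2)]] by simp
      have "seminorm N (y \<ominus>\<^bsub>N\<^esub> T x) \<le> \<epsilon> / 2 ^ k + K * seminorm M (s k \<ominus>\<^bsub>M\<^esub> x)" for k
        using triangle[OF yc T_closed[OF s(1)[of k]] Tx] s(2)[of k] K[of "s k \<ominus>\<^bsub>M\<^esub> x"] T_diff[OF s(1)[of k] x(1)] s(1)[of k] x(1)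
        by simp
      then show "\<exists>N'. \<forall>k\<ge>N'. seminorm N (y \<ominus>\<^bsub>N\<^esub> T x) \<le> \<epsilon> / 2 ^ k + K * seminorm M (s k \<ominus>\<^bsub>M\<^esub> x)" by blast
    qed
    then have "y \<ominus>\<^bsub>N\<^esub> T x = \<zero>\<^bsub>N\<^esub>"
      using N.seminorm_nonneg[of "y \<ominus>\<^bsub>N\<^esub> T x"] yc Tx by (intro definite) auto
    then have "T x = y" using N.M.diff_add_cancel_right[OF yc Tx] Tx by simp
    moreover have "seminorm M x \<le> 4 * real n + 1"
    proof -
      have "\<forall>\<^sub>F k in sequentially. seminorm M (s k \<ominus>\<^bsub>M\<^esub> x) < 1" using x(2) by (intro order_tendstoD(2)) auto
      then obtain k where k: "seminorm M (s k \<ominus>\<^bsub>M\<^esub> x) < 1" by (auto simp: eventually_sequentially)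
      have "x = s k \<ominus>\<^bsub>M\<^esub> (s k \<ominus>\<^bsub>M\<^esub> x)" using s(1)[of k] x(1) by algebra
      then have "seminorm M x \<le> seminorm M (s k) + seminorm M (s k \<ominus>\<^bsub>M\<^esub> x)"
        using M.seminorm_diff[of "s k" "s k \<ominus>\<^bsub>M\<^esub> x"] s(1)[of k] x(1) by simp
      moreover have "seminorm M (s k) \<le> 4 * real n"
        using tail'[of 0 k] s(1)[of k] s(4) by (simp add: a_minus_def M.M.a_inv_zero)
      ultimately show ?thesis using k by simp
    qed
    ultimately show ?thesis using x(1) by blast
  qed
  \<comment> \<open>Dividing by \<open>t\<close> brings norms up to \<open>\<beta>\<close> strictly
    below \<open>\<epsilon>\<close>; the maximum covers negative \<open>\<beta>\<close>, the summand
    1 gives strictness.\<close>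
  define t where "t = max \<beta> 0 / \<epsilon> + 1"
  have t: "0 < t" "\<beta> < t * \<epsilon>" using \<epsilon>(1) by (auto simp: t_def field_simps intro: add_nonneg_pos)
  have "\<exists>x\<in>carrier M. T x = y \<and> seminorm M x \<le> t * (4 * real n + 1)" if y: "y \<in> Y" "seminorm N y \<le> \<beta>" for y
  proof -
    have yc: "y \<in> carrier N" using y Y by simp
    have "seminorm N (sc (1 / t) \<odot>\<^bsub>N\<^esub> y) \<le> 1 / t * seminorm N y" using norm_sc_N[of "1 / t" y] yc t by simp
    also have "\<dots> < \<epsilon>" using y t by (simp add: field_simps)
    finally obtain x where x: "x \<in> carrier M" "T x = sc (1 / t) \<odot>\<^bsub>N\<^esub> y" "seminorm M x \<le> 4 * real n + 1"
      using small[OF Y_smult[OF y(1)]] by blast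
    have "T (sc t \<odot>\<^bsub>M\<^esub> x) = y" using x sc(1) sc_inv_N[of t y] t yc by (simp add: T_smult)
    moreover have "seminorm M (sc t \<odot>\<^bsub>M\<^esub> x) \<le> t * (4 * real n + 1)"
    proof (rule order_trans)
      show "seminorm M (sc t \<odot>\<^bsub>M\<^esub> x) \<le> t * seminorm M x" using norm_sc_M x(1) t(1) by simp
      show "t * seminorm M x \<le> t * (4 * real n + 1)" using x(3) t(1) by (intro mult_left_mono) auto
    qed
    ultimately show ?thesis using M.smult_closed sc(1) x(1) by blast
  qed
  then show ?thesis unfolding Y_def by blast
qed

text \<open>Completeness of the coefficients gives pointwise limits. They form a bounded function
  and are limits in the supremum norm because the Cauchy condition is uniform in the
  argument.\<close>

lemma (in seminormed_group_module) complete_norm_cochains: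
  assumes "complete_norm A" shows "complete_norm (BC n)"
  unfolding complete_norm_def
proof (intro conjI ballI impI allI)
  interpret C: seminormed_module R "BC n" by (rule seminormed_module_cochains)
  fix f assume f: "f \<in> carrier (BC n)" "seminorm (BC n) f = 0"
  have "f gs = \<zero>\<^bsub>A\<^esub>" if gs: "gs \<in> tuples G n" for gs
    using assms bounded_cochain_closed[OF f(1) gs] seminorm_cochain_ge[OF f(1) gs] f(2)
      seminorm_nonneg[OF bounded_cochain_closed[OF f(1) gs]] by (simp add: complete_norm_def)
  then show "f = \<zero>\<^bsub>BC n\<^esub>"
    by (intro bounded_cochain_ext[OF f(1) C.M.zero_closed]) (simp add: bounded_cochains_simps(2))
next
  interpret C: seminormed_module R "BC n" by (rule seminormed_module_cochains)
  fix u :: "nat \<Rightarrow> _" assume u: "range u \<subseteq> carrier (BC n)"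
    and cauchy: "\<forall>e>0. \<exists>N. \<forall>m\<ge>N. \<forall>k\<ge>N. seminorm (BC n) (u m \<ominus>\<^bsub>BC n\<^esub> u k) < e"
  have uc: "u m \<in> carrier (BC n)" for m using u by auto
  have ugs: "u m gs \<in> carrier A" if "gs \<in> tuples G n" for m gs using bounded_cochain_closed[OF uc that] .
  have pw: "seminorm A (u m gs \<ominus>\<^bsub>A\<^esub> u k gs) \<le> seminorm (BC n) (u m \<ominus>\<^bsub>BC n\<^esub> u k)" if gs: "gs \<in> tuples G n" for m k gs
    using seminorm_cochain_ge[OF C.M.minus_closed[OF uc uc] gs, of m k] gs by (simp add: cochain_diff[OF uc uc])
  have "\<exists>x\<in>carrier A. (\<lambda>m. seminorm A (u m gs \<ominus>\<^bsub>A\<^esub> x)) \<longlonglongrightarrow> 0" if gs: "gs \<in> tuples G n" for gs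
  proof -
    have "\<forall>e>0. \<exists>N. \<forall>m\<ge>N. \<forall>k\<ge>N. seminorm A (u m gs \<ominus>\<^bsub>A\<^esub> u k gs) < e"
      using cauchy pw[OF gs] by (meson le_less_trans)
    moreover have "range (\<lambda>m. u m gs) \<subseteq> carrier A" using ugs[OF gs] by auto
    ultimately show ?thesis using assms unfolding complete_norm_def by blast
  qed
  then obtain f where f: "\<And>gs. gs \<in> tuples G n \<Longrightarrow> f gs \<in> carrier A"
    "\<And>gs. gs \<in> tuples G n \<Longrightarrow> (\<lambda>m. seminorm A (u m gs \<ominus>\<^bsub>A\<^esub> f gs)) \<longlonglongrightarrow> 0" by metis
  \<comment> \<open>Let the second index of the Cauchy estimate tend to infinity with the argument
    fixed; the threshold \<open>N\<close> does not depend on the argument.\<close>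
  have unif: "\<exists>N. \<forall>m\<ge>N. \<forall>gs\<in>tuples G n. seminorm A (u m gs \<ominus>\<^bsub>A\<^esub> f gs) \<le> e" if e: "0 < e" for e :: real
  proof -
    obtain N where N: "\<And>m k. m \<ge> N \<Longrightarrow> k \<ge> N \<Longrightarrow> seminorm (BC n) (u m \<ominus>\<^bsub>BC n\<^esub> u k) < e"
      using cauchy e by blast
    have "seminorm A (u m gs \<ominus>\<^bsub>A\<^esub> f gs) \<le> e" if m: "N \<le> m" and gs: "gs \<in> tuples G n" for m gs
    proof (rule LIMSEQ_le_const)
      show "(\<lambda>k. e + seminorm A (u k gs \<ominus>\<^bsub>A\<^esub> f gs)) \<longlonglongrightarrow> e"
        using tendsto_add[OF tendsto_const[of e] f(2)[OF gs]] by simp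
      have "seminorm A (u m gs \<ominus>\<^bsub>A\<^esub> f gs) \<le> e + seminorm A (u k gs \<ominus>\<^bsub>A\<^esub> f gs)" if k: "N \<le> k" for k
      proof -
        have "u m gs \<ominus>\<^bsub>A\<^esub> f gs = (u m gs \<ominus>\<^bsub>A\<^esub> u k gs) \<oplus>\<^bsub>A\<^esub> (u k gs \<ominus>\<^bsub>A\<^esub> f gs)"
          using ugs[OF gs, of m] ugs[OF gs, of k] f(1)[OF gs] by algebra
        then have "seminorm A (u m gs \<ominus>\<^bsub>A\<^esub> f gs) \<le> seminorm A (u m gs \<ominus>\<^bsub>A\<^esub> u k gs) + seminorm A (u k gs \<ominus>\<^bsub>A\<^esub> f gs)"
          using seminorm_triangle[of "u m gs \<ominus>\<^bsub>A\<^esub> u k gs" "u k gs \<ominus>\<^bsub>A\<^esub> f gs"] ugs[OF gs] f(1)[OF gs] by simp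
        then show ?thesis using pw[OF gs, of m k] N[OF m k] by linarith
      qed
      then show "\<exists>N. \<forall>k\<ge>N. seminorm A (u m gs \<ominus>\<^bsub>A\<^esub> f gs) \<le> e + seminorm A (u k gs \<ominus>\<^bsub>A\<^esub> f gs)" by blast
    qed
    then show ?thesis by blast
  qed
  let ?f = "\<lambda>gs\<in>tuples G n. f gs"
  obtain N1 where N1: "\<And>gs. gs \<in> tuples G n \<Longrightarrow> seminorm A (u N1 gs \<ominus>\<^bsub>A\<^esub> f gs) \<le> 1"
    using unif[of 1] by auto
  have fc: "?f \<in> carrier (BC n)"
  proof (rule bounded_cochainI)
    fix gs assume gs: "gs \<in> tuples G n"
    show "f gs \<in> carrier A" by (rule f(1)[OF gs])
    have "f gs = u N1 gs \<ominus>\<^bsub>A\<^esub> (u N1 gs \<ominus>\<^bsub>A\<^esub> f gs)" using ugs[OF gs, of N1] f(1)[OF gs] by algebra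
    then have "seminorm A (f gs) \<le> seminorm A (u N1 gs) + seminorm A (u N1 gs \<ominus>\<^bsub>A\<^esub> f gs)"
      using seminorm_diff[of "u N1 gs" "u N1 gs \<ominus>\<^bsub>A\<^esub> f gs"] ugs[OF gs, of N1] f(1)[OF gs] by simp
    then show "seminorm A (f gs) \<le> seminorm (BC n) (u N1) + 1"
      using seminorm_cochain_ge[OF uc gs, of N1] N1[OF gs] by simp
  qed
  have "(\<lambda>m. seminorm (BC n) (u m \<ominus>\<^bsub>BC n\<^esub> ?f)) \<longlonglongrightarrow> 0"
  proof (rule LIMSEQ_I)
    fix e :: real assume "0 < e"
    then obtain N where N: "\<And>m gs. m \<ge> N \<Longrightarrow> gs \<in> tuples G n \<Longrightarrow> seminorm A (u m gs \<ominus>\<^bsub>A\<^esub> f gs) \<le> e / 2"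
      using unif[of "e / 2"] by auto
    have "seminorm (BC n) (u m \<ominus>\<^bsub>BC n\<^esub> ?f) \<le> e / 2" if "N \<le> m" for m
      using N[OF that] by (intro seminorm_cochain_le) (simp add: cochain_diff[OF uc fc])
    then show "\<exists>N. \<forall>m\<ge>N. norm (seminorm (BC n) (u m \<ominus>\<^bsub>BC n\<^esub> ?f) - 0) < e"
      using \<open>0 < e\<close> C.seminorm_nonneg[OF C.M.minus_closed[OF uc fc]] by (intro exI[of _ N]) fastforce
  qed
  then show "\<exists>x\<in>carrier (BC n). (\<lambda>m. seminorm (BC n) (u m \<ominus>\<^bsub>BC n\<^esub> x)) \<longlonglongrightarrow> 0" using fc by blast
qed

section \<open>Bounded primitives in the three cases\<close>

context extension_module
begin

lemma uniform_primitives_0: "uniform_primitives 0"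
  by (simp add: uniform_primitives_def)

text \<open>With \<open>Q\<close> finite there are only finitely many index tuples, so any choice of
  primitives has a largest norm.\<close>

lemma uniform_primitives_finite:
  assumes "finite (carrier Q)" shows "uniform_primitives q"
  unfolding uniform_primitives_def
proof (intro allI impI)
  fix k p b and \<beta> :: real
  assume q: "q = Suc k" and b: "\<forall>ys\<in>tuples Q p. b ys \<in> sub.Bc q \<and> seminorm (sub.res.BC q) (b ys) \<le> \<beta>"
  have "\<exists>u. u \<in> carrier (sub.res.BC k) \<and> sub.cob k u = b ys" if "ys \<in> tuples Q p" for ys
  proof -
    have "b ys \<in> sub.cob k ` carrier (sub.res.BC k)" using b that q by (simp only: coboundaries.simps)
    then show ?thesis by (elim imageE) auto
  qed
  then obtain u where u: "\<And>ys. ys \<in> tuples Q p \<Longrightarrow> u ys \<in> carrier (sub.res.BC k) \<and> sub.cob k (u ys) = b ys"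
    by metis
  have "finite (tuples Q p)"
    using finite_lists_length_eq[OF assms, of p] by (simp add: tuples_def conj_commute)
  then have "\<forall>ys\<in>tuples Q p. seminorm (sub.res.BC k) (u ys) \<le> Max ((\<lambda>ys. seminorm (sub.res.BC k) (u ys)) ` tuples Q p)"
    by (intro ballI Max_ge) auto
  then show "\<exists>u \<gamma>. \<forall>ys\<in>tuples Q p. u ys \<in> carrier (sub.res.BC k) \<and>
      seminorm (sub.res.BC k) (u ys) \<le> \<gamma> \<and> sub.cob k (u ys) = b ys"
    using u by blast
qed

text \<open>The open mapping theorem is applied to the coboundary map. Its image is complete: a
  Cauchy sequence of coboundaries converges to a cochain \<open>f\<close> by completeness of the
  cochains, \<open>f\<close> is a cocycle by continuity, and its class has seminorm zero and hence
  vanishes.\<close>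

lemma uniform_primitives_Banach:
  assumes real: "is_real_normed_ring R" and A: "complete_norm A" and H: "complete_norm (sub.Hc q)"
  shows "uniform_primitives q"
  unfolding uniform_primitives_def
proof (intro allI impI)
  fix k p b and \<beta> :: real
  assume q: "q = Suc k" and b: "\<forall>ys\<in>tuples Q p. b ys \<in> sub.Bc q \<and> seminorm (sub.res.BC q) (b ys) \<le> \<beta>"
  note compl = sub.res.complete_norm_cochains[OF A]
  have "\<exists>\<gamma>. \<forall>y\<in>sub.cob k ` carrier (sub.res.BC k). seminorm (sub.res.BC q) y \<le> \<beta> \<longrightarrow>
      (\<exists>x\<in>carrier (sub.res.BC k). sub.cob k x = y \<and> seminorm (sub.res.BC k) x \<le> \<gamma>)"
  proof (rule open_mapping[OF sub.res.seminormed_module_cochains compl sub.res.seminormed_module_cochains _ real])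
    show "f = \<zero>\<^bsub>sub.res.BC q\<^esub>" if "f \<in> carrier (sub.res.BC q)" "seminorm (sub.res.BC q) f = 0" for f
      using compl[of q] that by (simp add: complete_norm_def)
    show "sub.cob k \<in> linear_maps R (sub.res.BC k) (sub.res.BC q)"
      using sub.cob_closed(1) by (auto simp: linear_maps_def sub.cob_add sub.cob_smult q)
    show "seminorm (sub.res.BC q) (sub.cob k x) \<le> real (k + 2) * seminorm (sub.res.BC k) x"
      if "x \<in> carrier (sub.res.BC k)" for x using sub.cob_closed(2)[OF that] q by simp
    fix u :: "nat \<Rightarrow> _" assume u: "range u \<subseteq> sub.cob k ` carrier (sub.res.BC k)"
      and cauchy: "\<forall>e>0. \<exists>N. \<forall>m\<ge>N. \<forall>n\<ge>N. seminorm (sub.res.BC q) (u m \<ominus>\<^bsub>sub.res.BC q\<^esub> u n) < e"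
    have uB: "u n \<in> sub.Bc q" for n using u q by auto
    have uc: "u n \<in> carrier (sub.res.BC q)" for n
      by (rule sub.H.submodule_closed(1)[OF sub.submodule_coboundaries uB])
    obtain f where f: "f \<in> carrier (sub.res.BC q)"
      "(\<lambda>n. seminorm (sub.res.BC q) (u n \<ominus>\<^bsub>sub.res.BC q\<^esub> f)) \<longlonglongrightarrow> 0"
      using compl[of q] uc cauchy unfolding complete_norm_def by blast
    \<comment> \<open>Each \<open>u n\<close> is a cocycle, so the coboundary of \<open>f\<close>
      equals, up to sign, that of \<open>u n \<ominus> f\<close>, whose norm is at most
      \<open>q + 2\<close> times a null sequence.\<close>
    have cob_f: "sub.cob q f = \<zero>\<^bsub>sub.res.BC (Suc q)\<^esub>"
    proof -
      have cf: "sub.cob q f \<in> carrier (sub.res.BC (Suc q))" by (rule sub.cob_closed(1)[OF f(1)])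
      have le: "seminorm (sub.res.BC (Suc q)) (sub.cob q f) \<le>
          real (q + 2) * seminorm (sub.res.BC q) (u n \<ominus>\<^bsub>sub.res.BC q\<^esub> f)" for n
      proof -
        have "u n \<in> sub.Zc q" using uB coboundaries_subset_cocycles by blast
        then have "sub.cob q (u n \<ominus>\<^bsub>sub.res.BC q\<^esub> f) = \<ominus>\<^bsub>sub.res.BC (Suc q)\<^esub> sub.cob q f"
          using cf unfolding sub.cob_diff[OF uc f(1)] by (simp add: sub.cocycle_iff a_minus_def)
        then show ?thesis
          using sub.cob_closed(2)[OF sub.H.M.minus_closed[OF uc[of n] f(1)]] sub.H.seminorm_minus[OF cf] by simp
      qed
      have "seminorm (sub.res.BC (Suc q)) (sub.cob q f) \<le> 0"
        using tendsto_mult[OF tendsto_const[of "real (q + 2)"] f(2)] le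
        by (intro LIMSEQ_le_const[of "\<lambda>n. real (q + 2) * seminorm (sub.res.BC q) (u n \<ominus>\<^bsub>sub.res.BC q\<^esub> f)"]) auto
      then show ?thesis
        using compl[of "Suc q"] cf sub.H.seminorm_nonneg[OF cf] by (simp add: complete_norm_def)
    qed
    then have fZ: "f \<in> sub.Zc q" using f(1) by (simp add: sub.cocycle_iff)
    \<comment> \<open>The class of \<open>f\<close> contains its differences with the coboundaries
      \<open>u n\<close>, whose norms tend to zero.\<close>
    have cls_le: "seminorm (sub.Hc q) (sub.H.cls q f) \<le> seminorm (sub.res.BC q) (u n \<ominus>\<^bsub>sub.res.BC q\<^esub> f)" for n
    proof -
      have "(f \<ominus>\<^bsub>sub.res.BC q\<^esub> u n) \<ominus>\<^bsub>sub.res.BC q\<^esub> f = \<ominus>\<^bsub>sub.res.BC q\<^esub> u n"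
        using f(1) uc[of n] by algebra
      then have "f \<ominus>\<^bsub>sub.res.BC q\<^esub> u n \<in> sub.H.cls q f"
        using f(1) uc[of n] sub.H.submodule_closed(3)[OF sub.submodule_coboundaries uB[of n]]
        by (intro sub.H.cls_memI[OF fZ]) simp_all
      then show ?thesis
        using sub.H.seminorm_cls_le[OF fZ] sub.H.seminorm_diff_commute[OF f(1) uc[of n]] by metis
    qed
    have "seminorm (sub.Hc q) (sub.H.cls q f) \<le> 0"
      using f(2) cls_le by (intro LIMSEQ_le_const[of "\<lambda>n. seminorm (sub.res.BC q) (u n \<ominus>\<^bsub>sub.res.BC q\<^esub> f)"]) auto
    then have "sub.H.cls q f = \<zero>\<^bsub>sub.Hc q\<^esub>"
      using H sub.H.cls_closed[OF fZ] coef.seminorm_nonneg[OF sub.H.cls_closed[OF fZ]] by (simp add: complete_norm_def)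
    then have "f \<in> sub.Bc q" by (simp add: sub.H.cls_eq_zero_iff[OF fZ])
    then show "\<exists>y\<in>sub.cob k ` carrier (sub.res.BC k).
        (\<lambda>n. seminorm (sub.res.BC q) (u n \<ominus>\<^bsub>sub.res.BC q\<^esub> y)) \<longlonglongrightarrow> 0"
      using f(2) q by auto
  qed
  then obtain \<gamma> where "\<forall>y\<in>sub.cob k ` carrier (sub.res.BC k). seminorm (sub.res.BC q) y \<le> \<beta> \<longrightarrow>
      (\<exists>x\<in>carrier (sub.res.BC k). sub.cob k x = y \<and> seminorm (sub.res.BC k) x \<le> \<gamma>)" by blast
  moreover have "b ys \<in> sub.cob k ` carrier (sub.res.BC k)" if "ys \<in> tuples Q p" for ys
    using b that q by (simp only: coboundaries.simps)
  ultimately have "\<exists>x. x \<in> carrier (sub.res.BC k) \<and> sub.cob k x = b ys \<and> seminorm (sub.res.BC k) x \<le> \<gamma>"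
    if "ys \<in> tuples Q p" for ys using b that by blast
  then show "\<exists>u \<gamma>. \<forall>ys\<in>tuples Q p. u ys \<in> carrier (sub.res.BC k) \<and>
      seminorm (sub.res.BC k) (u ys) \<le> \<gamma> \<and> sub.cob k (u ys) = b ys"
    by metis
qed

end

theorem theorem6p14:
  fixes R :: "'r normed_ring"
    and L :: "'l monoid" and \<iota> :: "'l \<Rightarrow> 'g"
    and G :: "'g monoid" and \<pi> :: "'g \<Rightarrow> 'q"
    and Q :: "'q monoid"
    and A :: "('r, 'a) seminormed_module" and act :: "'g \<Rightarrow> 'a \<Rightarrow> 'a"
  assumes "normed_ring R"
    and "group_extension L \<iota> G \<pi> Q"
    and "seminormed_group_module R G A act"
  shows "\<exists>(E :: nat \<Rightarrow> int \<Rightarrow> int \<Rightarrow> ('r, ('q list \<Rightarrow> 'g list \<Rightarrow> 'a) set) seminormed_module) d.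
    spectral_sequence R E d \<and> first_quadrant E \<and>
    converges_to R E (bounded_cohomology G A act) \<and>
    (\<forall>p q. seminormed_module R (E 2 p q)) \<and>
    (\<forall>p q :: nat.
      finite (carrier Q) \<or>
      q = 0 \<or>
      (is_real_normed_ring R \<and> complete_norm A \<and>
        complete_norm (bounded_cohomology L A (act \<circ> \<iota>) q)) \<longrightarrow>
      isometrically_isomorphic R (E 2 (int p) (int q))
        (bounded_cohomology Q (bounded_cohomology L A (act \<circ> \<iota>) q)
          (quotient_act L \<iota> G \<pi> act q) p))"
proof -
  interpret extension_module R L \<iota> G \<pi> Q A act
    by (rule extension_module.intro[OF assms(2,3)])
  show ?thesis
  proof (intro exI[of _ E] exI[of _ ss.differential] conjI allI impI)
    show "spectral_sequence R E ss.differential" by (rule ss.spectral_sequence)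
    show "first_quadrant E" by (rule ss.first_quadrant)
    \<comment> \<open>Outside the earlier proofs \<open>comp_id\<close> is a simplification rule
      again and identifies \<open>act \<circ> id\<close> with \<open>act\<close>.\<close>
    show "converges_to R E (bounded_cohomology G A act)" using converges_to_cohomology by simp
    show "seminormed_module R (E 2 p q)" for p q
      by (rule seminormed_subquotient_module.seminormed_module_N[OF seminormed_subquotient_module_E])
    fix p q :: nat
    assume "finite (carrier Q) \<or> q = 0 \<or> (is_real_normed_ring R \<and> complete_norm A \<and> complete_norm (sub.Hc q))"
    then have "uniform_primitives q"
      using uniform_primitives_finite uniform_primitives_0 uniform_primitives_Banach by blast
    then show "isometrically_isomorphic R (E 2 (int p) (int q)) (bounded_cohomology Q (sub.Hc q) (qa q) p)"
      using second_page[of q p] by simp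
  qed
qed

end
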